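(* Let $0<e\le 1$ and let $\widetilde B$ satisfy the standing assumptions below. Then for every probability density $f$ on $\mathbb{R}^3$, $$I\big(Q_e^+(f,f)\big)\le \Big[1+(1-e)\,\frac{2+e+15e^2}{8e^3}\Big]\, I(f).$$ Consequently, if $f(v,t)$ is a solution of the inelastic Boltzmann equation (E1) below with initial datum $f(\cdot,0)$, then for all $t\ge 0$ $$I(f(\cdot,t))\le \exp\!\Big(\frac{(1-e)(2+e+15e^2)}{8e^3}\,t\Big)\, I(f(\cdot,0)).$$
   Context: Restitution coefficient $0<e\le1$. $\widetilde B$ is a positive, integrable, even function on $[-1,1]$, normalized so that $\int_{-1}^1\widetilde B(s)\,ds=2$ (equivalently $\int_{S^2}\widetilde B(k\cdot n)\,dn=4\pi$ for every unit vector $k$). Here $dn$ denotes the uniform measure on $S^2$ with total mass $4\pi$. For $v,w\in\mathbb{R}^3$, $n\in S^2$, the post-collisional velocity is $v'=v-\frac{1+e}{2}((v-w)\cdot n)\,n$. The gain operator $Q_e^+(f,f)$ is the (probability) density defined by $$\int_{\mathbb{R}^3}Q_e^+(f,f)\varphi\,dv=\frac1{4\pi}\int_{\mathbb{R}^3}\int_{\mathbb{R}^3}\int_{S^2}\widetilde B\Big(n\cdot\frac{v-w}{|v-w|}\Big)f(v)f(w)\varphi(v')\,dn\,dv\,dw$$ for all bounded continuous $\varphi$, and $Q_e(f,f)=Q_e^+(f,f)-f$ (loss term equals $f$ by the normalization). Equation (E1): for every bounded continuous $\varphi$, $\frac{d}{dt}\int f(v,t)\varphi(v)\,dv=\frac1{4\pi}\iiint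 \widetilde B(n\cdot\frac{v-w}{|v-w|})f(v,t)f(w,t)[\varphi(v')-\varphi(v)]\,dn\,dv\,dw$. Fisher information of a probability density $f$: $I(f)=4\int_{\mathbb{R}^3}|\nabla\sqrt f|^2dv$ if $\nabla\sqrt f\in L^2$ (distributional gradient), $+\infty$ otherwise. *)

theory Defs
  imports "HOL-Analysis.Analysis"
begin

type_synonym vec3 = "real ^ 3"

text \<open>Uniform (surface) measure on the unit sphere S^2 of total mass 4 pi, realised as the
  cone measure: the push-forward of 3 times Lebesgue measure on the unit ball under x / |x|.\<close>
definition S2 :: "vec3 measure" where
  "S2 = distr (density lborel (\<lambda>x. ennreal (3 * indicator (ball 0 1) x))) lborel
              (\<lambda>x. x /\<^sub>R norm x)"

definition prob_density :: "(vec3 \<Rightarrow> real) \<Rightarrow> bool" where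
  "prob_density f \<longleftrightarrow> f \<in> borel_measurable lborel \<and> (\<forall>v. 0 \<le> f v) \<and>
     integrable lborel f \<and> (\<integral>v. f v \<partial>lborel) = 1"

definition kernel_ok :: "(real \<Rightarrow> real) \<Rightarrow> bool" where
  "kernel_ok B \<longleftrightarrow> (\<forall>s\<in>{-1..1}. 0 < B s) \<and> set_integrable lborel {-1..1} B \<and>
     (\<forall>s\<in>{-1..1}. B (-s) = B s) \<and> (LINT s:{-1..1}|lborel. B s) = 2"

definition vpost :: "real \<Rightarrow> vec3 \<Rightarrow> vec3 \<Rightarrow> vec3 \<Rightarrow> vec3" where
  "vpost e v w n = v - (((1 + e) / 2) * ((v - w) \<bullet> n)) *\<^sub>R n"

definition gain_functional ::
  "real \<Rightarrow> (real \<Rightarrow> real) \<Rightarrow> (vec3 \<Rightarrow> real) \<Rightarrow> (vec3 \<Rightarrow> real) \<Rightarrow> real" where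
  "gain_functional e B f \<phi> = (1 / (4 * pi)) *
     (\<integral>v. \<integral>w. \<integral>n. B (n \<bullet> ((v - w) /\<^sub>R norm (v - w))) * f v * f w * \<phi> (vpost e v w n)
        \<partial>S2 \<partial>lborel \<partial>lborel)"

definition coll_functional ::
  "real \<Rightarrow> (real \<Rightarrow> real) \<Rightarrow> (vec3 \<Rightarrow> real) \<Rightarrow> (vec3 \<Rightarrow> real) \<Rightarrow> real" where
  "coll_functional e B f \<phi> = (1 / (4 * pi)) *
     (\<integral>v. \<integral>w. \<integral>n. B (n \<bullet> ((v - w) /\<^sub>R norm (v - w))) * f v * f w *
          (\<phi> (vpost e v w n) - \<phi> v) \<partial>S2 \<partial>lborel \<partial>lborel)"

definition bounded_continuous :: "(vec3 \<Rightarrow> real) \<Rightarrow> bool" where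
  "bounded_continuous \<phi> \<longleftrightarrow> continuous_on UNIV \<phi> \<and> bounded (range \<phi>)"

definition gain_density ::
  "real \<Rightarrow> (real \<Rightarrow> real) \<Rightarrow> (vec3 \<Rightarrow> real) \<Rightarrow> (vec3 \<Rightarrow> real) \<Rightarrow> bool" where
  "gain_density e B f g \<longleftrightarrow> prob_density g \<and>
     (\<forall>\<phi>. bounded_continuous \<phi> \<longrightarrow> (\<integral>v. g v * \<phi> v \<partial>lborel) = gain_functional e B f \<phi>)"

definition partial :: "3 \<Rightarrow> (vec3 \<Rightarrow> real) \<Rightarrow> vec3 \<Rightarrow> real" where
  "partial i \<psi> x = frechet_derivative \<psi> (at x) (axis i 1)"

fun Ck :: "nat \<Rightarrow> (vec3 \<Rightarrow> real) \<Rightarrow> bool" where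
  "Ck 0 \<psi> = continuous_on UNIV \<psi>"
| "Ck (Suc k) \<psi> = ((\<forall>x. \<psi> differentiable (at x)) \<and> (\<forall>i. Ck k (partial i \<psi>)))"

definition test_fun :: "(vec3 \<Rightarrow> real) \<Rightarrow> bool" where
  "test_fun \<psi> \<longleftrightarrow> (\<forall>k. Ck k \<psi>) \<and> bounded {x. \<psi> x \<noteq> 0}"

definition weak_grad :: "(vec3 \<Rightarrow> real) \<Rightarrow> (vec3 \<Rightarrow> vec3) \<Rightarrow> bool" where
  "weak_grad u G \<longleftrightarrow> G \<in> borel_measurable lborel \<and>
     (\<forall>K i. compact K \<longrightarrow> set_integrable lborel K (\<lambda>x. G x $ i)) \<and>
     (\<forall>\<psi> i. test_fun \<psi> \<longrightarrow>
        (\<integral>x. u x * partial i \<psi> x \<partial>lborel) = - (\<integral>x. G x $ i * \<psi> x \<partial>lborel))"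

text \<open>Fisher information I(f) = 4 \<int> |\<nabla> sqrt f|^2 (infinity if sqrt f has no weak gradient
  in L^2; the infimum over the empty set is infinity; weak gradients agree a.e.).\<close>
definition fisher :: "(vec3 \<Rightarrow> real) \<Rightarrow> ennreal" where
  "fisher f = (INF G \<in> {G. weak_grad (\<lambda>v. sqrt (f v)) G}.
                 4 * (\<integral>\<^sup>+ v. ennreal ((norm (G v))\<^sup>2) \<partial>lborel))"

definition E1_solution :: "real \<Rightarrow> (real \<Rightarrow> real) \<Rightarrow> (real \<Rightarrow> vec3 \<Rightarrow> real) \<Rightarrow> bool" where
  "E1_solution e B F \<longleftrightarrow> (\<forall>t\<ge>0. prob_density (F t)) \<and>
     (\<forall>\<phi>. bounded_continuous \<phi> \<longrightarrow> (\<forall>t\<ge>0.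
        ((\<lambda>s. \<integral>v. F s v * \<phi> v \<partial>lborel) has_real_derivative coll_functional e B (F t) \<phi>)
          (at t within {0..})))"

end

theory Submission
  imports Defs
begin

text \<open>
  A score of a density \<open>f\<close> is a vector field \<open>s\<close> with \<open>\<nabla> f = f s\<close> weakly, so that the Fisher information is
  \<open>\<integral> f |s|\<^sup>2\<close>. Translating the post-collisional velocity while rotating \<open>n\<close> along with the relative velocity
  preserves the collision measure \<open>B dn dv dw\<close>; integrating by parts along this flow shows that the score of
  the gain term is a conditional expectation of \<open>1/2 (s + s\<^sub>*) + 1/2 T (s - s\<^sub>*)\<close>, where \<open>T\<close> has norm at most
  \<open>1/e\<close>. The cross term is antisymmetric under exchange of the particles, so Jensen's inequality bounds the
  Fisher information of the gain term by the factor \<open>1/e\<^sup>2\<close>, which is below the constant of the theorem.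
  For the equation, the Wild sum expresses the solution as a mixture of iterated gain terms; the same
  cancellation bounds the information of the \<open>n\<close>-th one by the factor \<open>(1/e\<^sup>2)\<^sub>n / n!\<close> (Pochhammer symbol), and the
  binomial series sums these bounds to \<open>exp ((1/e\<^sup>2 - 1) t)\<close>.
\<close>

text \<open>The kernel is merely integrable and must never be differentiated. The flow preserves
  both the measure \<open>dn dv dw\<close> and the argument of \<open>B\<close>, so all derivatives
  fall on the densities and the test function. Seen from the centre of mass, a collision sends the
  relative velocity \<open>q\<close> to a vector \<open>u\<close> with
  \<open>|u| \<ge> (e/2) |q|\<close>; this is the origin of \<open>1/e\<close>. The derivative of
  the flow is bilinear in \<open>q\<close> and \<open>u\<close>, up to the factor
  \<open>1/|u|^2\<close>, and a Gram determinant gives its transpose the sharp norm, where the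
  triangle inequality would lose a factor three. Only weak gradients are available, so identities
  are proved for test functions and carried over by mollification. A solution is identified with its
  Wild sum by mass: the partial sums lie below the solution and their mass tends to one. The
  hypotheses restrict \<open>B\<close> on [-1, 1] only, whereas the measurable sets of
  \<open>S2\<close> are all Borel sets of the space. If \<open>B\<close> is not Borel outside
  [-1, 1], the sphere integrands fail to be measurable and the integrals take their default value;
  this case has an argument of its own.\<close>

section \<open>Lebesgue measure under translation and reflection; continuity of translation in
  L1\<close>

lemma lborel_distr_affine:
 fixes c :: "'a::euclidean_space"
 assumes "s = 1 \<or> s = -1"
 shows "distr lborel borel (\<lambda>x. c + s *\<^sub>R x) = lborel"
 using lborel_affine[of s c] assms by (auto simp: density_1)

lemma
 fixes f :: "'a::euclidean_space \<Rightarrow> 'b::{banach, second_countable_topology}"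
 assumes "s = 1 \<or> s = -1" and [measurable]: "f \<in> borel_measurable borel"
 shows integral_lborel_affine: "(LBINT x. f (c + s *\<^sub>R x)) = (LBINT x. f x)"
  and integrable_lborel_affine: "integrable lborel (\<lambda>x. f (c + s *\<^sub>R x)) \<longleftrightarrow> integrable lborel f"
proof -
 have "(\<integral>x. f x \<partial>distr lborel borel (\<lambda>x. c + s *\<^sub>R x)) = (LBINT x. f (c + s *\<^sub>R x))"
  by (rule integral_distr) auto
 then show "(LBINT x. f (c + s *\<^sub>R x)) = (LBINT x. f x)"
  using lborel_distr_affine[OF assms(1), of c] by simp
 have "integrable (distr lborel borel (\<lambda>x. c + s *\<^sub>R x)) f \<longleftrightarrow> integrable lborel (\<lambda>x. f (c + s *\<^sub>R x))"
  by (rule integrable_distr_eq) auto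
 then show "integrable lborel (\<lambda>x. f (c + s *\<^sub>R x)) \<longleftrightarrow> integrable lborel f"
  using lborel_distr_affine[OF assms(1), of c] by simp
qed

lemma nn_integral_lborel_affine:
 fixes f :: "'a::euclidean_space \<Rightarrow> ennreal"
 assumes "s = 1 \<or> s = -1" and [measurable]: "f \<in> borel_measurable borel"
 shows "(\<integral>\<^sup>+x. f (c + s *\<^sub>R x) \<partial>lborel) = (\<integral>\<^sup>+x. f x \<partial>lborel)"
proof -
 have "(\<integral>\<^sup>+x. f x \<partial>distr lborel borel (\<lambda>x. c + s *\<^sub>R x)) = (\<integral>\<^sup>+x. f (c + s *\<^sub>R x) \<partial>lborel)"
  by (rule nn_integral_distr) auto
 then show ?thesis
  using lborel_distr_affine[OF assms(1), of c] by simp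
qed

lemma
 fixes f :: "'a::euclidean_space \<Rightarrow> 'b::{banach, second_countable_topology}"
 assumes "f \<in> borel_measurable borel"
 shows integral_lborel_shift: "(LBINT x. f (x - c)) = (LBINT x. f x)"
  and integrable_lborel_shift: "integrable lborel (\<lambda>x. f (x - c)) \<longleftrightarrow> integrable lborel f"
  and integral_lborel_reflect: "(LBINT x. f (c - x)) = (LBINT x. f x)"
  and integrable_lborel_reflect: "integrable lborel (\<lambda>x. f (c - x)) \<longleftrightarrow> integrable lborel f"
 using integral_lborel_affine[of 1 f "-c", OF _ assms] integrable_lborel_affine[of 1 f "-c", OF _ assms]
  integral_lborel_affine[of "-1" f c, OF _ assms] integrable_lborel_affine[of "-1" f c, OF _ assms]
 by (auto simp: algebra_simps)

lemma integrable_indicator_compact: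
 fixes K :: "'a::euclidean_space set"
 assumes "compact K"
 shows "integrable lborel (indicator K :: 'a \<Rightarrow> real)"
 using assms emeasure_compact_finite[OF assms] by (intro integrable_real_indicator) (auto simp: borel_compact)

text \<open>On the boundary of \<open>K\<close> the difference of the indicators need not tend to
  zero pointwise, but its positive part does, because \<open>K\<close> is closed. By translation
  invariance the difference has integral zero, so its absolute value has twice the integral of its
  positive part.\<close>

lemma L1_translation_compact:
 fixes K :: "'a::euclidean_space set"
 assumes K: "compact K" and y: "y \<longlonglongrightarrow> 0"
 shows "(\<lambda>j. \<integral>x. \<bar>indicator K (x - y j) - indicator K x :: real\<bar> \<partial>lborel) \<longlonglongrightarrow> 0"
proof -
 have [measurable]: "K \<in> sets borel" using K by (simp add: borel_compact)
 have iK: "integrable lborel (indicator K :: 'a \<Rightarrow> real)"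
  using K emeasure_compact_finite[OF K] by simp
 have sh: "integrable lborel (\<lambda>x. indicator K (x - c) :: real)"
   "(LBINT x. indicat_real K (x - c)) = (LBINT x. indicat_real K x)" for c
  using iK integrable_lborel_shift[of "indicator K :: 'a \<Rightarrow> real" c]
   integral_lborel_shift[of "indicator K :: 'a \<Rightarrow> real" c] by auto
 obtain Y where Y: "\<And>j. norm (y j) \<le> Y"
  using convergent_imp_Bseq[of y] y by (auto simp: convergent_def Bseq_def)
 obtain R where R: "\<And>x. x \<in> K \<Longrightarrow> norm x \<le> R"
  using compact_imp_bounded[OF K] by (auto simp: bounded_iff)
 let ?p = "\<lambda>j x. max 0 (indicator K (x - y j) - indicator K x :: real)"
 have "(\<lambda>j. \<integral>x. ?p j x \<partial>lborel) \<longlonglongrightarrow> (\<integral>x. 0 \<partial>(lborel :: 'a measure))"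
 proof (rule integral_dominated_convergence[where w="indicator (cball 0 (R + Y))"])
  show "integrable lborel (indicator (cball 0 (R + Y)) :: 'a \<Rightarrow> real)"
   by (rule integrable_indicator_compact) simp
  show "AE x in lborel. (\<lambda>j. ?p j x) \<longlonglongrightarrow> 0"
  proof (rule AE_I2)
   fix x
   show "(\<lambda>j. ?p j x) \<longlonglongrightarrow> 0"
   proof (cases "x \<in> K")
    case True
    then have "?p j x = 0" for j by (auto simp: indicator_def)
    then show ?thesis by simp
   next
    case False
    have "(\<lambda>j. x - y j) \<longlonglongrightarrow> x - 0" by (intro tendsto_intros y)
    then have "eventually (\<lambda>j. x - y j \<in> - K) sequentially"
     using K False by (intro topological_tendstoD) (auto simp: open_Compl compact_imp_closed)
    then have "eventually (\<lambda>j. ?p j x = 0) sequentially"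
     by eventually_elim auto
    then show ?thesis by (rule tendsto_eventually)
   qed
  qed
  show "AE x in lborel. norm (?p j x) \<le> indicator (cball 0 (R + Y)) x" for j
  proof (rule AE_I2)
   fix x
   have "norm x \<le> R + Y" if "x - y j \<in> K"
    using R[OF that] Y[of j] norm_triangle_ineq[of "x - y j" "y j"] by simp
   then show "norm (?p j x) \<le> indicator (cball 0 (R + Y)) x"
    by (auto simp: indicator_def)
  qed
 qed auto
 then have l: "(\<lambda>j. 2 * (LBINT x. ?p j x)) \<longlonglongrightarrow> 0"
  by (intro tendsto_mult_right_zero) simp
 have "(LBINT x. \<bar>indicator K (x - y j) - indicator K x :: real\<bar>) = 2 * (LBINT x. ?p j x)" for j
 proof -
  have i1: "integrable lborel (\<lambda>x. indicator K (x - y j) - indicator K x :: real)"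
   using sh iK by (intro Bochner_Integration.integrable_diff)
  then have i2: "integrable lborel (?p j)" by auto
  have "(LBINT x. \<bar>indicator K (x - y j) - indicator K x :: real\<bar>)
    = (LBINT x. 2 * ?p j x - (indicator K (x - y j) - indicator K x :: real))"
   by (intro Bochner_Integration.integral_cong) (auto simp: indicator_def)
  also have "\<dots> = 2 * (LBINT x. ?p j x) - 0"
   using i1 i2 sh iK by (subst Bochner_Integration.integral_diff) auto
  finally show ?thesis by simp
 qed
 then show ?thesis using l by simp
qed

text \<open>Inner regularity concerns finite measures, so it is applied to Lebesgue measure
  restricted to \<open>A\<close>.\<close>

lemma finite_measure_inner_compact:
 fixes A :: "'a::euclidean_space set"
 assumes A[measurable]: "A \<in> sets borel" and fin: "emeasure lborel A < \<infinity>" and r: "0 < r"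
 obtains K where "compact K" "K \<subseteq> A" "emeasure lborel (A - K) < ennreal r"
proof -
 let ?M = "density lborel (indicator A :: 'a \<Rightarrow> ennreal)"
 have em: "emeasure ?M X = emeasure lborel (A \<inter> X)" if "X \<in> sets borel" for X
  using that by (subst emeasure_density) (auto simp: nn_integral_set_ennreal indicator_inter_arith[symmetric])
 have "emeasure ?M (space ?M) \<noteq> \<infinity>"
  using em[of UNIV] fin by auto
 from inner_regular[OF _ this A] have "emeasure lborel A = (SUP K\<in>{K. K \<subseteq> A \<and> compact K}. emeasure ?M K)"
  using em[OF A] by simp
 moreover have "\<exists>K. K \<subseteq> A \<and> compact K \<and> emeasure lborel A < emeasure lborel K + ennreal r"
 proof (cases "emeasure lborel A = 0")
  case True
  then show ?thesis using r by (intro exI[of _ "{}"]) auto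
 next
  case False
  then have "emeasure lborel A - ennreal r < emeasure lborel A"
   using r fin by (intro ennreal_between) (auto simp: zero_less_iff_neq_zero)
  with calculation obtain K where K: "K \<subseteq> A" "compact K" "emeasure lborel A - ennreal r < emeasure ?M K"
   by (auto simp: less_SUP_iff)
  have "emeasure ?M K = emeasure lborel K"
   using K em[of K] by (simp add: borel_compact Int_absorb1)
  then show ?thesis using K fin r
   by (intro exI[of _ K], cases "emeasure lborel A"; cases "emeasure lborel K")
    (auto simp: ennreal_minus ennreal_less_iff ennreal_plus[symmetric] ennreal_less_iff[OF diff_ge_0_iff_ge[THEN iffD2]]
     not_le simp del: ennreal_plus split: if_splits intro: ccontr)
 qed
 ultimately obtain K where K: "K \<subseteq> A" "compact K" "emeasure lborel A < emeasure lborel K + ennreal r" by blast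
 have "emeasure lborel (A - K) = emeasure lborel A - emeasure lborel K"
  using K by (intro emeasure_Diff) (use emeasure_compact_finite[OF K(2)] in \<open>auto simp: borel_compact less_top\<close>)
 also have "\<dots> < ennreal r"
  using K fin r emeasure_mono[of K A lborel] emeasure_compact_finite[OF K(2)]
  by (cases "emeasure lborel A"; cases "emeasure lborel K")
   (auto simp: ennreal_minus ennreal_less_iff ennreal_plus[symmetric] simp del: ennreal_plus)
 finally show ?thesis using that K by blast
qed

lemma L1_translation_set:
 fixes A :: "'a::euclidean_space set"
 assumes [measurable]: "A \<in> sets borel" and A: "emeasure lborel A < \<infinity>" and y: "y \<longlonglongrightarrow> 0"
 shows "(\<lambda>j. \<integral>x. \<bar>indicator A (x - y j) - indicator A x :: real\<bar> \<partial>lborel) \<longlonglongrightarrow> 0"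
proof (rule LIMSEQ_I)
 fix r :: real assume r: "0 < r"
 obtain K where K: "compact K" "K \<subseteq> A" "emeasure lborel (A - K) < ennreal (r/4)"
  using finite_measure_inner_compact[OF assms(1) A, of "r/4"] r by auto
 have [measurable]: "K \<in> sets borel" using K by (simp add: borel_compact)
 let ?d = "\<lambda>x. indicator (A - K) x :: real"
 have id: "integrable lborel ?d"
  using order.strict_trans[OF K(3) ennreal_less_top] by (intro integrable_real_indicator) auto
 have md: "(LBINT x. ?d x) < r/4"
  using K(3) r emeasure_eq_ennreal_measure[of lborel "A - K"] order.strict_trans[OF K(3) ennreal_less_top]
  by (simp add: ennreal_less_iff flip: less_top)
 have iA: "integrable lborel (indicator A :: 'a \<Rightarrow> real)" using A by simp
 have iK: "integrable lborel (indicator K :: 'a \<Rightarrow> real)"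
  using K(1) emeasure_compact_finite[OF K(1)] by simp
 from LIMSEQ_D[OF L1_translation_compact[OF K(1) y], of "r/4"] r obtain N where
  N: "\<And>j. j \<ge> N \<Longrightarrow> norm ((LBINT x. \<bar>indicator K (x - y j) - indicator K x :: real\<bar>) - 0) < r/4" by auto
 have "norm ((LBINT x. \<bar>indicator A (x - y j) - indicator A x :: real\<bar>) - 0) < r" if "j \<ge> N" for j
 proof -
  note sh = integrable_lborel_shift[THEN iffD2]
  have i1: "integrable lborel (\<lambda>x. ?d (x - y j))" by (rule sh) (use id in auto)
  have i2: "integrable lborel (\<lambda>x. indicator A (x - y j) :: real)" 
   by (rule integrable_lborel_shift[of "indicat_real A", THEN iffD2]) (use iA in auto)
  have i3: "integrable lborel (\<lambda>x. indicator K (x - y j) :: real)" 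
   by (rule integrable_lborel_shift[of "indicat_real K", THEN iffD2]) (use iK in auto)
  have "(LBINT x. \<bar>indicator A (x - y j) - indicator A x :: real\<bar>)
   \<le> (LBINT x. ?d (x - y j) + ?d x + \<bar>indicator K (x - y j) - indicator K x\<bar>)"
  proof (rule integral_mono)
   show "integrable lborel (\<lambda>x. \<bar>indicator A (x - y j) - indicator A x :: real\<bar>)"
    using i2 iA by (intro integrable_abs Bochner_Integration.integrable_diff)
   show "integrable lborel (\<lambda>x. ?d (x - y j) + ?d x + \<bar>indicator K (x - y j) - indicator K x\<bar>)"
    using i1 i3 id iK
    by (intro Bochner_Integration.integrable_add integrable_abs Bochner_Integration.integrable_diff)
  qed (use K(2) in \<open>auto simp: indicator_def\<close>)
  also have "\<dots> = 2 * (LBINT x. ?d x) + (LBINT x. \<bar>indicator K (x - y j) - indicator K x :: real\<bar>)"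
   using i1 i3 id iK integral_lborel_shift[of ?d "y j"] by simp
  also have "\<dots> < r" using N[OF that] md r by simp
  finally show ?thesis by simp
 qed
 then show "\<exists>N. \<forall>j\<ge>N. norm ((LBINT x. \<bar>indicator A (x - y j) - indicator A x :: real\<bar>) - 0) < r" by blast
qed

text \<open>Induction starting from indicators of sets of finite measure. In the limit case the L1
  error of an approximant is unchanged by translation, so it enters twice and the translation error
  of the approximant once.\<close>

lemma L1_translation_continuous:
 fixes f :: "'a::euclidean_space \<Rightarrow> real"
 assumes "integrable lborel f" and y: "y \<longlonglongrightarrow> 0"
 shows "(\<lambda>j. \<integral>x. \<bar>f (x - y j) - f x\<bar> \<partial>lborel) \<longlonglongrightarrow> 0"
 using assms(1)
proof induction
 case (base A c)
 then have A: "A \<in> sets borel" "emeasure lborel A < \<infinity>" by auto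
 have "(LBINT x. \<bar>indicator A (x - y j) *\<^sub>R c - indicator A x *\<^sub>R c\<bar>)
  = (LBINT x. \<bar>indicator A (x - y j) - indicator A x\<bar>) * \<bar>c\<bar>" for j
  by (subst integral_mult_left_zero[symmetric], intro Bochner_Integration.integral_cong)
   (auto simp: abs_mult[symmetric] algebra_simps)
 then show ?case
  using tendsto_mult_left_zero[OF L1_translation_set[OF A y]] by simp
next
 case (add f g)
 have i: "integrable lborel (\<lambda>x. f (x - y j))" "integrable lborel (\<lambda>x. g (x - y j))" for j
  using add by (auto intro!: integrable_lborel_shift[THEN iffD2])
 show ?case
 proof (rule tendsto_sandwich[OF _ _ tendsto_const])
  show "(\<lambda>j. (LBINT x. \<bar>f (x - y j) - f x\<bar>) + (LBINT x. \<bar>g (x - y j) - g x\<bar>)) \<longlonglongrightarrow> 0"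
   using tendsto_add[OF add(3,4)] by simp
  show "\<forall>\<^sub>F j in sequentially. (LBINT x. \<bar>f (x - y j) + g (x - y j) - (f x + g x)\<bar>)
   \<le> (LBINT x. \<bar>f (x - y j) - f x\<bar>) + (LBINT x. \<bar>g (x - y j) - g x\<bar>)"
  proof (intro always_eventually allI)
   fix j
   have "(LBINT x. \<bar>f (x - y j) + g (x - y j) - (f x + g x)\<bar>)
    \<le> (LBINT x. \<bar>f (x - y j) - f x\<bar> + \<bar>g (x - y j) - g x\<bar>)"
    using add(1,2) i by (intro integral_mono) auto
   also have "\<dots> = (LBINT x. \<bar>f (x - y j) - f x\<bar>) + (LBINT x. \<bar>g (x - y j) - g x\<bar>)"
    using add(1,2) i by (intro Bochner_Integration.integral_add) auto
   finally show "(LBINT x. \<bar>f (x - y j) + g (x - y j) - (f x + g x)\<bar>)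
    \<le> (LBINT x. \<bar>f (x - y j) - f x\<bar>) + (LBINT x. \<bar>g (x - y j) - g x\<bar>)" .
  qed
 qed auto
next
 case (lim f s)
 have [measurable]: "f \<in> borel_measurable borel" "\<And>k. s k \<in> borel_measurable borel" using lim by auto
 \<comment> \<open>The induction rule supplies
   \<open>\<bar>s k x\<bar> \<le> 2 * \<bar>f x\<bar>\<close>, whence the factor 3 in the dominating
   function.\<close>
 have fs: "(\<lambda>k. \<integral>x. \<bar>s k x - f x\<bar> \<partial>lborel) \<longlonglongrightarrow> (\<integral>x. 0 \<partial>(lborel :: 'a measure))"
 proof (rule integral_dominated_convergence[where w="\<lambda>x. 3 * \<bar>f x\<bar>"])
  show "AE x in lborel. (\<lambda>k. \<bar>s k x - f x\<bar>) \<longlonglongrightarrow> 0"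
   using lim(2) by (auto intro!: AE_I2 tendsto_rabs_zero simp: LIM_zero)
  show "AE x in lborel. norm \<bar>s k x - f x\<bar> \<le> 3 * \<bar>f x\<bar>" for k
  proof (rule AE_I2)
   fix x show "norm \<bar>s k x - f x\<bar> \<le> 3 * \<bar>f x\<bar>"
    using lim(3)[of x k] by simp
  qed
 qed (use lim in auto)
 show ?case
 proof (rule LIMSEQ_I)
  fix r :: real assume r: "0 < r"
  obtain k where k: "(LBINT x. \<bar>s k x - f x\<bar>) < r/4"
   using LIMSEQ_D[OF fs, of "r/4"] r by force
  obtain N where N: "\<And>j. j \<ge> N \<Longrightarrow> (LBINT x. \<bar>s k (x - y j) - s k x\<bar>) < r/4"
   using LIMSEQ_D[OF lim(5)[of k], of "r/4"] r by force
  have "norm ((LBINT x. \<bar>f (x - y j) - f x\<bar>) - 0) < r" if "j \<ge> N" for j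
  proof -
   note sh = integrable_lborel_shift[THEN iffD2]
   let ?d = "\<lambda>x. \<bar>s k x - f x\<bar>"
   have id: "integrable lborel ?d" using lim by auto
   have i1: "integrable lborel (\<lambda>x. ?d (x - y j))" by (rule sh) (use id in auto)
   have i2: "integrable lborel (\<lambda>x. f (x - y j))" "integrable lborel (\<lambda>x. s k (x - y j))"
    using lim by (auto intro!: sh)
   have "(LBINT x. \<bar>f (x - y j) - f x\<bar>)
    \<le> (LBINT x. ?d (x - y j) + ?d x + \<bar>s k (x - y j) - s k x\<bar>)"
    using i1 i2 id lim by (intro integral_mono) auto
   also have "\<dots> = 2 * (LBINT x. ?d x) + (LBINT x. \<bar>s k (x - y j) - s k x\<bar>)"
    using i1 i2 id lim integral_lborel_shift[of ?d "y j"] by simp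
   also have "\<dots> < r" using N[OF that] k r by simp
   finally show ?thesis by simp
  qed
  then show "\<exists>N. \<forall>j\<ge>N. norm ((LBINT x. \<bar>f (x - y j) - f x\<bar>) - 0) < r" by blast
 qed
qed

section \<open>Directional derivatives and the algebra of test functions\<close>

lemma partial_has_derivative:
 assumes "\<psi> differentiable (at x)"
 shows "((\<lambda>t. \<psi> (x + t *\<^sub>R axis i 1)) has_real_derivative partial i \<psi> x) (at 0)"
proof -
 have "(\<psi> has_derivative frechet_derivative \<psi> (at x)) (at x)"
  using assms by (simp add: frechet_derivative_works)
 then have "(\<psi> has_derivative frechet_derivative \<psi> (at x)) (at (x + 0 *\<^sub>R axis i 1))"
  by simp
 then have "((\<lambda>t. \<psi> (x + t *\<^sub>R axis i 1)) has_derivative (\<lambda>t. frechet_derivative \<psi> (at x) (t *\<^sub>R axis i 1))) (at 0)"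
  by (rule has_derivative_compose[rotated, where f="\<lambda>t. x + t *\<^sub>R axis i 1"]) (auto intro!: derivative_eq_intros)
 moreover have "frechet_derivative \<psi> (at x) (t *\<^sub>R axis i 1) = partial i \<psi> x * t" for t
  using linear_frechet_derivative[OF assms] by (simp add: linear_cmul partial_def)
 ultimately show ?thesis
  by (simp add: has_field_derivative_def mult_commute_abs)
qed

lemma partial_eqI: "(\<psi> has_derivative D) (at x) \<Longrightarrow> partial i \<psi> x = D (axis i 1)"
 unfolding partial_def by (metis frechet_derivative_at)

lemma frechet_derivative_partial:
 assumes "\<psi> differentiable (at (x::vec3))"
 shows "frechet_derivative \<psi> (at x) h = (\<Sum>i\<in>UNIV. h $ i * partial i \<psi> x)"
proof -
 have "h = (\<Sum>i\<in>UNIV. h $ i *\<^sub>R axis i 1)"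
  using basis_expansion[of h] by (simp add: scalar_mult_eq_scaleR)
 then have "frechet_derivative \<psi> (at x) h = frechet_derivative \<psi> (at x) (\<Sum>i\<in>UNIV. h $ i *\<^sub>R axis i 1)"
  by simp
 also have "\<dots> = (\<Sum>i\<in>UNIV. h $ i * partial i \<psi> x)"
  using linear_frechet_derivative[OF assms]
  by (simp add: linear_sum linear_cmul partial_def)
 finally show ?thesis .
qed

lemma Ck_Suc: "Ck (Suc k) \<psi> \<Longrightarrow> Ck k \<psi>"
proof (induction k arbitrary: \<psi>)
 case 0
 then show ?case
  by (auto intro!: differentiable_imp_continuous_within continuous_at_imp_continuous_on)
qed auto

lemma Ck_add: "Ck k f \<Longrightarrow> Ck k g \<Longrightarrow> Ck k (\<lambda>x. f x + g x)"
proof (induction k arbitrary: f g)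
 case (Suc k)
 have "partial i (\<lambda>x. f x + g x) = (\<lambda>x. partial i f x + partial i g x)" for i
 proof
  fix x
  have "(f has_derivative frechet_derivative f (at x)) (at x)"
   "(g has_derivative frechet_derivative g (at x)) (at x)"
   using Suc by (auto simp: frechet_derivative_works[symmetric])
  from partial_eqI[OF has_derivative_add[OF this]]
  show "partial i (\<lambda>x. f x + g x) x = partial i f x + partial i g x"
   by (simp add: partial_def)
 qed
 then show ?case using Suc by (auto intro!: differentiable_add)
qed (auto intro: continuous_on_add)

lemma partial_mult:
 assumes "f differentiable (at x)" "g differentiable (at x)"
 shows "partial i (\<lambda>x. f x * g x) x = f x * partial i g x + partial i f x * g x"
proof -
 have "(f has_derivative frechet_derivative f (at x)) (at x)"
  "(g has_derivative frechet_derivative g (at x)) (at x)"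
  using assms by (auto simp: frechet_derivative_works[symmetric])
 from partial_eqI[OF has_derivative_mult[OF this]]
 show ?thesis by (simp add: partial_def)
qed

lemma Ck_mult: "Ck k f \<Longrightarrow> Ck k g \<Longrightarrow> Ck k (\<lambda>x. f x * g x)"
proof (induction k arbitrary: f g)
 case (Suc k)
 have "partial i (\<lambda>x. f x * g x) = (\<lambda>x. f x * partial i g x + partial i f x * g x)" for i
  using Suc.prems partial_mult by fastforce
 moreover have "Ck k f" "Ck k g" using Suc.prems Ck_Suc by auto
 ultimately show ?case using Suc by (auto intro!: differentiable_mult Ck_add)
qed (auto intro: continuous_on_mult)

lemma Ck_cmult: "Ck k f \<Longrightarrow> Ck k (\<lambda>x. c * f x)"
proof (induction k arbitrary: f)
 case (Suc k)
 have "partial i (\<lambda>x. c * f x) = (\<lambda>x. c * partial i f x)" for i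
  using Suc.prems partial_mult[of "\<lambda>_. c"] partial_eqI[OF has_derivative_const] by fastforce
 then show ?case using Suc by (auto intro!: differentiable_mult differentiable_const)
qed (auto intro!: continuous_intros)

lemma partial_affine:
 assumes "\<psi> differentiable (at (d + c *\<^sub>R x))"
 shows "(\<lambda>x. \<psi> (d + c *\<^sub>R x)) differentiable (at x)"
  and "partial i (\<lambda>x. \<psi> (d + c *\<^sub>R x)) x = c * partial i \<psi> (d + c *\<^sub>R x)"
proof -
 have "(\<psi> has_derivative frechet_derivative \<psi> (at (d + c *\<^sub>R x))) (at (d + c *\<^sub>R x))"
  using assms by (simp add: frechet_derivative_works)
 then have *: "((\<lambda>x. \<psi> (d + c *\<^sub>R x)) has_derivative (\<lambda>h. frechet_derivative \<psi> (at (d + c *\<^sub>R x)) (c *\<^sub>R h))) (at x)"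
  by (rule has_derivative_compose[rotated, where f="\<lambda>x. d + c *\<^sub>R x"]) (auto intro!: derivative_eq_intros)
 then show "(\<lambda>x. \<psi> (d + c *\<^sub>R x)) differentiable (at x)"
  by (auto simp: differentiable_def)
 show "partial i (\<lambda>x. \<psi> (d + c *\<^sub>R x)) x = c * partial i \<psi> (d + c *\<^sub>R x)"
  using partial_eqI[OF *] linear_frechet_derivative[OF assms] by (simp add: partial_def linear_cmul)
qed

lemma Ck_affine: "Ck k \<psi> \<Longrightarrow> Ck k (\<lambda>x. \<psi> (d + c *\<^sub>R x))"
proof (induction k arbitrary: \<psi>)
 case 0
 then show ?case by (auto intro!: continuous_intros elim: continuous_on_compose2)
next
 case (Suc k)
 then have "partial i (\<lambda>x. \<psi> (d + c *\<^sub>R x)) = (\<lambda>x. c * partial i \<psi> (d + c *\<^sub>R x))" for i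
  by (intro ext partial_affine) auto
 then show ?case using Suc partial_affine by (auto intro!: Ck_cmult)
qed

lemma test_fun_differentiable: "test_fun \<psi> \<Longrightarrow> \<psi> differentiable (at x)"
 unfolding test_fun_def by (metis Ck.simps(2))

lemma test_fun_continuous: "test_fun \<psi> \<Longrightarrow> continuous_on A \<psi>"
 unfolding test_fun_def by (metis Ck.simps(1) continuous_on_subset subset_UNIV)

lemma test_fun_measurable[measurable_dest]: "test_fun \<psi> \<Longrightarrow> \<psi> \<in> borel_measurable borel"
 by (simp add: borel_measurable_continuous_onI test_fun_continuous)

lemma test_fun_support:
 assumes "test_fun \<psi>"
 obtains R where "R > 0" "\<And>x. norm x > R \<Longrightarrow> \<psi> x = 0"
 using assms unfolding test_fun_def bounded_pos by force

lemma test_fun_partial: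
 assumes "test_fun \<psi>" shows "test_fun (partial i \<psi>)"
proof -
 obtain R where R: "R > 0" "\<And>x. norm x > R \<Longrightarrow> \<psi> x = 0" using test_fun_support[OF assms] by blast
 have "partial i \<psi> x = 0" if "norm x > R" for x
 proof -
  have "((\<lambda>_. 0) has_derivative (\<lambda>_. 0)) (at x)" by simp
  then have "(\<psi> has_derivative (\<lambda>_. 0)) (at x)"
  by (rule has_derivative_transform_within_open[where s="- cball 0 R"]) (use that R in auto)
  then show ?thesis using partial_eqI by blast
 qed
 then have "{x. partial i \<psi> x \<noteq> 0} \<subseteq> cball 0 R" by (auto simp: not_less[symmetric])
 then show ?thesis using assms unfolding test_fun_def
  by (metis Ck.simps(2) bounded_cball bounded_subset)
qed

lemma test_fun_bounded:
 assumes "test_fun \<psi>"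
 obtains M where "M > 0" "\<And>x. \<bar>\<psi> x\<bar> \<le> M"
proof -
 obtain R where R: "R > 0" "\<And>x. norm x > R \<Longrightarrow> \<psi> x = 0" using test_fun_support[OF assms] by blast
 have "bounded (\<psi> ` cball 0 R)"
  by (intro compact_imp_bounded compact_continuous_image test_fun_continuous assms compact_cball)
 then obtain M where M: "M > 0" "\<And>x. x \<in> cball 0 R \<Longrightarrow> \<bar>\<psi> x\<bar> \<le> M"
  unfolding bounded_pos by auto
 have "\<bar>\<psi> x\<bar> \<le> M" for x
  using M R by (cases "norm x > R") auto
 then show ?thesis using that M by blast
qed

lemma integrable_bounded_support:
 fixes f :: "'a::euclidean_space \<Rightarrow> real"
 assumes [measurable]: "f \<in> borel_measurable borel" and "\<And>x. \<bar>f x\<bar> \<le> M" "\<And>x. norm x > R \<Longrightarrow> f x = 0"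
 shows "integrable lborel f"
proof (rule Bochner_Integration.integrable_bound)
 show "integrable lborel (\<lambda>x::'a. M * indicator (cball 0 R) x :: real)"
  using emeasure_compact_finite[OF compact_cball[of "0::'a" R]] by (intro integrable_mult_right integrable_real_indicator) auto
 show "AE x in lborel. norm (f x) \<le> norm (M * indicator (cball 0 R) x :: real)"
  using assms(2,3) by (intro AE_I2) (fastforce simp: indicator_def not_le intro: order_trans[OF _ abs_ge_self])
qed simp

lemma test_fun_integrable: "test_fun \<psi> \<Longrightarrow> integrable lborel \<psi>"
 by (metis integrable_bounded_support test_fun_bounded test_fun_support test_fun_measurable)

lemma test_fun_mult: "test_fun f \<Longrightarrow> test_fun g \<Longrightarrow> test_fun (\<lambda>x. f x * g x)"
 unfolding test_fun_def by (auto intro: Ck_mult bounded_subset)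

lemma test_fun_cmult: "test_fun f \<Longrightarrow> test_fun (\<lambda>x. c * f x)"
 unfolding test_fun_def by (auto intro: Ck_cmult bounded_subset)

lemma test_fun_affine:
 assumes "test_fun \<psi>" "c \<noteq> 0"
 shows "test_fun (\<lambda>x. \<psi> (d + c *\<^sub>R x))"
proof -
 obtain R where R: "R > 0" "\<And>x. norm x > R \<Longrightarrow> \<psi> x = 0" using test_fun_support[OF assms(1)] by blast
 have "norm x \<le> (R + norm d) / \<bar>c\<bar>" if "\<psi> (d + c *\<^sub>R x) \<noteq> 0" for x
 proof -
  have "norm (d + c *\<^sub>R x) \<le> R" using R that by (meson not_less)
  then have "norm (c *\<^sub>R x) \<le> R + norm d"
   using norm_triangle_ineq2[of "c *\<^sub>R x" "-d"] by (simp add: add.commute)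
  then show ?thesis using assms(2) by (simp add: field_simps)
 qed
 then have "bounded {x. \<psi> (d + c *\<^sub>R x) \<noteq> 0}" unfolding bounded_iff by blast
 then show ?thesis using assms Ck_affine unfolding test_fun_def by blast
qed

lemma partial_test_affine:
 "test_fun \<psi> \<Longrightarrow> partial i (\<lambda>x. \<psi> (d + c *\<^sub>R x)) x = c * partial i \<psi> (d + c *\<^sub>R x)"
 by (intro partial_affine test_fun_differentiable)

section \<open>Mollification of integrable functions\<close>

lemma
 fixes h :: "'a::euclidean_space \<Rightarrow> real"
 assumes c: "c \<noteq> 0" and [measurable]: "h \<in> borel_measurable borel"
 shows integral_lborel_scale: "(LBINT y. h (t + c *\<^sub>R y)) * \<bar>c\<bar> ^ DIM('a) = (LBINT y. h y)"
  and integrable_lborel_scale: "integrable lborel h \<Longrightarrow> integrable lborel (\<lambda>y. h (t + c *\<^sub>R y))"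
proof -
 let ?D = "distr lborel borel (\<lambda>x. t + c *\<^sub>R x)"
 note eq = lborel_affine[OF c, where t=t and 'a='a]
 have "(LBINT y. h y) = (\<integral>y. h y \<partial>density ?D (\<lambda>_. ennreal (\<bar>c\<bar> ^ DIM('a))))"
  using arg_cong[OF eq, of "\<lambda>M. integral\<^sup>L M h"] by simp
 also have "\<dots> = (\<integral>y. \<bar>c\<bar> ^ DIM('a) * h y \<partial>?D)"
  by (subst integral_density) auto
 also have "\<dots> = (LBINT y. \<bar>c\<bar> ^ DIM('a) * h (t + c *\<^sub>R y))"
  by (subst integral_distr) auto
 finally show "(LBINT y. h (t + c *\<^sub>R y)) * \<bar>c\<bar> ^ DIM('a) = (LBINT y. h y)"
  by (simp add: mult.commute)
 assume "integrable lborel h"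
 then have "integrable (density ?D (\<lambda>_. ennreal (\<bar>c\<bar> ^ DIM('a)))) h"
  using arg_cong[OF eq, of "\<lambda>M. integrable M h"] by simp
 then have "integrable ?D (\<lambda>y. \<bar>c\<bar> ^ DIM('a) * h y)"
  by (subst (asm) integrable_density) auto
 then have "integrable lborel (\<lambda>y. \<bar>c\<bar> ^ DIM('a) * h (t + c *\<^sub>R y))"
  by (subst (asm) integrable_distr_eq) auto
 then show "integrable lborel (\<lambda>y. h (t + c *\<^sub>R y))"
  using c by simp
qed

definition mollifier :: "(vec3 \<Rightarrow> real) \<Rightarrow> bool" where
 "mollifier \<eta> \<longleftrightarrow> test_fun \<eta> \<and> (\<forall>x. 0 \<le> \<eta> x) \<and> (LBINT x. \<eta> x) = 1"

text \<open>The normalised square of a test function that is not identically zero serves as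
  mollifier. Wherever a mollifier is wanted below, such a test function is at hand, or else the
  claim is trivial.\<close>

lemma mollifier_exists:
 assumes \<psi>: "test_fun \<psi>" and "\<psi> x \<noteq> 0"
 obtains \<eta> where "mollifier \<eta>"
proof -
 let ?I = "\<integral>x. \<psi> x * \<psi> x \<partial>lborel"
 have t: "test_fun (\<lambda>x. \<psi> x * \<psi> x)" using \<psi> \<psi> by (rule test_fun_mult)
 have "?I \<noteq> 0"
 proof
  assume "?I = 0"
  then have "AE x in lborel. \<psi> x * \<psi> x = 0"
   using test_fun_integrable[OF t] by (subst (asm) integral_nonneg_eq_0_iff_AE) auto
  \<comment> \<open>A closed set of full measure is the whole space, so \<open>\<psi>\<close> would
    vanish identically.\<close>
  then have "AE x in lebesgue. x \<in> {x. \<psi> x = 0}"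
   by (auto intro: AE_completion)
  moreover have "closed {x. \<psi> x = 0}"
   by (intro closed_Collect_eq test_fun_continuous \<psi> continuous_on_const)
  ultimately have "x \<in> {x. \<psi> x = 0}"
   by (intro mem_closed_if_AE_lebesgue) auto
  then show False using assms by simp
 qed
 moreover have "0 \<le> ?I" by (intro Bochner_Integration.integral_nonneg) auto
 ultimately have "mollifier (\<lambda>x. (1 / ?I) * (\<psi> x * \<psi> x))"
  unfolding mollifier_def using test_fun_cmult[OF t, of "1 / ?I"] by auto
 then show ?thesis using that by blast
qed

definition eta_scaled :: "(vec3 \<Rightarrow> real) \<Rightarrow> nat \<Rightarrow> vec3 \<Rightarrow> real" where
 "eta_scaled \<eta> j x = real (Suc j) ^ 3 * \<eta> (real (Suc j) *\<^sub>R x)"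

text \<open>The fourth power is the normalising cube of \<open>eta_scaled\<close> times the factor
  from the chain rule.\<close>

definition deta_scaled :: "(vec3 \<Rightarrow> real) \<Rightarrow> 3 \<Rightarrow> nat \<Rightarrow> vec3 \<Rightarrow> real" where
 "deta_scaled \<eta> i j x = real (Suc j) ^ 4 * partial i \<eta> (real (Suc j) *\<^sub>R x)"

definition mollify :: "(vec3 \<Rightarrow> real) \<Rightarrow> nat \<Rightarrow> (vec3 \<Rightarrow> real) \<Rightarrow> vec3 \<Rightarrow> real" where
 "mollify \<eta> j f x = (LBINT y. f y * eta_scaled \<eta> j (x - y))"

lemma mollifier_test: "mollifier \<eta> \<Longrightarrow> test_fun \<eta>" by (simp add: mollifier_def)

lemma test_fun_eta_scaled: "test_fun \<eta> \<Longrightarrow> test_fun (eta_scaled \<eta> j)"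
 using test_fun_cmult[OF test_fun_affine[of \<eta> "real (Suc j)" 0], of "real (Suc j) ^ 3"]
 by (simp add: eta_scaled_def[abs_def])

lemma partial_eta_scaled: "test_fun \<eta> \<Longrightarrow> partial i (eta_scaled \<eta> j) x = deta_scaled \<eta> i j x"
 using partial_mult[where f="\<lambda>_. real (Suc j) ^ 3" and x=x and g="\<lambda>x. \<eta> (0 + real (Suc j) *\<^sub>R x)" and i=i]
  partial_affine(1)[of \<eta> 0 "real (Suc j)" x] partial_affine(2)[of \<eta> 0 "real (Suc j)" x i] test_fun_differentiable[of \<eta>]
  partial_eqI[OF has_derivative_const[of "real (Suc j) ^ 3"]]
 by (simp add: eta_scaled_def[abs_def] deta_scaled_def power_numeral_reduce)

lemma test_fun_deta_scaled: "test_fun \<eta> \<Longrightarrow> test_fun (deta_scaled \<eta> i j)"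
 using test_fun_partial[OF test_fun_eta_scaled, of \<eta> i j] partial_eta_scaled[of \<eta> i j]
 by (simp add: ext[of "partial i (eta_scaled \<eta> j)" "deta_scaled \<eta> i j"])

lemma test_fun_reflect: "test_fun \<psi> \<Longrightarrow> test_fun (\<lambda>y. \<psi> (x - y))"
 using test_fun_affine[of \<psi> "-1" x] by simp

lemma test_fun_shift: "test_fun \<psi> \<Longrightarrow> test_fun (\<lambda>x. \<psi> (x - y))"
 using test_fun_affine[of \<psi> 1 "-y"] by simp

lemma partial_reflect: "test_fun \<psi> \<Longrightarrow> partial i (\<lambda>y. \<psi> (x - y)) y = - partial i \<psi> (x - y)"
 using partial_test_affine[of \<psi> i x "-1" y] by simp

lemma partial_shift: "test_fun \<psi> \<Longrightarrow> partial i (\<lambda>x. \<psi> (x - y)) x = partial i \<psi> (x - y)"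
 using partial_test_affine[of \<psi> i "-y" 1 x] by simp

lemma mollify_measurable[measurable]:
 assumes [measurable]: "f \<in> borel_measurable borel" and \<eta>: "test_fun \<eta>"
 shows "mollify \<eta> j f \<in> borel_measurable borel"
proof -
 have [measurable]: "eta_scaled \<eta> j \<in> borel_measurable borel"
  using test_fun_eta_scaled[OF \<eta>] by (rule test_fun_measurable)
 show ?thesis unfolding mollify_def[abs_def] by measurable
qed

lemma integrable_mult_test_fun:
 assumes f: "integrable lborel f" and \<psi>: "test_fun \<psi>"
 shows "integrable lborel (\<lambda>y. f y * \<psi> y)"
proof -
 obtain M where M: "\<And>x. \<bar>\<psi> x\<bar> \<le> M" using test_fun_bounded[OF \<psi>] by blast
 show ?thesis
 proof (rule Bochner_Integration.integrable_bound)
  show "integrable lborel (\<lambda>y. M * f y)" using f by simp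
  show "AE y in lborel. norm (f y * \<psi> y) \<le> norm (M * f y)"
   using M by (intro AE_I2) (auto simp: abs_mult mult.commute[of "\<bar>f _\<bar>"] intro!: mult_right_mono intro: order_trans[OF _ abs_ge_self])
 qed (use f \<psi> test_fun_measurable in auto)
qed

text \<open>Substituting \<open>z = Suc j * (x - y)\<close> turns the convolution into an average of
  translates of \<open>f\<close> whose weight does not depend on \<open>j\<close>, which is the form
  to which continuity of translation applies.\<close>

lemma mollify_alt:
 assumes [measurable]: "f \<in> borel_measurable borel" and \<eta>: "test_fun \<eta>"
 shows "mollify \<eta> j f x = (LBINT z. f (x - z /\<^sub>R real (Suc j)) * \<eta> z)"
proof -
 have [measurable]: "\<eta> \<in> borel_measurable borel"
  using \<eta> by (rule test_fun_measurable)
 have "(LBINT y. f (x - (real (Suc j) *\<^sub>R x + - real (Suc j) *\<^sub>R y) /\<^sub>R real (Suc j)) * \<eta> (real (Suc j) *\<^sub>R x + - real (Suc j) *\<^sub>R y))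
  * \<bar>- real (Suc j)\<bar> ^ 3 = (LBINT z. f (x - z /\<^sub>R real (Suc j)) * \<eta> z)"
  using integral_lborel_scale[of "- real (Suc j)" "\<lambda>z. f (x - z /\<^sub>R real (Suc j)) * \<eta> z" "real (Suc j) *\<^sub>R x"] by simp
 moreover have "x - (real (Suc j) *\<^sub>R x + - real (Suc j) *\<^sub>R y) /\<^sub>R real (Suc j) = y" for y
  by (simp add: scaleR_diff_right del: of_nat_Suc)
 moreover have "real (Suc j) *\<^sub>R x + - real (Suc j) *\<^sub>R y = real (Suc j) *\<^sub>R (x - y)" for y
  by (simp add: scaleR_diff_right del: of_nat_Suc)
 ultimately show ?thesis
  unfolding mollify_def eta_scaled_def by (simp only: abs_minus_cancel abs_of_nat integral_mult_left_zero[symmetric]) (simp add: ac_simps del: of_nat_Suc flip: integral_mult_right_zero)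
qed

text \<open>The error is an average over \<open>z\<close>, with weight \<open>\<eta> z\<close>, of
  the differences between a translate of \<open>f\<close> and \<open>f\<close>. By Fubini its L1
  norm is at most the average of their L1 norms; these tend to zero for each \<open>z\<close> and
  are bounded by twice the norm of \<open>f\<close>.\<close>

lemma mollify_L1:
 assumes f: "integrable lborel f" and \<eta>: "mollifier \<eta>"
 shows "integrable lborel (mollify \<eta> j f)"
  and "(\<lambda>j. \<integral>x. \<bar>mollify \<eta> j f x - f x\<bar> \<partial>lborel) \<longlonglongrightarrow> 0"
proof -
 note [measurable] = borel_measurable_integrable[OF f, simplified]
 have t: "test_fun \<eta>" and pos: "\<And>x. 0 \<le> \<eta> x" and one: "(LBINT x. \<eta> x) = 1"
  using \<eta> by (auto simp: mollifier_def)
 have [measurable]: "\<eta> \<in> borel_measurable borel" using t by (rule test_fun_measurable)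
 have \<eta>i: "integrable lborel \<eta>" using t by (rule test_fun_integrable)
 let ?n = "\<integral>x. \<bar>f x\<bar> \<partial>lborel"
 define d where "d j x z = f (x - z /\<^sub>R real (Suc j)) - f x" for j x z
 have [measurable]: "(\<lambda>(x, z). d j x z) \<in> borel_measurable (borel \<Otimes>\<^sub>M borel)" for j
  unfolding d_def by measurable
 have sh: "integrable lborel (\<lambda>x. f (x - c))" for c
  using f by (simp add: integrable_lborel_shift)
 have di: "integrable lborel (\<lambda>x. d j x z)" for j z
  unfolding d_def using sh f by auto
 have dn: "(LBINT x. \<bar>d j x z\<bar>) \<le> 2 * ?n" for j z
 proof -
  have "(LBINT x. \<bar>d j x z\<bar>) \<le> (LBINT x. \<bar>f (x - z /\<^sub>R real (Suc j))\<bar> + \<bar>f x\<bar>)"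
   using di[of j z] sh f by (intro integral_mono) (auto simp: d_def)
  also have "\<dots> = 2 * ?n"
   using sh f integral_lborel_shift[of "\<lambda>x. \<bar>f x\<bar>"] by (simp del: of_nat_Suc)
  finally show ?thesis .
 qed
 have pi: "integrable (lborel \<Otimes>\<^sub>M lborel) (\<lambda>(z, x). \<eta> z * d j x z)" for j
 proof (rule lborel_pair.Fubini_integrable)
  show "integrable lborel (\<lambda>z. \<integral>x. norm (case (z, x) of (z, x) \<Rightarrow> \<eta> z * d j x z) \<partial>lborel)"
  proof (rule Bochner_Integration.integrable_bound)
   show "integrable lborel (\<lambda>z. 2 * ?n * \<eta> z)" using \<eta>i by simp
   show "AE z in lborel. norm (LBINT x. norm (case (z, x) of (z, x) \<Rightarrow> \<eta> z * d j x z)) \<le> norm (2 * ?n * \<eta> z)"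
    using mult_left_mono[OF dn pos] pos by (intro AE_I2) (simp add: abs_mult mult.commute)
  qed simp
  show "AE z in lborel. integrable lborel (\<lambda>x. case (z, x) of (z, x) \<Rightarrow> \<eta> z * d j x z)"
   using di by auto
 qed simp
 have pi': "integrable (lborel \<Otimes>\<^sub>M lborel) (\<lambda>(x, z). \<eta> z * d j x z)" for j
  using lborel_pair.integrable_product_swap[OF pi[of j]] by (simp add: case_prod_beta')
 have diff: "AE x in lborel. mollify \<eta> j f x - f x = (LBINT z. \<eta> z * d j x z)" for j
  using lborel_pair.AE_integrable_fst'[OF pi'[of j]]
 proof eventually_elim
  case (elim x)
  then have i: "integrable lborel (\<lambda>z. \<eta> z * d j x z)" by simp
  have "mollify \<eta> j f x = (LBINT z. \<eta> z * d j x z + \<eta> z * f x)"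
   by (simp add: mollify_alt[OF _ t] d_def algebra_simps del: of_nat_Suc)
  also have "\<dots> = (LBINT z. \<eta> z * d j x z) + f x"
   using i \<eta>i one by simp
  finally show ?case by simp
 qed
 have int: "integrable lborel (\<lambda>x. \<integral>z. \<eta> z * d j x z \<partial>lborel)" for j
  using lborel_pair.integrable_fst'[OF pi'[of j]] by simp
 have mi: "integrable lborel (\<lambda>x. mollify \<eta> j f x - f x)" for j
  using int diff by (subst integrable_cong_AE[OF _ _ diff]) (use t in auto)
 show "integrable lborel (mollify \<eta> j f)"
  using Bochner_Integration.integrable_add[OF mi[of j] f] by simp
 have le: "(LBINT x. \<bar>mollify \<eta> j f x - f x\<bar>) \<le> (\<integral>z. \<eta> z * (LBINT x. \<bar>d j x z\<bar>) \<partial>lborel)" for j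
 proof -
  have pa: "integrable (lborel \<Otimes>\<^sub>M lborel) (\<lambda>(x, z). \<bar>\<eta> z * d j x z\<bar>)"
   using integrable_abs[OF pi'[of j]] by (simp add: case_prod_beta')
  have "(LBINT x. \<bar>mollify \<eta> j f x - f x\<bar>) = (\<integral>x. \<bar>\<integral>z. \<eta> z * d j x z \<partial>lborel\<bar> \<partial>lborel)"
   using diff[of j] by (intro integral_cong_AE) (use t in auto)
  also have "\<dots> \<le> (\<integral>x. \<integral>z. \<bar>\<eta> z * d j x z\<bar> \<partial>lborel \<partial>lborel)"
  proof (rule integral_mono)
   show "integrable lborel (\<lambda>x. \<integral>z. \<bar>\<eta> z * d j x z\<bar> \<partial>lborel)"
    using lborel_pair.integrable_fst'[OF pa] by simp
  qed (use int in auto)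
  also have "\<dots> = (\<integral>z. \<integral>x. \<bar>\<eta> z * d j x z\<bar> \<partial>lborel \<partial>lborel)"
   using lborel_pair.Fubini_integral[of "\<lambda>x z. \<bar>\<eta> z * d j x z\<bar>"] pa by simp
  also have "\<dots> = (\<integral>z. \<eta> z * (LBINT x. \<bar>d j x z\<bar>) \<partial>lborel)"
   using pos by (simp add: abs_mult)
  finally show ?thesis .
 qed
 have "(\<lambda>j. \<integral>z. \<eta> z * (LBINT x. \<bar>d j x z\<bar>) \<partial>lborel) \<longlonglongrightarrow> (\<integral>z. 0 \<partial>(lborel :: vec3 measure))"
 proof (rule integral_dominated_convergence[where w="\<lambda>z. \<eta> z * (2 * ?n)"])
  show "AE z in lborel. (\<lambda>j. \<eta> z * (LBINT x. \<bar>d j x z\<bar>)) \<longlonglongrightarrow> 0"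
  proof (rule AE_I2)
   fix z :: vec3
   have "(\<lambda>j. inverse (real (Suc j)) *\<^sub>R z) \<longlonglongrightarrow> 0 *\<^sub>R z"
    by (rule tendsto_scaleR[OF LIMSEQ_inverse_real_of_nat tendsto_const])
   then have "(\<lambda>j. \<integral>x. \<bar>d j x z\<bar> \<partial>lborel) \<longlonglongrightarrow> 0"
    unfolding d_def using L1_translation_continuous[OF f, of "\<lambda>j. z /\<^sub>R real (Suc j)"] by simp
   then show "(\<lambda>j. \<eta> z * (LBINT x. \<bar>d j x z\<bar>)) \<longlonglongrightarrow> 0"
    by (rule tendsto_mult_right_zero)
  qed
  show "AE z in lborel. norm (\<eta> z * (LBINT x. \<bar>d j x z\<bar>)) \<le> \<eta> z * (2 * ?n)" for j
   using dn[of j] pos by (intro AE_I2) (auto simp: abs_mult intro!: mult_left_mono)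
 qed (use \<eta>i in auto)
 then have "(\<lambda>j. \<integral>z. \<eta> z * (LBINT x. \<bar>d j x z\<bar>) \<partial>lborel) \<longlonglongrightarrow> 0" by simp
 then show "(\<lambda>j. \<integral>x. \<bar>mollify \<eta> j f x - f x\<bar> \<partial>lborel) \<longlonglongrightarrow> 0"
  by (rule tendsto_sandwich[OF _ _ tendsto_const, rotated 2]) (use le in auto)
qed

section \<open>Derivatives of convolutions; extending integral identities from test functions to
  weakly differentiable functions\<close>

lemma test_fun_lipschitz:
 assumes "test_fun \<psi>"
 obtains L where "L > 0" "\<And>x y. \<bar>\<psi> x - \<psi> y\<bar> \<le> L * norm (x - y)"
proof -
 have "\<exists>M>0. \<forall>x. \<bar>partial i \<psi> x\<bar> \<le> M" for i
  using test_fun_bounded[OF test_fun_partial[OF assms]] by metis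
 then obtain M where M: "\<And>i. M i > 0" "\<And>i x. \<bar>partial i \<psi> x\<bar> \<le> M i" by metis
 let ?L = "\<Sum>i\<in>UNIV. M i"
 have "\<bar>frechet_derivative \<psi> (at x) h\<bar> \<le> ?L * norm h" for x h
 proof -
  have "\<bar>frechet_derivative \<psi> (at x) h\<bar> \<le> (\<Sum>i\<in>UNIV. \<bar>h $ i * partial i \<psi> x\<bar>)"
   unfolding frechet_derivative_partial[OF test_fun_differentiable[OF assms]] by (rule sum_abs)
  also have "\<dots> \<le> (\<Sum>i\<in>UNIV. norm h * M i)"
   using M component_le_norm_cart[of h] by (intro sum_mono) (auto simp: abs_mult intro!: mult_mono)
  finally show ?thesis by (simp add: sum_distrib_left mult.commute)
 qed
 then have "norm (\<psi> x - \<psi> y) \<le> ?L * norm (x - y)" for x y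
  using test_fun_differentiable[OF assms]
  by (intro differentiable_bound[of UNIV \<psi> "\<lambda>x. frechet_derivative \<psi> (at x)"])
   (auto simp: frechet_derivative_works[symmetric] intro!: onorm_le)
 moreover have "?L > 0" using M by (intro sum_pos) auto
 ultimately show ?thesis using that by auto
qed

text \<open>Derivatives are taken along sequences because dominated convergence speaks of
  sequences.\<close>

lemma has_real_derivative_at_0_seq:
 assumes "\<And>X. (\<And>k. X k \<noteq> 0) \<Longrightarrow> X \<longlonglongrightarrow> 0 \<Longrightarrow> (\<lambda>k. (F (X k) - F 0) / X k) \<longlonglongrightarrow> D"
 shows "(F has_real_derivative D) (at 0)"
 using assms by (auto simp: has_field_derivative_iff tendsto_at_iff_sequentially comp_def)

lemma has_real_derivative_seqD:
 assumes "(F has_real_derivative D) (at 0)" "\<And>k. X k \<noteq> 0" "X \<longlonglongrightarrow> 0"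
 shows "(\<lambda>k. (F (X k) - F 0) / X k) \<longlonglongrightarrow> D"
proof -
 have "((\<lambda>t. (F t - F 0) / t) \<longlongrightarrow> D) (at 0)"
  using assms(1) by (simp add: has_field_derivative_iff)
 then have "((\<lambda>t. (F t - F 0) / t) \<circ> X) \<longlonglongrightarrow> D"
  using assms(2,3) unfolding tendsto_at_iff_sequentially by simp
 then show ?thesis by (simp add: comp_def)
qed

lemma convolution_has_derivative:
 assumes f: "integrable lborel f" and \<phi>: "test_fun \<phi>"
 shows "((\<lambda>t. \<integral>y. f y * \<phi> (x + t *\<^sub>R axis i 1 - y) \<partial>lborel) has_real_derivative
  (LBINT y. f y * partial i \<phi> (x - y))) (at 0)"
proof (rule has_real_derivative_at_0_seq)
 fix X :: "nat \<Rightarrow> real" assume X: "\<And>k. X k \<noteq> 0" "X \<longlonglongrightarrow> 0"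
 note [measurable] = borel_measurable_integrable[OF f, simplified] test_fun_measurable[OF \<phi>]
  test_fun_measurable[OF test_fun_partial[OF \<phi>]]
 obtain L where L: "\<And>x y. \<bar>\<phi> x - \<phi> y\<bar> \<le> L * norm (x - y)" using test_fun_lipschitz[OF \<phi>] by blast
 have fi: "integrable lborel (\<lambda>y. f y * \<phi> (z - y))" for z
  using f test_fun_reflect[OF \<phi>] by (rule integrable_mult_test_fun)
 let ?F = "\<lambda>t y. f y * \<phi> (x + t *\<^sub>R axis i 1 - y)"
 have "(\<lambda>k. \<integral>y. (?F (X k) y - ?F 0 y) / X k \<partial>lborel) \<longlonglongrightarrow> (LBINT y. f y * partial i \<phi> (x - y))"
 proof (rule integral_dominated_convergence[where w="\<lambda>y. L * \<bar>f y\<bar>"])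
  show "AE y in lborel. (\<lambda>k. (?F (X k) y - ?F 0 y) / X k) \<longlonglongrightarrow> f y * partial i \<phi> (x - y)"
  proof (rule AE_I2)
   fix y
   have "(\<lambda>k. (\<phi> ((x - y) + X k *\<^sub>R axis i 1) - \<phi> ((x - y) + 0 *\<^sub>R axis i 1)) / X k) \<longlonglongrightarrow> partial i \<phi> (x - y)"
    using has_real_derivative_seqD[OF partial_has_derivative[OF test_fun_differentiable[OF \<phi>]], OF X] .
   then have "(\<lambda>k. f y * ((\<phi> ((x - y) + X k *\<^sub>R axis i 1) - \<phi> ((x - y) + 0 *\<^sub>R axis i 1)) / X k)) \<longlonglongrightarrow> f y * partial i \<phi> (x - y)"
    by (intro tendsto_mult_left)
   then show "(\<lambda>k. (?F (X k) y - ?F 0 y) / X k) \<longlonglongrightarrow> f y * partial i \<phi> (x - y)"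
    by (simp add: algebra_simps diff_divide_distrib)
  qed
  show "AE y in lborel. norm ((?F (X k) y - ?F 0 y) / X k) \<le> L * \<bar>f y\<bar>" for k
  proof (rule AE_I2)
   fix y
   have "\<bar>\<phi> (x + X k *\<^sub>R axis i 1 - y) - \<phi> (x - y)\<bar> \<le> L * \<bar>X k\<bar>"
    using L[of "x + X k *\<^sub>R axis i 1 - y" "x - y"] by simp
   then have "\<bar>f y\<bar> * \<bar>\<phi> (x + X k *\<^sub>R axis i 1 - y) - \<phi> (x - y)\<bar> \<le> \<bar>f y\<bar> * (L * \<bar>X k\<bar>)"
    by (intro mult_left_mono) auto
   then show "norm ((?F (X k) y - ?F 0 y) / X k) \<le> L * \<bar>f y\<bar>"
    using X(1)[of k] by (simp add: divide_le_eq abs_mult[symmetric] right_diff_distrib) (simp add: abs_mult ac_simps)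
  qed
 qed (use f in auto)
 then show "(\<lambda>k. ((LBINT y. ?F (X k) y) - (LBINT y. ?F 0 y)) / X k) \<longlonglongrightarrow> (LBINT y. f y * partial i \<phi> (x - y))"
  using fi by simp
qed

lemma convolution_bounds:
 assumes f: "integrable lborel f" and \<phi>: "test_fun \<phi>"
 obtains M where "M \<ge> 0" "\<And>x. \<bar>\<integral>y. f y * \<phi> (x - y) \<partial>lborel\<bar> \<le> M"
  "\<And>x z. \<bar>(LBINT y. f y * \<phi> (x - y)) - (LBINT y. f y * \<phi> (z - y))\<bar> \<le> M * norm (x - z)"
proof -
 obtain L where L: "L > 0" "\<And>x y. \<bar>\<phi> x - \<phi> y\<bar> \<le> L * norm (x - y)" using test_fun_lipschitz[OF \<phi>] by blast
 obtain K where K: "K > 0" "\<And>x. \<bar>\<phi> x\<bar> \<le> K" using test_fun_bounded[OF \<phi>] by blast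
 have fi: "integrable lborel (\<lambda>y. f y * \<phi> (z - y))" for z
  using f test_fun_reflect[OF \<phi>] by (rule integrable_mult_test_fun)
 let ?n = "\<integral>y. \<bar>f y\<bar> \<partial>lborel"
 have n: "?n \<ge> 0" by (rule Bochner_Integration.integral_nonneg) auto
 have 1: "\<bar>\<integral>y. f y * \<phi> (x - y) \<partial>lborel\<bar> \<le> K * ?n" for x
 proof -
  have "\<bar>\<integral>y. f y * \<phi> (x - y) \<partial>lborel\<bar> \<le> (LBINT y. \<bar>f y * \<phi> (x - y)\<bar>)"
   by (rule integral_abs_bound)
  also have "\<dots> \<le> (LBINT y. K * \<bar>f y\<bar>)"
  proof (rule integral_mono)
   show "integrable lborel (\<lambda>y. \<bar>f y * \<phi> (x - y)\<bar>)" using fi by (rule integrable_abs)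
  qed (use f K in \<open>auto simp: abs_mult mult.commute[of K] intro!: mult_left_mono\<close>)
  finally show ?thesis by simp
 qed
 have 2: "\<bar>(LBINT y. f y * \<phi> (x - y)) - (LBINT y. f y * \<phi> (z - y))\<bar> \<le> (L * ?n) * norm (x - z)" for x z
 proof -
  have "\<bar>(LBINT y. f y * \<phi> (x - y)) - (LBINT y. f y * \<phi> (z - y))\<bar> = \<bar>\<integral>y. f y * (\<phi> (x - y) - \<phi> (z - y)) \<partial>lborel\<bar>"
   using fi by (simp add: right_diff_distrib)
  also have "\<dots> \<le> (LBINT y. \<bar>f y * (\<phi> (x - y) - \<phi> (z - y))\<bar>)"
   by (rule integral_abs_bound)
  also have "\<dots> \<le> (LBINT y. (L * norm (x - z)) * \<bar>f y\<bar>)"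
  proof (rule integral_mono)
   show "integrable lborel (\<lambda>y. \<bar>f y * (\<phi> (x - y) - \<phi> (z - y))\<bar>)"
    using fi by (simp add: right_diff_distrib)
   show "\<bar>f y * (\<phi> (x - y) - \<phi> (z - y))\<bar> \<le> (L * norm (x - z)) * \<bar>f y\<bar>" for y
    using mult_left_mono[OF L(2)[of "x - y" "z - y"], of "\<bar>f y\<bar>"] by (simp add: abs_mult ac_simps)
  qed (use f in simp)
  finally show ?thesis by (simp add: ac_simps)
 qed
 show ?thesis
 proof (rule that[of "max (K * ?n) (L * ?n)"])
  show "\<bar>(LBINT y. f y * \<phi> (x - y)) - (LBINT y. f y * \<phi> (z - y))\<bar> \<le> max (K * ?n) (L * ?n) * norm (x - z)" for x z
   using 2[of x z] by (rule order_trans) (auto intro!: mult_right_mono)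
 qed (use 1 K L n in \<open>auto intro: max.coboundedI1 simp: le_max_iff_disj\<close>)
qed

text \<open>Every difference quotient integrates to zero by translation invariance. The steps have
  length at most 1, so all quotients vanish outside the ball of radius \<open>R + 1\<close>, where
  the Lipschitz constant dominates them.\<close>

lemma integral_directional_derivative_zero:
 fixes \<Phi> D :: "vec3 \<Rightarrow> real"
 assumes \<Phi>: "integrable lborel \<Phi>" and [measurable]: "D \<in> borel_measurable borel"
  and supp: "\<And>x. norm x > R \<Longrightarrow> \<Phi> x = 0"
  and lip: "\<And>x t. \<bar>\<Phi> (x + t *\<^sub>R axis i 1) - \<Phi> x\<bar> \<le> M * \<bar>t\<bar>"
  and der: "\<And>x. ((\<lambda>t. \<Phi> (x + t *\<^sub>R axis i 1)) has_real_derivative D x) (at 0)"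
 shows "(LBINT x. D x) = 0"
proof -
 note [measurable] = borel_measurable_integrable[OF \<Phi>, simplified]
 let ?X = "\<lambda>k. inverse (real (Suc k))"
 let ?e = "axis i 1 :: vec3"
 have M: "M \<ge> 0" using lip[of 0 1] by simp
 have sh: "integrable lborel (\<lambda>x. \<Phi> (x + c))" "(LBINT x. \<Phi> (x + c)) = (LBINT x. \<Phi> x)" for c
  using integrable_lborel_shift[of \<Phi> "-c"] integral_lborel_shift[of \<Phi> "-c"] \<Phi> by auto
 have "(\<lambda>k. \<integral>x. (\<Phi> (x + ?X k *\<^sub>R ?e) - \<Phi> x) / ?X k \<partial>lborel) \<longlonglongrightarrow> (LBINT x. D x)"
 proof (rule integral_dominated_convergence[where w="\<lambda>x. M * indicator (cball 0 (R + 1)) x"])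
  show "integrable lborel (\<lambda>x::vec3. M * indicator (cball 0 (R + 1)) x :: real)"
   using integrable_indicator_compact[OF compact_cball[of "0::vec3" "R + 1"]] by simp
  show "AE x in lborel. (\<lambda>k. (\<Phi> (x + ?X k *\<^sub>R ?e) - \<Phi> x) / ?X k) \<longlonglongrightarrow> D x"
  proof (rule AE_I2)
   fix x
   show "(\<lambda>k. (\<Phi> (x + ?X k *\<^sub>R ?e) - \<Phi> x) / ?X k) \<longlonglongrightarrow> D x"
    using has_real_derivative_seqD[OF der[of x], of ?X] LIMSEQ_inverse_real_of_nat by simp
  qed
  show "AE x in lborel. norm ((\<Phi> (x + ?X k *\<^sub>R ?e) - \<Phi> x) / ?X k) \<le> M * indicator (cball 0 (R + 1)) x" for k
  proof (rule AE_I2)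
   fix x
   show "norm ((\<Phi> (x + ?X k *\<^sub>R ?e) - \<Phi> x) / ?X k) \<le> M * indicator (cball 0 (R + 1)) x"
   proof (cases "norm x \<le> R + 1")
    case True
    then show ?thesis
     using lip[of x "?X k"] by (simp add: divide_le_eq indicator_def)
   next
    case False
    have "norm x \<le> norm (x + ?X k *\<^sub>R ?e) + norm (?X k *\<^sub>R ?e)"
     using norm_triangle_ineq4[of "x + ?X k *\<^sub>R ?e" "?X k *\<^sub>R ?e"] by simp
    also have "norm (?X k *\<^sub>R ?e) \<le> 1" by (simp add: inverse_le_1_iff)
    finally have "\<Phi> (x + ?X k *\<^sub>R ?e) = 0" "\<Phi> x = 0" using False supp by auto
    then show ?thesis using M by simp
   qed
  qed
 qed auto
 moreover have "(LBINT x. (\<Phi> (x + ?X k *\<^sub>R ?e) - \<Phi> x) / ?X k) = 0" for k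
  using sh \<Phi> by simp
 ultimately show ?thesis by (simp add: LIMSEQ_const_iff)
qed


text \<open>Moves the smoothing kernel from the weight \<open>a\<close> to the function
  \<open>f\<close>; this is how \<open>weak_divergence_extend\<close> trades smooth test functions
  for a mollified density.\<close>

lemma convolution_Fubini:
 assumes f: "integrable lborel f" and \<phi>: "test_fun \<phi>" and [measurable]: "a \<in> borel_measurable borel"
  and a: "\<And>x. \<bar>a x\<bar> \<le> A"
 shows "(\<integral>y. f y * (LBINT x. \<phi> (x - y) * a x) \<partial>lborel) = (\<integral>x. a x * (LBINT y. f y * \<phi> (x - y)) \<partial>lborel)"
  and "integrable lborel (\<lambda>x. a x * (LBINT y. f y * \<phi> (x - y)))"
  and "integrable lborel (\<lambda>y. f y * (LBINT x. \<phi> (x - y) * a x))"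
proof -
 note [measurable] = borel_measurable_integrable[OF f, simplified] test_fun_measurable[OF \<phi>]
 have A: "A \<ge> 0" using a[of undefined] by linarith
 have \<phi>i: "integrable lborel (\<lambda>x. \<phi> (x - y))" for y
  using test_fun_integrable[OF test_fun_shift[OF \<phi>]] .
 have \<phi>a: "integrable lborel (\<lambda>x. \<phi> (x - y) * a x)" for y
 proof (rule Bochner_Integration.integrable_bound)
  show "integrable lborel (\<lambda>x. A * \<phi> (x - y))" using \<phi>i by simp
  show "AE x in lborel. norm (\<phi> (x - y) * a x) \<le> norm (A * \<phi> (x - y))"
   using a A by (intro AE_I2) (simp add: abs_mult mult.commute mult_right_mono)
 qed simp
 let ?n = "\<integral>x. \<bar>\<phi> x\<bar> \<partial>lborel"
 have le: "(LBINT x. \<bar>\<phi> (x - y) * a x\<bar>) \<le> A * ?n" for y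
 proof -
  have "(LBINT x. \<bar>\<phi> (x - y) * a x\<bar>) \<le> (LBINT x. A * \<bar>\<phi> (x - y)\<bar>)"
  proof (rule integral_mono)
   show "integrable lborel (\<lambda>x. \<bar>\<phi> (x - y) * a x\<bar>)" using \<phi>a by (rule integrable_abs)
  qed (use a A \<phi>i in \<open>auto simp: abs_mult mult.commute mult_right_mono\<close>)
  also have "\<dots> = A * ?n"
   using integral_lborel_shift[of "\<lambda>x. \<bar>\<phi> x\<bar>" y] by simp
  finally show ?thesis .
 qed
 have pi: "integrable (lborel \<Otimes>\<^sub>M lborel) (\<lambda>(y, x). f y * \<phi> (x - y) * a x)"
 proof (rule lborel_pair.Fubini_integrable)
  show "integrable lborel (\<lambda>y. \<integral>x. norm (case (y, x) of (y, x) \<Rightarrow> f y * \<phi> (x - y) * a x) \<partial>lborel)"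
  proof (rule Bochner_Integration.integrable_bound)
   show "integrable lborel (\<lambda>y. A * ?n * f y)" using f by simp
   have "\<bar>f y\<bar> * (LBINT x. \<bar>\<phi> (x - y) * a x\<bar>) \<le> \<bar>f y\<bar> * (A * ?n)" for y
    using le by (intro mult_left_mono) auto
   moreover have "\<bar>A * ?n * f y\<bar> = \<bar>f y\<bar> * (A * ?n)" for y
    using A by (simp add: abs_mult)
   moreover have "(LBINT x. \<bar>f y * \<phi> (x - y) * a x\<bar>) = \<bar>f y\<bar> * (LBINT x. \<bar>\<phi> (x - y) * a x\<bar>)" for y
    by (subst integral_mult_right_zero[symmetric]) (simp add: abs_mult mult.assoc)
   ultimately show "AE y in lborel. norm (LBINT x. norm (case (y, x) of (y, x) \<Rightarrow> f y * \<phi> (x - y) * a x))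
     \<le> norm (A * ?n * f y)"
    by (intro AE_I2) simp
  qed simp
  show "AE y in lborel. integrable lborel (\<lambda>x. case (y, x) of (y, x) \<Rightarrow> f y * \<phi> (x - y) * a x)"
   using \<phi>a by (auto simp: mult.assoc)
 qed simp
 have pi': "integrable (lborel \<Otimes>\<^sub>M lborel) (\<lambda>(x, y). f y * \<phi> (x - y) * a x)"
  using lborel_pair.integrable_product_swap[OF pi] by (simp add: case_prod_beta')
 show "integrable lborel (\<lambda>x. a x * (LBINT y. f y * \<phi> (x - y)))"
  using lborel_pair.integrable_fst'[OF pi'] by (simp add: mult.commute)
 show "integrable lborel (\<lambda>y. f y * (LBINT x. \<phi> (x - y) * a x))"
  using lborel_pair.integrable_fst'[OF pi] by (simp add: mult.assoc)
 show "(\<integral>y. f y * (LBINT x. \<phi> (x - y) * a x) \<partial>lborel) = (\<integral>x. a x * (LBINT y. f y * \<phi> (x - y)) \<partial>lborel)"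
 proof -
  have "(LBINT x. f y * \<phi> (x - y) * a x) = f y * (LBINT x. \<phi> (x - y) * a x)" for y
   by (simp add: mult.assoc)
  moreover have "(LBINT y. f y * \<phi> (x - y) * a x) = a x * (LBINT y. f y * \<phi> (x - y))" for x
   by simp
  ultimately show ?thesis
   using lborel_pair.Fubini_integral[of "\<lambda>x y. f y * \<phi> (x - y) * a x"] pi' by (simp add: mult.commute[of "a _"])
 qed
qed

text \<open>The reflected kernel \<open>y \<mapsto> eta_scaled \<eta> j (x - y)\<close> is itself an
  admissible test function. The support condition restricts the use to those \<open>x\<close> for
  which the weak derivative is known.\<close>

lemma mollify_weak_derivative:
 assumes \<eta>: "test_fun \<eta>"
  and w: "\<And>\<phi>. test_fun \<phi> \<Longrightarrow> (\<And>z. norm z > R' \<Longrightarrow> \<phi> z = 0) \<Longrightarrow>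
   (LBINT x. f x * partial i \<phi> x) = - (LBINT x. p x * \<phi> x)"
  and supp: "\<And>z. norm z > R' \<Longrightarrow> eta_scaled \<eta> j (x - z) = 0"
 shows "(LBINT y. f y * deta_scaled \<eta> i j (x - y)) = mollify \<eta> j p x"
proof -
 have t: "test_fun (eta_scaled \<eta> j)" using \<eta> by (rule test_fun_eta_scaled)
 show ?thesis
  using w[OF test_fun_reflect[OF t], of x] supp
  by (simp add: mollify_def partial_reflect[OF t] partial_eta_scaled[OF \<eta>])
qed

lemma tendsto_integral_bounded_mult:
 assumes "\<And>j. integrable M (F j)" "integrable M f" and [measurable]: "a \<in> borel_measurable M"
  and a: "\<And>x. \<bar>a x\<bar> \<le> (A::real)"
  and lim: "(\<lambda>j. \<integral>x. \<bar>F j x - f x\<bar> \<partial>M) \<longlonglongrightarrow> 0"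
 shows "(\<lambda>j. \<integral>x. a x * F j x \<partial>M) \<longlonglongrightarrow> (\<integral>x. a x * f x \<partial>M)"
proof -
 have A: "A \<ge> 0" using a[of undefined] by linarith
 have ia: "integrable M (\<lambda>x. a x * g x)" if "integrable M g" for g
 proof (rule Bochner_Integration.integrable_bound)
  show "integrable M (\<lambda>x. A * g x)" using that by simp
  show "AE x in M. norm (a x * g x) \<le> norm (A * g x)"
   using a A by (intro AE_I2) (simp add: abs_mult mult_right_mono)
 qed (use that in measurable)
 have "(\<lambda>j. (\<integral>x. a x * F j x \<partial>M) - (\<integral>x. a x * f x \<partial>M)) \<longlonglongrightarrow> 0"
 proof (rule Lim_null_comparison)
  show "\<forall>\<^sub>F j in sequentially. norm ((\<integral>x. a x * F j x \<partial>M) - (\<integral>x. a x * f x \<partial>M)) \<le> A * (\<integral>x. \<bar>F j x - f x\<bar> \<partial>M)"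
  proof (intro always_eventually allI)
   fix j
   have d: "integrable M (\<lambda>x. F j x - f x)" using assms by auto
   have "norm ((\<integral>x. a x * F j x \<partial>M) - (\<integral>x. a x * f x \<partial>M)) = \<bar>\<integral>x. a x * (F j x - f x) \<partial>M\<bar>"
    using ia[OF assms(1)] ia[OF assms(2)] by (simp add: right_diff_distrib)
   also have "\<dots> \<le> (\<integral>x. \<bar>a x * (F j x - f x)\<bar> \<partial>M)" by (rule integral_abs_bound)
   also have "\<dots> \<le> (\<integral>x. A * \<bar>F j x - f x\<bar> \<partial>M)"
    using integrable_abs[OF ia[OF d]] d a A by (intro integral_mono) (auto simp: abs_mult mult_right_mono)
   finally show "norm ((\<integral>x. a x * F j x \<partial>M) - (\<integral>x. a x * f x \<partial>M)) \<le> A * (\<integral>x. \<bar>F j x - f x\<bar> \<partial>M)"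
    by simp
  qed
  show "(\<lambda>j. A * (\<integral>x. \<bar>F j x - f x\<bar> \<partial>M)) \<longlonglongrightarrow> 0" using lim by (rule tendsto_mult_right_zero)
 qed
 then show ?thesis by (rule LIM_zero_cancel)
qed

text \<open>Taking translated mollifiers as test functions and integrating the translation against
  \<open>f\<close> yields the identity for the mollified \<open>f\<close>, whose gradient is the
  mollified \<open>p\<close>. Both converge in L1, and the coefficients are bounded, so the identity
  passes to the limit.\<close>

lemma weak_divergence_extend:
 fixes b :: "3 \<Rightarrow> vec3 \<Rightarrow> real"
 assumes \<eta>: "mollifier \<eta>"
  and [measurable]: "a \<in> borel_measurable borel" "\<And>i. b i \<in> borel_measurable borel"
  and a: "\<And>x. \<bar>a x\<bar> \<le> A" and b: "\<And>i x. \<bar>b i x\<bar> \<le> A"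
  and div: "\<And>\<phi>. test_fun \<phi> \<Longrightarrow> (LBINT x. \<phi> x * a x + (\<Sum>i\<in>UNIV. partial i \<phi> x * b i x)) = 0"
  and f: "integrable lborel f" and p: "\<And>i. integrable lborel (p i)"
  and w: "\<And>\<phi> i. test_fun \<phi> \<Longrightarrow> (LBINT x. f x * partial i \<phi> x) = - (LBINT x. p i x * \<phi> x)"
 shows "(LBINT x. f x * a x + (\<Sum>i\<in>UNIV. p i x * b i x)) = 0"
proof -
 have t: "test_fun \<eta>" using \<eta> by (rule mollifier_test)
 have bi: "integrable lborel (\<lambda>x. g x * c x)" if "integrable lborel g" "c \<in> borel_measurable borel" "\<And>x. \<bar>c x\<bar> \<le> A"
  for g c :: "vec3 \<Rightarrow> real"
 proof (rule Bochner_Integration.integrable_bound)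
  show "integrable lborel (\<lambda>x. A * g x)" using that by simp
  show "AE x in lborel. norm (g x * c x) \<le> norm (A * g x)"
   using that(3) by (intro AE_I2) (simp add: abs_mult mult.commute[of "\<bar>g _\<bar>"] mult_right_mono order_trans[OF _ abs_ge_self])
 qed (use that in measurable)
 have z: "(LBINT x. a x * mollify \<eta> j f x) + (\<Sum>i\<in>UNIV. \<integral>x. b i x * mollify \<eta> j (p i) x \<partial>lborel) = 0" for j
 proof -
  let ?e = "eta_scaled \<eta> j" and ?d = "\<lambda>i. deta_scaled \<eta> i j"
  have te: "test_fun ?e" and td: "\<And>i. test_fun (?d i)"
   using t by (auto intro: test_fun_eta_scaled test_fun_deta_scaled)
  have e0: "(LBINT x. ?e (x - y) * a x) + (\<Sum>i\<in>UNIV. \<integral>x. ?d i (x - y) * b i x \<partial>lborel) = 0" for y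
  proof -
   have "(LBINT x. ?e (x - y) * a x + (\<Sum>i\<in>UNIV. ?d i (x - y) * b i x)) = 0"
    using div[OF test_fun_shift[OF te, of y]] by (simp add: partial_shift[OF te] partial_eta_scaled[OF t])
   moreover have "integrable lborel (\<lambda>x. ?e (x - y) * a x)" "\<And>i. integrable lborel (\<lambda>x. ?d i (x - y) * b i x)"
    using test_fun_integrable[OF test_fun_shift[OF te, of y]] test_fun_integrable[OF test_fun_shift[OF td]] a b
    by (auto intro!: bi)
   ultimately show ?thesis by (subst (asm) Bochner_Integration.integral_add) auto
  qed
  note F = convolution_Fubini[OF f te \<open>a \<in> borel_measurable borel\<close> a]
   convolution_Fubini[OF f td \<open>b _ \<in> borel_measurable borel\<close> b]
  have "0 = (\<integral>y. f y * ((LBINT x. ?e (x - y) * a x) + (\<Sum>i\<in>UNIV. \<integral>x. ?d i (x - y) * b i x \<partial>lborel)) \<partial>lborel)"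
   using e0 by simp
  also have "\<dots> = (\<integral>y. f y * (LBINT x. ?e (x - y) * a x) \<partial>lborel) + (\<Sum>i\<in>UNIV. \<integral>y. f y * (LBINT x. ?d i (x - y) * b i x) \<partial>lborel)"
   using F(3,6) by (simp add: distrib_left sum_distrib_left)
  also have "\<dots> = (LBINT x. a x * mollify \<eta> j f x) + (\<Sum>i\<in>UNIV. \<integral>x. b i x * mollify \<eta> j (p i) x \<partial>lborel)"
  proof -
   have "(LBINT y. f y * ?d i (x - y)) = mollify \<eta> j (p i) x" for i x
   proof -
    have tr: "test_fun (\<lambda>z. ?e (x - z))" using te by (rule test_fun_reflect)
    show ?thesis using w[OF tr, of i] by (simp add: mollify_def partial_reflect[OF te] partial_eta_scaled[OF t])
   qed
   then show ?thesis using F(1,4) by (simp add: mollify_def)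
  qed
  finally show ?thesis by simp
 qed
 have "(\<lambda>j. (LBINT x. a x * mollify \<eta> j f x) + (\<Sum>i\<in>UNIV. \<integral>x. b i x * mollify \<eta> j (p i) x \<partial>lborel))
  \<longlonglongrightarrow> (LBINT x. a x * f x) + (\<Sum>i\<in>UNIV. \<integral>x. b i x * p i x \<partial>lborel)"
  using a b f p \<eta> by (intro tendsto_add tendsto_sum tendsto_integral_bounded_mult[where A=A] mollify_L1) auto
 then have "(LBINT x. a x * f x) + (\<Sum>i\<in>UNIV. \<integral>x. b i x * p i x \<partial>lborel) = 0"
  using z by (simp add: LIMSEQ_const_iff)
 moreover have "integrable lborel (\<lambda>x. f x * a x)" "\<And>i. integrable lborel (\<lambda>x. p i x * b i x)"
  using f p a b by (auto intro!: bi)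
 ultimately show ?thesis by (simp add: mult.commute)
qed

section \<open>A local weak chain rule\<close>

lemma
 fixes f w :: "'a \<Rightarrow> real"
 assumes w: "integrable M w" and [measurable]: "f \<in> borel_measurable M" and le: "\<And>x. \<bar>f x\<bar> \<le> w x"
 shows integrable_dominated: "integrable M f"
  and abs_integral_dominated: "\<bar>\<integral>x. f x \<partial>M\<bar> \<le> (\<integral>x. w x \<partial>M)"
proof -
 show f: "integrable M f"
  using le by (intro Bochner_Integration.integrable_bound[OF w]) (auto intro!: AE_I2 order_trans[OF _ abs_ge_self])
 have "\<bar>\<integral>x. f x \<partial>M\<bar> \<le> (\<integral>x. \<bar>f x\<bar> \<partial>M)" by (rule integral_abs_bound)
 also have "\<dots> \<le> (\<integral>x. w x \<partial>M)" using f w le by (intro integral_mono) auto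
 finally show "\<bar>\<integral>x. f x \<partial>M\<bar> \<le> (\<integral>x. w x \<partial>M)" .
qed

text \<open>The classical chain rule holds for the mollified \<open>u\<close>; the limit is then
  taken. The margin between \<open>R\<close> and \<open>R'\<close> is there because the rule will be
  applied to functions cut off to a ball, whose weak derivative is known only against test functions
  supported inside that ball.\<close>

lemma weak_chain_rule_local:
 fixes H :: "real \<Rightarrow> real"
 assumes u: "integrable lborel u" and G: "integrable lborel G"
  and w: "\<And>\<phi>. test_fun \<phi> \<Longrightarrow> (\<And>z. norm z > R' \<Longrightarrow> \<phi> z = 0) \<Longrightarrow>
   (LBINT x. u x * partial i \<phi> x) = - (LBINT x. G x * \<phi> x)"
  and H: "\<And>t. (H has_real_derivative H' t) (at t)" and H'c: "continuous_on UNIV H'" and H'b: "\<And>t. \<bar>H' t\<bar> \<le> L"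
  and \<psi>: "test_fun \<psi>" and supp: "\<And>z. norm z > R \<Longrightarrow> \<psi> z = 0" and "R < R'"
 shows "(LBINT x. H (u x) * partial i \<psi> x) = - (LBINT x. H' (u x) * G x * \<psi> x)"
proof (cases "\<exists>x. \<psi> x \<noteq> 0")
 case False
 then have "\<psi> = (\<lambda>_. 0)" by auto
 moreover have "partial i (\<lambda>_. 0) x = 0" for x by (rule partial_eqI) simp
 ultimately show ?thesis by simp
next
 case True
 then obtain \<eta> where \<eta>: "mollifier \<eta>" using mollifier_exists[OF \<psi>] by blast
 note t = mollifier_test[OF \<eta>]
 note [measurable] = borel_measurable_integrable[OF u, simplified] borel_measurable_integrable[OF G, simplified]
  test_fun_measurable[OF \<psi>] test_fun_measurable[OF test_fun_partial[OF \<psi>]]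
 have [measurable]: "H \<in> borel_measurable borel"
  using H by (intro borel_measurable_continuous_onI continuous_at_imp_continuous_on ballI DERIV_isCont)
 have [measurable]: "H' \<in> borel_measurable borel"
  using H'c by (rule borel_measurable_continuous_onI)
 have L: "L \<ge> 0" using H'b[of 0] by linarith
 have Hlip: "\<bar>H s - H r\<bar> \<le> L * \<bar>s - r\<bar>" for s r
 proof -
  have "onorm ((*) (H' x)) \<le> L" for x
   using H'b by (intro onorm_le) (simp add: abs_mult mult_right_mono)
  then show ?thesis
   using differentiable_bound[of UNIV H "\<lambda>t. (*) (H' t)" L s r] H by (auto simp: has_field_derivative_def)
 qed
 obtain S where S: "S > 0" "\<And>x. norm x > S \<Longrightarrow> \<eta> x = 0" using test_fun_support[OF t] by blast
 obtain K where K: "K > 0" "\<And>x. \<bar>\<psi> x\<bar> \<le> K" using test_fun_bounded[OF \<psi>] by blast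
 obtain K' where K': "K' > 0" "\<And>x. \<bar>partial i \<psi> x\<bar> \<le> K'" using test_fun_bounded[OF test_fun_partial[OF \<psi>, of i]] by blast
 obtain KL where KL: "KL > 0" "\<And>x y. \<bar>\<psi> x - \<psi> y\<bar> \<le> KL * norm (x - y)" using test_fun_lipschitz[OF \<psi>] by blast
 let ?u = "\<lambda>j. mollify \<eta> j u" and ?G = "\<lambda>j. mollify \<eta> j G"
 note um = mollify_measurable[OF \<open>u \<in> borel_measurable borel\<close> t] and Gm = mollify_measurable[OF \<open>G \<in> borel_measurable borel\<close> t]
 note [measurable] = um Gm
 have bdint: "integrable lborel (\<lambda>x. f x * \<psi> x)" if [measurable]: "f \<in> borel_measurable borel" and "\<And>x. \<bar>f x\<bar> \<le> N" for f N
  by (rule integrable_bounded_support[where M="N * K" and R=R])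
   (use that K supp in \<open>auto simp: abs_mult intro!: mult_mono intro: order_trans[OF abs_ge_zero]\<close>)
 \<comment> \<open>From the index \<open>J\<close> on the mollifier is narrower than the margin, so
   kernels centred in the support of \<open>\<psi>\<close> stay inside the ball of radius
   \<open>R'\<close>.\<close>
 obtain J where J: "S / real (Suc j) \<le> R' - R" if "j \<ge> J" for j
 proof -
  have "(\<lambda>j. S * inverse (real (Suc j))) \<longlonglongrightarrow> S * 0"
   by (intro tendsto_mult tendsto_const LIMSEQ_inverse_real_of_nat)
  then have "\<forall>\<^sub>F j in sequentially. S * inverse (real (Suc j)) < R' - R"
   using \<open>R < R'\<close> by (intro order_tendstoD(2)) auto
  then have "\<exists>J. \<forall>j\<ge>J. S / real (Suc j) \<le> R' - R"
   unfolding eventually_sequentially divide_inverse using less_imp_le by blast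
  then show ?thesis using that by blast
 qed
 have step: "(LBINT x. partial i \<psi> x * H (?u j x)) = - (LBINT x. (H' (?u j x) * \<psi> x) * ?G j x)" if "j \<ge> J" for j
 proof -
  let ?e = "eta_scaled \<eta> j"
  have te: "test_fun ?e" using t by (rule test_fun_eta_scaled)
  let ?D = "\<lambda>x. \<integral>y. u y * deta_scaled \<eta> i j (x - y) \<partial>lborel"
  obtain M where M: "M \<ge> 0" "\<And>x. \<bar>?u j x\<bar> \<le> M" "\<And>x z. \<bar>?u j x - ?u j z\<bar> \<le> M * norm (x - z)"
   by (rule convolution_bounds[OF u te, folded mollify_def]) (rule that; assumption)
  obtain M' where M': "M' \<ge> 0" "\<And>x. \<bar>?D x\<bar> \<le> M'"
   by (rule convolution_bounds[OF u test_fun_deta_scaled[OF t, of i j]]) (rule that; assumption)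
  have [measurable]: "deta_scaled \<eta> i j \<in> borel_measurable borel"
   using test_fun_measurable[OF test_fun_deta_scaled[OF t]] .
  have [measurable]: "?D \<in> borel_measurable borel" by measurable
  \<comment> \<open>The derivative of the mollified \<open>u\<close> is the mollified
    \<open>G\<close> only near the support of \<open>\<psi>\<close>; elsewhere the factor
    \<open>\<psi> x\<close> is zero.\<close>
  have DG: "?D x * \<psi> x = ?G j x * \<psi> x" for x
  proof (cases "\<psi> x = 0")
   case False
   then have x: "norm x \<le> R" using supp[of x] by (auto simp: not_less[symmetric])
   have "?e (x - z) = 0" if "norm z > R'" for z
   proof -
    have "norm z \<le> norm (x - z) + norm x" using norm_triangle_ineq[of "z - x" x] by (simp add: norm_minus_commute)
    then have "S / real (Suc j) < norm (x - z)" using J[OF \<open>j \<ge> J\<close>] that x by linarith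
    then have "S < norm (real (Suc j) *\<^sub>R (x - z))"
     by (simp add: divide_less_eq mult.commute del: of_nat_Suc)
    then show ?thesis unfolding eta_scaled_def using S(2) by simp
   qed
   then have "?D x = ?G j x" using w by (intro mollify_weak_derivative[OF t]) auto
   then show ?thesis by simp
  qed simp
  define HM where "HM = \<bar>H 0\<bar> + L * M"
  have Hb: "\<bar>H (?u j x)\<bar> \<le> HM" for x
   using Hlip[of "?u j x" 0] mult_left_mono[OF M(2)[of x] L] by (simp add: HM_def)
  have "(LBINT x. H (?u j x) * partial i \<psi> x + H' (?u j x) * ?D x * \<psi> x) = 0"
  proof (rule integral_directional_derivative_zero[where \<Phi>="\<lambda>x. H (?u j x) * \<psi> x" and R=R and i=i and M="HM * KL + K * (L * M)"])
   show "integrable lborel (\<lambda>x. H (?u j x) * \<psi> x)" using Hb by (intro bdint) auto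
   show "\<bar>H (?u j (x + t *\<^sub>R axis i 1)) * \<psi> (x + t *\<^sub>R axis i 1) - H (?u j x) * \<psi> x\<bar> \<le> (HM * KL + K * (L * M)) * \<bar>t\<bar>" for x t
   proof -
    let ?y = "x + t *\<^sub>R axis i 1"
    have "\<bar>H (?u j ?y) * \<psi> ?y - H (?u j x) * \<psi> x\<bar> = \<bar>H (?u j ?y) * (\<psi> ?y - \<psi> x) + \<psi> x * (H (?u j ?y) - H (?u j x))\<bar>"
     by (simp add: algebra_simps)
    also have "\<dots> \<le> \<bar>H (?u j ?y)\<bar> * \<bar>\<psi> ?y - \<psi> x\<bar> + \<bar>\<psi> x\<bar> * \<bar>H (?u j ?y) - H (?u j x)\<bar>"
     by (simp add: abs_mult[symmetric])
    also have "\<dots> \<le> HM * (KL * \<bar>t\<bar>) + K * (L * (M * \<bar>t\<bar>))"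
    proof (intro add_mono mult_mono)
     show "\<bar>\<psi> ?y - \<psi> x\<bar> \<le> KL * \<bar>t\<bar>" using KL(2)[of ?y x] by simp
     show "\<bar>H (?u j ?y) - H (?u j x)\<bar> \<le> L * (M * \<bar>t\<bar>)"
      using Hlip[of "?u j ?y" "?u j x"] mult_left_mono[OF M(3)[of ?y x] L] by simp
     show "0 \<le> HM" using Hb[of x] by linarith
    qed (use Hb K in auto)
    finally show ?thesis by (simp add: algebra_simps)
   qed
   show "((\<lambda>t. H (?u j (x + t *\<^sub>R axis i 1)) * \<psi> (x + t *\<^sub>R axis i 1)) has_real_derivative
     H (?u j x) * partial i \<psi> x + H' (?u j x) * ?D x * \<psi> x) (at 0)" for x
   proof -
    have d1: "((\<lambda>t. ?u j (x + t *\<^sub>R axis i 1)) has_real_derivative ?D x) (at 0)"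
     using convolution_has_derivative[OF u te, of x i] by (simp add: mollify_def partial_eta_scaled[OF t])
    have "((\<lambda>t. H (?u j (x + t *\<^sub>R axis i 1))) has_real_derivative H' (?u j x) * ?D x) (at 0)"
     using DERIV_chain2[where f=H and g="\<lambda>t. ?u j (x + t *\<^sub>R axis i 1)" and x=0 and s=UNIV, OF _ d1] H[of "?u j x"] by simp
    from DERIV_mult[OF this partial_has_derivative[OF test_fun_differentiable[OF \<psi>], of x i]]
    show ?thesis by (simp add: algebra_simps)
   qed
  qed (use supp in auto)
  moreover have "integrable lborel (\<lambda>x. H (?u j x) * partial i \<psi> x)"
  proof -
   obtain RR where "\<And>x. norm x > RR \<Longrightarrow> partial i \<psi> x = 0" using test_fun_support[OF test_fun_partial[OF \<psi>]] by blast
   then show ?thesis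
    using Hb K' by (intro integrable_bounded_support[where M="HM * K'" and R=RR])
     (auto simp: abs_mult intro!: mult_mono intro: order_trans[OF abs_ge_zero])
  qed
  moreover have "integrable lborel (\<lambda>x. H' (?u j x) * ?D x * \<psi> x)"
   using H'b M' L by (intro bdint[where N="L * M'"]) (auto simp: abs_mult intro!: mult_mono)
  ultimately have "(LBINT x. H (?u j x) * partial i \<psi> x) = - (LBINT x. H' (?u j x) * ?D x * \<psi> x)"
   by simp
  moreover have "(LBINT x. H' (?u j x) * ?D x * \<psi> x) = (LBINT x. (H' (?u j x) * \<psi> x) * ?G j x)"
   by (intro Bochner_Integration.integral_cong refl) (use DG in \<open>simp add: mult.assoc mult.commute[of "\<psi> _"]\<close>)
  moreover have "(LBINT x. H (?u j x) * partial i \<psi> x) = (LBINT x. partial i \<psi> x * H (?u j x))"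
   by (simp only: mult.commute)
  ultimately show ?thesis by simp
 qed
 have ui: "integrable lborel (?u j)" and Gi: "integrable lborel (?G j)" for j
  using mollify_L1(1)[OF u \<eta>] mollify_L1(1)[OF G \<eta>] by auto
 \<comment> \<open>\<open>H'\<close> is only continuous, so the factor \<open>H' (?u j x)\<close>
   calls for pointwise convergence; L1 convergence gives it along a subsequence.\<close>
 obtain r where r: "strict_mono r" "AE x in lborel. (\<lambda>k. ?u (r k) x - u x) \<longlonglongrightarrow> 0"
  using tendsto_L1_AE_subseq[of lborel "\<lambda>j x. ?u j x - u x"] ui u mollify_L1(2)[OF u \<eta>] by auto
 have rl: "filterlim r sequentially sequentially" using r(1) by (rule filterlim_subseq)
 have l1: "(\<lambda>k. \<integral>x. partial i \<psi> x * (H (?u (r k) x) - H (u x)) \<partial>lborel) \<longlonglongrightarrow> 0"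
 proof (rule Lim_null_comparison)
  show "(\<lambda>k. K' * L * (LBINT x. \<bar>?u (r k) x - u x\<bar>)) \<longlonglongrightarrow> 0"
   using filterlim_compose[OF mollify_L1(2)[OF u \<eta>] rl] by (rule tendsto_mult_right_zero)
  show "\<forall>\<^sub>F k in sequentially. norm (LBINT x. partial i \<psi> x * (H (?u (r k) x) - H (u x))) \<le> K' * L * (LBINT x. \<bar>?u (r k) x - u x\<bar>)"
  proof (intro always_eventually allI)
   fix k
   have le: "\<bar>partial i \<psi> x * (H (?u (r k) x) - H (u x))\<bar> \<le> K' * L * \<bar>?u (r k) x - u x\<bar>" for x
    using mult_mono[OF K'(2)[of x] Hlip[of "?u (r k) x" "u x"]] K' L by (simp add: abs_mult mult.assoc)
   have i: "integrable lborel (\<lambda>x. K' * L * \<bar>?u (r k) x - u x\<bar>)" using ui u by auto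
   have "norm (LBINT x. partial i \<psi> x * (H (?u (r k) x) - H (u x))) \<le> (LBINT x. K' * L * \<bar>?u (r k) x - u x\<bar>)"
    using abs_integral_dominated[OF i _ le] by simp
   then show "norm (LBINT x. partial i \<psi> x * (H (?u (r k) x) - H (u x))) \<le> K' * L * (LBINT x. \<bar>?u (r k) x - u x\<bar>)"
    by simp
  qed
 qed
 have l2: "(\<lambda>k. \<integral>x. H' (?u (r k) x) * \<psi> x * (?G (r k) x - G x) \<partial>lborel) \<longlonglongrightarrow> 0"
 proof (rule Lim_null_comparison)
  show "(\<lambda>k. L * K * (LBINT x. \<bar>?G (r k) x - G x\<bar>)) \<longlonglongrightarrow> 0"
   using filterlim_compose[OF mollify_L1(2)[OF G \<eta>] rl] by (rule tendsto_mult_right_zero)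
  show "\<forall>\<^sub>F k in sequentially. norm (LBINT x. H' (?u (r k) x) * \<psi> x * (?G (r k) x - G x)) \<le> L * K * (LBINT x. \<bar>?G (r k) x - G x\<bar>)"
  proof (intro always_eventually allI)
   fix k
   have le: "\<bar>H' (?u (r k) x) * \<psi> x * (?G (r k) x - G x)\<bar> \<le> L * K * \<bar>?G (r k) x - G x\<bar>" for x
    using mult_mono[OF H'b[of "?u (r k) x"] K(2)[of x]] L by (simp add: abs_mult mult_right_mono)
   have i: "integrable lborel (\<lambda>x. L * K * \<bar>?G (r k) x - G x\<bar>)" using Gi G by auto
   have "norm (LBINT x. H' (?u (r k) x) * \<psi> x * (?G (r k) x - G x)) \<le> (LBINT x. L * K * \<bar>?G (r k) x - G x\<bar>)"
    using abs_integral_dominated[OF i _ le] by simp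
   then show "norm (LBINT x. H' (?u (r k) x) * \<psi> x * (?G (r k) x - G x)) \<le> L * K * (LBINT x. \<bar>?G (r k) x - G x\<bar>)"
    by simp
  qed
 qed
 have Gw: "integrable lborel (\<lambda>x. L * K * \<bar>G x\<bar>)" using G by auto
 have le3: "\<bar>H' s * \<psi> x * G x\<bar> \<le> L * K * \<bar>G x\<bar>" for s x
  using mult_mono[OF H'b[of s] K(2)[of x]] L by (simp add: abs_mult mult_right_mono)
 have l3: "(\<lambda>k. \<integral>x. H' (?u (r k) x) * \<psi> x * G x \<partial>lborel) \<longlonglongrightarrow> (LBINT x. H' (u x) * \<psi> x * G x)"
 proof (rule integral_dominated_convergence[OF _ _ Gw])
  show "AE x in lborel. (\<lambda>k. H' (?u (r k) x) * \<psi> x * G x) \<longlonglongrightarrow> H' (u x) * \<psi> x * G x"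
   using r(2)
  proof eventually_elim
   case (elim x)
   have "(\<lambda>k. H' (?u (r k) x)) \<longlonglongrightarrow> H' (u x)"
    by (rule continuous_on_tendsto_compose[OF H'c LIM_zero_cancel[OF elim]]) auto
   then show ?case by (intro tendsto_intros)
  qed
 qed (use le3 in auto)
 have i3: "integrable lborel (\<lambda>x. H' (v x) * \<psi> x * G x)" if [measurable]: "v \<in> borel_measurable borel" for v
  by (rule Bochner_Integration.integrable_bound[OF Gw]) (use le3 in \<open>auto intro!: AE_I2 order_trans[OF _ abs_ge_self]\<close>)
 have i4: "integrable lborel (\<lambda>x. H' (v x) * \<psi> x * (?G j x - G x))" if [measurable]: "v \<in> borel_measurable borel" for v j
 proof (rule Bochner_Integration.integrable_bound)
  show "integrable lborel (\<lambda>x. L * K * (?G j x - G x))" using Gi G by auto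
  show "AE x in lborel. norm (H' (v x) * \<psi> x * (?G j x - G x)) \<le> norm (L * K * (?G j x - G x))"
   using mult_mono[OF H'b K(2)] L K by (intro AE_I2) (simp add: abs_mult mult_right_mono)
 qed simp
 have "(\<lambda>k. \<integral>x. H' (?u (r k) x) * \<psi> x * ?G (r k) x \<partial>lborel) \<longlonglongrightarrow> 0 + (LBINT x. H' (u x) * \<psi> x * G x)"
  using tendsto_add[OF l2 l3] i3[OF um] i4[OF um]
  by (subst (asm) Bochner_Integration.integral_add[symmetric]) (auto simp: algebra_simps)
 moreover have "(\<lambda>k. \<integral>x. partial i \<psi> x * H (?u (r k) x) \<partial>lborel) \<longlonglongrightarrow> 0 + (LBINT x. partial i \<psi> x * H (u x))"
 proof -
  have Hi: "integrable lborel (\<lambda>x. partial i \<psi> x * H (v x))" if v: "integrable lborel v" for v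
  proof (rule Bochner_Integration.integrable_bound)
   show "integrable lborel (\<lambda>x. \<bar>H 0\<bar> * \<bar>partial i \<psi> x\<bar> + K' * L * \<bar>v x\<bar>)"
    using v test_fun_integrable[OF test_fun_partial[OF \<psi>]] by auto
   show "AE x in lborel. norm (partial i \<psi> x * H (v x)) \<le> norm (\<bar>H 0\<bar> * \<bar>partial i \<psi> x\<bar> + K' * L * \<bar>v x\<bar>)"
   proof (rule AE_I2)
    fix x
    have "\<bar>H (v x)\<bar> \<le> \<bar>H 0\<bar> + L * \<bar>v x\<bar>" using Hlip[of "v x" 0] by simp
    then have "\<bar>partial i \<psi> x\<bar> * \<bar>H (v x)\<bar> \<le> \<bar>partial i \<psi> x\<bar> * (\<bar>H 0\<bar> + L * \<bar>v x\<bar>)" by (rule mult_left_mono) simp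
    also have "\<dots> \<le> \<bar>H 0\<bar> * \<bar>partial i \<psi> x\<bar> + K' * (L * \<bar>v x\<bar>)"
     using mult_right_mono[OF K'(2)[of x], of "L * \<bar>v x\<bar>"] L by (simp add: algebra_simps)
    finally have *: "norm (partial i \<psi> x * H (v x)) \<le> \<bar>H 0\<bar> * \<bar>partial i \<psi> x\<bar> + K' * L * \<bar>v x\<bar>"
     by (simp add: abs_mult mult.assoc)
    show "norm (partial i \<psi> x * H (v x)) \<le> norm (\<bar>H 0\<bar> * \<bar>partial i \<psi> x\<bar> + K' * L * \<bar>v x\<bar>)"
     by (rule order_trans[OF *]) (simp only: real_norm_def abs_ge_self)
   qed
  qed (use v in measurable)
  show ?thesis
   using tendsto_add[OF l1 tendsto_const[of "\<integral>x. partial i \<psi> x * H (u x) \<partial>lborel"]] Hi[OF ui] Hi[OF u]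
   by (simp add: right_diff_distrib)
 qed
 moreover have "\<forall>\<^sub>F k in sequentially. (LBINT x. partial i \<psi> x * H (?u (r k) x)) = - (LBINT x. (H' (?u (r k) x) * \<psi> x) * ?G (r k) x)"
  using eventually_ge_at_top[of J]
  by eventually_elim (rule step, meson le_trans r(1) seq_suble)
 ultimately have "(\<lambda>k. - (LBINT x. (H' (?u (r k) x) * \<psi> x) * ?G (r k) x)) \<longlonglongrightarrow> (LBINT x. partial i \<psi> x * H (u x))"
  "(\<lambda>k. - (LBINT x. (H' (?u (r k) x) * \<psi> x) * ?G (r k) x)) \<longlonglongrightarrow> - (LBINT x. H' (u x) * \<psi> x * G x)"
  by (auto intro!: tendsto_minus elim: Lim_transform_eventually)
 from LIMSEQ_unique[OF this] show ?thesis by (simp add: ac_simps)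
qed

lemma partial_zero_outside:
 assumes "\<And>x. norm x > R \<Longrightarrow> \<psi> x = 0" "norm x > R"
 shows "partial i \<psi> x = 0"
proof -
 have "((\<lambda>_. 0) has_derivative (\<lambda>_. 0)) (at x)" by simp
 then have "(\<psi> has_derivative (\<lambda>_. 0)) (at x)"
  by (rule has_derivative_transform_within_open[where s="- cball 0 R"]) (use assms in auto)
 then show ?thesis using partial_eqI by blast
qed

section \<open>Scores and their relation to Fisher information\<close>

text \<open>The relation is linear in the pair formed by \<open>f\<close> and \<open>f s\<close>,
  unlike the weak gradient of the square root, and therefore survives mixtures and push-forwards.
  The mass is left free.\<close>

definition has_score :: "(vec3 \<Rightarrow> real) \<Rightarrow> (vec3 \<Rightarrow> vec3) \<Rightarrow> bool" where
 "has_score f s \<longleftrightarrow> f \<in> borel_measurable borel \<and> (\<forall>v. 0 \<le> f v) \<and> integrable lborel f \<and>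
  s \<in> borel_measurable borel \<and> integrable lborel (\<lambda>v. f v * (norm (s v))\<^sup>2) \<and>
  (\<forall>\<psi> i. test_fun \<psi> \<longrightarrow> (LBINT v. f v * partial i \<psi> v) = - (LBINT v. f v * s v $ i * \<psi> v))"

lemma borel_measurable_vec_nth_comp:
 "f \<in> borel_measurable M \<Longrightarrow> (\<lambda>x. f x $ i) \<in> borel_measurable M" for f :: "_ \<Rightarrow> vec3"
 by (rule borel_measurable_continuous_on[of "\<lambda>x. x $ i", OF _]) (auto intro: continuous_intros)

lemma borel_measurable_vec_lambda:
 fixes f :: "'a \<Rightarrow> vec3"
 assumes "\<And>i. (\<lambda>x. f x $ i) \<in> borel_measurable M"
 shows "f \<in> borel_measurable M"
proof -
 have "(\<lambda>x. f x \<bullet> b) \<in> borel_measurable M" if "b \<in> Basis" for b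
  using that assms by (auto simp: Basis_vec_def inner_axis)
 then show ?thesis by (simp add: borel_measurable_euclidean_space[of f])
qed

lemma norm_sq_vec3: "(norm (x :: vec3))\<^sup>2 = (\<Sum>i\<in>UNIV. (x $ i)\<^sup>2)"
 by (subst power2_norm_eq_inner) (simp add: inner_vec_def power2_eq_square)

text \<open>Chain rule for the square of \<open>sqrt f\<close>. The root is only locally integrable
  and the square has an unbounded derivative, so the root is cut off to a ball and the square is
  approximated. Where \<open>f\<close> vanishes, division by zero makes the score zero, so the
  energies are compared by an inequality.\<close>

lemma has_scoreI_weak_grad:
 assumes [measurable]: "f \<in> borel_measurable borel" and pos: "\<And>v. 0 \<le> f v" and f: "integrable lborel f"
  and wg: "weak_grad (\<lambda>v. sqrt (f v)) G" and fin: "(\<integral>\<^sup>+ v. ennreal ((norm (G v))\<^sup>2) \<partial>lborel) < \<infinity>"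
 shows "has_score f (\<lambda>v. (2 / sqrt (f v)) *\<^sub>R G v)"
  and "ennreal (LBINT v. f v * (norm ((2 / sqrt (f v)) *\<^sub>R G v))\<^sup>2) \<le> 4 * (\<integral>\<^sup>+ v. ennreal ((norm (G v))\<^sup>2) \<partial>lborel)"
proof -
 have [measurable]: "G \<in> borel_measurable borel" using wg by (simp add: weak_grad_def)
 then have [measurable]: "(\<lambda>x. G x $ i) \<in> borel_measurable borel" for i by (rule borel_measurable_vec_nth_comp)
 have G2: "integrable lborel (\<lambda>v. (norm (G v))\<^sup>2)"
  using fin by (intro integrableI_nonneg) auto
 let ?s = "\<lambda>v. (2 / sqrt (f v)) *\<^sub>R G v"
 have le: "f v * (norm (?s v))\<^sup>2 \<le> 4 * (norm (G v))\<^sup>2" for v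
 proof (cases "f v = 0")
  case False
  have "(norm (?s v))\<^sup>2 = 4 / f v * (norm (G v))\<^sup>2"
   using pos[of v] by (simp add: power_mult_distrib power_divide)
  then show ?thesis using False by simp
 qed simp
 have i2: "integrable lborel (\<lambda>v. f v * (norm (?s v))\<^sup>2)"
 proof (rule integrable_dominated[where w="\<lambda>v. 4 * (norm (G v))\<^sup>2"])
  show "integrable lborel (\<lambda>v. 4 * (norm (G v))\<^sup>2)" using G2 by (rule integrable_mult_right)
  show "(\<lambda>v. f v * (norm (?s v))\<^sup>2) \<in> borel_measurable lborel" by measurable
  show "\<bar>f v * (norm (?s v))\<^sup>2\<bar> \<le> 4 * (norm (G v))\<^sup>2" for v
   using le[of v] pos[of v] by (simp only: abs_of_nonneg mult_nonneg_nonneg zero_le_power2)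
 qed
 have "(LBINT v. f v * (norm (?s v))\<^sup>2) \<le> (LBINT v. 4 * (norm (G v))\<^sup>2)"
  by (rule integral_mono[OF i2 integrable_mult_right[OF G2] le])
 also have "ennreal \<dots> = (\<integral>\<^sup>+ v. ennreal (4 * (norm (G v))\<^sup>2) \<partial>lborel)"
  by (rule nn_integral_eq_integral[symmetric, OF integrable_mult_right[OF G2]]) simp
 also have "\<dots> = 4 * (\<integral>\<^sup>+ v. ennreal ((norm (G v))\<^sup>2) \<partial>lborel)"
  by (simp add: ennreal_mult' nn_integral_cmult)
 finally show "ennreal (LBINT v. f v * (norm (?s v))\<^sup>2) \<le> 4 * (\<integral>\<^sup>+ v. ennreal ((norm (G v))\<^sup>2) \<partial>lborel)"
  by (simp only: ennreal_leI)
 have ibp: "(LBINT v. f v * partial i \<psi> v) = - (LBINT v. f v * ?s v $ i * \<psi> v)" if \<psi>: "test_fun \<psi>" for \<psi> i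
 proof -
  note [measurable] = test_fun_measurable[OF \<psi>] test_fun_measurable[OF test_fun_partial[OF \<psi>]]
  obtain R where R: "R > 0" "\<And>x. norm x > R \<Longrightarrow> \<psi> x = 0" using test_fun_support[OF \<psi>] by blast
  obtain K where K: "K > 0" "\<And>x. \<bar>\<psi> x\<bar> \<le> K" using test_fun_bounded[OF \<psi>] by blast
  obtain K' where K': "K' > 0" "\<And>x. \<bar>partial i \<psi> x\<bar> \<le> K'" using test_fun_bounded[OF test_fun_partial[OF \<psi>, of i]] by blast
  \<comment> \<open>The extra unit of radius is the margin that \<open>weak_chain_rule_local\<close>
    asks for around the support of \<open>\<psi>\<close>.\<close>
  let ?K = "cball 0 (R + 1) :: vec3 set"
  define u where "u x = indicator ?K x * sqrt (f x)" for x
  define g where "g x = indicator ?K x * G x $ i" for x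
  have [measurable]: "?K \<in> sets borel" by simp
  have [measurable]: "u \<in> borel_measurable borel" "g \<in> borel_measurable borel"
   unfolding u_def[abs_def] g_def[abs_def] by measurable
  have sq: "sqrt t \<le> 1 + t" if "0 \<le> t" for t
  proof (rule real_le_lsqrt)
   show "t \<le> (1 + t)\<^sup>2" using that zero_le_power2[of t] by (simp add: power2_sum)
  qed (use that in simp_all)
  have ui: "integrable lborel u"
  proof (rule integrable_dominated[where w="\<lambda>x. indicator ?K x + f x"])
   show "integrable lborel (\<lambda>x. indicator ?K x + f x)"
    using integrable_indicator_compact[OF compact_cball] f by (rule Bochner_Integration.integrable_add)
   show "\<bar>u x\<bar> \<le> indicator ?K x + f x" for x
    using sq[OF pos[of x]] pos[of x] by (cases "x \<in> ?K") (simp_all add: u_def)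
  qed simp
  have gi: "integrable lborel g"
   using wg unfolding weak_grad_def set_integrable_def g_def by simp
  have w: "(LBINT x. u x * partial i \<phi> x) = - (LBINT x. g x * \<phi> x)"
   if "test_fun \<phi>" and o: "\<And>z. norm z > R + 1 \<Longrightarrow> \<phi> z = 0" for \<phi>
  proof -
   have "(LBINT x. sqrt (f x) * partial i \<phi> x) = - (LBINT x. G x $ i * \<phi> x)"
    using wg that(1) by (simp add: weak_grad_def)
   moreover have "sqrt (f x) * partial i \<phi> x = u x * partial i \<phi> x" for x
    using partial_zero_outside[of "R + 1" \<phi> x, OF o] by (cases "x \<in> ?K") (auto simp: u_def)
   moreover have "G x $ i * \<phi> x = g x * \<phi> x" for x
    using o[of x] by (cases "x \<in> ?K") (auto simp: g_def)
   ultimately show ?thesis by simp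
  qed
  define d where "d m = inverse (real (Suc m))" for m
  have d: "d m > 0" for m by (simp add: d_def)
  have dl: "d \<longlonglongrightarrow> 0" unfolding d_def by (rule LIMSEQ_inverse_real_of_nat)
  \<comment> \<open>Approximations of the square from below with bounded derivative;
    \<open>\<bar>H' m t\<bar> \<le> 2 * \<bar>t\<bar>\<close> uniformly in \<open>m\<close> gives
    the domination.\<close>
  define H where "H m t = t\<^sup>2 / (1 + d m * t\<^sup>2)" for m t
  define H' where "H' m t = 2 * t / (1 + d m * t\<^sup>2)\<^sup>2" for m t
  have nz: "1 + d m * t\<^sup>2 \<ge> 1" for m t using d[of m] by simp
  have nz': "1 + d m * t\<^sup>2 \<noteq> 0" for m t using nz[of m t] by linarith
  have H': "(H m has_real_derivative H' m t) (at t)" for m t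
   unfolding H_def H'_def using nz'[of m t]
   by (auto intro!: derivative_eq_intros simp: power2_eq_square field_simps)
  have H'le: "\<bar>H' m t\<bar> \<le> 2 * \<bar>t\<bar>" for m t
  proof -
   have "2 * \<bar>t\<bar> / (1 + d m * t\<^sup>2)\<^sup>2 \<le> 2 * \<bar>t\<bar> / 1"
    using nz[of m t] by (intro divide_left_mono) auto
   then show ?thesis using nz[of m t] by (simp add: H'_def abs_mult)
  qed
  have H'b: "\<bar>H' m t\<bar> \<le> 1 + 1 / d m" for m t
  proof -
   have "2 * \<bar>t\<bar> \<le> 1 + t\<^sup>2" using sum_squares_bound[of "\<bar>t\<bar>" 1] by simp
   also have "\<dots> \<le> (1 + 1 / d m) * (1 + d m * t\<^sup>2)" using d[of m] by (simp add: field_simps)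
   also have "\<dots> \<le> (1 + 1 / d m) * (1 + d m * t\<^sup>2)\<^sup>2"
    using d[of m] by (intro mult_left_mono self_le_power nz) auto
   finally show ?thesis using nz[of m t] by (simp add: H'_def abs_mult divide_le_eq)
  qed
  have Hle: "0 \<le> H m t" "H m t \<le> t\<^sup>2" for m t
   using nz[of m t] divide_left_mono[of 1 "1 + d m * t\<^sup>2" "t\<^sup>2"] by (auto simp: H_def)
  have H'c: "continuous_on UNIV (H' m)" for m
   unfolding H'_def using nz' by (intro continuous_intros) auto
  have Hm[measurable]: "H m \<in> borel_measurable borel" "H' m \<in> borel_measurable borel" for m
   unfolding H_def H'_def by measurable
  have eq: "(LBINT x. H m (u x) * partial i \<psi> x) = - (LBINT x. H' m (u x) * g x * \<psi> x)" for m
   using weak_chain_rule_local[OF ui gi w H' H'c H'b \<psi> R(2), of "R + 1"] by simp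
  have usq: "(u x)\<^sup>2 = indicator ?K x * f x" for x using pos[of x] by (simp add: u_def indicator_def)
  have usqle: "(u x)\<^sup>2 \<le> f x" for x using pos[of x] by (cases "x \<in> ?K") (simp_all add: usq)
  have l1: "(\<lambda>m. \<integral>x. H m (u x) * partial i \<psi> x \<partial>lborel) \<longlonglongrightarrow> (LBINT x. (u x)\<^sup>2 * partial i \<psi> x)"
  proof (rule integral_dominated_convergence[where w="\<lambda>x. K' * f x"])
   show "AE x in lborel. (\<lambda>m. H m (u x) * partial i \<psi> x) \<longlonglongrightarrow> (u x)\<^sup>2 * partial i \<psi> x"
   proof (rule AE_I2)
    fix x
    have "(\<lambda>m. (u x)\<^sup>2 / (1 + d m * (u x)\<^sup>2) * partial i \<psi> x) \<longlonglongrightarrow> (u x)\<^sup>2 / (1 + 0 * (u x)\<^sup>2) * partial i \<psi> x"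
     by (intro tendsto_intros dl) auto
    then show "(\<lambda>m. H m (u x) * partial i \<psi> x) \<longlonglongrightarrow> (u x)\<^sup>2 * partial i \<psi> x"
     by (simp add: H_def)
   qed
   show "AE x in lborel. norm (H m (u x) * partial i \<psi> x) \<le> K' * f x" for m
   proof (rule AE_I2)
    fix x
    have "H m (u x) \<le> f x" using Hle(2)[of m "u x"] usqle[of x] by linarith
    then show "norm (H m (u x) * partial i \<psi> x) \<le> K' * f x"
     using mult_mono[OF _ K'(2)[of x], of "H m (u x)" "f x"] Hle(1)[of m "u x"] pos[of x] by (simp add: abs_mult mult.commute)
   qed
  qed (use f in auto)
  have Gf: "\<bar>2 * u x * g x * \<psi> x\<bar> \<le> K * (f x + (norm (G x))\<^sup>2)" for x
  proof -
   have "2 * (\<bar>u x\<bar> * \<bar>g x\<bar>) \<le> \<bar>u x\<bar>\<^sup>2 + \<bar>g x\<bar>\<^sup>2" using sum_squares_bound[of "\<bar>u x\<bar>" "\<bar>g x\<bar>"] by (simp add: mult.assoc)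
   also have "\<dots> \<le> f x + (norm (G x))\<^sup>2"
   proof (intro add_mono)
    show "\<bar>u x\<bar>\<^sup>2 \<le> f x" using usqle[of x] by simp
    show "\<bar>g x\<bar>\<^sup>2 \<le> (norm (G x))\<^sup>2"
     using component_le_norm_cart[of "G x" i] by (intro power_mono) (auto simp: g_def indicator_def)
   qed
   finally have "(2 * (\<bar>u x\<bar> * \<bar>g x\<bar>)) * \<bar>\<psi> x\<bar> \<le> (f x + (norm (G x))\<^sup>2) * K"
    using K pos by (intro mult_mono) auto
   then show ?thesis by (simp add: abs_mult ac_simps)
  qed
  have l2: "(\<lambda>m. \<integral>x. H' m (u x) * g x * \<psi> x \<partial>lborel) \<longlonglongrightarrow> (LBINT x. 2 * u x * g x * \<psi> x)"
  proof (rule integral_dominated_convergence[where w="\<lambda>x. K * (f x + (norm (G x))\<^sup>2)"])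
   show "AE x in lborel. (\<lambda>m. H' m (u x) * g x * \<psi> x) \<longlonglongrightarrow> 2 * u x * g x * \<psi> x"
   proof (rule AE_I2)
    fix x
    have "(\<lambda>m. 2 * u x / (1 + d m * (u x)\<^sup>2)\<^sup>2 * g x * \<psi> x) \<longlonglongrightarrow> 2 * u x / (1 + 0 * (u x)\<^sup>2)\<^sup>2 * g x * \<psi> x"
     by (intro tendsto_intros dl) auto
    then show "(\<lambda>m. H' m (u x) * g x * \<psi> x) \<longlonglongrightarrow> 2 * u x * g x * \<psi> x"
     by (simp add: H'_def)
   qed
   show "AE x in lborel. norm (H' m (u x) * g x * \<psi> x) \<le> K * (f x + (norm (G x))\<^sup>2)" for m
   proof (rule AE_I2)
    fix x
    have "\<bar>H' m (u x)\<bar> * (\<bar>g x\<bar> * \<bar>\<psi> x\<bar>) \<le> (2 * \<bar>u x\<bar>) * (\<bar>g x\<bar> * \<bar>\<psi> x\<bar>)"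
     by (intro mult_right_mono H'le) auto
    then show "norm (H' m (u x) * g x * \<psi> x) \<le> K * (f x + (norm (G x))\<^sup>2)"
     using Gf[of x] by (simp add: abs_mult mult.assoc)
   qed
  qed (use f G2 in auto)
  have "(LBINT x. (u x)\<^sup>2 * partial i \<psi> x) = - (LBINT x. 2 * u x * g x * \<psi> x)"
   using LIMSEQ_unique[OF l1] tendsto_minus[OF l2] eq by simp
  moreover have "(u x)\<^sup>2 * partial i \<psi> x = f x * partial i \<psi> x" for x
   using partial_zero_outside[of R \<psi> x i, OF R(2)] by (cases "x \<in> ?K") (auto simp: usq)
  moreover have "2 * u x * g x * \<psi> x = f x * ?s x $ i * \<psi> x" for x
  proof (cases "x \<in> ?K")
   case True
   then show ?thesis using pos[of x] real_sqrt_mult_self[of "f x"]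
    by (cases "f x = 0") (auto simp: u_def g_def field_simps)
  qed (use R(2)[of x] in auto)
  ultimately show ?thesis by simp
 qed
 show "has_score f ?s"
  unfolding has_score_def using ibp pos f i2 by auto
qed

text \<open>Converse passage, by the chain rule for a smoothed square root. The slope of the root
  blows up where \<open>g\<close> is small, but the weak gradient \<open>g s\<close> carries a
  factor \<open>g\<close> that compensates.\<close>

lemma weak_grad_sqrt_score:
 assumes gs: "has_score g s"
 shows "weak_grad (\<lambda>v. sqrt (g v)) (\<lambda>v. (sqrt (g v) / 2) *\<^sub>R s v)"
proof -
 have [measurable]: "g \<in> borel_measurable borel" "s \<in> borel_measurable borel" and pos: "\<And>v. 0 \<le> g v"
  and gi: "integrable lborel g" and gs2: "integrable lborel (\<lambda>v. g v * (norm (s v))\<^sup>2)"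
  and w0: "\<And>\<psi> i. test_fun \<psi> \<Longrightarrow> (LBINT v. g v * partial i \<psi> v) = - (LBINT v. g v * s v $ i * \<psi> v)"
  using gs by (auto simp: has_score_def)
 have [measurable]: "(\<lambda>x. s x $ i) \<in> borel_measurable borel" for i
  using \<open>s \<in> borel_measurable borel\<close> by (rule borel_measurable_vec_nth_comp)
 let ?G = "\<lambda>v. (sqrt (g v) / 2) *\<^sub>R s v"
 have Gle: "\<bar>?G v $ i\<bar> \<le> 1 + g v * (norm (s v))\<^sup>2" for v i
 proof -
  have "\<bar>?G v $ i\<bar> \<le> norm (?G v)" by (rule component_le_norm_cart)
  also have "\<dots> \<le> 1 + (norm (?G v))\<^sup>2"
   using sum_squares_bound[of "norm (?G v)" 1] norm_ge_zero[of "?G v"] unfolding power_one mult_1_right by linarith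
  also have "\<dots> \<le> 1 + g v * (norm (s v))\<^sup>2" using pos[of v] by (simp add: power_mult_distrib power_divide)
  finally show ?thesis .
 qed
 have loc: "set_integrable lborel K (\<lambda>x. ?G x $ i)" if "compact K" for K i
 proof -
  have [measurable]: "K \<in> sets borel" using that by (simp add: borel_compact)
  show ?thesis unfolding set_integrable_def
  proof (rule integrable_dominated[where w="\<lambda>x. indicator K x + g x * (norm (s x))\<^sup>2"])
   show "integrable lborel (\<lambda>x. indicator K x + g x * (norm (s x))\<^sup>2)"
    using integrable_indicator_compact[OF that] gs2 by (rule Bochner_Integration.integrable_add)
   show "(\<lambda>x. indicator K x *\<^sub>R ?G x $ i) \<in> borel_measurable lborel"
    by (simp only: vector_scaleR_component) measurable
   show "\<bar>indicator K x *\<^sub>R ?G x $ i\<bar> \<le> indicator K x + g x * (norm (s x))\<^sup>2" for x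
   proof (cases "x \<in> K")
    case True
    then show ?thesis using Gle[of x i] by (simp only: indicator_simps scaleR_one)
   next
    case False
    then show ?thesis using pos[of x] by simp
   qed
  qed
 qed
 have ibp: "(LBINT x. sqrt (g x) * partial i \<psi> x) = - (LBINT x. ?G x $ i * \<psi> x)" if \<psi>: "test_fun \<psi>" for \<psi> i
 proof -
  note [measurable] = test_fun_measurable[OF \<psi>] test_fun_measurable[OF test_fun_partial[OF \<psi>]]
  obtain R where R: "R > 0" "\<And>x. norm x > R \<Longrightarrow> \<psi> x = 0" using test_fun_support[OF \<psi>] by blast
  obtain K where K: "K > 0" "\<And>x. \<bar>\<psi> x\<bar> \<le> K" using test_fun_bounded[OF \<psi>] by blast
  have gsi: "integrable lborel (\<lambda>v. g v * s v $ i)"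
  proof (rule integrable_dominated[where w="\<lambda>v. g v + g v * (norm (s v))\<^sup>2"])
   show "\<bar>g v * s v $ i\<bar> \<le> g v + g v * (norm (s v))\<^sup>2" for v
   proof -
    have "\<bar>s v $ i\<bar> \<le> 1 + (norm (s v))\<^sup>2"
     using component_le_norm_cart[of "s v" i] sum_squares_bound[of "norm (s v)" 1] norm_ge_zero[of "s v"]
     unfolding power_one mult_1_right by linarith
    from mult_left_mono[OF this pos[of v]] show ?thesis using pos[of v] by (simp add: abs_mult distrib_left)
   qed
  qed (use gi gs2 in auto)
  define d where "d m = inverse (real (Suc m))" for m
  have d: "d m > 0" "d m \<le> 1" for m by (auto simp: d_def inverse_le_1_iff)
  have dl: "d \<longlonglongrightarrow> 0" unfolding d_def by (rule LIMSEQ_inverse_real_of_nat)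
  \<comment> \<open>\<open>r m\<close> smooths the absolute value, so that \<open>H m\<close> is
    differentiable across 0 with bounded derivative and tends to the root of the absolute
    value.\<close>
  define r where "r m t = sqrt (t\<^sup>2 + d m)" for m t
  define H where "H m t = sqrt (r m t)" for m t
  define H' where "H' m t = t / (2 * r m t * sqrt (r m t))" for m t
  have tp: "t\<^sup>2 + d m > 0" for m t using d[of m] by (intro add_nonneg_pos) auto
  have rp: "r m t > 0" for m t using tp by (simp add: r_def)
  have rt: "\<bar>t\<bar> \<le> r m t" for m t unfolding r_def using d(1)[of m] by (intro real_le_rsqrt) auto
  have rd: "sqrt (d m) \<le> r m t" for m t unfolding r_def using d(1)[of m] by (intro real_sqrt_le_mono) auto
  have H': "(H m has_real_derivative H' m t) (at t)" for m t
   unfolding H_def H'_def r_def using tp[of t m]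
   by (auto intro!: derivative_eq_intros simp: divide_simps)
  have H'b: "\<bar>H' m t\<bar> \<le> 1 / (2 * sqrt (sqrt (d m)))" for m t
  proof -
   have "\<bar>H' m t\<bar> = (\<bar>t\<bar> / r m t) / (2 * sqrt (r m t))" using rp[of m t] by (simp add: H'_def abs_mult)
   also have "\<dots> \<le> 1 / (2 * sqrt (sqrt (d m)))"
    using rp[of m t] rt[of t m] rd[of m t] d(1)[of m] by (intro frac_le) auto
   finally show ?thesis .
  qed
  have H'c: "continuous_on UNIV (H' m)" for m
   unfolding H'_def r_def using tp less_imp_neq[OF tp, symmetric] by (intro continuous_intros) (auto simp: add_nonneg_eq_0_iff)
  have [measurable]: "H m \<in> borel_measurable borel" "H' m \<in> borel_measurable borel" for m
   unfolding H_def H'_def r_def by measurable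
  have eq: "(LBINT x. H m (g x) * partial i \<psi> x) = - (LBINT x. H' m (g x) * (g x * s x $ i) * \<psi> x)" for m
   by (rule weak_chain_rule_local[OF gi gsi _ H' H'c H'b \<psi> R(2), of "R + 1"]) (use w0 in auto)
  have l1: "(\<lambda>m. \<integral>x. H m (g x) * partial i \<psi> x \<partial>lborel) \<longlonglongrightarrow> (LBINT x. sqrt (g x) * partial i \<psi> x)"
  proof (rule integral_dominated_convergence[where w="\<lambda>x. \<bar>g x * partial i \<psi> x\<bar> + \<bar>partial i \<psi> x\<bar>"])
   show "AE x in lborel. (\<lambda>m. H m (g x) * partial i \<psi> x) \<longlonglongrightarrow> sqrt (g x) * partial i \<psi> x"
   proof (rule AE_I2)
    fix x
    have "(\<lambda>m. sqrt (sqrt ((g x)\<^sup>2 + d m)) * partial i \<psi> x) \<longlonglongrightarrow> sqrt (sqrt ((g x)\<^sup>2 + 0)) * partial i \<psi> x"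
     by (intro tendsto_intros dl)
    then show "(\<lambda>m. H m (g x) * partial i \<psi> x) \<longlonglongrightarrow> sqrt (g x) * partial i \<psi> x"
     using pos[of x] by (simp add: H_def r_def)
   qed
   show "AE x in lborel. norm (H m (g x) * partial i \<psi> x) \<le> \<bar>g x * partial i \<psi> x\<bar> + \<bar>partial i \<psi> x\<bar>" for m
   proof (rule AE_I2)
    fix x
    have "r m (g x) \<le> g x + 1" unfolding r_def
     using pos[of x] d(2)[of m] by (intro real_le_lsqrt) (auto simp: power2_eq_square algebra_simps)
    also have "\<dots> \<le> (g x + 1)\<^sup>2" using pos[of x] by (simp add: power2_eq_square algebra_simps)
    finally have "H m (g x) \<le> g x + 1" unfolding H_def using pos[of x] by (intro real_le_lsqrt) (auto intro: less_imp_le rp)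
    then have "\<bar>H m (g x)\<bar> * \<bar>partial i \<psi> x\<bar> \<le> (g x + 1) * \<bar>partial i \<psi> x\<bar>"
     using rp[of m "g x"] by (intro mult_right_mono) (auto simp: H_def)
    then show "norm (H m (g x) * partial i \<psi> x) \<le> \<bar>g x * partial i \<psi> x\<bar> + \<bar>partial i \<psi> x\<bar>"
     using pos[of x] by (simp add: abs_mult distrib_right)
   qed
  qed (use integrable_mult_test_fun[OF gi test_fun_partial[OF \<psi>]] test_fun_integrable[OF test_fun_partial[OF \<psi>]] in auto)
  have l2: "(\<lambda>m. \<integral>x. H' m (g x) * (g x * s x $ i) * \<psi> x \<partial>lborel) \<longlonglongrightarrow> (LBINT x. ?G x $ i * \<psi> x)"
  proof (rule integral_dominated_convergence[where w="\<lambda>x. \<bar>\<psi> x\<bar> + K * (g x * (norm (s x))\<^sup>2)"])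
   show "AE x in lborel. (\<lambda>m. H' m (g x) * (g x * s x $ i) * \<psi> x) \<longlonglongrightarrow> ?G x $ i * \<psi> x"
   proof (rule AE_I2)
    fix x
    show "(\<lambda>m. H' m (g x) * (g x * s x $ i) * \<psi> x) \<longlonglongrightarrow> ?G x $ i * \<psi> x"
    proof (cases "g x = 0")
     case False
     with pos[of x] have gp: "g x > 0" by (simp add: order_less_le)
     have "(\<lambda>m. g x / (2 * sqrt ((g x)\<^sup>2 + d m) * sqrt (sqrt ((g x)\<^sup>2 + d m))) * (g x * s x $ i) * \<psi> x)
      \<longlonglongrightarrow> g x / (2 * sqrt ((g x)\<^sup>2 + 0) * sqrt (sqrt ((g x)\<^sup>2 + 0))) * (g x * s x $ i) * \<psi> x"
      using gp by (intro tendsto_intros dl) auto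
     moreover have "g x / (2 * sqrt ((g x)\<^sup>2 + 0) * sqrt (sqrt ((g x)\<^sup>2 + 0))) * (g x * s x $ i) * \<psi> x
       = (g x / sqrt (g x)) * s x $ i * \<psi> x / 2"
      using gp by simp
     moreover have "(g x / sqrt (g x)) * s x $ i * \<psi> x / 2 = ?G x $ i * \<psi> x"
      using gp by (subst real_div_sqrt) simp_all
     ultimately show ?thesis unfolding H'_def r_def by (simp only:)
    qed (simp add: H'_def)
   qed
   show "AE x in lborel. norm (H' m (g x) * (g x * s x $ i) * \<psi> x) \<le> \<bar>\<psi> x\<bar> + K * (g x * (norm (s x))\<^sup>2)" for m
   proof (rule AE_I2)
    fix x
    \<comment> \<open>This bound is uniform in \<open>m\<close>, although the bound on
      \<open>H' m\<close> alone explodes as \<open>d m\<close> tends to zero.\<close>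
    have "\<bar>H' m (g x) * g x\<bar> \<le> sqrt (g x) / 2"
    proof (cases "g x = 0")
     case False
     with pos[of x] have gp: "g x > 0" by (simp add: order_less_le)
     have "g x * g x = (g x * sqrt (g x)) * sqrt (g x)" using gp by simp
     also have "\<dots> \<le> (r m (g x) * sqrt (r m (g x))) * sqrt (g x)"
      using gp rt[of "g x" m] rp[of m "g x"] by (intro mult_right_mono mult_mono) auto
     finally have "g x * g x \<le> r m (g x) * sqrt (r m (g x)) * sqrt (g x)" .
     then show ?thesis using rp[of m "g x"] gp by (simp add: H'_def abs_mult field_simps)
    qed simp
    then have "\<bar>H' m (g x) * g x\<bar> * \<bar>s x $ i\<bar> \<le> (sqrt (g x) / 2) * \<bar>s x $ i\<bar>" by (rule mult_right_mono) simp
    also have "\<dots> = \<bar>?G x $ i\<bar>" using pos[of x] by (simp add: abs_mult)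
    also have "\<dots> \<le> 1 + g x * (norm (s x))\<^sup>2" by (rule Gle)
    finally have "\<bar>H' m (g x) * g x\<bar> * \<bar>s x $ i\<bar> * \<bar>\<psi> x\<bar> \<le> (1 + g x * (norm (s x))\<^sup>2) * \<bar>\<psi> x\<bar>" by (rule mult_right_mono) simp
    also have "\<dots> \<le> \<bar>\<psi> x\<bar> + K * (g x * (norm (s x))\<^sup>2)"
     using mult_left_mono[OF K(2)[of x], of "g x * (norm (s x))\<^sup>2"] pos[of x] by (simp add: algebra_simps)
    finally show "norm (H' m (g x) * (g x * s x $ i) * \<psi> x) \<le> \<bar>\<psi> x\<bar> + K * (g x * (norm (s x))\<^sup>2)"
     by (simp add: abs_mult mult.assoc)
   qed
  qed (use test_fun_integrable[OF \<psi>] gs2 in auto)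
  show ?thesis using LIMSEQ_unique[OF l1] tendsto_minus[OF l2] eq by simp
 qed
 show ?thesis unfolding weak_grad_def using loc ibp by auto
qed

lemma fisher_le_score:
 assumes gs: "has_score g s"
 shows "fisher g \<le> ennreal (LBINT v. g v * (norm (s v))\<^sup>2)"
proof -
 have [measurable]: "g \<in> borel_measurable borel" "s \<in> borel_measurable borel" and pos: "\<And>v. 0 \<le> g v"
  and gs2: "integrable lborel (\<lambda>v. g v * (norm (s v))\<^sup>2)"
  using gs by (auto simp: has_score_def)
 let ?G = "\<lambda>v. (sqrt (g v) / 2) *\<^sub>R s v"
 have "fisher g \<le> 4 * (\<integral>\<^sup>+ v. ennreal ((norm (?G v))\<^sup>2) \<partial>lborel)"
  unfolding fisher_def using weak_grad_sqrt_score[OF gs] by (intro INF_lower) simp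
 also have "\<dots> = (\<integral>\<^sup>+ v. ennreal (4 * (norm (?G v))\<^sup>2) \<partial>lborel)"
  by (simp add: ennreal_mult' nn_integral_cmult)
 also have "\<dots> = (\<integral>\<^sup>+ v. ennreal (g v * (norm (s v))\<^sup>2) \<partial>lborel)"
  using pos by (simp add: power_mult_distrib power_divide)
 also have "\<dots> = ennreal (LBINT v. g v * (norm (s v))\<^sup>2)"
  using gs2 pos by (intro nn_integral_eq_integral) auto
 finally show ?thesis .
qed

section \<open>Conditional expectations and the score of an image measure\<close>

text \<open>\<open>d\<close> is the conditional expectation of \<open>h\<close> given
  \<open>X\<close>, written as a function of the value of \<open>X\<close>. It is the Radon-Nikodym
  derivative of the image of \<open>h M\<close> with respect to the image of
  \<open>M\<close>.\<close>

lemma conditional_density_nonneg: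
 fixes h :: "'a \<Rightarrow> real" and g :: "vec3 \<Rightarrow> real"
 assumes X[measurable]: "X \<in> measurable M borel" and h: "integrable M h" and h0: "\<And>\<omega>. 0 \<le> h \<omega>"
  and g: "integrable lborel g" and g0: "\<And>x. 0 \<le> g x"
  and distr: "distr M borel X = density lborel (\<lambda>x. ennreal (g x))"
 shows "\<exists>d. d \<in> borel_measurable borel \<and> integrable lborel (\<lambda>x. g x * d x) \<and>
  (\<forall>\<phi> C. \<phi> \<in> borel_measurable borel \<longrightarrow> (\<forall>x. \<bar>\<phi> x\<bar> \<le> C) \<longrightarrow>
   (\<integral>\<omega>. h \<omega> * \<phi> (X \<omega>) \<partial>M) = (LBINT x. g x * d x * \<phi> x))"
proof -
 note [measurable] = borel_measurable_integrable[OF h] borel_measurable_integrable[OF g, simplified]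
 let ?D = "distr M borel X" and ?hM = "density M (\<lambda>\<omega>. ennreal (h \<omega>))"
 let ?N = "distr ?hM borel X"
 have X': "X \<in> measurable ?hM borel" by simp
 have "emeasure ?D (space ?D) = (\<integral>\<^sup>+x. ennreal (g x) \<partial>lborel)"
  unfolding distr by (simp add: emeasure_density)
 also have "\<dots> < \<infinity>" using g g0 by (simp add: nn_integral_eq_integral)
 finally interpret D: finite_measure ?D by (intro finite_measureI) simp
 have "emeasure ?N (space ?N) = (\<integral>\<^sup>+\<omega>. ennreal (h \<omega>) \<partial>M)"
  using measurable_space[OF X] by (subst emeasure_distr[OF X']) (auto simp: emeasure_density intro!: nn_integral_cong)
 also have "\<dots> < \<infinity>" using h h0 by (simp add: nn_integral_eq_integral)
 finally have Nfin: "finite_measure ?N" by (intro finite_measureI) simp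
 have ac: "absolutely_continuous ?D ?N"
  unfolding absolutely_continuous_def
 proof
  fix A assume "A \<in> null_sets ?D"
  then have A[measurable]: "A \<in> sets borel" and z: "emeasure M (X -` A \<inter> space M) = 0"
   by (auto simp: null_sets_def emeasure_distr)
  then have "AE \<omega> in M. \<omega> \<notin> X -` A \<inter> space M"
   by (intro AE_not_in) (auto simp: null_sets_def)
  then have "(\<integral>\<^sup>+\<omega>. ennreal (h \<omega>) * indicator (X -` A \<inter> space M) \<omega> \<partial>M) = 0"
   by (subst nn_integral_0_iff_AE) (auto simp: indicator_def elim!: eventually_mono)
  then show "A \<in> null_sets ?N"
   by (auto simp: null_sets_def emeasure_distr emeasure_density)
 qed
 obtain d where d[measurable]: "d \<in> borel_measurable ?D" and dRN: "AE x in ?D. RN_deriv ?D ?N x = ennreal (d x)"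
  and d0: "\<And>x. 0 \<le> d x"
 proof (rule D.real_RN_deriv[OF Nfin ac])
  show "sets ?N = sets ?D" by simp
  show thesis if "d \<in> borel_measurable ?D" "AE x in ?D. RN_deriv ?D ?N x = ennreal (d x)" "\<And>x. 0 \<le> d x" for d
   using that by (rule \<open>\<And>d. d \<in> borel_measurable ?D \<Longrightarrow> AE x in ?D. RN_deriv ?D ?N x = ennreal (d x) \<Longrightarrow> (\<And>x. 0 \<le> d x) \<Longrightarrow> thesis\<close>)
 qed
 have [measurable]: "d \<in> borel_measurable borel" using d by simp
 have "?N = density ?D (RN_deriv ?D ?N)"
  using D.density_RN_deriv[OF ac] by simp
 also have "\<dots> = density ?D (\<lambda>x. ennreal (d x))"
  using dRN by (intro density_cong) auto
 also have "\<dots> = density lborel (\<lambda>x. ennreal (g x) * ennreal (d x))"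
  unfolding distr by (rule density_density_eq) auto
 finally have N: "?N = density lborel (\<lambda>x. ennreal (g x * d x))"
  using g0 by (simp add: ennreal_mult')
 have "(\<integral>\<^sup>+x. ennreal (g x * d x) \<partial>lborel) = emeasure ?N (space ?N)"
  unfolding N by (simp add: emeasure_density)
 also have "\<dots> < \<infinity>" using finite_measure.emeasure_finite[OF Nfin, of "space ?N"] by (simp add: less_top)
 finally have gd: "integrable lborel (\<lambda>x. g x * d x)"
  using g0 d0 by (intro integrableI_nonneg) auto
 have "(\<integral>\<omega>. h \<omega> * \<phi> (X \<omega>) \<partial>M) = (LBINT x. g x * d x * \<phi> x)" if [measurable]: "\<phi> \<in> borel_measurable borel" for \<phi> :: "vec3 \<Rightarrow> real"
 proof -
  have "(\<integral>\<omega>. h \<omega> * \<phi> (X \<omega>) \<partial>M) = (\<integral>\<omega>. \<phi> (X \<omega>) \<partial>?hM)"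
   using h0 by (subst integral_density) auto
  also have "\<dots> = (\<integral>x. \<phi> x \<partial>?N)" by (rule integral_distr[symmetric]) auto
  also have "\<dots> = (LBINT x. g x * d x * \<phi> x)"
   unfolding N using g0 d0 by (subst integral_density) auto
  finally show ?thesis .
 qed
 then show ?thesis using gd by (intro exI[of _ d]) auto
qed

lemma conditional_density:
 fixes h :: "'a \<Rightarrow> real" and g :: "vec3 \<Rightarrow> real"
 assumes X[measurable]: "X \<in> measurable M borel" and h: "integrable M h"
  and g: "integrable lborel g" and g0: "\<And>x. 0 \<le> g x"
  and distr: "distr M borel X = density lborel (\<lambda>x. ennreal (g x))"
 shows "\<exists>d. d \<in> borel_measurable borel \<and> integrable lborel (\<lambda>x. g x * d x) \<and>
  (\<forall>\<phi> C. \<phi> \<in> borel_measurable borel \<longrightarrow> (\<forall>x. \<bar>\<phi> x\<bar> \<le> C) \<longrightarrow>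
   (\<integral>\<omega>. h \<omega> * \<phi> (X \<omega>) \<partial>M) = (LBINT x. g x * d x * \<phi> x))"
proof -
 let ?p = "\<lambda>\<omega>. max 0 (h \<omega>)" and ?m = "\<lambda>\<omega>. max 0 (- h \<omega>)"
 have hi: "integrable M ?p" "integrable M ?m" using h by auto
 obtain dp where dp[measurable]: "dp \<in> borel_measurable borel" and dpi: "integrable lborel (\<lambda>x. g x * dp x)"
  and dpe: "\<And>\<phi> C. \<phi> \<in> borel_measurable borel \<Longrightarrow> (\<And>x. \<bar>\<phi> x\<bar> \<le> C) \<Longrightarrow>
   (\<integral>\<omega>. ?p \<omega> * \<phi> (X \<omega>) \<partial>M) = (LBINT x. g x * dp x * \<phi> x)"
  using conditional_density_nonneg[OF X hi(1) _ g g0 distr] by auto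
 obtain dm where dm[measurable]: "dm \<in> borel_measurable borel" and dmi: "integrable lborel (\<lambda>x. g x * dm x)"
  and dme: "\<And>\<phi> C. \<phi> \<in> borel_measurable borel \<Longrightarrow> (\<And>x. \<bar>\<phi> x\<bar> \<le> C) \<Longrightarrow>
   (\<integral>\<omega>. ?m \<omega> * \<phi> (X \<omega>) \<partial>M) = (LBINT x. g x * dm x * \<phi> x)"
  using conditional_density_nonneg[OF X hi(2) _ g g0 distr] by auto
 have bd: "integrable N (\<lambda>\<omega>. f \<omega> * \<phi> (Y \<omega>))"
  if "integrable N f" and [measurable]: "Y \<in> measurable N borel" "\<phi> \<in> borel_measurable borel" and b: "\<And>x. \<bar>\<phi> x\<bar> \<le> C"
  for N :: "'c measure" and f :: "'c \<Rightarrow> real" and Y and \<phi> :: "vec3 \<Rightarrow> real" and C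
 proof (rule integrable_dominated[where w="\<lambda>\<omega>. C * \<bar>f \<omega>\<bar>"])
  show "integrable N (\<lambda>\<omega>. C * \<bar>f \<omega>\<bar>)" using that(1) by (intro integrable_mult_right integrable_abs)
  show "(\<lambda>\<omega>. f \<omega> * \<phi> (Y \<omega>)) \<in> borel_measurable N" using borel_measurable_integrable[OF that(1)] by measurable
  show "\<bar>f \<omega> * \<phi> (Y \<omega>)\<bar> \<le> C * \<bar>f \<omega>\<bar>" for \<omega>
   unfolding abs_mult mult.commute[of "\<bar>f \<omega>\<bar>"] by (intro mult_right_mono b) simp
 qed
 have "(\<integral>\<omega>. h \<omega> * \<phi> (X \<omega>) \<partial>M) = (LBINT x. g x * (dp x - dm x) * \<phi> x)"
  if [measurable]: "\<phi> \<in> borel_measurable borel" and b: "\<And>x. \<bar>\<phi> x\<bar> \<le> C" for \<phi> :: "vec3 \<Rightarrow> real" and C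
 proof -
  have "(\<integral>\<omega>. h \<omega> * \<phi> (X \<omega>) \<partial>M) = (\<integral>\<omega>. ?p \<omega> * \<phi> (X \<omega>) - ?m \<omega> * \<phi> (X \<omega>) \<partial>M)"
   by (intro Bochner_Integration.integral_cong) (auto simp: max_def)
  also have "\<dots> = (\<integral>\<omega>. ?p \<omega> * \<phi> (X \<omega>) \<partial>M) - (\<integral>\<omega>. ?m \<omega> * \<phi> (X \<omega>) \<partial>M)"
   by (rule Bochner_Integration.integral_diff) (rule bd[OF hi(1) X _ b] bd[OF hi(2) X _ b], measurable)+
  also have "\<dots> = (LBINT x. g x * dp x * \<phi> x) - (LBINT x. g x * dm x * \<phi> x)"
   using dpe[where \<phi>=\<phi> and C=C, OF _ b] dme[where \<phi>=\<phi> and C=C, OF _ b] by simp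
  also have "\<dots> = (LBINT x. g x * dp x * \<phi> x - g x * dm x * \<phi> x)"
   by (rule Bochner_Integration.integral_diff[symmetric]) (rule bd[OF dpi _ _ b] bd[OF dmi _ _ b], measurable)+
  finally show ?thesis by (simp add: algebra_simps)
 qed
 moreover have "integrable lborel (\<lambda>x. g x * (dp x - dm x))"
  using Bochner_Integration.integrable_diff[OF dpi dmi] by (simp add: right_diff_distrib)
 ultimately show ?thesis by (intro exI[of _ "\<lambda>x. dp x - dm x"]) auto
qed

text \<open>The score is the conditional expectation of \<open>\<Theta>\<close> given
  \<open>X\<close>, and the energy bound is Jensen's inequality. Square integrability of
  \<open>S\<close> is part of what has to be shown, so the estimate is made on the sets
  \<open>T N\<close> where \<open>S\<close> is bounded, and then \<open>N\<close> tends to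
  infinity.\<close>

lemma score_pushforward:
 fixes \<Theta> :: "'a \<Rightarrow> vec3"
 assumes M: "finite_measure M" and X[measurable]: "X \<in> measurable M borel" and \<Theta>[measurable]: "\<Theta> \<in> borel_measurable M"
  and \<Theta>2: "integrable M (\<lambda>\<omega>. (norm (\<Theta> \<omega>))\<^sup>2)"
  and g: "integrable lborel g" and g0: "\<And>x. 0 \<le> g x"
  and distr: "distr M borel X = density lborel (\<lambda>x. ennreal (g x))"
  and ibp: "\<And>\<psi> i. test_fun \<psi> \<Longrightarrow> (\<integral>\<omega>. partial i \<psi> (X \<omega>) \<partial>M) = - (\<integral>\<omega>. \<Theta> \<omega> $ i * \<psi> (X \<omega>) \<partial>M)"
 shows "\<exists>S. has_score g S \<and> (LBINT x. g x * (norm (S x))\<^sup>2) \<le> (\<integral>\<omega>. (norm (\<Theta> \<omega>))\<^sup>2 \<partial>M)"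
proof -
 interpret finite_measure M by fact
 note [measurable] = borel_measurable_integrable[OF g, simplified]
 have \<Theta>m[measurable]: "(\<lambda>\<omega>. \<Theta> \<omega> $ i) \<in> borel_measurable M" for i
  using \<Theta> by (rule borel_measurable_vec_nth_comp)
 have \<Theta>i: "integrable M (\<lambda>\<omega>. \<Theta> \<omega> $ i)" for i
 proof (rule integrable_dominated[where w="\<lambda>\<omega>. 1 + (norm (\<Theta> \<omega>))\<^sup>2"])
  show "\<bar>\<Theta> \<omega> $ i\<bar> \<le> 1 + (norm (\<Theta> \<omega>))\<^sup>2" for \<omega>
   using component_le_norm_cart[of "\<Theta> \<omega>" i] sum_squares_bound[of "norm (\<Theta> \<omega>)" 1] norm_ge_zero[of "\<Theta> \<omega>"]
   unfolding power_one mult_1_right by linarith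
 qed (use \<Theta>2 in auto)
 have "\<exists>d. \<forall>i. d i \<in> borel_measurable borel \<and> integrable lborel (\<lambda>x. g x * d i x) \<and>
  (\<forall>\<phi> C. \<phi> \<in> borel_measurable borel \<longrightarrow> (\<forall>x. \<bar>\<phi> x\<bar> \<le> C) \<longrightarrow>
   (\<integral>\<omega>. \<Theta> \<omega> $ i * \<phi> (X \<omega>) \<partial>M) = (LBINT x. g x * d i x * \<phi> x))"
  by (rule choice, rule allI, rule conditional_density[OF X \<Theta>i g g0 distr])
 then obtain d where dd: "\<forall>i. d i \<in> borel_measurable borel \<and> integrable lborel (\<lambda>x. g x * d i x) \<and>
  (\<forall>\<phi> C. \<phi> \<in> borel_measurable borel \<longrightarrow> (\<forall>x. \<bar>\<phi> x\<bar> \<le> C) \<longrightarrow>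
   (\<integral>\<omega>. \<Theta> \<omega> $ i * \<phi> (X \<omega>) \<partial>M) = (LBINT x. g x * d i x * \<phi> x))" ..
 have d[measurable]: "d i \<in> borel_measurable borel" and di: "integrable lborel (\<lambda>x. g x * d i x)" for i
  using dd by simp_all
 have de: "(\<integral>\<omega>. \<Theta> \<omega> $ i * \<phi> (X \<omega>) \<partial>M) = (LBINT x. g x * d i x * \<phi> x)"
  if "\<phi> \<in> borel_measurable borel" "\<And>x. \<bar>\<phi> x\<bar> \<le> C" for i \<phi> C
 proof -
  have "\<forall>x. \<bar>\<phi> x\<bar> \<le> C" using that(2) by blast
  then show ?thesis using dd that(1) by blast
 qed
 have gX: "(\<integral>\<omega>. \<phi> (X \<omega>) \<partial>M) = (LBINT x. g x * \<phi> x)" if [measurable]: "\<phi> \<in> borel_measurable borel" for \<phi> :: "vec3 \<Rightarrow> real"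
 proof -
  have "(\<integral>\<omega>. \<phi> (X \<omega>) \<partial>M) = (\<integral>x. \<phi> x \<partial>distr M borel X)" by (rule integral_distr[symmetric]) auto
  also have "\<dots> = (LBINT x. g x * \<phi> x)" unfolding distr using g0 by (subst integral_density) auto
  finally show ?thesis .
 qed
 define S :: "vec3 \<Rightarrow> vec3" where "S x = (\<chi> i. d i x)" for x
 have Sn: "S x $ i = d i x" for x i by (simp add: S_def)
 have [measurable]: "S \<in> borel_measurable borel"
  by (rule borel_measurable_vec_lambda) (simp add: Sn)
 let ?J = "\<integral>\<omega>. (norm (\<Theta> \<omega>))\<^sup>2 \<partial>M"
 have J0: "0 \<le> ?J" by (rule Bochner_Integration.integral_nonneg) simp
 define T where "T N = {x. norm (S x) \<le> real N}" for N :: nat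
 have [measurable]: "T N \<in> sets borel" for N unfolding T_def by measurable
 have trunc: "integrable lborel (\<lambda>x. g x * (norm (S x))\<^sup>2 * indicator (T N) x) \<and>
  (LBINT x. g x * (norm (S x))\<^sup>2 * indicator (T N) x) \<le> ?J" for N
 proof -
  let ?c = "\<lambda>i x. d i x * indicator (T N) x :: real"
  have cb: "\<bar>?c i x\<bar> \<le> real N" for i x
   using component_le_norm_cart[of "S x" i] by (cases "x \<in> T N") (auto simp: Sn T_def)
  have cm[measurable]: "?c i \<in> borel_measurable borel" for i by measurable
  have ci: "integrable M (\<lambda>\<omega>. \<Theta> \<omega> $ i * ?c i (X \<omega>))" for i
  proof (rule integrable_dominated[where w="\<lambda>\<omega>. real N * \<bar>\<Theta> \<omega> $ i\<bar>"])
   show "integrable M (\<lambda>\<omega>. real N * \<bar>\<Theta> \<omega> $ i\<bar>)" using \<Theta>i by (intro integrable_mult_right integrable_abs)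
   show "\<bar>\<Theta> \<omega> $ i * ?c i (X \<omega>)\<bar> \<le> real N * \<bar>\<Theta> \<omega> $ i\<bar>" for \<omega>
    unfolding abs_mult[of "\<Theta> \<omega> $ i"] mult.commute[of "\<bar>\<Theta> \<omega> $ i\<bar>"] by (intro mult_right_mono cb) simp
  qed measurable
  have ci2: "integrable M (\<lambda>\<omega>. (?c i (X \<omega>))\<^sup>2)" for i
  proof (rule integrable_dominated[where w="\<lambda>\<omega>. (real N)\<^sup>2"])
   show "\<bar>(?c i (X \<omega>))\<^sup>2\<bar> \<le> (real N)\<^sup>2" for \<omega>
    unfolding power_abs by (intro power_mono cb) simp
  qed auto
  have gi: "integrable lborel (\<lambda>x. g x * d i x * ?c i x)" for i
  proof (rule integrable_dominated[where w="\<lambda>x. real N * \<bar>g x * d i x\<bar>"])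
   show "integrable lborel (\<lambda>x. real N * \<bar>g x * d i x\<bar>)" using di by (intro integrable_mult_right integrable_abs)
   show "\<bar>g x * d i x * ?c i x\<bar> \<le> real N * \<bar>g x * d i x\<bar>" for x
    unfolding abs_mult[of "g x * d i x"] mult.commute[of "\<bar>g x * d i x\<bar>"] by (intro mult_right_mono cb) simp
  qed measurable
  have e1: "g x * (norm (S x))\<^sup>2 * indicator (T N) x = (\<Sum>i\<in>UNIV. g x * d i x * ?c i x)" for x
   unfolding norm_sq_vec3 Sn by (simp add: sum_distrib_left sum_distrib_right power2_eq_square mult.assoc)
  have e2: "g x * (norm (S x))\<^sup>2 * indicator (T N) x = g x * (\<Sum>i\<in>UNIV. (?c i x)\<^sup>2)" for x
   unfolding norm_sq_vec3 Sn by (cases "x \<in> T N") simp_all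
  have int: "integrable lborel (\<lambda>x. g x * (norm (S x))\<^sup>2 * indicator (T N) x)"
   unfolding e1 using gi by (intro Bochner_Integration.integrable_sum)
  let ?I = "\<integral>x. g x * (norm (S x))\<^sup>2 * indicator (T N) x \<partial>lborel"
  have "2 * ?I = 2 * (\<Sum>i\<in>UNIV. \<integral>x. g x * d i x * ?c i x \<partial>lborel)"
   unfolding e1 by (subst Bochner_Integration.integral_sum) (auto intro: gi)
  also have "\<dots> = (\<Sum>i\<in>UNIV. 2 * (\<integral>\<omega>. \<Theta> \<omega> $ i * ?c i (X \<omega>) \<partial>M))"
   using de[OF cm cb] by (simp add: sum_distrib_left)
  also have "\<dots> = (\<integral>\<omega>. (\<Sum>i\<in>UNIV. 2 * (\<Theta> \<omega> $ i * ?c i (X \<omega>))) \<partial>M)"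
   using ci by (subst Bochner_Integration.integral_sum) auto
  \<comment> \<open>Young's inequality for \<open>\<Theta>\<close> and the truncated
    \<open>S\<close>. The left side is twice the truncated energy and the last sum integrates to one
    copy of it, so one copy is left on the left.\<close>
  also have "\<dots> \<le> (\<integral>\<omega>. (norm (\<Theta> \<omega>))\<^sup>2 + (\<Sum>i\<in>UNIV. (?c i (X \<omega>))\<^sup>2) \<partial>M)"
  proof (rule integral_mono)
   show "integrable M (\<lambda>\<omega>. (\<Sum>i\<in>UNIV. 2 * (\<Theta> \<omega> $ i * ?c i (X \<omega>))))"
    using ci by (intro Bochner_Integration.integrable_sum integrable_mult_right)
   show "integrable M (\<lambda>\<omega>. (norm (\<Theta> \<omega>))\<^sup>2 + (\<Sum>i\<in>UNIV. (?c i (X \<omega>))\<^sup>2))"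
    using ci2 \<Theta>2 by (intro Bochner_Integration.integrable_sum Bochner_Integration.integrable_add)
   show "(\<Sum>i\<in>UNIV. 2 * (\<Theta> \<omega> $ i * ?c i (X \<omega>))) \<le> (norm (\<Theta> \<omega>))\<^sup>2 + (\<Sum>i\<in>UNIV. (?c i (X \<omega>))\<^sup>2)" for \<omega>
    unfolding norm_sq_vec3 sum.distrib[symmetric]
    by (intro sum_mono) (use sum_squares_bound in \<open>simp add: mult.assoc\<close>)
  qed
  also have "\<dots> = ?J + (\<integral>\<omega>. (\<Sum>i\<in>UNIV. (?c i (X \<omega>))\<^sup>2) \<partial>M)"
   using ci2 \<Theta>2 by (intro Bochner_Integration.integral_add Bochner_Integration.integrable_sum)
  also have "(\<integral>\<omega>. (\<Sum>i\<in>UNIV. (?c i (X \<omega>))\<^sup>2) \<partial>M) = ?I"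
   unfolding e2 by (rule gX) measurable
  finally have "?I \<le> ?J" by simp
  with int show ?thesis by simp
 qed
 have "(\<integral>\<^sup>+x. ennreal (g x * (norm (S x))\<^sup>2) \<partial>lborel) = (\<integral>\<^sup>+x. (SUP N. ennreal (g x * (norm (S x))\<^sup>2 * indicator (T N) x)) \<partial>lborel)"
 proof (rule nn_integral_cong)
  fix x
  obtain N :: nat where N: "norm (S x) \<le> real N" using real_arch_simple by blast
  show "ennreal (g x * (norm (S x))\<^sup>2) = (SUP N. ennreal (g x * (norm (S x))\<^sup>2 * indicator (T N) x))"
  proof (rule antisym)
   show "ennreal (g x * (norm (S x))\<^sup>2) \<le> (SUP N. ennreal (g x * (norm (S x))\<^sup>2 * indicator (T N) x))"
    using N by (intro SUP_upper2[of N]) (auto simp: T_def)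
   show "(SUP N. ennreal (g x * (norm (S x))\<^sup>2 * indicator (T N) x)) \<le> ennreal (g x * (norm (S x))\<^sup>2)"
    using g0[of x] by (intro SUP_least ennreal_leI) (auto simp: indicator_def)
  qed
 qed
 also have "\<dots> = (SUP N. \<integral>\<^sup>+x. ennreal (g x * (norm (S x))\<^sup>2 * indicator (T N) x) \<partial>lborel)"
 proof (rule nn_integral_monotone_convergence_SUP)
  show "incseq (\<lambda>N x. ennreal (g x * (norm (S x))\<^sup>2 * indicator (T N) x))"
   using g0 by (intro incseq_SucI le_funI ennreal_leI mult_left_mono) (auto simp: T_def indicator_def)
 qed measurable
 also have "\<dots> \<le> ennreal ?J"
 proof (rule SUP_least)
  fix N
  have "(\<integral>\<^sup>+x. ennreal (g x * (norm (S x))\<^sup>2 * indicator (T N) x) \<partial>lborel) = ennreal (LBINT x. g x * (norm (S x))\<^sup>2 * indicator (T N) x)"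
   using trunc[of N] g0 by (intro nn_integral_eq_integral) auto
  also have "\<dots> \<le> ennreal ?J" using trunc[of N] by (intro ennreal_leI) simp
  finally show "(\<integral>\<^sup>+x. ennreal (g x * (norm (S x))\<^sup>2 * indicator (T N) x) \<partial>lborel) \<le> ennreal ?J" .
 qed
 finally have le: "(\<integral>\<^sup>+x. ennreal (g x * (norm (S x))\<^sup>2) \<partial>lborel) \<le> ennreal ?J" .
 have S2i: "integrable lborel (\<lambda>x. g x * (norm (S x))\<^sup>2)"
  using g0 le by (intro integrableI_nonneg) (auto intro: le_less_trans)
 have "ennreal (LBINT x. g x * (norm (S x))\<^sup>2) \<le> ennreal ?J"
  using le nn_integral_eq_integral[OF S2i] g0 by simp
 then have "(LBINT x. g x * (norm (S x))\<^sup>2) \<le> ?J" using J0 by (simp add: ennreal_le_iff)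
 moreover have "has_score g S"
  unfolding has_score_def
 proof (intro conjI allI impI)
  fix \<psi> i assume \<psi>: "test_fun \<psi>"
  obtain K where K: "\<And>x. \<bar>\<psi> x\<bar> \<le> K" using test_fun_bounded[OF \<psi>] by blast
  have "(LBINT v. g v * partial i \<psi> v) = (\<integral>\<omega>. partial i \<psi> (X \<omega>) \<partial>M)"
   using gX[OF test_fun_measurable[OF test_fun_partial[OF \<psi>]]] by simp
  also have "\<dots> = - (LBINT v. g v * S v $ i * \<psi> v)"
   using ibp[OF \<psi>, of i] de[OF test_fun_measurable[OF \<psi>] K, of i] by (simp add: Sn)
  finally show "(LBINT v. g v * partial i \<psi> v) = - (LBINT v. g v * S v $ i * \<psi> v)" .
 qed (use g g0 S2i in auto)
 ultimately show ?thesis by blast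
qed

section \<open>Comparing densities through continuous test functions; scores of mixtures\<close>

text \<open>If \<open>h < f\<close> on a set of positive measure, that set contains a compact
  \<open>K\<close> of positive measure. The indicator of \<open>K\<close> is a limit of continuous
  functions with values in [0, 1], built from the distance to \<open>K\<close>, so
  \<open>f - h\<close> would have nonpositive integral over \<open>K\<close>.\<close>

lemma AE_le_of_bounded_continuous:
 fixes f h :: "vec3 \<Rightarrow> real"
 assumes f: "integrable lborel f" and h: "integrable lborel h"
  and le: "\<And>\<phi>. bounded_continuous \<phi> \<Longrightarrow> (\<And>x. 0 \<le> \<phi> x) \<Longrightarrow> (LBINT x. f x * \<phi> x) \<le> (LBINT x. h x * \<phi> x)"
 shows "AE x in lborel. f x \<le> h x"
proof -
 note [measurable] = borel_measurable_integrable[OF f, simplified] borel_measurable_integrable[OF h, simplified]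
 define A where "A = {x. h x < f x}"
 have [measurable]: "A \<in> sets borel" unfolding A_def by measurable
 have null: "emeasure lborel K = 0" if K: "compact K" "K \<subseteq> A" for K
 proof (cases "K = {}")
  case False
  have [measurable]: "K \<in> sets borel" using K by (simp add: borel_compact)
  define \<phi> where "\<phi> n x = max 0 (1 - real n * infdist x K)" for n x
  have \<phi>c: "continuous_on UNIV (\<phi> n)" for n
   unfolding \<phi>_def by (intro continuous_intros)
  have [measurable]: "\<phi> n \<in> borel_measurable borel" for n
   using \<phi>c by (rule borel_measurable_continuous_onI)
  have \<phi>b: "0 \<le> \<phi> n x" "\<phi> n x \<le> 1" for n x by (auto simp: \<phi>_def infdist_nonneg)
  have bc: "bounded_continuous (\<phi> n)" for n
   unfolding bounded_continuous_def using \<phi>c \<phi>b by (auto intro!: boundedI[of _ 1])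
  have lim: "(\<lambda>n. \<phi> n x) \<longlonglongrightarrow> indicator K x" for x
  proof (cases "x \<in> K")
   case True
   then show ?thesis by (simp add: \<phi>_def)
  next
   case False
   then have ip: "infdist x K > 0"
    using in_closed_iff_infdist_zero[OF compact_imp_closed[OF K(1)] \<open>K \<noteq> {}\<close>, of x] infdist_nonneg[of x K] by simp
   obtain n0 :: nat where n0: "1 / infdist x K < real n0" using reals_Archimedean2 by blast
   have "\<phi> n x = 0" if "n \<ge> n0" for n
   proof -
    have "1 < real n0 * infdist x K" using n0 ip by (simp add: divide_less_eq)
    also have "\<dots> \<le> real n * infdist x K" using that ip by (intro mult_right_mono) auto
    finally show ?thesis by (simp add: \<phi>_def)
   qed
   then have "\<forall>\<^sub>F n in sequentially. \<phi> n x = 0" unfolding eventually_sequentially by blast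
   then show ?thesis using False by (simp add: tendsto_eventually)
  qed
  have conv: "(\<lambda>n. \<integral>x. q x * \<phi> n x \<partial>lborel) \<longlonglongrightarrow> (LBINT x. q x * indicator K x)" if q: "integrable lborel q" for q
  proof (rule integral_dominated_convergence[where w="\<lambda>x. \<bar>q x\<bar>"])
   show "AE x in lborel. (\<lambda>n. q x * \<phi> n x) \<longlonglongrightarrow> q x * indicator K x"
    by (intro AE_I2 tendsto_mult_left lim)
   show "AE x in lborel. norm (q x * \<phi> n x) \<le> \<bar>q x\<bar>" for n
    using \<phi>b mult_left_le[of "\<phi> n _" "\<bar>q _\<bar>"] by (intro AE_I2) (simp add: abs_mult)
  qed (use q in auto)
  have "(LBINT x. f x * indicator K x) \<le> (LBINT x. h x * indicator K x)"
   by (rule LIMSEQ_le[OF conv[OF f] conv[OF h]]) (use le[OF bc] \<phi>b in auto)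
  moreover have iK: "integrable lborel (\<lambda>x. q x * indicator K x)" if q: "integrable lborel q" for q :: "vec3 \<Rightarrow> real"
   by (rule integrable_dominated[where w="\<lambda>x. \<bar>q x\<bar>"]) (use q in \<open>auto simp: indicator_def\<close>)
  ultimately have "(LBINT x. (f x - h x) * indicator K x) \<le> 0"
   using iK[OF f] iK[OF h] by (simp add: left_diff_distrib)
  moreover have nn: "0 \<le> (f x - h x) * indicator K x" for x
   using K(2) by (auto simp: indicator_def A_def)
  ultimately have "(LBINT x. (f x - h x) * indicator K x) = 0"
   by (intro antisym Bochner_Integration.integral_nonneg) auto
  moreover have "integrable lborel (\<lambda>x. (f x - h x) * indicator K x)"
   using iK[of "\<lambda>x. f x - h x"] f h by auto
  ultimately have "AE x in lborel. (f x - h x) * indicator K x = 0"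
   using integral_nonneg_eq_0_iff_AE[of lborel "\<lambda>x. (f x - h x) * indicator K x"] nn by auto
  then have "AE x in lborel. x \<notin> K"
   using K(2) by (auto simp: A_def indicator_def elim!: eventually_mono)
  then show ?thesis by (subst (asm) AE_iff_measurable[of K]) auto
 qed simp
 have "emeasure lborel (A \<inter> cball 0 (real n)) = 0" for n
 proof (rule ccontr)
  assume nz: "emeasure lborel (A \<inter> cball 0 (real n)) \<noteq> 0"
  have fin: "emeasure lborel (A \<inter> cball 0 (real n)) < \<infinity>"
   by (rule le_less_trans[OF emeasure_mono emeasure_compact_finite[OF compact_cball[of "0::vec3" "real n"]]]) auto
  then obtain r where r: "emeasure lborel (A \<inter> cball 0 (real n)) = ennreal r" "r > 0"
  proof -
   obtain r where "emeasure lborel (A \<inter> cball 0 (real n)) = ennreal r" "0 \<le> r"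
    using fin by (cases "emeasure lborel (A \<inter> cball 0 (real n))") auto
   then show ?thesis using that nz by (cases "r = 0") auto
  qed
  obtain K where K: "compact K" "K \<subseteq> A \<inter> cball 0 (real n)" "emeasure lborel (A \<inter> cball 0 (real n) - K) < ennreal r"
   using finite_measure_inner_compact[OF _ fin r(2)] by auto
  have "emeasure lborel (A \<inter> cball 0 (real n)) \<le> emeasure lborel (A \<inter> cball 0 (real n) - K) + emeasure lborel K"
   using K by (intro order_trans[OF emeasure_mono emeasure_subadditive]) (auto simp: borel_compact)
  then show False using K null[of K] r by auto
 qed
 then have "emeasure lborel (\<Union>n. A \<inter> cball 0 (real n)) = 0"
  by (intro emeasure_UN_eq_0) auto
 moreover have "(\<Union>n. A \<inter> cball 0 (real n)) = A"
  using real_arch_simple by auto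
 ultimately have "emeasure lborel A = 0" by simp
 moreover have "{x \<in> space lborel. \<not> f x \<le> h x} = A" by (auto simp: A_def)
 ultimately show ?thesis by (intro AE_I[of _ _ A]) simp_all
qed

text \<open>Draw the index together with the velocity: on pairs \<open>(k, v)\<close> with density
  \<open>p k * g k v\<close> the field \<open>s k v\<close> acts as a score, and forgetting
  \<open>k\<close> is a push-forward, so convexity comes from \<open>score_pushforward\<close>. A
  mixture with a single term transfers a score to a density that is equal almost everywhere.\<close>

lemma score_mixture:
 fixes g :: "nat \<Rightarrow> vec3 \<Rightarrow> real" and p J :: "nat \<Rightarrow> real"
 assumes gs: "\<And>k. has_score (g k) (s k)" and p: "\<And>k. 0 \<le> p k"
  and J: "\<And>k. (LBINT v. g k v * (norm (s k v))\<^sup>2) \<le> J k"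
  and sJ: "summable (\<lambda>k. p k * J k)" and sm: "summable (\<lambda>k. p k * (LBINT v. g k v))"
  and [measurable]: "G \<in> borel_measurable borel" and G0: "\<And>v. 0 \<le> G v"
  and G: "AE v in lborel. (\<lambda>k. p k * g k v) sums G v"
 shows "\<exists>S. has_score G S \<and> (LBINT v. G v * (norm (S v))\<^sup>2) \<le> (\<Sum>k. p k * J k)"
proof -
 have gm[measurable]: "g k \<in> borel_measurable borel" and sm'[measurable]: "s k \<in> borel_measurable borel"
  and g0: "0 \<le> g k v" and gi: "integrable lborel (g k)"
  and s2: "integrable lborel (\<lambda>v. g k v * (norm (s k v))\<^sup>2)" for k v
  using gs[of k] by (auto simp: has_score_def)
 let ?C = "count_space (UNIV :: nat set) \<Otimes>\<^sub>M (lborel :: vec3 measure)"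
 interpret C: sigma_finite_measure "count_space (UNIV :: nat set)"
  by (rule sigma_finite_measure_count_space)
 interpret P: pair_sigma_finite "count_space (UNIV :: nat set)" "lborel :: vec3 measure" ..
 have pm: "(\<lambda>(k, v). f k v) \<in> borel_measurable ?C" if "\<And>k. f k \<in> borel_measurable borel" for f :: "nat \<Rightarrow> vec3 \<Rightarrow> 'z::topological_space"
  by (rule measurable_pair_measure_countable1) (use that in auto)
 define q where "q = (\<lambda>(k, v). p k * g k v)"
 have q[measurable]: "q \<in> borel_measurable ?C" unfolding q_def by (rule pm) measurable
 have q0: "0 \<le> q x" for x using p g0 by (auto simp: q_def split: prod.split)
 let ?M = "density ?C (\<lambda>x. ennreal (q x))"
 let ?\<Theta> = "\<lambda>(k, v). s k v"
 have \<Theta>[measurable]: "?\<Theta> \<in> borel_measurable ?C" by (rule pm) measurable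
 have nnC: "(\<integral>\<^sup>+x. ennreal (q x) * F x \<partial>?C) = (\<Sum>k. ennreal (p k) * (\<integral>\<^sup>+v. ennreal (g k v) * F (k, v) \<partial>lborel))"
  if F[measurable]: "F \<in> borel_measurable ?C" for F
 proof -
  have "(\<integral>\<^sup>+x. ennreal (q x) * F x \<partial>?C) = (\<integral>\<^sup>+k. \<integral>\<^sup>+v. ennreal (q (k, v)) * F (k, v) \<partial>lborel \<partial>count_space UNIV)"
   by (rule lborel.nn_integral_fst[symmetric]) measurable
  also have "\<dots> = (\<Sum>k. \<integral>\<^sup>+v. ennreal (q (k, v)) * F (k, v) \<partial>lborel)"
   by (rule nn_integral_count_space_nat)
  also have "\<dots> = (\<Sum>k. ennreal (p k) * (\<integral>\<^sup>+v. ennreal (g k v) * F (k, v) \<partial>lborel))"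
  proof (rule suminf_cong)
   fix k
   have [measurable]: "(\<lambda>v. F (k, v)) \<in> borel_measurable borel"
    using measurable_compose[OF measurable_Pair1'[of k "count_space UNIV" lborel] F] by simp
   have "(\<integral>\<^sup>+v. ennreal (q (k, v)) * F (k, v) \<partial>lborel) = (\<integral>\<^sup>+v. ennreal (p k) * (ennreal (g k v) * F (k, v)) \<partial>lborel)"
    using p by (simp add: q_def ennreal_mult' mult.assoc)
   also have "\<dots> = ennreal (p k) * (\<integral>\<^sup>+v. ennreal (g k v) * F (k, v) \<partial>lborel)"
    by (rule nn_integral_cmult) measurable
   finally show "(\<integral>\<^sup>+v. ennreal (q (k, v)) * F (k, v) \<partial>lborel) = ennreal (p k) * (\<integral>\<^sup>+v. ennreal (g k v) * F (k, v) \<partial>lborel)" .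
  qed
  finally show ?thesis .
 qed
 have J0: "0 \<le> J k" for k
  using J[of k] by (rule order_trans[rotated]) (rule Bochner_Integration.integral_nonneg, simp add: g0)
 have mass: "(\<integral>\<^sup>+x. ennreal (q x) \<partial>?C) < \<infinity>"
 proof -
  have "(\<integral>\<^sup>+x. ennreal (q x) \<partial>?C) = (\<Sum>k. ennreal (p k * (LBINT v. g k v)))"
   using nnC[of "\<lambda>_. 1"] p g0 gi by (simp add: nn_integral_eq_integral ennreal_mult')
  also have "\<dots> = ennreal (\<Sum>k. p k * (LBINT v. g k v))"
   using p g0 sm by (intro suminf_ennreal2) (auto intro!: mult_nonneg_nonneg Bochner_Integration.integral_nonneg)
  finally show ?thesis by simp
 qed
 have energy: "(\<integral>\<^sup>+x. ennreal (q x) * ennreal ((norm (?\<Theta> x))\<^sup>2) \<partial>?C) \<le> ennreal (\<Sum>k. p k * J k)"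
 proof -
  have "(\<integral>\<^sup>+x. ennreal (q x) * ennreal ((norm (?\<Theta> x))\<^sup>2) \<partial>?C) = (\<Sum>k. ennreal (p k) * (\<integral>\<^sup>+v. ennreal (g k v) * ennreal ((norm (s k v))\<^sup>2) \<partial>lborel))"
   using nnC[of "\<lambda>x. ennreal ((norm (?\<Theta> x))\<^sup>2)"] by simp
  also have "\<dots> = (\<Sum>k. ennreal (p k * (LBINT v. g k v * (norm (s k v))\<^sup>2)))"
  proof (rule suminf_cong)
   fix k
   have "(\<integral>\<^sup>+v. ennreal (g k v) * ennreal ((norm (s k v))\<^sup>2) \<partial>lborel) = (\<integral>\<^sup>+v. ennreal (g k v * (norm (s k v))\<^sup>2) \<partial>lborel)"
    using g0 by (simp add: ennreal_mult')
   also have "\<dots> = ennreal (LBINT v. g k v * (norm (s k v))\<^sup>2)"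
    using g0 s2 by (intro nn_integral_eq_integral) auto
   finally show "ennreal (p k) * (\<integral>\<^sup>+v. ennreal (g k v) * ennreal ((norm (s k v))\<^sup>2) \<partial>lborel) = ennreal (p k * (LBINT v. g k v * (norm (s k v))\<^sup>2))"
    using p by (simp add: ennreal_mult')
  qed
  also have "\<dots> \<le> (\<Sum>k. ennreal (p k * J k))"
   using J p by (intro suminf_le ennreal_leI mult_left_mono) auto
  also have "\<dots> = ennreal (\<Sum>k. p k * J k)"
   using p J0 sJ by (intro suminf_ennreal2) auto
  finally show ?thesis .
 qed
 have M: "finite_measure ?M"
  using mass by (intro finite_measureI) (simp add: emeasure_density less_top)
 have MX: "snd \<in> measurable ?M borel" by simp
 have distr: "distr ?M borel snd = density lborel (\<lambda>v. ennreal (G v))"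
 proof (rule measure_eqI)
  fix A assume "A \<in> sets (distr ?M borel snd)"
  then have A[measurable]: "A \<in> sets borel" by simp
  have "emeasure (distr ?M borel snd) A = (\<integral>\<^sup>+x. indicator A (snd x) \<partial>?M)"
   by (subst nn_integral_distr[symmetric, OF MX]) auto
  also have "\<dots> = (\<integral>\<^sup>+x. ennreal (q x) * indicator A (snd x) \<partial>?C)"
   by (rule nn_integral_density) measurable
  also have "\<dots> = (\<integral>\<^sup>+v. \<integral>\<^sup>+k. ennreal (q (k, v)) * indicator A v \<partial>count_space UNIV \<partial>lborel)"
   by (subst P.nn_integral_snd[symmetric]) (simp_all)
  also have "\<dots> = (\<integral>\<^sup>+v. ennreal (G v) * indicator A v \<partial>lborel)"
  proof (rule nn_integral_cong_AE)
   show "AE v in lborel. (\<integral>\<^sup>+k. ennreal (q (k, v)) * indicator A v \<partial>count_space UNIV) = ennreal (G v) * indicator A v"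
    using G
   proof eventually_elim
    case (elim v)
    have "(\<integral>\<^sup>+k. ennreal (q (k, v)) * indicator A v \<partial>count_space UNIV) = (\<Sum>k. ennreal (p k * g k v)) * indicator A v"
     by (simp add: nn_integral_count_space_nat q_def)
    also have "(\<Sum>k. ennreal (p k * g k v)) = ennreal (G v)"
     unfolding sums_unique[OF elim]
     by (rule suminf_ennreal2[OF _ sums_summable[OF elim]]) (intro mult_nonneg_nonneg p g0)
    finally show ?case .
   qed
  qed
  also have "\<dots> = emeasure (density lborel (\<lambda>v. ennreal (G v))) A"
   by (simp add: emeasure_density)
  finally show "emeasure (distr ?M borel snd) A = emeasure (density lborel (\<lambda>v. ennreal (G v))) A" .
 qed simp
 have Gi: "integrable lborel G"
 proof (rule integrableI_nonneg)
  have "(\<integral>\<^sup>+v. ennreal (G v) \<partial>lborel) = emeasure (distr ?M borel snd) UNIV"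
   unfolding distr by (simp add: emeasure_density)
  also have "\<dots> = (\<integral>\<^sup>+x. ennreal (q x) \<partial>?C)"
  proof -
   have "snd -` UNIV \<inter> space ?M = space ?C" by simp
   then have "emeasure (distr ?M borel snd) UNIV = emeasure ?M (space ?C)"
    using emeasure_distr[OF MX, of UNIV] by simp
   also have "\<dots> = (\<integral>\<^sup>+x. ennreal (q x) * indicator (space ?C) x \<partial>?C)"
    by (rule emeasure_density) auto
   finally show ?thesis by (simp cong: nn_integral_cong)
  qed
  finally show "(\<integral>\<^sup>+v. ennreal (G v) \<partial>lborel) < \<infinity>" using mass by simp
 qed (use G0 in auto)
 have E2: "(\<integral>\<^sup>+x. ennreal ((norm (?\<Theta> x))\<^sup>2) \<partial>?M) \<le> ennreal (\<Sum>k. p k * J k)"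
  using energy by (subst nn_integral_density) auto
 have \<Theta>2: "integrable ?M (\<lambda>x. (norm (?\<Theta> x))\<^sup>2)"
  using E2 by (intro integrableI_nonneg) (auto simp: le_less_trans[OF _ ennreal_less_top])
 have sJ0: "0 \<le> (\<Sum>k. p k * J k)"
  by (intro suminf_nonneg sJ mult_nonneg_nonneg p J0)
 have "(\<integral>x. (norm (?\<Theta> x))\<^sup>2 \<partial>?M) \<le> (\<Sum>k. p k * J k)"
  using E2 nn_integral_eq_integral[OF \<Theta>2] sJ0 by (simp add: ennreal_le_iff)
 moreover have "\<exists>S. has_score G S \<and> (LBINT v. G v * (norm (S v))\<^sup>2) \<le> (\<integral>x. (norm (?\<Theta> x))\<^sup>2 \<partial>?M)"
 proof (rule score_pushforward[OF M MX _ \<Theta>2 Gi G0 distr])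
  show "?\<Theta> \<in> borel_measurable ?M" by simp
  fix \<psi> i assume \<psi>: "test_fun \<psi>"
  note [measurable] = test_fun_measurable[OF \<psi>] test_fun_measurable[OF test_fun_partial[OF \<psi>]]
  obtain K where K: "\<And>x. \<bar>\<psi> x\<bar> \<le> K" using test_fun_bounded[OF \<psi>] by blast
  obtain K' where K': "\<And>x. \<bar>partial i \<psi> x\<bar> \<le> K'" using test_fun_bounded[OF test_fun_partial[OF \<psi>, of i]] by blast
  have K0: "0 \<le> K" using K[of 0] by linarith
  interpret M: finite_measure ?M by (rule M)
  have \<Theta>i[measurable]: "(\<lambda>x. ?\<Theta> x $ i) \<in> borel_measurable ?C"
   by (rule borel_measurable_vec_nth_comp) measurable
  have i1: "integrable ?M (\<lambda>x. partial i \<psi> (snd x))"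
   by (rule integrable_dominated[where w="\<lambda>_. K'"]) (use K' in auto)
  have i2: "integrable ?M (\<lambda>x. ?\<Theta> x $ i * \<psi> (snd x))"
  proof (rule integrable_dominated[where w="\<lambda>x. (1 + (norm (?\<Theta> x))\<^sup>2) * K"])
   show "integrable ?M (\<lambda>x. (1 + (norm (?\<Theta> x))\<^sup>2) * K)"
    using \<Theta>2 by (intro integrable_mult_left Bochner_Integration.integrable_add) auto
   show "\<bar>?\<Theta> x $ i * \<psi> (snd x)\<bar> \<le> (1 + (norm (?\<Theta> x))\<^sup>2) * K" for x
    unfolding abs_mult
    using component_le_norm_cart[of "?\<Theta> x" i] sum_squares_bound[of "norm (?\<Theta> x)" 1] norm_ge_zero[of "?\<Theta> x"] K0
    unfolding power_one mult_1_right by (intro mult_mono K) (linarith | simp)+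
  qed measurable
  have j1: "integrable ?C (\<lambda>x. q x * partial i \<psi> (snd x))"
   using i1 q0 by (subst (asm) integrable_density) auto
  have j2: "integrable ?C (\<lambda>x. q x * (?\<Theta> x $ i * \<psi> (snd x)))"
   using i2 q0 by (subst (asm) integrable_density) auto
  have "(\<integral>x. partial i \<psi> (snd x) \<partial>?M) = (\<integral>x. q x * partial i \<psi> (snd x) \<partial>?C)"
   using q0 by (subst integral_density) auto
  also have "\<dots> = (\<integral>k. \<integral>v. q (k, v) * partial i \<psi> v \<partial>lborel \<partial>count_space UNIV)"
   using P.integral_fst'[OF j1] by simp
  also have "\<dots> = (\<integral>k. - (LBINT v. q (k, v) * (s k v $ i * \<psi> v)) \<partial>count_space UNIV)"
  proof (rule Bochner_Integration.integral_cong[OF refl])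
   fix k
   have "(LBINT v. g k v * partial i \<psi> v) = - (LBINT v. g k v * s k v $ i * \<psi> v)"
    using gs[of k] \<psi> by (simp add: has_score_def)
   then show "(LBINT v. q (k, v) * partial i \<psi> v) = - (LBINT v. q (k, v) * (s k v $ i * \<psi> v))"
    by (simp add: q_def mult.assoc)
  qed
  also have "\<dots> = - (\<integral>x. q x * (?\<Theta> x $ i * \<psi> (snd x)) \<partial>?C)"
   using P.integral_fst'[OF j2] by simp
  also have "\<dots> = - (\<integral>x. ?\<Theta> x $ i * \<psi> (snd x) \<partial>?M)"
   using q0 by (subst integral_density) auto
  finally show "(\<integral>x. partial i \<psi> (snd x) \<partial>?M) = - (\<integral>x. ?\<Theta> x $ i * \<psi> (snd x) \<partial>?M)" .
 qed
 ultimately show ?thesis by (meson order_trans)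
qed

section \<open>Linear changes of variables and integration over the sphere\<close>

lemma lborel_linear_bij:
 fixes f g :: "vec3 \<Rightarrow> vec3"
 assumes f: "linear f" and g: "linear g" and fg: "\<And>x. f (g x) = x" and gf: "\<And>x. g (f x) = x"
  and h[measurable]: "h \<in> borel_measurable borel"
 shows "(\<integral>\<^sup>+x. h (f x) \<partial>lborel) = ennreal \<bar>det (matrix g)\<bar> * (\<integral>\<^sup>+x. h x \<partial>lborel)"
proof -
 let ?c = "\<bar>det (matrix g)\<bar>"
 have "det (matrix f) * det (matrix g) = det (matrix (f \<circ> g))"
  using f g by (simp add: matrix_compose det_mul)
 also have "f \<circ> g = id" using fg by auto
 finally have "det (matrix f) * det (matrix g) = 1" by (simp only: matrix_id det_I)
 then have c: "?c > 0" by auto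
 have fm[measurable]: "f \<in> borel_measurable borel"
  using f by (intro borel_measurable_continuous_onI linear_continuous_on linear_conv_bounded_linear[THEN iffD1])
 have "lborel = density (distr lborel borel f) (\<lambda>_. ennreal (1 / ?c))"
 proof (rule lborel_eqI)
  fix l u :: vec3 assume lu: "\<And>b. b \<in> Basis \<Longrightarrow> l \<bullet> b \<le> u \<bullet> b"
  have im: "f -` box l u = g ` box l u"
   using fg gf by (auto simp: image_iff) metis
  have lm: "box l u \<in> lmeasurable" by simp
  have "emeasure (density (distr lborel borel f) (\<lambda>_. ennreal (1 / ?c))) (box l u)
   = ennreal (1 / ?c) * emeasure lborel (f -` box l u)"
   by (simp add: emeasure_density nn_integral_cmult emeasure_distr)
  also have "emeasure lborel (f -` box l u) = emeasure lebesgue (g ` box l u)"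
   unfolding im[symmetric] using measurable_sets[OF fm, of "box l u"] by simp
  also have "\<dots> = ennreal (?c * measure lebesgue (box l u))"
   using measurable_linear_image[OF g lm] measure_linear_image[OF g lm]
   by (simp add: emeasure_eq_measure2)
  also have "measure lebesgue (box l u) = (\<Prod>b\<in>Basis. (u - l) \<bullet> b)"
   using lu by (simp add: measure_lborel_box_eq)
  finally show "emeasure (density (distr lborel borel f) (\<lambda>_. ennreal (1 / ?c))) (box l u) = (\<Prod>b\<in>Basis. (u - l) \<bullet> b)"
   using c by (simp add: ennreal_mult'[symmetric])
 qed simp
 then have "(\<integral>\<^sup>+x. h x \<partial>lborel) = (\<integral>\<^sup>+x. h x \<partial>density (distr lborel borel f) (\<lambda>_. ennreal (1 / ?c)))"
  by simp
 also have "\<dots> = ennreal (1 / ?c) * (\<integral>\<^sup>+x. h (f x) \<partial>lborel)"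
  by (simp add: nn_integral_density nn_integral_distr nn_integral_cmult)
 finally have "ennreal ?c * (\<integral>\<^sup>+x. h x \<partial>lborel) = (ennreal ?c * ennreal (1 / ?c)) * (\<integral>\<^sup>+x. h (f x) \<partial>lborel)"
  by (simp add: mult.assoc)
 also have "ennreal ?c * ennreal (1 / ?c) = 1" using c by (simp add: ennreal_mult'[symmetric])
 finally show ?thesis by simp
qed

lemma sets_S2[measurable_cong, simp]: "sets S2 = sets borel"
 by (simp add: S2_def)

lemma space_S2[simp]: "space S2 = UNIV"
 by (simp add: S2_def)

lemma nn_integral_S2:
 assumes h[measurable]: "h \<in> borel_measurable borel"
 shows "(\<integral>\<^sup>+n. h n \<partial>S2) = (\<integral>\<^sup>+x. 3 * (indicator (ball 0 1) x * h (x /\<^sub>R norm x)) \<partial>lborel)"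
proof -
 have [measurable]: "ball 0 1 \<in> sets (borel :: vec3 measure)" by simp
 have "(\<integral>\<^sup>+n. h n \<partial>S2) = (\<integral>\<^sup>+x. h (x /\<^sub>R norm x) \<partial>density lborel (\<lambda>x. ennreal (3 * indicator (ball 0 1) x)))"
  unfolding S2_def by (subst nn_integral_distr) auto
 also have "\<dots> = (\<integral>\<^sup>+x. ennreal (3 * indicator (ball 0 1) x) * h (x /\<^sub>R norm x) \<partial>lborel)"
  by (subst nn_integral_density) auto
 also have "\<dots> = (\<integral>\<^sup>+x. 3 * (indicator (ball 0 1) x * h (x /\<^sub>R norm x)) \<partial>lborel)"
  by (intro nn_integral_cong) (auto simp: indicator_def)
 finally show ?thesis .
qed

text \<open>\<open>S2\<close> is a measure on the whole space. Only the origin, a null set of the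
  ball, is not sent to a unit vector by the normalisation.\<close>

lemma AE_S2_norm: "AE n in S2. norm n = 1"
proof -
 have m: "{n :: vec3. norm n \<noteq> 1} \<in> sets borel" by measurable
 have "emeasure S2 {n :: vec3. norm n \<noteq> 1} = (\<integral>\<^sup>+n. indicator {n :: vec3. norm n \<noteq> 1} n \<partial>S2)"
  using m by simp
 also have "\<dots> = (\<integral>\<^sup>+x. 3 * (indicator (ball 0 1) x * indicator {n :: vec3. norm n \<noteq> 1} (x /\<^sub>R norm x)) \<partial>lborel)"
  using nn_integral_S2[of "indicator {n :: vec3. norm n \<noteq> 1}"] m by simp
 also have "\<dots> = (\<integral>\<^sup>+x. 0 \<partial>(lborel :: vec3 measure))"
 proof (rule nn_integral_cong_AE)
  have "AE x in lborel. x \<noteq> (0 :: vec3)" by (rule AE_lborel_singleton)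
  then show "AE x in lborel. 3 * (indicator (ball 0 1) x * indicator {n :: vec3. norm n \<noteq> 1} (x /\<^sub>R norm x)) = (0 :: ennreal)"
   by eventually_elim simp
 qed
 finally show ?thesis using m by (intro AE_I[of _ _ "{n :: vec3. norm n \<noteq> 1}"]) auto
qed

lemma emeasure_S2: "emeasure S2 UNIV = ennreal (4 * pi)"
proof -
 have "emeasure S2 UNIV = (\<integral>\<^sup>+n. 1 \<partial>S2)" by simp
 also have "\<dots> = (\<integral>\<^sup>+x. 3 * (indicator (ball 0 1) x * 1) \<partial>(lborel :: vec3 measure))"
  by (rule nn_integral_S2) simp
 also have "\<dots> = (\<integral>\<^sup>+x. 3 * indicator (ball 0 1) x \<partial>(lborel :: vec3 measure))"
  by (simp only: mult_1_right)
 also have "\<dots> = 3 * emeasure lborel (ball (0::vec3) 1)"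
  by (rule nn_integral_cmult_indicator) simp
 also have "\<dots> = ennreal (4 * pi)"
  by (subst emeasure_ball) (simp_all add: unit_ball_vol_3 ennreal_mult'[symmetric] flip: ennreal_numeral)
 finally show ?thesis .
qed

lemma finite_measure_S2: "finite_measure S2"
 by (rule finite_measureI) (simp add: emeasure_S2)

lemma nn_integral_S2_orthogonal:
 assumes R: "orthogonal_transformation R" and h[measurable]: "h \<in> borel_measurable borel"
 shows "(\<integral>\<^sup>+n. h (R n) \<partial>S2) = (\<integral>\<^sup>+n. h n \<partial>S2)"
proof -
 have lin: "linear R" and nR: "\<And>x. norm (R x) = norm x"
  using R by (auto simp: orthogonal_transformation)
 have Rm[measurable]: "R \<in> borel_measurable borel"
  using lin by (intro borel_measurable_continuous_onI linear_continuous_on linear_conv_bounded_linear[THEN iffD1])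
 have bij: "bij R" using R by (rule orthogonal_transformation_bij)
 let ?g = "inv R"
 have og: "orthogonal_transformation ?g" using R by (rule orthogonal_transformation_inv)
 let ?F = "\<lambda>x. 3 * (indicator (ball 0 1) x * h (x /\<^sub>R norm x))"
 have "(\<integral>\<^sup>+n. h (R n) \<partial>S2) = (\<integral>\<^sup>+x. 3 * (indicator (ball 0 1) x * h (R (x /\<^sub>R norm x))) \<partial>lborel)"
  by (rule nn_integral_S2) measurable
 also have "\<dots> = (\<integral>\<^sup>+x. ?F (R x) \<partial>lborel)"
  using nR by (intro nn_integral_cong) (simp add: linear_cmul[OF lin] indicator_def)
 also have "\<dots> = ennreal \<bar>det (matrix ?g)\<bar> * (\<integral>\<^sup>+x. ?F x \<partial>lborel)"
  using lin og bij by (intro lborel_linear_bij)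
   (auto simp: orthogonal_transformation_linear bij_def surj_f_inv_f inv_f_f indicator_def)
 also have "\<dots> = (\<integral>\<^sup>+n. h n \<partial>S2)"
  using og by (simp add: nn_integral_S2)
 finally show ?thesis .
qed

text \<open>Cylindrical coordinates with the height first and the plane kept as one vector: Fubini
  separates the two, and the plane part can be scaled as a whole.\<close>

definition cyl :: "real \<times> (real \<times> real) \<Rightarrow> vec3" where
 "cyl p = vector [fst (snd p), snd (snd p), fst p]"

lemma cyl_nth: "cyl p $ 1 = fst (snd p)" "cyl p $ 2 = snd (snd p)" "cyl p $ 3 = fst p"
 by (simp_all add: cyl_def)

lemma norm_cyl: "norm (cyl (t, y)) = sqrt (t\<^sup>2 + (norm y)\<^sup>2)"
proof -
 have "(norm y)\<^sup>2 = fst y * fst y + snd y * snd y"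
  by (subst power2_norm_eq_inner) (simp add: inner_prod_def)
 then show ?thesis
  by (simp add: norm_eq_sqrt_inner[of "cyl _"] inner_vec_def sum_3 cyl_nth power2_eq_square[of t] add_ac)
qed

lemma measurable_cyl[measurable]: "cyl \<in> borel_measurable borel"
proof -
 have "continuous_on UNIV (\<lambda>p. cyl p $ i)" for i
  using exhaust_3[of i] by (elim disjE; simp only: cyl_nth) (intro continuous_intros)+
 then have "continuous_on UNIV cyl" by (subst continuous_on_componentwise) (auto simp: Basis_vec_def inner_axis)
 then show ?thesis by (rule borel_measurable_continuous_onI)
qed

lemma emeasure_lborel_Times:
 fixes A :: "'a::euclidean_space set" and B :: "'b::euclidean_space set"
 assumes "A \<in> sets borel" "B \<in> sets borel"
 shows "emeasure lborel (A \<times> B) = emeasure lborel A * emeasure lborel B"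
 unfolding lborel_prod[symmetric] using assms by (intro lborel.emeasure_pair_measure_Times) auto

lemma prod_UNIV_3: "prod f (UNIV :: 3 set) = f 1 * (f 2 * f 3)"
 unfolding UNIV_3 by simp

lemma lborel_cyl: "lborel = distr lborel borel cyl"
proof (rule lborel_eqI)
 fix l u :: vec3 assume lu: "\<And>b. b \<in> Basis \<Longrightarrow> l \<bullet> b \<le> u \<bullet> b"
 have le: "l $ i \<le> u $ i" for i
  using lu[of "axis i 1"] by (simp add: inner_axis)
 have "cyl -` box l u = box (l $ 3) (u $ 3) \<times> (box (l $ 1) (u $ 1) \<times> box (l $ 2) (u $ 2))"
  by (auto simp: mem_box_cart forall_3 cyl_nth)
 then have "emeasure (distr lborel borel cyl) (box l u) = emeasure lborel (box (l $ 3) (u $ 3) \<times> (box (l $ 1) (u $ 1) \<times> box (l $ 2) (u $ 2)))"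
  by (simp add: emeasure_distr)
 also have "\<dots> = ennreal ((u $ 3 - l $ 3) * ((u $ 1 - l $ 1) * (u $ 2 - l $ 2)))"
  using le by (simp add: emeasure_lborel_Times borel_Times ennreal_mult' box_real)
 also have "\<dots> = (\<Prod>i\<in>UNIV. (u - l) $ i)"
  unfolding prod_UNIV_3 vector_minus_component by (rule arg_cong[where f=ennreal]) algebra
 also have "(\<Prod>i\<in>UNIV. (u - l) $ i) = (\<Prod>b\<in>Basis. (u - l) \<bullet> b)"
 proof -
  have "(Basis :: vec3 set) = (\<lambda>i. axis i 1) ` UNIV" by (auto simp: Basis_vec_def)
  moreover have "inj (\<lambda>i :: 3. axis i (1::real))" by (auto simp: inj_on_def axis_eq_axis)
  ultimately show ?thesis by (subst \<open>Basis = _\<close>, subst prod.reindex) (simp_all add: inner_axis)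
 qed
 finally show "emeasure (distr lborel borel cyl) (box l u) = (\<Prod>b\<in>Basis. (u - l) \<bullet> b)" .
qed simp


lemma nn_integral_lborel_scale:
 fixes f :: "'a::euclidean_space \<Rightarrow> ennreal"
 assumes "0 < c" and [measurable]: "f \<in> borel_measurable borel"
 shows "(\<integral>\<^sup>+y. f y \<partial>lborel) = ennreal (c ^ DIM('a)) * (\<integral>\<^sup>+y. f (c *\<^sub>R y) \<partial>lborel)"
proof -
 let ?D = "density (distr lborel borel (\<lambda>y. 0 + c *\<^sub>R y)) (\<lambda>_. \<bar>c\<bar> ^ DIM('a))"
 have "(\<integral>\<^sup>+y. f y \<partial>lborel) = (\<integral>\<^sup>+y. f y \<partial>?D)"
  using assms(1) by (subst lborel_affine[of c 0]) simp_all
 also have "\<dots> = ennreal (c ^ DIM('a)) * (\<integral>\<^sup>+y. f (c *\<^sub>R y) \<partial>lborel)"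
  using assms(1) by (simp add: nn_integral_density nn_integral_distr nn_integral_cmult)
 finally show ?thesis .
qed

text \<open>With \<open>t\<close> the slope of a vector against the plane,
  \<open>t / sqrt (1 + t\<^sup>2)\<close> is the cosine of its angle with the axis. The substitution
  rule is for compact intervals, so the line is exhausted by the intervals from \<open>- N\<close>
  to \<open>N\<close>.\<close>

lemma nn_integral_stereo:
 fixes h :: "real \<Rightarrow> real"
 assumes h[measurable]: "h \<in> borel_measurable borel"
 shows "(\<integral>\<^sup>+t. ennreal (h (t / sqrt (1 + t\<^sup>2)) * (1 / (sqrt (1 + t\<^sup>2))^3)) \<partial>lborel)
  = (\<integral>\<^sup>+c. ennreal (h c) * indicator {-1<..<1} c \<partial>lborel)"
proof -
 define w where "w t = t / sqrt (1 + t\<^sup>2)" for t :: real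
 define w' where "w' t = 1 / (sqrt (1 + t\<^sup>2))^3" for t :: real
 have pos: "1 + t\<^sup>2 > 0" for t :: real by (simp add: add_pos_nonneg)
 have pos': "sqrt (1 + t\<^sup>2) > 0" for t :: real using pos by simp
 have [measurable]: "w \<in> borel_measurable borel" "w' \<in> borel_measurable borel"
  unfolding w_def w'_def by measurable
 have dw: "(w has_real_derivative w' t) (at t)" for t
 proof -
  have "(w has_real_derivative (1 * sqrt (1 + t\<^sup>2) - t * (inverse (sqrt (1 + t\<^sup>2)) / 2 * (2 * t))) / (sqrt (1 + t\<^sup>2) * sqrt (1 + t\<^sup>2))) (at t)"
   unfolding w_def[abs_def] using pos[of t] by (auto intro!: derivative_eq_intros)
  moreover have "(1 * sqrt (1 + t\<^sup>2) - t * (inverse (sqrt (1 + t\<^sup>2)) / 2 * (2 * t))) / (sqrt (1 + t\<^sup>2) * sqrt (1 + t\<^sup>2)) = w' t"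
  proof -
   let ?r = "sqrt (1 + t\<^sup>2)"
   have r2: "?r * ?r = 1 + t\<^sup>2" using pos[of t] by simp
   have "1 * ?r - t * (inverse ?r / 2 * (2 * t)) = (?r * ?r - t\<^sup>2) / ?r"
    using pos'[of t] by (simp add: field_simps power2_eq_square)
   also have "\<dots> = 1 / ?r" unfolding r2 by simp
   finally show ?thesis by (simp add: w'_def power3_eq_cube)
  qed
  ultimately show ?thesis by simp
 qed
 have w'0: "0 \<le> w' t" for t unfolding w'_def using pos'[of t] by simp
 have w'c: "continuous_on A w'" for A
  unfolding w'_def using pos' less_imp_neq[OF pos'] by (intro continuous_intros) (auto simp: add_nonneg_eq_0_iff)
 have wmono: "w s \<le> w t" if "s \<le> t" for s t
  using that dw w'0 by (intro DERIV_nonneg_imp_nondecreasing[of s t w]) blast+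
 have w1: "\<bar>w t\<bar> < 1" for t
 proof -
  have "\<bar>t\<bar> = sqrt (t\<^sup>2)" by simp
  also have "\<dots> < sqrt (1 + t\<^sup>2)" by (intro real_sqrt_less_mono) simp
  finally show ?thesis using pos'[of t] by (simp add: w_def)
 qed
 have surj: "\<exists>t. w t = c" if "\<bar>c\<bar> < 1" for c
 proof -
  have c1: "1 - c\<^sup>2 > 0" using that by (simp add: abs_square_less_1)
  define t where "t = c / sqrt (1 - c\<^sup>2)"
  have "1 + t\<^sup>2 = 1 / (1 - c\<^sup>2)" using c1 by (simp add: t_def power_divide field_simps)
  then have "w t = c" using c1 by (simp add: w_def t_def real_sqrt_divide)
  then show ?thesis ..
 qed
 have fin: "(\<integral>\<^sup>+c. ennreal (h c) * indicator {w (- real N)..w (real N)} c \<partial>lborel) = (\<integral>\<^sup>+t. ennreal (h (w t) * w' t) * indicator {- real N..real N} t \<partial>lborel)" for N :: nat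
 proof -
  have "(\<integral>\<^sup>+c. ennreal (h c * indicator {w (- real N)..w (real N)} c) \<partial>lborel) = (\<integral>\<^sup>+t. ennreal (h (w t) * w' t * indicator {- real N..real N} t) \<partial>lborel)"
   by (rule nn_integral_substitution) (use dw w'c w'0 in \<open>auto simp: set_borel_measurable_def\<close>)
  then show ?thesis by (simp add: ennreal_mult'' indicator_def of_bool_def if_distrib cong: if_cong)
 qed
 have "(\<integral>\<^sup>+t. ennreal (h (w t) * w' t) \<partial>lborel) = (\<integral>\<^sup>+t. (SUP N. ennreal (h (w t) * w' t) * indicator {- real N..real N} t) \<partial>lborel)"
 proof (rule nn_integral_cong)
  fix t :: real
  obtain N :: nat where N: "\<bar>t\<bar> \<le> real N" using real_arch_simple by blast
  show "ennreal (h (w t) * w' t) = (SUP N. ennreal (h (w t) * w' t) * indicator {- real N..real N} t)"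
   using N by (intro antisym SUP_upper2[of N] SUP_least) (auto simp: indicator_def)
 qed
 also have "\<dots> = (SUP N. \<integral>\<^sup>+t. ennreal (h (w t) * w' t) * indicator {- real N..real N} t \<partial>lborel)"
  by (rule nn_integral_monotone_convergence_SUP) (auto simp: incseq_def le_fun_def indicator_def)
 also have "\<dots> = (SUP N. \<integral>\<^sup>+c. ennreal (h c) * indicator {w (- real N)..w (real N)} c \<partial>lborel)"
  by (simp only: fin)
 also have "\<dots> = (\<integral>\<^sup>+c. (SUP N. ennreal (h c) * indicator {w (- real N)..w (real N)} c) \<partial>lborel)"
 proof (rule nn_integral_monotone_convergence_SUP[symmetric])
  show "incseq (\<lambda>N c. ennreal (h c) * indicator {w (- real N)..w (real N)} c)"
  proof (intro incseq_SucI le_funI mult_left_mono)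
   fix N :: nat and c
   show "indicator {w (- real N)..w (real N)} c \<le> (indicator {w (- real (Suc N))..w (real (Suc N))} c :: ennreal)"
    using wmono[of "- real (Suc N)" "- real N"] wmono[of "real N" "real (Suc N)"] by (auto simp: indicator_def)
  qed simp
 qed measurable
 also have "\<dots> = (\<integral>\<^sup>+c. ennreal (h c) * indicator {-1<..<1} c \<partial>lborel)"
 proof (rule nn_integral_cong)
  fix c :: real
  show "(SUP N. ennreal (h c) * indicator {w (- real N)..w (real N)} c) = ennreal (h c) * indicator {-1<..<1} c"
  proof (cases "\<bar>c\<bar> < 1")
   case True
   then obtain t where t: "w t = c" using surj by blast
   obtain N :: nat where N: "\<bar>t\<bar> \<le> real N" using real_arch_simple by blast
   have "c \<in> {w (- real N)..w (real N)}" using wmono[of "- real N" t] wmono[of t "real N"] N t by auto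
   then show ?thesis using True
    by (intro antisym SUP_upper2[of N] SUP_least) (auto simp: indicator_def)
  next
   case False
   then have "c \<notin> {w (- real N)..w (real N)}" for N
    using w1[of "- real N"] w1[of "real N"] by auto
   then have "indicator {w (- real N)..w (real N)} c = (0 :: ennreal)" for N by (rule indicator_simps(2))
   moreover have "indicator {-1<..<1} c = (0 :: ennreal)"
    by (rule indicator_simps(2)) (use False in auto)
   ultimately show ?thesis by (simp only: mult_zero_right SUP_const UNIV_not_empty not_False_eq_True)
  qed
 qed
 finally show ?thesis by (simp only: w_def w'_def)
qed

text \<open>Integrating out the radial part leaves an unknown constant, which is found from the total mass.\<close>

lemma nn_integral_S2_zonal:
 fixes h :: "real \<Rightarrow> real"
 assumes h[measurable]: "h \<in> borel_measurable borel" and h0: "\<And>c. 0 \<le> h c" and k: "norm k = 1"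
 shows "(\<integral>\<^sup>+n. ennreal (h (n \<bullet> k)) \<partial>S2) = ennreal (2 * pi) * (\<integral>\<^sup>+c. ennreal (h c) * indicator {-1..1} c \<partial>lborel)"
proof -
 let ?J = "\<integral>\<^sup>+y. ennreal (norm y) * indicator (ball 0 1) y \<partial>(lborel :: (real \<times> real) measure)"
 have zonal: "(\<integral>\<^sup>+n. ennreal (h (n $ 3)) \<partial>S2) = 3 * ?J * (\<integral>\<^sup>+c. ennreal (h c) * indicator {-1..1} c \<partial>lborel)"
  if h[measurable]: "h \<in> borel_measurable borel" and h0: "\<And>c. 0 \<le> h c" for h :: "real \<Rightarrow> real"
 proof -
  define F where "F t y = 3 * (indicator {p. t\<^sup>2 + (norm p)\<^sup>2 < 1} y * ennreal (h (t / sqrt (t\<^sup>2 + (norm y)\<^sup>2))))" for t and y :: "real \<times> real"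
  have Fm: "(\<lambda>(t, y). F t y) \<in> borel_measurable (lborel \<Otimes>\<^sub>M lborel)"
   unfolding F_def by measurable
  have [measurable]: "(\<lambda>x :: vec3. x $ 3) \<in> borel_measurable borel"
   by (intro borel_measurable_continuous_onI continuous_intros)
  have [measurable]: "ball 0 1 \<in> sets (borel :: vec3 measure)" by simp
  have Qm: "(\<lambda>x :: vec3. 3 * (indicator (ball 0 1) x * ennreal (h ((x /\<^sub>R norm x) $ 3)))) \<in> borel_measurable borel"
   by measurable
  have "(\<integral>\<^sup>+n. ennreal (h (n $ 3)) \<partial>S2) = (\<integral>\<^sup>+x. 3 * (indicator (ball 0 1) x * ennreal (h ((x /\<^sub>R norm x) $ 3))) \<partial>(lborel :: vec3 measure))"
   by (rule nn_integral_S2) measurable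
  also have "\<dots> = (\<integral>\<^sup>+x. 3 * (indicator (ball 0 1) x * ennreal (h ((x /\<^sub>R norm x) $ 3))) \<partial>distr lborel borel cyl)"
   by (subst lborel_cyl) simp
  also have "\<dots> = (\<integral>\<^sup>+p. 3 * (indicator (ball 0 1) (cyl p) * ennreal (h ((cyl p /\<^sub>R norm (cyl p)) $ 3))) \<partial>lborel)"
   by (rule nn_integral_distr) (use Qm in simp_all)
  also have "\<dots> = (\<integral>\<^sup>+p. (case p of (t, y) \<Rightarrow> F t y) \<partial>(lborel \<Otimes>\<^sub>M lborel))"
   unfolding lborel_prod
  proof (rule nn_integral_cong)
   fix p :: "real \<times> real \<times> real"
   obtain t y where p: "p = (t, y)" by (cases p)
   have "norm (cyl (t, y)) < 1 \<longleftrightarrow> t\<^sup>2 + (norm y)\<^sup>2 < 1" by (simp add: norm_cyl)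
   then show "3 * (indicator (ball 0 1) (cyl p) * ennreal (h ((cyl p /\<^sub>R norm (cyl p)) $ 3))) = (case p of (t, y) \<Rightarrow> F t y)"
    by (simp add: p F_def norm_cyl cyl_nth divide_inverse mult.commute indicator_def)
  qed
  also have "\<dots> = (\<integral>\<^sup>+y. \<integral>\<^sup>+t. F t y \<partial>lborel \<partial>lborel)"
   using lborel_pair.nn_integral_snd[OF Fm] by simp
  \<comment> \<open>Measuring the height in units of \<open>norm y\<close> makes \<open>t\<close>
    the slope. Then the argument of \<open>h\<close> depends on \<open>t\<close> alone, and for
    fixed \<open>t\<close> the vector \<open>y\<close> ranges over a ball of radius
    \<open>1 / sqrt (1 + t\<^sup>2)\<close>.\<close>
  also have "\<dots> = (\<integral>\<^sup>+y. \<integral>\<^sup>+t. ennreal (norm y) * F (norm y * t) y \<partial>lborel \<partial>lborel)"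
  proof (rule nn_integral_cong_AE)
   have "AE y in lborel. y \<noteq> (0 :: real \<times> real)" by (rule AE_lborel_singleton)
   then show "AE y in lborel. (\<integral>\<^sup>+t. F t y \<partial>lborel) = (\<integral>\<^sup>+t. ennreal (norm y) * F (norm y * t) y \<partial>lborel)"
   proof eventually_elim
    case (elim y)
    have [measurable]: "(\<lambda>t. F t y) \<in> borel_measurable borel" unfolding F_def by measurable
    show ?case using nn_integral_real_affine[of "\<lambda>t. F t y" "norm y" 0] elim
     by (simp add: nn_integral_cmult)
   qed
  qed
  also have "\<dots> = (\<integral>\<^sup>+t. \<integral>\<^sup>+y. ennreal (norm y) * F (norm y * t) y \<partial>lborel \<partial>lborel)"
   by (rule lborel_pair.Fubini'[symmetric]) (unfold F_def, measurable)
  also have "\<dots> = (\<integral>\<^sup>+t. 3 * ?J * ennreal (h (t / sqrt (1 + t\<^sup>2)) * (1 / (sqrt (1 + t\<^sup>2))^3)) \<partial>lborel)"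
  proof (rule nn_integral_cong)
   fix t :: real
   let ?r = "sqrt (1 + t\<^sup>2)"
   have rp: "?r > 0" by (simp add: add_pos_nonneg)
   have r2: "?r\<^sup>2 = 1 + t\<^sup>2" by (simp add: add_nonneg_nonneg)
   have [measurable]: "ball 0 (1 / ?r) \<in> sets (borel :: (real \<times> real) measure)" "ball 0 1 \<in> sets (borel :: (real \<times> real) measure)"
    by simp_all
   have Fe: "ennreal (norm y) * F (norm y * t) y = 3 * ennreal (h (t / ?r)) * (ennreal (norm y) * indicator (ball 0 (1 / ?r)) y)" if "y \<noteq> 0" for y
   proof -
    have s: "(norm y * t)\<^sup>2 + (norm y)\<^sup>2 = (norm y * ?r)\<^sup>2" by (simp add: power_mult_distrib r2 distrib_left)
    have "sqrt ((norm y * t)\<^sup>2 + (norm y)\<^sup>2) = norm y * ?r" unfolding s using rp by (simp add: real_sqrt_abs abs_mult)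
    moreover have "(norm y * t)\<^sup>2 + (norm y)\<^sup>2 < 1 \<longleftrightarrow> norm y < 1 / ?r"
     unfolding s using rp by (simp add: power_less_one_iff pos_less_divide_eq abs_square_less_1 abs_mult)
    ultimately show ?thesis using that by (simp add: F_def indicator_def mult_ac)
   qed
   have "(\<integral>\<^sup>+y. ennreal (norm y) * F (norm y * t) y \<partial>lborel) = (\<integral>\<^sup>+y. 3 * ennreal (h (t / ?r)) * (ennreal (norm y) * indicator (ball 0 (1 / ?r)) y) \<partial>(lborel :: (real \<times> real) measure))"
   proof (rule nn_integral_cong_AE)
    have "AE y in lborel. y \<noteq> (0 :: real \<times> real)" by (rule AE_lborel_singleton)
    then show "AE y in lborel. ennreal (norm y) * F (norm y * t) y = 3 * ennreal (h (t / ?r)) * (ennreal (norm y) * indicator (ball 0 (1 / ?r)) y)"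
     by eventually_elim (rule Fe)
   qed
   also have "\<dots> = 3 * ennreal (h (t / ?r)) * (\<integral>\<^sup>+y. ennreal (norm y) * indicator (ball 0 (1 / ?r)) y \<partial>(lborel :: (real \<times> real) measure))"
    by (rule nn_integral_cmult) measurable
   \<comment> \<open>Of the three powers of \<open>1 / ?r\<close>, two come from the dimension of
     the plane and one from the factor \<open>norm y\<close>.\<close>
   also have "(\<integral>\<^sup>+y. ennreal (norm y) * indicator (ball 0 (1 / ?r)) y \<partial>(lborel :: (real \<times> real) measure)) = ennreal (1 / ?r^3) * ?J"
   proof -
    have "(\<integral>\<^sup>+y. ennreal (norm y) * indicator (ball 0 (1 / ?r)) y \<partial>(lborel :: (real \<times> real) measure))
     = ennreal ((1 / ?r)^2) * (\<integral>\<^sup>+y. ennreal (norm ((1 / ?r) *\<^sub>R y)) * indicator (ball 0 (1 / ?r)) ((1 / ?r) *\<^sub>R y) \<partial>(lborel :: (real \<times> real) measure))"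
    proof -
     have D: "DIM(real \<times> real) = 2" by simp
     show ?thesis
      by (rule nn_integral_lborel_scale[where 'a="real \<times> real", unfolded D]) (use rp in simp, measurable)
    qed
    also have "\<dots> = ennreal ((1 / ?r)^2) * (\<integral>\<^sup>+y. ennreal (1 / ?r) * (ennreal (norm y) * indicator (ball 0 1) y) \<partial>(lborel :: (real \<times> real) measure))"
    proof (intro arg_cong[where f="\<lambda>x. ennreal ((1 / ?r)^2) * x"] nn_integral_cong)
     fix y :: "real \<times> real"
     have "norm ((1 / ?r) *\<^sub>R y) = (1 / ?r) * norm y" using rp by simp
     moreover from this have "(1 / ?r) *\<^sub>R y \<in> ball 0 (1 / ?r) \<longleftrightarrow> y \<in> ball 0 1"
      using rp by (simp add: divide_less_cancel)
     ultimately show "ennreal (norm ((1 / ?r) *\<^sub>R y)) * indicator (ball 0 (1 / ?r)) ((1 / ?r) *\<^sub>R y)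
       = ennreal (1 / ?r) * (ennreal (norm y) * indicator (ball 0 1) y)"
      using rp ennreal_mult'[of "1 / ?r" "norm y"] by (auto simp: indicator_def)
    qed
    also have "\<dots> = ennreal ((1 / ?r)^2) * (ennreal (1 / ?r) * ?J)"
     by (subst nn_integral_cmult) auto
    also have "\<dots> = ennreal (1 / ?r^3) * ?J"
     using rp by (simp add: mult.assoc[symmetric] ennreal_mult'[symmetric] power3_eq_cube power2_eq_square)
    finally show ?thesis .
   qed
   finally have *: "(\<integral>\<^sup>+y. ennreal (norm y) * F (norm y * t) y \<partial>lborel) = 3 * ennreal (h (t / ?r)) * (ennreal (1 / ?r^3) * ?J)" .
   show "(\<integral>\<^sup>+y. ennreal (norm y) * F (norm y * t) y \<partial>lborel) = 3 * ?J * ennreal (h (t / ?r) * (1 / ?r^3))"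
   proof -
    have E: "ennreal (h (t / ?r) * (1 / ?r^3)) = ennreal (h (t / ?r)) * ennreal (1 / ?r^3)"
     using h0 rp by (intro ennreal_mult) simp_all
    show ?thesis unfolding E * by (simp only: mult_ac)
   qed
  qed
  also have "\<dots> = 3 * ?J * (\<integral>\<^sup>+t. ennreal (h (t / sqrt (1 + t\<^sup>2)) * (1 / (sqrt (1 + t\<^sup>2))^3)) \<partial>lborel)"
   by (rule nn_integral_cmult) measurable
  also have "\<dots> = 3 * ?J * (\<integral>\<^sup>+c. ennreal (h c) * indicator {-1<..<1} c \<partial>lborel)"
   by (simp only: nn_integral_stereo[OF h])
  also have "(\<integral>\<^sup>+c. ennreal (h c) * indicator {-1<..<1} c \<partial>lborel) = (\<integral>\<^sup>+c. ennreal (h c) * indicator {-1..1} c \<partial>lborel)"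
  proof (rule nn_integral_cong_AE)
   have "AE c in lborel. c \<noteq> (1::real)" "AE c in lborel. c \<noteq> (-1::real)" by (rule AE_lborel_singleton)+
   then show "AE c in lborel. ennreal (h c) * indicator {-1<..<1} c = ennreal (h c) * indicator {-1..1} c"
    by eventually_elim (auto simp: indicator_def)
  qed
  finally show ?thesis .
 qed
 have "ennreal (4 * pi) = 3 * ?J * (\<integral>\<^sup>+c. ennreal 1 * indicator {-1..1::real} c \<partial>lborel)"
  using zonal[of "\<lambda>_. 1"] by (simp add: emeasure_S2)
 also have "(\<integral>\<^sup>+c. ennreal 1 * indicator {-1..1::real} c \<partial>lborel) = 2" by simp
 finally have "3 * ?J * 2 = ennreal (2 * pi) * 2" by (simp add: ennreal_mult'[symmetric] flip: ennreal_numeral)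
 moreover have "a = b" if "a * 2 = b * 2" for a b :: ennreal
  using arg_cong[OF that, of "\<lambda>x. x / 2"] by (simp add: ennreal_mult_divide_eq)
 ultimately have J: "3 * ?J = ennreal (2 * pi)" by blast
 obtain R :: "vec3 \<Rightarrow> vec3" where R: "orthogonal_transformation R" "R (axis 3 1) = k"
  using orthogonal_transformation_exists[of "axis 3 1 :: vec3" k] k by auto
 have [measurable]: "(\<lambda>n. n \<bullet> k) \<in> borel_measurable borel" by measurable
 have "(\<integral>\<^sup>+n. ennreal (h (n \<bullet> k)) \<partial>S2) = (\<integral>\<^sup>+n. ennreal (h (R n \<bullet> k)) \<partial>S2)"
  by (rule nn_integral_S2_orthogonal[symmetric, OF R(1)]) measurable
 also have "\<dots> = (\<integral>\<^sup>+n. ennreal (h (n $ 3)) \<partial>S2)"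
  using R by (simp add: orthogonal_transformation_def inner_axis flip: R(2))
 also have "\<dots> = ennreal (2 * pi) * (\<integral>\<^sup>+c. ennreal (h c) * indicator {-1..1} c \<partial>lborel)"
  using zonal[OF h h0] J by simp
 finally show ?thesis .
qed

section \<open>The collision in the centre-of-mass frame, rotations, and the flow of the relative
  velocity\<close>

text \<open>The post-collisional velocity seen from the centre of mass, as \<open>vpost_relu\<close>
  shows. For unit \<open>n\<close> it multiplies the part of \<open>q\<close> orthogonal to
  \<open>n\<close> by 1/2 and the part along \<open>n\<close> by - e/2.\<close>

definition relu :: "real \<Rightarrow> vec3 \<Rightarrow> vec3 \<Rightarrow> vec3" where
 "relu e q n = (1/2) *\<^sub>R q - (((1 + e) / 2) * (q \<bullet> n)) *\<^sub>R n"

text \<open>For unit \<open>n\<close> this is the inverse of \<open>relu\<close>, with factors 2 and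
  - 2/e on the two parts.\<close>

definition relq :: "real \<Rightarrow> vec3 \<Rightarrow> vec3 \<Rightarrow> vec3" where
 "relq e u n = 2 *\<^sub>R u - ((2 * (1 + e) / e) * (u \<bullet> n)) *\<^sub>R n"

lemma vpost_relu: "vpost e v w n = (1/2) *\<^sub>R (v + w) + relu e (v - w) n"
proof -
 have "(1/2) *\<^sub>R (v + w) + (1/2) *\<^sub>R (v - w) = v"
  by (simp add: scaleR_add_right scaleR_diff_right flip: scaleR_add_left)
 then show ?thesis unfolding vpost_def relu_def by (metis add_diff_eq)
qed

lemma relq_relu:
 assumes "norm n = 1" "0 < e" shows "relq e (relu e q n) n = q"
proof -
 have nn: "n \<bullet> n = 1" using assms(1) by (simp add: dot_square_norm)
 have a: "relu e q n \<bullet> n = - (e / 2) * (q \<bullet> n)"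
  using nn by (simp add: relu_def inner_diff_left field_simps)
 have "(1 + e) * (q \<bullet> n) = - (2 * (1 + e) / e * (- (e / 2) * (q \<bullet> n)))"
  using assms(2) by (simp add: field_simps)
 then show ?thesis unfolding relq_def a unfolding relu_def
  by (simp add: scaleR_diff_right scaleR_left.minus)
qed

lemma relu_relq:
 assumes "norm n = 1" "0 < e" shows "relu e (relq e u n) n = u"
proof -
 have nn: "n \<bullet> n = 1" using assms(1) by (simp add: dot_square_norm)
 have a: "relq e u n \<bullet> n = - (2 / e) * (u \<bullet> n)"
  using nn assms(2) by (simp add: relq_def inner_diff_left field_simps)
 have "(1 + e) / e * (u \<bullet> n) = - ((1 + e) / 2 * (- (2 / e) * (u \<bullet> n)))"
  using assms(2) by (simp add: field_simps)
 then show ?thesis unfolding relu_def a unfolding relq_def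
  using assms(2) by (simp add: scaleR_diff_right scaleR_left.minus) (simp add: field_simps)
qed

lemma linear_relu: "linear (\<lambda>q. relu e q n)"
 by (rule linearI) (simp_all add: relu_def inner_add_left distrib_left scaleR_add_left scaleR_add_right scaleR_diff_right add_divide_distrib mult.left_commute)

lemma linear_relq: "linear (\<lambda>u. relq e u n)"
 by (rule linearI) (simp_all add: relq_def inner_add_left distrib_left scaleR_add_left scaleR_add_right scaleR_diff_right add_divide_distrib mult.left_commute)

text \<open>The eigenvalues are 2, twice, and - 2/e. That the determinant does not depend on
  \<open>n\<close> lets the Jacobians cancel in \<open>nn_integral_flow_q\<close>.\<close>

lemma det_relq:
 assumes "norm n = 1" "0 < e" shows "det (matrix (\<lambda>u. relq e u n)) = - (8 / e)"
proof -
 have n: "n$1 * n$1 + n$2 * n$2 + n$3 * n$3 = 1"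
  using assms(1) by (simp add: norm_eq_1 inner_vec_def sum_3)
 define K where "K = 2 * (1 + e) / e"
 have M: "matrix (\<lambda>u. relq e u n) $ i $ j = (if i = j then 2 else 0) - K * n $ j * n $ i" for i j
  by (simp add: matrix_def relq_def K_def inner_axis inner_commute[of _ n] axis_def)
   (simp add: inner_commute inner_axis[unfolded axis_def])
 have "det (matrix (\<lambda>u. relq e u n)) = 8 - 4 * K * (n$1 * n$1 + n$2 * n$2 + n$3 * n$3)"
  unfolding det_3 M by (simp add: algebra_simps)
 also have "\<dots> = - (8 / e)" unfolding n K_def using assms(2) by (simp add: field_simps)
 finally show ?thesis .
qed

text \<open>The smallest stretching factor of \<open>relu\<close> is e/2, attained along
  \<open>n\<close>; every \<open>1 / e\<close> in the estimates comes from here.\<close>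

lemma relu_norm:
 assumes "norm n = 1" "0 < e" "e \<le> 1" shows "e * norm q \<le> 2 * norm (relu e q n)"
proof -
 have nn: "n \<bullet> n = 1" using assms(1) by (simp add: dot_square_norm)
 have "4 * (relu e q n \<bullet> relu e q n) = q \<bullet> q - (1 - e\<^sup>2) * (q \<bullet> n)\<^sup>2"
  using nn by (simp add: relu_def inner_diff_left inner_diff_right inner_commute field_simps power2_eq_square)
 moreover have "(1 - e\<^sup>2) * (q \<bullet> n)\<^sup>2 \<le> (1 - e\<^sup>2) * (q \<bullet> q)"
 proof (rule mult_left_mono)
  show "(q \<bullet> n)\<^sup>2 \<le> q \<bullet> q" using Cauchy_Schwarz_ineq[of q n] nn by simp
  show "0 \<le> 1 - e\<^sup>2" using assms by (simp add: power_le_one)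
 qed
 ultimately have "e\<^sup>2 * (q \<bullet> q) \<le> 4 * (relu e q n \<bullet> relu e q n)" by (simp add: algebra_simps)
 then have "(e * norm q)\<^sup>2 \<le> (2 * norm (relu e q n))\<^sup>2"
  by (simp add: power_mult_distrib power2_norm_eq_inner)
 then show ?thesis by (rule power2_le_imp_le) simp
qed

text \<open>Makes the flow act on the relative velocity as a rotation and a dilation only, which
  preserves its angle with the rotated normal.\<close>

lemma relq_equivariant:
 assumes "orthogonal_transformation R" shows "relq e (c *\<^sub>R R u) (R n) = c *\<^sub>R R (relq e u n)"
 using assms by (simp add: relq_def orthogonal_transformation_def linear_diff linear_cmul scaleR_diff_right mult.left_commute mult.commute)

text \<open>The rotation taking the unit vector \<open>a\<close> to the unit vector \<open>b\<close> in their plane; for \<open>b = - a\<close> the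
 division by zero makes it a reflection, which is still orthogonal.\<close>
definition minrot :: "vec3 \<Rightarrow> vec3 \<Rightarrow> vec3 \<Rightarrow> vec3" where
 "minrot a b x = x - ((x \<bullet> (a + b)) / (1 + a \<bullet> b)) *\<^sub>R (a + b) + (2 * (x \<bullet> a)) *\<^sub>R b"

lemma unit_add_eq_0:
 assumes "norm a = 1" "norm b = 1" "1 + a \<bullet> b = 0" shows "a + b = (0 :: vec3)"
proof -
 have "(a + b) \<bullet> (a + b) = 2 * (1 + a \<bullet> b)"
  using assms(1,2) by (simp add: inner_add_left inner_add_right inner_commute norm_eq_1)
 then show ?thesis using assms(3) by simp
qed

lemma minrot_inner:
 assumes "norm a = 1" "norm b = 1" shows "minrot a b x \<bullet> minrot a b y = x \<bullet> y"
proof (cases "1 + a \<bullet> b = 0")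
 case True
 then have "a + b = 0" using assms by (intro unit_add_eq_0)
 then have b: "b = - a" by (simp add: eq_neg_iff_add_eq_0 add.commute)
 have aa: "a \<bullet> a = 1" using assms by (simp add: norm_eq_1)
 show ?thesis unfolding minrot_def b using aa
  by (simp add: inner_diff_left inner_diff_right inner_commute algebra_simps)
next
 case False
 define D m where "D = 1 + a \<bullet> b" and "m = a + b"
 have aa: "a \<bullet> a = 1" "b \<bullet> b = 1" using assms by (auto simp: norm_eq_1)
 have mm: "m \<bullet> m = 2 * D" using aa by (simp add: m_def D_def inner_add_left inner_add_right inner_commute)
 have mb: "m \<bullet> b = D" "b \<bullet> m = D" using aa by (simp_all add: m_def D_def inner_add_left inner_add_right inner_commute)
 have xb: "x \<bullet> b = x \<bullet> m - x \<bullet> a" "y \<bullet> b = y \<bullet> m - y \<bullet> a" "b \<bullet> y = y \<bullet> m - y \<bullet> a" "m \<bullet> y = y \<bullet> m"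
  by (simp_all add: m_def inner_add_right inner_commute)
 have D: "D \<noteq> 0" using False by (simp add: D_def)
 show ?thesis
  unfolding minrot_def D_def[symmetric] m_def[symmetric]
  using D by (simp add: inner_add_left inner_add_right inner_diff_left inner_diff_right mm mb xb aa field_simps)
qed

lemma minrot_orthogonal:
 assumes "norm a = 1" "norm b = 1" shows "orthogonal_transformation (minrot a b)"
proof -
 have "linear (minrot a b)"
  by (rule linearI) (simp_all add: minrot_def inner_add_left add_divide_distrib algebra_simps)
 then show ?thesis using minrot_inner[OF assms] by (simp add: orthogonal_transformation_def)
qed

lemma minrot_self:
 assumes "norm a = 1" "norm b = 1" shows "minrot a b a = b"
proof (cases "1 + a \<bullet> b = 0")
 case True
 then have "a + b = 0" using assms by (intro unit_add_eq_0)
 then have b: "b = - a" by (simp add: eq_neg_iff_add_eq_0 add.commute)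
 show ?thesis unfolding minrot_def b using assms by (simp add: norm_eq_1 scaleR_2)
next
 case False
 then show ?thesis using assms by (simp add: minrot_def norm_eq_1 inner_add_right scaleR_2)
qed

text \<open>Provides the Lipschitz bound of the flow. For an obtuse angle
  \<open>norm (b - a)\<close> is at least 1 and the triangle inequality suffices; otherwise the
  displacement is computed from the inner products of \<open>x\<close> with \<open>a\<close> and
  \<open>b\<close>.\<close>

lemma minrot_dist:
 assumes "norm a = 1" "norm b = 1" shows "norm (minrot a b x - x) \<le> 2 * norm x * norm (b - a)"
proof -
 have aa: "a \<bullet> a = 1" "b \<bullet> b = 1" using assms by (auto simp: norm_eq_1)
 define c where "c = a \<bullet> b"
 have dd: "(norm (b - a))\<^sup>2 = 2 - 2 * c"
  using aa by (simp add: power2_norm_eq_inner inner_diff_left inner_diff_right inner_commute c_def)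
 have nR: "norm (minrot a b x) = norm x"
  using minrot_inner[OF assms, of x x] by (simp add: norm_eq_sqrt_inner)
 show ?thesis
 proof (cases "c \<ge> 0")
  case False
  then have "1\<^sup>2 \<le> (norm (b - a))\<^sup>2" using dd by simp
  then have "1 \<le> norm (b - a)" by (rule power2_le_imp_le) simp
  moreover have "norm (minrot a b x - x) \<le> 2 * norm x"
   using norm_triangle_ineq4[of "minrot a b x" x] nR by simp
  ultimately show ?thesis using mult_left_mono[of 1 "norm (b - a)" "2 * norm x"] by simp
 next
  case True
  define p r where "p = x \<bullet> a" and "r = x \<bullet> b"
  have D: "1 + c > 0" using True by simp
  have "minrot a b x \<bullet> x = x \<bullet> x - (p + r)\<^sup>2 / (1 + c) + 2 * p * r"
  proof -
   have "a \<bullet> x = p" "b \<bullet> x = r" "x \<bullet> a = p" "x \<bullet> b = r" by (simp_all add: p_def r_def inner_commute)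
   then show ?thesis
    by (simp add: minrot_def inner_add_left inner_diff_left inner_add_right c_def power2_eq_square)
  qed
  then have "(norm (minrot a b x - x))\<^sup>2 = 2 * (p + r)\<^sup>2 / (1 + c) - 4 * p * r"
   using minrot_inner[OF assms, of x x] inner_commute[of x "minrot a b x"]
   by (simp add: power2_norm_eq_inner inner_diff_left inner_diff_right)
  also have "\<dots> = (2 * (p - r)\<^sup>2 + 4 * (p * r) * (1 - c)) / (1 + c)"
   using D by (simp add: field_simps power2_eq_square)
  also have "\<dots> \<le> 2 * (p - r)\<^sup>2 + 4 * (norm x)\<^sup>2 * (1 - c)"
  proof -
   have c1: "c \<le> 1" using dd zero_le_power2[of "norm (b - a)"] by linarith
   have "p * r \<le> \<bar>p\<bar> * \<bar>r\<bar>" by (simp add: abs_mult[symmetric])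
   also have "\<dots> \<le> norm x * norm x"
    using Cauchy_Schwarz_ineq2[of x a] Cauchy_Schwarz_ineq2[of x b] assms by (intro mult_mono) (auto simp: p_def r_def)
   finally have "p * r * (1 - c) \<le> (norm x)\<^sup>2 * (1 - c)"
    using c1 by (intro mult_right_mono) (auto simp: power2_eq_square)
   then have le: "2 * (p - r)\<^sup>2 + 4 * (p * r) * (1 - c) \<le> 2 * (p - r)\<^sup>2 + 4 * (norm x)\<^sup>2 * (1 - c)" by simp
   have nn: "0 \<le> 2 * (p - r)\<^sup>2 + 4 * (norm x)\<^sup>2 * (1 - c)" using c1 by simp
   have "(2 * (p - r)\<^sup>2 + 4 * (p * r) * (1 - c)) / (1 + c) \<le> (2 * (p - r)\<^sup>2 + 4 * (norm x)\<^sup>2 * (1 - c)) / (1 + c)"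
    using le D by (intro divide_right_mono) auto
   also have "\<dots> \<le> (2 * (p - r)\<^sup>2 + 4 * (norm x)\<^sup>2 * (1 - c)) / 1"
    using nn True by (intro divide_left_mono) auto
   finally show ?thesis by simp
  qed
  also have "\<dots> \<le> (2 * norm x * norm (b - a))\<^sup>2"
  proof -
   have "\<bar>p - r\<bar> \<le> norm x * norm (b - a)"
    using Cauchy_Schwarz_ineq2[of x "a - b"] by (simp add: p_def r_def inner_diff_right norm_minus_commute)
   then have "(p - r)\<^sup>2 \<le> (norm x * norm (b - a))\<^sup>2"
    by (metis abs_ge_zero power2_abs power_mono)
   moreover have "4 * (norm x)\<^sup>2 * (1 - c) = 2 * ((norm x)\<^sup>2 * (norm (b - a))\<^sup>2)"
    unfolding dd by (simp add: algebra_simps)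
   moreover have "(2 * norm x * norm (b - a))\<^sup>2 = 4 * ((norm x)\<^sup>2 * (norm (b - a))\<^sup>2)"
    by (simp add: power_mult_distrib)
   ultimately show ?thesis unfolding power_mult_distrib[of "norm x" "norm (b - a)"] by linarith
  qed
  finally show ?thesis by (rule power2_le_imp_le) simp
 qed
qed

definition urot :: "vec3 \<Rightarrow> vec3 \<Rightarrow> vec3 \<Rightarrow> vec3" where
 "urot u y = minrot (u /\<^sub>R norm u) ((u + y) /\<^sub>R norm (u + y))"

lemma urot_orthogonal: "u \<noteq> 0 \<Longrightarrow> u + y \<noteq> 0 \<Longrightarrow> orthogonal_transformation (urot u y)"
 unfolding urot_def by (rule minrot_orthogonal) auto

lemma urot_self:
 assumes "u \<noteq> 0" "u + y \<noteq> 0" shows "(norm (u + y) / norm u) *\<^sub>R urot u y u = u + y"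
proof -
 have "urot u y (u /\<^sub>R norm u) = (u + y) /\<^sub>R norm (u + y)"
  unfolding urot_def using assms by (intro minrot_self) auto
 then have "urot u y u /\<^sub>R norm u = (u + y) /\<^sub>R norm (u + y)"
  using urot_orthogonal[OF assms] by (simp add: orthogonal_transformation_def linear_cmul)
 then have "norm (u + y) *\<^sub>R (urot u y u /\<^sub>R norm u) = norm (u + y) *\<^sub>R ((u + y) /\<^sub>R norm (u + y))" by simp
 then show ?thesis using assms by (simp add: divide_inverse)
qed

text \<open>The pre-collisional relative velocity for which the collision with the rotated normal
  produces \<open>relu e q n + y\<close>.\<close>

definition flow_q :: "real \<Rightarrow> vec3 \<Rightarrow> vec3 \<Rightarrow> vec3 \<Rightarrow> vec3" where
 "flow_q e y q n = relq e (relu e q n + y) (urot (relu e q n) y n)"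

lemma flow_q_eq:
 assumes n: "norm n = 1" and e: "0 < e" and u: "relu e q n \<noteq> 0" "relu e q n + y \<noteq> 0"
 shows "flow_q e y q n = (norm (relu e q n + y) / norm (relu e q n)) *\<^sub>R urot (relu e q n) y q"
 unfolding flow_q_def
 by (subst urot_self[OF u, symmetric]) (simp add: relq_equivariant[OF urot_orthogonal[OF u]] relq_relu[OF n e])

text \<open>The ratio of \<open>norm q\<close> to the norm of \<open>relu e q n\<close> is at most
  2/e. It is multiplied by 5 times \<open>norm y\<close>: once for the dilation and four times for
  the rotation.\<close>

lemma flow_q_dist:
 assumes n: "norm n = 1" and e: "0 < e" "e \<le> 1" and u: "relu e q n \<noteq> 0" "relu e q n + y \<noteq> 0"
 shows "norm (flow_q e y q n - q) \<le> 10 / e * norm y"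
proof -
 let ?u = "relu e q n"
 let ?s = "norm (?u + y)" and ?r = "norm ?u" and ?a = "?u /\<^sub>R norm ?u" and ?b = "(?u + y) /\<^sub>R norm (?u + y)"
 have r: "?r > 0" using u by simp
 have nR: "norm (urot ?u y q) = norm q"
  using urot_orthogonal[OF u] by (simp add: orthogonal_transformation)
 have "?r *\<^sub>R ?b - ?u = ?r *\<^sub>R (?b - ?a)" using u by (simp add: scaleR_diff_right)
 then have "?r * norm (?b - ?a) = norm (?r *\<^sub>R ?b - ?u)" by simp
 also have "\<dots> \<le> norm (?r *\<^sub>R ?b - ?s *\<^sub>R ?b) + norm (?s *\<^sub>R ?b - ?u)"
  using norm_triangle_ineq[of "?r *\<^sub>R ?b - ?s *\<^sub>R ?b" "?s *\<^sub>R ?b - ?u"] by simp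
 also have "norm (?s *\<^sub>R ?b - ?u) = norm y" using u by simp
 also have "norm (?r *\<^sub>R ?b - ?s *\<^sub>R ?b) = \<bar>?r - ?s\<bar>"
  using u by (simp only: scaleR_diff_left[symmetric] norm_scaleR) simp
 also have "\<bar>?r - ?s\<bar> \<le> norm y" using norm_triangle_ineq3[of ?u "?u + y"] by simp
 finally have ab: "?r * norm (?b - ?a) \<le> 2 * norm y" by simp
 have fq: "flow_q e y q n - q = ((?s - ?r) / ?r) *\<^sub>R urot ?u y q + (urot ?u y q - q)"
  unfolding flow_q_eq[OF n e(1) u] using r by (simp add: diff_divide_distrib algebra_simps)
 have "norm (flow_q e y q n - q) \<le> \<bar>?s - ?r\<bar> / ?r * norm q + norm (urot ?u y q - q)"
  unfolding fq using norm_triangle_ineq[of "((?s - ?r) / ?r) *\<^sub>R urot ?u y q" "urot ?u y q - q"] nR r by simp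
 also have "norm (urot ?u y q - q) \<le> 2 * norm q * norm (?b - ?a)"
  unfolding urot_def using u by (intro minrot_dist) auto
 also have "\<bar>?s - ?r\<bar> / ?r * norm q + 2 * norm q * norm (?b - ?a) = norm q / ?r * (\<bar>?s - ?r\<bar> + 2 * (?r * norm (?b - ?a)))"
  using r by (simp add: field_simps)
 also have "\<dots> \<le> (2 / e) * (norm y + 2 * (2 * norm y))"
 proof (rule mult_mono)
  show "norm q / ?r \<le> 2 / e" using relu_norm[OF n e, of q] r e by (simp add: field_simps)
  have "\<bar>?s - ?r\<bar> \<le> norm y" using norm_triangle_ineq3[of "?u + y" ?u] by simp
  then show "\<bar>?s - ?r\<bar> + 2 * (?r * norm (?b - ?a)) \<le> norm y + 2 * (2 * norm y)" using ab by linarith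
 qed (use r e in auto)
 finally show ?thesis by simp
qed

section \<open>Invariance of the measure dn dv dw under the flow, and the derivative of the
  flow\<close>

definition M3 :: "(vec3 \<times> vec3 \<times> vec3) measure" where
 "M3 = lborel \<Otimes>\<^sub>M (lborel \<Otimes>\<^sub>M S2)"

interpretation S2: finite_measure S2 by (rule finite_measure_S2)
interpretation lS2: pair_sigma_finite "lborel :: vec3 measure" S2 ..

lemma sigma_finite_lborel_S2: "sigma_finite_measure ((lborel :: vec3 measure) \<Otimes>\<^sub>M S2)" ..

lemma sets_M3[measurable_cong]: "sets M3 = sets borel"
proof -
 have "sets M3 = sets ((borel :: vec3 measure) \<Otimes>\<^sub>M ((borel :: vec3 measure) \<Otimes>\<^sub>M (borel :: vec3 measure)))"
  unfolding M3_def by (intro sets_pair_measure_cong) auto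
 then show ?thesis by (simp only: borel_prod)
qed

lemma space_M3[simp]: "space M3 = UNIV"
 by (simp add: M3_def space_pair_measure)

lemma measurable_M3_eq: "borel_measurable M3 = borel_measurable borel"
 by (rule measurable_cong_sets) (simp_all add: sets_M3)

lemma nn_integral_M3:
 assumes H: "H \<in> borel_measurable borel"
 shows "(\<integral>\<^sup>+x. H x \<partial>M3) = (\<integral>\<^sup>+v. \<integral>\<^sup>+w. \<integral>\<^sup>+n. H (v, w, n) \<partial>S2 \<partial>lborel \<partial>lborel)"
  and "(\<integral>\<^sup>+x. H x \<partial>M3) = (\<integral>\<^sup>+n. \<integral>\<^sup>+v. \<integral>\<^sup>+w. H (v, w, n) \<partial>lborel \<partial>lborel \<partial>S2)"
proof -
 have [measurable]: "H \<in> borel_measurable (borel \<Otimes>\<^sub>M (borel \<Otimes>\<^sub>M borel))"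
  using H by (simp add: borel_prod)
 have "(\<integral>\<^sup>+x. H x \<partial>M3) = (\<integral>\<^sup>+v. \<integral>\<^sup>+wn. H (v, wn) \<partial>(lborel \<Otimes>\<^sub>M S2) \<partial>lborel)"
  unfolding M3_def by (rule sigma_finite_measure.nn_integral_fst[OF sigma_finite_lborel_S2, symmetric]) measurable
 also have "\<dots> = (\<integral>\<^sup>+v. \<integral>\<^sup>+w. \<integral>\<^sup>+n. H (v, w, n) \<partial>S2 \<partial>lborel \<partial>lborel)"
 proof (rule nn_integral_cong)
  fix v :: vec3
  show "(\<integral>\<^sup>+wn. H (v, wn) \<partial>(lborel \<Otimes>\<^sub>M S2)) = (\<integral>\<^sup>+w. \<integral>\<^sup>+n. H (v, w, n) \<partial>S2 \<partial>lborel)"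
   by (rule S2.nn_integral_fst[symmetric]) measurable
 qed
 finally show 1: "(\<integral>\<^sup>+x. H x \<partial>M3) = (\<integral>\<^sup>+v. \<integral>\<^sup>+w. \<integral>\<^sup>+n. H (v, w, n) \<partial>S2 \<partial>lborel \<partial>lborel)" .
 also have "\<dots> = (\<integral>\<^sup>+v. \<integral>\<^sup>+n. \<integral>\<^sup>+w. H (v, w, n) \<partial>lborel \<partial>S2 \<partial>lborel)"
  by (intro nn_integral_cong lS2.Fubini'[symmetric]) measurable
 also have "\<dots> = (\<integral>\<^sup>+n. \<integral>\<^sup>+v. \<integral>\<^sup>+w. H (v, w, n) \<partial>lborel \<partial>lborel \<partial>S2)"
  by (intro lS2.Fubini'[symmetric]) measurable
 finally show "(\<integral>\<^sup>+x. H x \<partial>M3) = (\<integral>\<^sup>+n. \<integral>\<^sup>+v. \<integral>\<^sup>+w. H (v, w, n) \<partial>lborel \<partial>lborel \<partial>S2)" .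
qed

lemma nn_integral_lborel_shift:
 fixes f :: "'a::euclidean_space \<Rightarrow> ennreal"
 assumes "f \<in> borel_measurable borel"
 shows "(\<integral>\<^sup>+x. f (x + c) \<partial>lborel) = (\<integral>\<^sup>+x. f x \<partial>lborel)"
 using nn_integral_lborel_affine[of 1 f c] assms by (simp add: add.commute)

text \<open>Both substitutions are shears, that is, translations in one variable while the other is
  fixed, so the Jacobian is 1.\<close>

lemma nn_integral_center_of_mass:
 fixes F :: "vec3 \<Rightarrow> vec3 \<Rightarrow> ennreal"
 assumes F: "(\<lambda>(v, w). F v w) \<in> borel_measurable (borel \<Otimes>\<^sub>M borel)"
 shows "(\<integral>\<^sup>+v. \<integral>\<^sup>+w. F v w \<partial>lborel \<partial>lborel)
  = (\<integral>\<^sup>+q. \<integral>\<^sup>+z. F (z + (1/2) *\<^sub>R q) (z - (1/2) *\<^sub>R q) \<partial>lborel \<partial>lborel)"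
proof -
 note [measurable] = F
 have "(\<integral>\<^sup>+v. \<integral>\<^sup>+w. F v w \<partial>lborel \<partial>lborel) = (\<integral>\<^sup>+w. \<integral>\<^sup>+v. F v w \<partial>lborel \<partial>lborel)"
  by (rule lborel_pair.Fubini'[symmetric]) measurable
 also have "\<dots> = (\<integral>\<^sup>+w. \<integral>\<^sup>+q. F (q + w) w \<partial>lborel \<partial>lborel)"
  by (intro nn_integral_cong nn_integral_lborel_shift[symmetric]) measurable
 also have "\<dots> = (\<integral>\<^sup>+q. \<integral>\<^sup>+w. F (q + w) w \<partial>lborel \<partial>lborel)"
  by (rule lborel_pair.Fubini'[symmetric]) measurable
 also have "\<dots> = (\<integral>\<^sup>+q. \<integral>\<^sup>+z. F (q + (z + - ((1/2) *\<^sub>R q))) (z + - ((1/2) *\<^sub>R q)) \<partial>lborel \<partial>lborel)"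
 proof (rule nn_integral_cong)
  fix q :: vec3
  show "(\<integral>\<^sup>+w. F (q + w) w \<partial>lborel) = (\<integral>\<^sup>+z. F (q + (z + - ((1/2) *\<^sub>R q))) (z + - ((1/2) *\<^sub>R q)) \<partial>lborel)"
   by (rule nn_integral_lborel_shift[of "\<lambda>w. F (q + w) w", symmetric]) measurable
 qed
 also have "\<dots> = (\<integral>\<^sup>+q. \<integral>\<^sup>+z. F (z + (1/2) *\<^sub>R q) (z - (1/2) *\<^sub>R q) \<partial>lborel \<partial>lborel)"
 proof -
  have "q + (z + - ((1/2) *\<^sub>R q)) = z + (1/2) *\<^sub>R q" for q z :: vec3
   by (simp add: vec_eq_iff)
  then show ?thesis by (simp only: diff_conv_add_uminus)
 qed
 finally show ?thesis .
qed

lemma measurable_relu[measurable]: "(\<lambda>(q, n). relu e q n) \<in> borel_measurable (borel \<Otimes>\<^sub>M borel)"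
 unfolding relu_def[abs_def] by measurable

lemma measurable_relq[measurable]: "(\<lambda>(q, n). relq e q n) \<in> borel_measurable (borel \<Otimes>\<^sub>M borel)"
 unfolding relq_def[abs_def] by measurable

lemma measurable_urot[measurable]: "(\<lambda>(u, n). urot u y n) \<in> borel_measurable (borel \<Otimes>\<^sub>M borel)"
 unfolding urot_def[abs_def] minrot_def[abs_def] by measurable

lemma measurable_flow_q[measurable]: "(\<lambda>(q, n). flow_q e y q n) \<in> borel_measurable (borel \<Otimes>\<^sub>M borel)"
 unfolding flow_q_def[abs_def] by measurable

lemma nn_integral_relu:
 assumes e: "0 < e" and [measurable]: "(\<lambda>(q, n). k q n) \<in> borel_measurable (borel \<Otimes>\<^sub>M borel)"
 shows "(\<integral>\<^sup>+n. \<integral>\<^sup>+q. k (relu e q n) n \<partial>lborel \<partial>S2) = ennreal (8 / e) * (\<integral>\<^sup>+n. \<integral>\<^sup>+u. k u n \<partial>lborel \<partial>S2)"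
proof -
 have "(\<integral>\<^sup>+n. \<integral>\<^sup>+q. k (relu e q n) n \<partial>lborel \<partial>S2) = (\<integral>\<^sup>+n. ennreal (8 / e) * (\<integral>\<^sup>+u. k u n \<partial>lborel) \<partial>S2)"
 proof (rule nn_integral_cong_AE)
  show "AE n in S2. (\<integral>\<^sup>+q. k (relu e q n) n \<partial>lborel) = ennreal (8 / e) * (\<integral>\<^sup>+u. k u n \<partial>lborel)"
   using AE_S2_norm
  proof eventually_elim
   case (elim n)
   have "(\<integral>\<^sup>+q. k (relu e q n) n \<partial>lborel) = ennreal \<bar>det (matrix (\<lambda>u. relq e u n))\<bar> * (\<integral>\<^sup>+u. k u n \<partial>lborel)"
    by (rule lborel_linear_bij[OF linear_relu linear_relq]) (use relu_relq[OF elim e] relq_relu[OF elim e] in simp_all)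
   then show ?case using e by (simp add: det_relq[OF elim e])
  qed
 qed
 also have "\<dots> = ennreal (8 / e) * (\<integral>\<^sup>+n. \<integral>\<^sup>+u. k u n \<partial>lborel \<partial>S2)"
  by (rule nn_integral_cmult) measurable
 finally show ?thesis .
qed

text \<open>In the variables \<open>u = relu e q n\<close> and \<open>n\<close> the flow is a
  translation of \<open>u\<close> by \<open>y\<close> together with a rotation of \<open>n\<close>
  that depends on \<open>u\<close> and \<open>y\<close> only. For fixed \<open>u\<close> the
  rotation preserves \<open>S2\<close>, and then the translation preserves Lebesgue measure. Passing
  from \<open>q\<close> to \<open>u\<close> and back costs the same factor 8/e.\<close>

lemma nn_integral_flow_q:
 assumes e: "0 < e" and k[measurable]: "(\<lambda>(q, n). k q n) \<in> borel_measurable (borel \<Otimes>\<^sub>M borel)"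
 shows "(\<integral>\<^sup>+n. \<integral>\<^sup>+q. k (flow_q e y q n) (urot (relu e q n) y n) \<partial>lborel \<partial>S2) = (\<integral>\<^sup>+n. \<integral>\<^sup>+q. k q n \<partial>lborel \<partial>S2)"
proof -
 have "(\<integral>\<^sup>+n. \<integral>\<^sup>+q. k (flow_q e y q n) (urot (relu e q n) y n) \<partial>lborel \<partial>S2)
   = ennreal (8 / e) * (\<integral>\<^sup>+n. \<integral>\<^sup>+u. k (relq e (u + y) (urot u y n)) (urot u y n) \<partial>lborel \<partial>S2)"
  unfolding flow_q_def by (rule nn_integral_relu[OF e]) measurable
 also have "(\<integral>\<^sup>+n. \<integral>\<^sup>+u. k (relq e (u + y) (urot u y n)) (urot u y n) \<partial>lborel \<partial>S2)
   = (\<integral>\<^sup>+u. \<integral>\<^sup>+n. k (relq e (u + y) (urot u y n)) (urot u y n) \<partial>S2 \<partial>lborel)"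
  by (rule lS2.Fubini') measurable
 also have "\<dots> = (\<integral>\<^sup>+u. \<integral>\<^sup>+n. k (relq e (u + y) n) n \<partial>S2 \<partial>lborel)"
 proof (rule nn_integral_cong_AE)
  have "AE u in lborel. u \<noteq> (0 :: vec3)" "AE u in lborel. u \<noteq> - y" by (rule AE_lborel_singleton)+
  then show "AE u in lborel. (\<integral>\<^sup>+n. k (relq e (u + y) (urot u y n)) (urot u y n) \<partial>S2) = (\<integral>\<^sup>+n. k (relq e (u + y) n) n \<partial>S2)"
  proof eventually_elim
   case (elim u)
   then have "u + y \<noteq> 0" by (simp add: eq_neg_iff_add_eq_0)
   then show ?case using elim
    by (intro nn_integral_S2_orthogonal[where h="\<lambda>n. k (relq e (u + y) n) n"] urot_orthogonal) measurable
  qed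
 qed
 also have "\<dots> = (\<integral>\<^sup>+n. \<integral>\<^sup>+u. k (relq e (u + y) n) n \<partial>lborel \<partial>S2)"
  by (rule lS2.Fubini'[symmetric]) measurable
 also have "\<dots> = (\<integral>\<^sup>+n. \<integral>\<^sup>+u. k (relq e u n) n \<partial>lborel \<partial>S2)"
 proof (rule nn_integral_cong)
  fix n :: vec3
  show "(\<integral>\<^sup>+u. k (relq e (u + y) n) n \<partial>lborel) = (\<integral>\<^sup>+u. k (relq e u n) n \<partial>lborel)"
   by (rule nn_integral_lborel_shift[of "\<lambda>u. k (relq e u n) n"]) measurable
 qed
 also have "ennreal (8 / e) * \<dots> = (\<integral>\<^sup>+n. \<integral>\<^sup>+q. k (relq e (relu e q n) n) n \<partial>lborel \<partial>S2)"
  by (rule nn_integral_relu[OF e, symmetric]) measurable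
 also have "\<dots> = (\<integral>\<^sup>+n. \<integral>\<^sup>+q. k q n \<partial>lborel \<partial>S2)"
  by (rule nn_integral_cong_AE) (use AE_S2_norm in eventually_elim, simp add: relq_relu e)
 finally show ?thesis .
qed

text \<open>The flow moves the post-collisional velocity by \<open>2 y\<close>, keeps the other one fixed, and turns \<open>n\<close>
 along with the relative velocity so that the argument of the kernel does not change.\<close>
definition flow :: "real \<Rightarrow> vec3 \<Rightarrow> vec3 \<times> vec3 \<times> vec3 \<Rightarrow> vec3 \<times> vec3 \<times> vec3" where
 "flow e y = (\<lambda>(v, w, n). ((1/2) *\<^sub>R (v + w) + y + (1/2) *\<^sub>R flow_q e y (v - w) n,
  (1/2) *\<^sub>R (v + w) + y - (1/2) *\<^sub>R flow_q e y (v - w) n, urot (relu e (v - w) n) y n))"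

lemma measurable_flow'[measurable]:
 "flow e y \<in> (borel \<Otimes>\<^sub>M (borel \<Otimes>\<^sub>M borel)) \<rightarrow>\<^sub>M (borel \<Otimes>\<^sub>M (borel \<Otimes>\<^sub>M borel))"
 unfolding flow_def by measurable

lemma measurable_flow: "flow e y \<in> borel_measurable borel"
 using measurable_flow'[of e y] by (simp add: borel_prod)

lemma nn_integral_flow:
 assumes e: "0 < e" and H: "H \<in> borel_measurable borel"
 shows "(\<integral>\<^sup>+x. H (flow e y x) \<partial>M3) = (\<integral>\<^sup>+x. H x \<partial>M3)"
proof -
 have [measurable]: "H \<in> borel_measurable (borel \<Otimes>\<^sub>M (borel \<Otimes>\<^sub>M borel))"
  using H by (simp add: borel_prod)
 let ?k = "\<lambda>q n. \<integral>\<^sup>+z. H (z + (1/2) *\<^sub>R q, z - (1/2) *\<^sub>R q, n) \<partial>lborel"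
 have cm: "(1/2) *\<^sub>R (z + (1/2) *\<^sub>R q + (z - (1/2) *\<^sub>R q)) = z" "z + (1/2) *\<^sub>R q - (z - (1/2) *\<^sub>R q) = q" for z q :: vec3
  by (simp_all add: vec_eq_iff)
 have "(\<integral>\<^sup>+x. H (flow e y x) \<partial>M3) = (\<integral>\<^sup>+n. \<integral>\<^sup>+v. \<integral>\<^sup>+w. H (flow e y (v, w, n)) \<partial>lborel \<partial>lborel \<partial>S2)"
  by (rule nn_integral_M3(2)) (rule measurable_compose[OF measurable_flow H])
 also have "\<dots> = (\<integral>\<^sup>+n. \<integral>\<^sup>+q. \<integral>\<^sup>+z. H (flow e y (z + (1/2) *\<^sub>R q, z - (1/2) *\<^sub>R q, n)) \<partial>lborel \<partial>lborel \<partial>S2)"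
 proof (rule nn_integral_cong)
  fix n :: vec3
  show "(\<integral>\<^sup>+v. \<integral>\<^sup>+w. H (flow e y (v, w, n)) \<partial>lborel \<partial>lborel) = (\<integral>\<^sup>+q. \<integral>\<^sup>+z. H (flow e y (z + (1/2) *\<^sub>R q, z - (1/2) *\<^sub>R q, n)) \<partial>lborel \<partial>lborel)"
   by (rule nn_integral_center_of_mass) measurable
 qed
 also have "\<dots> = (\<integral>\<^sup>+n. \<integral>\<^sup>+q. \<integral>\<^sup>+z. H (z + y + (1/2) *\<^sub>R flow_q e y q n, z + y - (1/2) *\<^sub>R flow_q e y q n, urot (relu e q n) y n) \<partial>lborel \<partial>lborel \<partial>S2)"
  by (simp only: flow_def prod.case cm)
 also have "\<dots> = (\<integral>\<^sup>+n. \<integral>\<^sup>+q. ?k (flow_q e y q n) (urot (relu e q n) y n) \<partial>lborel \<partial>S2)"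
 proof (rule nn_integral_cong, rule nn_integral_cong)
  fix n q :: vec3
  show "(\<integral>\<^sup>+z. H (z + y + (1/2) *\<^sub>R flow_q e y q n, z + y - (1/2) *\<^sub>R flow_q e y q n, urot (relu e q n) y n) \<partial>lborel) = ?k (flow_q e y q n) (urot (relu e q n) y n)"
   by (rule nn_integral_lborel_shift[of "\<lambda>z. H (z + (1/2) *\<^sub>R flow_q e y q n, z - (1/2) *\<^sub>R flow_q e y q n, urot (relu e q n) y n)"]) measurable
 qed
 also have "\<dots> = (\<integral>\<^sup>+n. \<integral>\<^sup>+q. ?k q n \<partial>lborel \<partial>S2)"
  by (rule nn_integral_flow_q[OF e]) measurable
 also have "\<dots> = (\<integral>\<^sup>+n. \<integral>\<^sup>+v. \<integral>\<^sup>+w. H (v, w, n) \<partial>lborel \<partial>lborel \<partial>S2)"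
 proof (rule nn_integral_cong)
  fix n :: vec3
  show "(\<integral>\<^sup>+q. ?k q n \<partial>lborel) = (\<integral>\<^sup>+v. \<integral>\<^sup>+w. H (v, w, n) \<partial>lborel \<partial>lborel)"
   by (rule nn_integral_center_of_mass[symmetric]) measurable
 qed
 also have "\<dots> = (\<integral>\<^sup>+x. H x \<partial>M3)"
  using nn_integral_M3(2)[OF H] by simp
 finally show ?thesis .
qed

text \<open>For a unit vector \<open>n\<close> and given \<open>v\<close>, the excluded
  \<open>w\<close> are at most two points, since \<open>relu\<close> is injective in the relative
  velocity.\<close>

lemma AE_M3: "AE x in M3. norm (snd (snd x)) = 1 \<and> fst x - fst (snd x) \<noteq> a \<and> relu e (fst x - fst (snd x)) (snd (snd x)) \<noteq> b"
 if e: "0 < e"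
proof -
 let ?P = "\<lambda>x. norm (snd (snd x)) = 1 \<and> fst x - fst (snd x) \<noteq> a \<and> relu e (fst x - fst (snd x)) (snd (snd x)) \<noteq> b"
 have m: "Measurable.pred borel ?P"
 proof -
  have "Measurable.pred (borel \<Otimes>\<^sub>M (borel \<Otimes>\<^sub>M borel)) ?P" by measurable
  then show ?thesis by (simp add: borel_prod)
 qed
 then have Pm[measurable]: "{x. \<not> ?P x} \<in> sets borel" by measurable
 have "emeasure M3 {x. \<not> ?P x} = (\<integral>\<^sup>+x. indicator {x. \<not> ?P x} x \<partial>M3)"
  by (rule nn_integral_indicator[symmetric]) (unfold sets_M3, rule Pm)
 also have "\<dots> = (\<integral>\<^sup>+n. \<integral>\<^sup>+v. \<integral>\<^sup>+w. indicator {x. \<not> ?P x} (v, w, n) \<partial>lborel \<partial>lborel \<partial>S2)"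
  by (rule nn_integral_M3(2)) measurable
 also have "\<dots> = (\<integral>\<^sup>+n. 0 \<partial>S2)"
 proof (rule nn_integral_cong_AE)
  show "AE n in S2. (\<integral>\<^sup>+v. \<integral>\<^sup>+w. indicator {x. \<not> ?P x} (v, w, n) \<partial>lborel \<partial>lborel) = 0"
   using AE_S2_norm
  proof eventually_elim
   case (elim n)
   have "(\<integral>\<^sup>+w. indicator {x. \<not> ?P x} (v, w, n) \<partial>lborel) = 0" for v
   proof -
    have "(\<integral>\<^sup>+w. indicator {x. \<not> ?P x} (v, w, n) \<partial>lborel) = (\<integral>\<^sup>+w. 0 \<partial>(lborel :: vec3 measure))"
    proof (rule nn_integral_cong_AE)
     have "AE w in lborel. w \<noteq> v - a" "AE w in lborel. w \<noteq> v - relq e b n" by (rule AE_lborel_singleton)+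
     then show "AE w in lborel. indicator {x. \<not> ?P x} (v, w, n) = (0::ennreal)"
     proof eventually_elim
      case (elim w)
      have "v - w \<noteq> a" using elim(1) by auto
      moreover have "relu e (v - w) n \<noteq> b"
      proof
       assume "relu e (v - w) n = b"
       then have "v - w = relq e b n" using relq_relu[OF \<open>norm n = 1\<close> e, of "v - w"] by simp
       then have "w = v - relq e b n" by (simp add: algebra_simps)
       then show False using elim(2) by simp
      qed
      ultimately show ?case using \<open>norm n = 1\<close> by simp
     qed
    qed
    then show ?thesis by simp
   qed
   then show ?case by simp
  qed
 qed
 finally have "emeasure M3 {x. \<not> ?P x} = 0" by simp
 then show ?thesis
  by (intro AE_I[of _ _ "{x. \<not> ?P x}"]) (unfold sets_M3, use Pm in auto)
qed

definition kcos :: "vec3 \<times> vec3 \<times> vec3 \<Rightarrow> real" where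
 "kcos = (\<lambda>(v, w, n). n \<bullet> ((v - w) /\<^sub>R norm (v - w)))"

text \<open>The relative velocity is rotated and dilated while \<open>n\<close> is rotated alike, so
  \<open>kcos\<close> is unchanged. The displacement \<open>2 *\<^sub>R y\<close> is
  \<open>y\<close> from the centre of mass plus \<open>y\<close> from the velocity relative to
  it.\<close>

lemma flow_props:
 assumes e: "0 < e" and n: "norm n = 1" and q: "v \<noteq> w" and u: "relu e (v - w) n \<noteq> 0" "relu e (v - w) n + y \<noteq> 0"
  and fl: "flow e y (v, w, n) = (v', w', n')"
 shows "kcos (v', w', n') = kcos (v, w, n)" "vpost e v' w' n' = vpost e v w n + 2 *\<^sub>R y"
proof -
 let ?u = "relu e (v - w) n"
 have f: "v' = (1/2) *\<^sub>R (v + w) + y + (1/2) *\<^sub>R flow_q e y (v - w) n"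
  "w' = (1/2) *\<^sub>R (v + w) + y - (1/2) *\<^sub>R flow_q e y (v - w) n" "n' = urot ?u y n"
  using fl by (auto simp: flow_def)
 have d: "v' - w' = flow_q e y (v - w) n" unfolding f by (simp add: vec_eq_iff)
 have s: "v' + w' = (v + w) + 2 *\<^sub>R y" unfolding f
  by (simp add: vec_eq_iff field_simps)
 have O: "orthogonal_transformation (urot ?u y)" using u by (rule urot_orthogonal)
 define c where "c = norm (?u + y) / norm ?u"
 have c: "c > 0" using u by (simp add: c_def)
 have fq: "flow_q e y (v - w) n = c *\<^sub>R urot ?u y (v - w)" unfolding c_def by (rule flow_q_eq[OF n e u])
 have nr: "norm (urot ?u y x) = norm x" for x using O by (simp add: orthogonal_transformation)
 have ir: "urot ?u y x \<bullet> urot ?u y z = x \<bullet> z" for x z using O by (simp add: orthogonal_transformation_def)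
 have "kcos (v', w', n') = (n \<bullet> (v - w)) * c / (c * norm (v - w))"
  unfolding kcos_def prod.case d fq f(3) using c by (simp add: nr ir divide_inverse mult_ac)
 also have "\<dots> = kcos (v, w, n)"
  using c by (simp add: kcos_def divide_inverse mult_ac)
 finally show "kcos (v', w', n') = kcos (v, w, n)" .
 have "norm (urot ?u y n) = 1" using nr n by simp
 then have "relu e (v' - w') n' = ?u + y"
  unfolding d f(3) flow_q_def by (rule relu_relq[OF _ e])
 then show "vpost e v' w' n' = vpost e v w n + 2 *\<^sub>R y"
  unfolding vpost_relu s by (simp add: vec_eq_iff field_simps)
qed

lemma flow_dist:
 assumes e: "0 < e" "e \<le> 1" and n: "norm n = 1" and u: "relu e (v - w) n \<noteq> 0" "relu e (v - w) n + y \<noteq> 0"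
  and fl: "flow e y (v, w, n) = (v', w', n')"
 shows "norm (v' - v) \<le> 6 / e * norm y" "norm (w' - w) \<le> 6 / e * norm y"
proof -
 let ?d = "flow_q e y (v - w) n - (v - w)"
 have f: "v' = (1/2) *\<^sub>R (v + w) + y + (1/2) *\<^sub>R flow_q e y (v - w) n"
  "w' = (1/2) *\<^sub>R (v + w) + y - (1/2) *\<^sub>R flow_q e y (v - w) n"
  using fl by (auto simp: flow_def)
 have v: "v' - v = y + (1/2) *\<^sub>R ?d" "w' - w = y - (1/2) *\<^sub>R ?d"
  unfolding f by (simp_all add: vec_eq_iff field_simps)
 have d: "norm ((1/2) *\<^sub>R ?d) \<le> 5 / e * norm y"
  using flow_q_dist[OF n e u] by simp
 have "norm y * 1 \<le> norm y * (1 / e)" using e by (intro mult_left_mono) auto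
 moreover have "5 / e * norm y = 5 * (norm y * (1 / e))" "6 / e * norm y = 6 * (norm y * (1 / e))" by simp_all
 ultimately have "norm y + 5 / e * norm y \<le> 6 / e * norm y" by linarith
 then show "norm (v' - v) \<le> 6 / e * norm y" "norm (w' - w) \<le> 6 / e * norm y"
  unfolding v using d norm_triangle_ineq[of y "(1/2) *\<^sub>R ?d"] norm_triangle_ineq4[of y "(1/2) *\<^sub>R ?d"] by linarith+
qed

text \<open>The velocity of \<open>flow_q\<close> at the start in direction \<open>h\<close>. The
  term with \<open>q\<close> is the dilation, at rate
  \<open>(u \<bullet> h) / (norm u)\<^sup>2\<close>; the other two are the infinitesimal rotation in
  the plane of \<open>u\<close> and \<open>h\<close>.\<close>

definition dflow :: "real \<Rightarrow> vec3 \<Rightarrow> vec3 \<times> vec3 \<times> vec3 \<Rightarrow> vec3" where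
 "dflow e h = (\<lambda>(v, w, n). let q = v - w; u = relu e q n in
  (1 / (norm u)\<^sup>2) *\<^sub>R ((u \<bullet> h) *\<^sub>R q - (q \<bullet> h) *\<^sub>R u + (q \<bullet> u) *\<^sub>R h))"

lemma measurable_dflow'[measurable]:
 "dflow e h \<in> (borel \<Otimes>\<^sub>M (borel \<Otimes>\<^sub>M borel)) \<rightarrow>\<^sub>M borel"
 unfolding dflow_def Let_def by measurable

text \<open>Three Cauchy-Schwarz estimates, crude but uniform, which is what boundedness of the
  coefficients requires; the sharp constant is obtained in \<open>norm_Tt\<close>.\<close>

lemma dflow_bound:
 assumes e: "0 < e" "e \<le> 1" and n: "norm n = 1"
 shows "norm (dflow e h (v, w, n)) \<le> 6 / e * norm h"
proof -
 let ?q = "v - w" let ?u = "relu e ?q n"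
 show ?thesis
 proof (cases "?u = 0")
  case True
  then show ?thesis using e by (simp add: dflow_def Let_def)
 next
  case False
  then have r: "norm ?u > 0" by simp
  define X where "X = (?u \<bullet> h) *\<^sub>R ?q - (?q \<bullet> h) *\<^sub>R ?u + (?q \<bullet> ?u) *\<^sub>R h"
  have "norm X \<le> \<bar>?u \<bullet> h\<bar> * norm ?q + \<bar>?q \<bullet> h\<bar> * norm ?u + \<bar>?q \<bullet> ?u\<bar> * norm h"
   unfolding X_def
   by (rule norm_triangle_le, rule add_mono, rule norm_triangle_le_diff) simp_all
  also have "\<dots> \<le> (norm ?u * norm h) * norm ?q + (norm ?q * norm h) * norm ?u + (norm ?q * norm ?u) * norm h"
   by (intro add_mono mult_right_mono Cauchy_Schwarz_ineq2) auto
  finally have X: "norm X \<le> norm ?u * norm h * norm ?q + norm ?q * norm h * norm ?u + norm ?q * norm ?u * norm h" .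
  have "norm (dflow e h (v, w, n)) \<le> 3 * (norm ?q * norm ?u * norm h) / (norm ?u)\<^sup>2"
  proof -
   have "norm (dflow e h (v, w, n)) = norm X / (norm ?u)\<^sup>2"
    unfolding dflow_def Let_def prod.case X_def[symmetric] by simp
   also have "\<dots> \<le> 3 * (norm ?q * norm ?u * norm h) / (norm ?u)\<^sup>2"
    using X by (intro divide_right_mono) (simp_all add: mult_ac)
   finally show ?thesis .
  qed
  also have "\<dots> = 3 * (norm ?q / norm ?u) * norm h" using r by (simp add: power2_eq_square)
  also have "\<dots> \<le> 3 * (2 / e) * norm h"
   using relu_norm[OF n e, of ?q] r e by (intro mult_right_mono mult_left_mono) (simp_all add: field_simps)
  finally show ?thesis by simp
 qed
qed

text \<open>Clearing the normalisation of \<open>u + t *\<^sub>R h\<close> rewrites the flow as an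
  expression in functions that are visibly differentiable at 0.\<close>

lemma flow_q_has_vector_derivative:
 assumes n: "norm n = 1" and e: "0 < e" and u0: "relu e (v - w) n \<noteq> 0"
 shows "((\<lambda>t. flow_q e (t *\<^sub>R h) (v - w) n) has_vector_derivative dflow e h (v, w, n)) (at 0)"
proof -
 define q u r a where "q = v - w" and "u = relu e q n" and "r = norm u" and "a = u /\<^sub>R norm u"
 have r: "r > 0" using u0 by (simp add: r_def u_def q_def)
 have ua: "u = r *\<^sub>R a" using r by (simp add: a_def r_def)
 have aa: "a \<bullet> a = 1" using r by (simp add: a_def r_def dot_square_norm power2_eq_square)
 define s d p where "s t = norm (u + t *\<^sub>R h)" and "d t = s t + a \<bullet> (u + t *\<^sub>R h)" and "p t = s t *\<^sub>R a + (u + t *\<^sub>R h)" for t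
 \<comment> \<open>Multiplying the formula of \<open>minrot\<close> by \<open>s t\<close> replaces
   the unit vector \<open>b\<close> along \<open>u + t *\<^sub>R h\<close>: \<open>p t\<close>
   stands for \<open>s t *\<^sub>R (a + b)\<close> and \<open>d t\<close> for
   \<open>s t * (1 + a \<bullet> b)\<close>.\<close>
 define G where "G t = (s t / r) *\<^sub>R q - ((q \<bullet> p t) / (r * d t)) *\<^sub>R p t + (2 * (q \<bullet> a) / r) *\<^sub>R (u + t *\<^sub>R h)" for t
 define \<sigma> where "\<sigma> = a \<bullet> h"
 have au: "a \<bullet> u = r" "u \<bullet> u = r\<^sup>2" using aa by (simp_all add: ua power2_eq_square)
 have s0: "s 0 = r" and d0: "d 0 = 2 * r" and p0: "p 0 = (2 * r) *\<^sub>R a"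
 proof -
  show s0: "s 0 = r" by (simp add: s_def r_def)
  show "d 0 = 2 * r" by (simp add: d_def s0 au)
  have "p 0 = r *\<^sub>R a + r *\<^sub>R a" unfolding p_def s0 by (simp add: ua)
  then show "p 0 = (2 * r) *\<^sub>R a" by (simp flip: scaleR_add_left)
 qed
 have ds: "(s has_real_derivative \<sigma>) (at 0)"
 proof -
  have "((\<lambda>t. sqrt ((u + t *\<^sub>R h) \<bullet> (u + t *\<^sub>R h))) has_real_derivative ((u \<bullet> h + h \<bullet> u) * (inverse (sqrt (u \<bullet> u)) / 2))) (at 0)"
  proof -
   have "((\<lambda>t. u \<bullet> u + (u \<bullet> h + h \<bullet> u) * t + (h \<bullet> h) * t\<^sup>2) has_real_derivative (u \<bullet> h + h \<bullet> u)) (at 0)"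
    by (auto intro!: derivative_eq_intros)
   moreover have "(u + t *\<^sub>R h) \<bullet> (u + t *\<^sub>R h) = u \<bullet> u + (u \<bullet> h + h \<bullet> u) * t + (h \<bullet> h) * t\<^sup>2" for t
    by (simp add: inner_add_left inner_add_right algebra_simps power2_eq_square)
   ultimately have D: "((\<lambda>t. (u + t *\<^sub>R h) \<bullet> (u + t *\<^sub>R h)) has_real_derivative (u \<bullet> h + h \<bullet> u)) (at 0)" by simp
   have "((\<lambda>t. sqrt ((u + t *\<^sub>R h) \<bullet> (u + t *\<^sub>R h))) has_real_derivative (inverse (sqrt (u \<bullet> u)) / 2) * (u \<bullet> h + h \<bullet> u)) (at 0)"
    by (rule DERIV_chain2[where f=sqrt, OF _ D]) (use au r DERIV_real_sqrt[of "r\<^sup>2"] in simp)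
   then show ?thesis by (simp add: mult.commute)
  qed
  moreover have "(u \<bullet> h + h \<bullet> u) * (inverse (sqrt (u \<bullet> u)) / 2) = \<sigma>"
   using r by (simp add: au \<sigma>_def) (simp add: ua inner_commute[of h])
  ultimately show ?thesis by (simp add: s_def[abs_def] norm_eq_sqrt_inner)
 qed
 have dd: "(d has_real_derivative 2 * \<sigma>) (at 0)"
 proof -
  have "((\<lambda>t. s t + (a \<bullet> u + t * \<sigma>)) has_real_derivative \<sigma> + \<sigma>) (at 0)"
   by (auto intro!: derivative_eq_intros ds)
  moreover have "d = (\<lambda>t. s t + (a \<bullet> u + t * \<sigma>))" by (simp add: d_def fun_eq_iff inner_add_right \<sigma>_def)
  ultimately show ?thesis by simp
 qed
 have dl: "((\<lambda>t. u + t *\<^sub>R h) has_vector_derivative h) (at 0)"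
  by (auto intro!: derivative_eq_intros)
 have dp: "(p has_vector_derivative \<sigma> *\<^sub>R a + h) (at 0)"
 proof -
  have "((\<lambda>t. s t *\<^sub>R a) has_vector_derivative \<sigma> *\<^sub>R a) (at 0)"
   using has_vector_derivative_scaleR[OF ds has_vector_derivative_const[of a]] by simp
  from has_vector_derivative_add[OF this dl] show ?thesis by (simp add: p_def[abs_def])
 qed
 have dqp: "((\<lambda>t. q \<bullet> p t) has_real_derivative (\<sigma> * (q \<bullet> a) + q \<bullet> h)) (at 0)"
 proof -
  have "((\<lambda>t. s t * (q \<bullet> a) + (q \<bullet> u + t * (q \<bullet> h))) has_real_derivative \<sigma> * (q \<bullet> a) + q \<bullet> h) (at 0)"
   by (auto intro!: derivative_eq_intros ds)
  then show ?thesis by (simp add: p_def[abs_def] inner_add_right)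
 qed
 have dc: "((\<lambda>t. (q \<bullet> p t) / (r * d t)) has_real_derivative (q \<bullet> h - \<sigma> * (q \<bullet> a)) / (2 * r\<^sup>2)) (at 0)"
 proof -
  have "((\<lambda>t. r * d t) has_real_derivative r * (2 * \<sigma>)) (at 0)"
   using DERIV_cmult[OF dd] .
  from DERIV_divide[OF dqp this] have "((\<lambda>t. (q \<bullet> p t) / (r * d t)) has_real_derivative
   ((\<sigma> * (q \<bullet> a) + q \<bullet> h) * (r * (2 * r)) - (2 * r * (q \<bullet> a)) * (r * (2 * \<sigma>))) / (r * (2 * r) * (r * (2 * r)))) (at 0)"
   using r by (simp add: d0 p0)
  moreover have "((\<sigma> * (q \<bullet> a) + q \<bullet> h) * (r * (2 * r)) - (2 * r * (q \<bullet> a)) * (r * (2 * \<sigma>))) / (r * (2 * r) * (r * (2 * r))) = (q \<bullet> h - \<sigma> * (q \<bullet> a)) / (2 * r\<^sup>2)"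
   using r by (simp add: field_simps power2_eq_square)
  ultimately show ?thesis by simp
 qed
 have c0: "(q \<bullet> p 0) / (r * d 0) = (q \<bullet> a) / r" using r by (simp add: d0 p0)
 have dsr: "((\<lambda>t. s t / r) has_real_derivative \<sigma> / r) (at 0)" using DERIV_cdivide[OF ds] .
 have "(G has_vector_derivative
   ((s 0 / r) *\<^sub>R 0 + (\<sigma> / r) *\<^sub>R q) - (((q \<bullet> p 0) / (r * d 0)) *\<^sub>R (\<sigma> *\<^sub>R a + h) + ((q \<bullet> h - \<sigma> * (q \<bullet> a)) / (2 * r\<^sup>2)) *\<^sub>R p 0)
   + ((2 * (q \<bullet> a) / r) *\<^sub>R h + 0 *\<^sub>R (u + 0 *\<^sub>R h))) (at 0)"
  unfolding G_def[abs_def]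
  by (intro has_vector_derivative_add has_vector_derivative_diff has_vector_derivative_scaleR dsr dc dp dl has_vector_derivative_const DERIV_const)
 moreover have "((s 0 / r) *\<^sub>R 0 + (\<sigma> / r) *\<^sub>R q) - (((q \<bullet> p 0) / (r * d 0)) *\<^sub>R (\<sigma> *\<^sub>R a + h) + ((q \<bullet> h - \<sigma> * (q \<bullet> a)) / (2 * r\<^sup>2)) *\<^sub>R p 0)
   + ((2 * (q \<bullet> a) / r) *\<^sub>R h + 0 *\<^sub>R (u + 0 *\<^sub>R h)) = dflow e h (v, w, n)"
 proof -
  have "dflow e h (v, w, n) = (1 / r\<^sup>2) *\<^sub>R ((r * \<sigma>) *\<^sub>R q - (q \<bullet> h) *\<^sub>R (r *\<^sub>R a) + (r * (q \<bullet> a)) *\<^sub>R h)"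
   unfolding dflow_def Let_def prod.case q_def[symmetric] u_def[symmetric] r_def[symmetric]
   by (subst (1 2 3) ua) (simp add: \<sigma>_def)
  then have DF: "dflow e h (v, w, n) = (1 / r) *\<^sub>R (\<sigma> *\<^sub>R q - (q \<bullet> h) *\<^sub>R a + (q \<bullet> a) *\<^sub>R h)"
   using r by (simp add: vec_eq_iff field_simps power2_eq_square)
  have c2: "((q \<bullet> h - \<sigma> * (q \<bullet> a)) / (2 * r\<^sup>2)) *\<^sub>R p 0 = ((q \<bullet> h - \<sigma> * (q \<bullet> a)) / r) *\<^sub>R a"
   unfolding p0 using r by (simp add: power2_eq_square)
  show ?thesis unfolding c0 c2 DF using r
   by (simp add: vec_eq_iff) (simp add: field_simps)
 qed
 ultimately have dG: "(G has_vector_derivative dflow e h (v, w, n)) (at 0)" by simp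
 have GF: "flow_q e (t *\<^sub>R h) q n = G t" if "u + t *\<^sub>R h \<noteq> 0" for t
 proof -
  have st: "s t > 0" using that by (simp add: s_def)
  define b where "b = (u + t *\<^sub>R h) /\<^sub>R norm (u + t *\<^sub>R h)"
  have sb: "s t *\<^sub>R b = u + t *\<^sub>R h" using that by (simp add: s_def b_def)
  have sab: "s t *\<^sub>R (a + b) = p t" unfolding scaleR_add_right sb p_def ..
  have D: "s t * (1 + a \<bullet> b) = d t"
  proof -
   have "s t * (a \<bullet> b) = a \<bullet> (s t *\<^sub>R b)" by simp
   then show ?thesis unfolding sb by (simp add: d_def distrib_left)
  qed
  have quot: "(q \<bullet> (a + b)) / (1 + a \<bullet> b) = (q \<bullet> p t) / d t"
   unfolding D[symmetric] sab[symmetric] using st by simp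
  have "flow_q e (t *\<^sub>R h) q n = (s t / r) *\<^sub>R minrot a b q"
   using flow_q_eq[OF n e, of q "t *\<^sub>R h"] u0 that by (simp add: urot_def s_def r_def a_def b_def u_def q_def)
  also have "\<dots> = (s t / r) *\<^sub>R q - ((q \<bullet> p t) / d t / r) *\<^sub>R (s t *\<^sub>R (a + b)) + (2 * (q \<bullet> a) / r) *\<^sub>R (s t *\<^sub>R b)"
   unfolding minrot_def quot by (simp add: scaleR_add_right scaleR_diff_right mult_ac)
  also have "\<dots> = G t" unfolding sab sb G_def by (simp add: mult.commute)
  finally show ?thesis .
 qed
 show ?thesis
  unfolding q_def[symmetric]
 proof (rule has_vector_derivative_transform_within[OF dG])
  \<comment> \<open>Within this radius \<open>t *\<^sub>R h\<close> is shorter than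
    \<open>u\<close>, so their sum does not vanish; the summand 1 covers
    \<open>h = 0\<close>.\<close>
  show "0 < r / (norm h + 1)" using r by (simp add: add_nonneg_pos)
  fix t :: real assume "dist t 0 < r / (norm h + 1)"
  then have "\<bar>t\<bar> * (norm h + 1) < r" by (simp add: pos_less_divide_eq add_nonneg_pos)
  moreover have "\<bar>t\<bar> * norm h \<le> \<bar>t\<bar> * (norm h + 1)" by (intro mult_left_mono) auto
  ultimately have "norm (t *\<^sub>R h) < norm u" by (simp add: r_def)
  then have "u + t *\<^sub>R h \<noteq> 0" by (metis add.inverse_inverse eq_neg_iff_add_eq_0 less_irrefl norm_minus_cancel)
  then show "G t = flow_q e (t *\<^sub>R h) q n" by (rule GF[symmetric])
 qed simp
qed

section \<open>The collision measure with kernel and its symmetries\<close>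

lemma lborel_lborel_S2_pair: "pair_sigma_finite (lborel :: vec3 measure) ((lborel :: vec3 measure) \<Otimes>\<^sub>M S2)"
 by (rule pair_sigma_finite.intro[OF sigma_finite_lborel sigma_finite_lborel_S2])

lemma measurable_triple_iff:
 "f \<in> borel_measurable (borel \<Otimes>\<^sub>M (borel \<Otimes>\<^sub>M borel)) \<longleftrightarrow> f \<in> borel_measurable (borel :: (vec3 \<times> vec3 \<times> vec3) measure)"
 by (simp add: borel_prod)

lemma measurable_kcos[measurable]: "kcos \<in> borel_measurable (borel \<Otimes>\<^sub>M (borel \<Otimes>\<^sub>M borel))"
 unfolding kcos_def by measurable

lemma measurable_vpost[measurable]: "(\<lambda>(v, w, n). vpost e v w n) \<in> borel_measurable (borel \<Otimes>\<^sub>M (borel \<Otimes>\<^sub>M borel))"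
 unfolding vpost_def by measurable

text \<open>Here the kernel is Borel, nonnegative and even on the whole line.
  \<open>collision_kernel\<close> will reach this situation by cutting a given kernel off outside
  [-1, 1].\<close>

locale collision =
 fixes e :: real and B :: "real \<Rightarrow> real"
 assumes e0: "0 < e" and e1: "e \<le> 1" and Bm[measurable]: "B \<in> borel_measurable borel"
  and B0: "\<And>s. 0 \<le> B s" and Be: "\<And>s. B (- s) = B s"
  and Bi: "(\<integral>\<^sup>+c. ennreal (B c) * indicator {-1..1} c \<partial>lborel) = 2"
begin

definition KM :: "(vec3 \<times> vec3 \<times> vec3) measure" where
 "KM = density M3 (\<lambda>\<omega>. ennreal (B (kcos \<omega>)))"

lemma sets_KM[measurable_cong, simp]: "sets KM = sets borel"
 by (simp add: KM_def sets_M3)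

lemma space_KM[simp]: "space KM = UNIV"
 by (simp add: KM_def)

lemma Bk_measurable: "(\<lambda>\<omega>. ennreal (B (kcos \<omega>))) \<in> borel_measurable borel"
proof -
 have "(\<lambda>\<omega>. ennreal (B (kcos \<omega>))) \<in> borel_measurable (borel \<Otimes>\<^sub>M (borel \<Otimes>\<^sub>M borel))" by measurable
 then show ?thesis by (simp only: measurable_triple_iff)
qed

lemma nn_integral_KM:
 assumes "H \<in> borel_measurable borel"
 shows "(\<integral>\<^sup>+\<omega>. H \<omega> \<partial>KM) = (\<integral>\<^sup>+\<omega>. ennreal (B (kcos \<omega>)) * H \<omega> \<partial>M3)"
 unfolding KM_def using assms Bk_measurable by (intro nn_integral_density) (simp_all only: measurable_M3_eq)

lemma AE_KM_good:
 "AE \<omega> in KM. norm (snd (snd \<omega>)) = 1 \<and> fst \<omega> - fst (snd \<omega>) \<noteq> 0 \<and> relu e (fst \<omega> - fst (snd \<omega>)) (snd (snd \<omega>)) \<noteq> b"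
proof -
 have "(\<lambda>\<omega>. ennreal (B (kcos \<omega>))) \<in> borel_measurable M3"
  using Bk_measurable by (simp only: measurable_M3_eq)
 from AE_density[OF this] show ?thesis
  unfolding KM_def using AE_M3[OF e0, of 0 b] by auto
qed

lemma nn_integral_kernel:
 assumes "v \<noteq> w"
 shows "(\<integral>\<^sup>+n. ennreal (B (kcos (v, w, n))) \<partial>S2) = ennreal (4 * pi)"
proof -
 let ?k = "(v - w) /\<^sub>R norm (v - w)"
 have k: "norm ?k = 1" using assms by simp
 have "(\<integral>\<^sup>+n. ennreal (B (n \<bullet> ?k)) \<partial>S2) = ennreal (2 * pi) * 2"
  using nn_integral_S2_zonal[OF Bm B0 k] Bi by simp
 also have "\<dots> = ennreal (4 * pi)" by (simp add: ennreal_mult'[symmetric] flip: ennreal_numeral)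
 finally show ?thesis by (simp add: kcos_def)
qed

text \<open>For \<open>v \<noteq> w\<close> the kernel has mass \<open>4 * pi\<close> over the
  sphere, and for each \<open>v\<close> the diagonal is a single point.\<close>

lemma nn_integral_KM_prod:
 assumes [measurable]: "F \<in> borel_measurable borel" "G \<in> borel_measurable borel"
 shows "(\<integral>\<^sup>+\<omega>. F (fst \<omega>) * G (fst (snd \<omega>)) \<partial>KM) = ennreal (4 * pi) * ((\<integral>\<^sup>+v. F v \<partial>lborel) * (\<integral>\<^sup>+w. G w \<partial>lborel))"
proof -
 have m: "(\<lambda>\<omega> :: vec3 \<times> vec3 \<times> vec3. F (fst \<omega>) * G (fst (snd \<omega>))) \<in> borel_measurable borel"
 proof -
  have "(\<lambda>\<omega> :: vec3 \<times> vec3 \<times> vec3. F (fst \<omega>) * G (fst (snd \<omega>))) \<in> borel_measurable (borel \<Otimes>\<^sub>M (borel \<Otimes>\<^sub>M borel))" by measurable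
  then show ?thesis by (simp only: measurable_triple_iff)
 qed
 have "(\<integral>\<^sup>+\<omega>. F (fst \<omega>) * G (fst (snd \<omega>)) \<partial>KM) = (\<integral>\<^sup>+\<omega>. ennreal (B (kcos \<omega>)) * (F (fst \<omega>) * G (fst (snd \<omega>))) \<partial>M3)"
  by (rule nn_integral_KM[OF m])
 also have "\<dots> = (\<integral>\<^sup>+v. \<integral>\<^sup>+w. \<integral>\<^sup>+n. ennreal (B (kcos (v, w, n))) * (F v * G w) \<partial>S2 \<partial>lborel \<partial>lborel)"
  by (subst nn_integral_M3(1)) (use Bk_measurable m in simp_all)
 also have "\<dots> = (\<integral>\<^sup>+v. \<integral>\<^sup>+w. ennreal (4 * pi) * F v * G w \<partial>lborel \<partial>lborel)"
 proof (rule nn_integral_cong, rule nn_integral_cong_AE)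
  fix v :: vec3
  have "AE w in lborel. w \<noteq> v" by (rule AE_lborel_singleton)
  then show "AE w in lborel. (\<integral>\<^sup>+n. ennreal (B (kcos (v, w, n))) * (F v * G w) \<partial>S2) = ennreal (4 * pi) * F v * G w"
  proof eventually_elim
   case (elim w)
   have "(\<integral>\<^sup>+n. ennreal (B (kcos (v, w, n))) * (F v * G w) \<partial>S2) = (\<integral>\<^sup>+n. ennreal (B (kcos (v, w, n))) \<partial>S2) * (F v * G w)"
    by (rule nn_integral_multc) (simp only: kcos_def prod.case, measurable)
   then show ?case using nn_integral_kernel[of v w] elim by (simp add: mult.assoc)
  qed
 qed
 also have "\<dots> = (\<integral>\<^sup>+v. ennreal (4 * pi) * F v * (\<integral>\<^sup>+w. G w \<partial>lborel) \<partial>lborel)"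
  by (intro nn_integral_cong nn_integral_cmult) measurable
 also have "\<dots> = (\<integral>\<^sup>+v. ennreal (4 * pi) * F v \<partial>lborel) * (\<integral>\<^sup>+w. G w \<partial>lborel)"
  by (rule nn_integral_multc) measurable
 also have "(\<integral>\<^sup>+v. ennreal (4 * pi) * F v \<partial>lborel) = ennreal (4 * pi) * (\<integral>\<^sup>+v. F v \<partial>lborel)"
  by (rule nn_integral_cmult) measurable
 finally show ?thesis by (simp add: mult.assoc)
qed

lemma integrable_KM:
 fixes F G :: "vec3 \<Rightarrow> real"
 assumes F: "integrable lborel F" and G: "integrable lborel G" and \<Phi>: "\<Phi> \<in> borel_measurable borel"
  and b: "AE \<omega> in KM. \<bar>\<Phi> \<omega>\<bar> \<le> C"
 shows "integrable KM (\<lambda>\<omega>. F (fst \<omega>) * G (fst (snd \<omega>)) * \<Phi> \<omega>)"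
proof -
 have [measurable]: "F \<in> borel_measurable borel" "G \<in> borel_measurable borel"
  using F G by auto
 have m: "(\<lambda>\<omega> :: vec3 \<times> vec3 \<times> vec3. F (fst \<omega>) * G (fst (snd \<omega>))) \<in> borel_measurable borel"
 proof -
  have "(\<lambda>\<omega> :: vec3 \<times> vec3 \<times> vec3. F (fst \<omega>) * G (fst (snd \<omega>))) \<in> borel_measurable (borel \<Otimes>\<^sub>M (borel \<Otimes>\<^sub>M borel))" by measurable
  then show ?thesis by (simp only: measurable_triple_iff)
 qed
 have i: "integrable KM (\<lambda>\<omega>. F (fst \<omega>) * G (fst (snd \<omega>)))"
 proof (rule integrableI_bounded)
  show "(\<lambda>\<omega>. F (fst \<omega>) * G (fst (snd \<omega>))) \<in> borel_measurable KM" using m by simp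
  have "(\<integral>\<^sup>+\<omega>. ennreal (norm (F (fst \<omega>) * G (fst (snd \<omega>)))) \<partial>KM) = (\<integral>\<^sup>+\<omega>. ennreal \<bar>F (fst \<omega>)\<bar> * ennreal \<bar>G (fst (snd \<omega>))\<bar> \<partial>KM)"
   by (simp add: abs_mult ennreal_mult)
  also have "\<dots> = ennreal (4 * pi) * ((\<integral>\<^sup>+v. ennreal \<bar>F v\<bar> \<partial>lborel) * (\<integral>\<^sup>+w. ennreal \<bar>G w\<bar> \<partial>lborel))"
   by (rule nn_integral_KM_prod[of "\<lambda>v. ennreal \<bar>F v\<bar>" "\<lambda>v. ennreal \<bar>G v\<bar>"]) measurable
  also have "\<dots> < \<infinity>"
   using F G by (simp add: nn_integral_eq_integral ennreal_mult_less_top)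
  finally show "(\<integral>\<^sup>+\<omega>. ennreal (norm (F (fst \<omega>) * G (fst (snd \<omega>)))) \<partial>KM) < \<infinity>" .
 qed
 show ?thesis
 proof (rule Bochner_Integration.integrable_bound)
  show "integrable KM (\<lambda>\<omega>. C * (F (fst \<omega>) * G (fst (snd \<omega>))))" using i by (rule integrable_mult_right)
  show "(\<lambda>\<omega>. F (fst \<omega>) * G (fst (snd \<omega>)) * \<Phi> \<omega>) \<in> borel_measurable KM" using m \<Phi> by simp
  show "AE \<omega> in KM. norm (F (fst \<omega>) * G (fst (snd \<omega>)) * \<Phi> \<omega>) \<le> norm (C * (F (fst \<omega>) * G (fst (snd \<omega>))))"
   using b
  proof eventually_elim
   case (elim \<omega>)
   then have "\<bar>\<Phi> \<omega>\<bar> \<le> \<bar>C\<bar>" by linarith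
   then have "\<bar>F (fst \<omega>) * G (fst (snd \<omega>))\<bar> * \<bar>\<Phi> \<omega>\<bar> \<le> \<bar>F (fst \<omega>) * G (fst (snd \<omega>))\<bar> * \<bar>C\<bar>"
    by (rule mult_left_mono) simp
   then show ?case by (simp only: real_norm_def abs_mult mult_ac)
  qed
 qed
qed

lemma AE_KM_flow:
 "AE \<omega> in KM. kcos (flow e y \<omega>) = kcos \<omega> \<and> vpost e (fst (flow e y \<omega>)) (fst (snd (flow e y \<omega>))) (snd (snd (flow e y \<omega>)))
  = vpost e (fst \<omega>) (fst (snd \<omega>)) (snd (snd \<omega>)) + 2 *\<^sub>R y"
 "AE \<omega> in M3. kcos (flow e y \<omega>) = kcos \<omega>"
proof -
 have *: "kcos (flow e y \<omega>) = kcos \<omega> \<and> vpost e (fst (flow e y \<omega>)) (fst (snd (flow e y \<omega>))) (snd (snd (flow e y \<omega>)))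
  = vpost e (fst \<omega>) (fst (snd \<omega>)) (snd (snd \<omega>)) + 2 *\<^sub>R y"
  if "norm (snd (snd \<omega>)) = 1" "fst \<omega> - fst (snd \<omega>) \<noteq> 0" "relu e (fst \<omega> - fst (snd \<omega>)) (snd (snd \<omega>)) \<noteq> 0"
   "relu e (fst \<omega> - fst (snd \<omega>)) (snd (snd \<omega>)) \<noteq> - y" for \<omega>
 proof -
  obtain v w n where \<omega>: "\<omega> = (v, w, n)" by (metis prod.exhaust)
  obtain v' w' n' where f: "flow e y (v, w, n) = (v', w', n')" by (metis prod.exhaust)
  have "relu e (v - w) n + y \<noteq> 0" using that(4) by (simp add: \<omega> eq_neg_iff_add_eq_0)
  then show ?thesis using flow_props[OF e0 _ _ _ _ f] that by (simp add: \<omega> f)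
 qed
 show "AE \<omega> in KM. kcos (flow e y \<omega>) = kcos \<omega> \<and> vpost e (fst (flow e y \<omega>)) (fst (snd (flow e y \<omega>))) (snd (snd (flow e y \<omega>)))
  = vpost e (fst \<omega>) (fst (snd \<omega>)) (snd (snd \<omega>)) + 2 *\<^sub>R y"
  using AE_KM_good[of 0] AE_KM_good[of "- y"] by eventually_elim (rule *, auto)
 show "AE \<omega> in M3. kcos (flow e y \<omega>) = kcos \<omega>"
  using AE_M3[OF e0, of 0 0] AE_M3[OF e0, of 0 "- y"] by eventually_elim (rule *[THEN conjunct1], auto)
qed

lemma distr_KM_eqI:
 assumes T: "T \<in> borel_measurable borel"
  and inv: "\<And>H. H \<in> borel_measurable borel \<Longrightarrow> (\<integral>\<^sup>+\<omega>. ennreal (B (kcos \<omega>)) * H (T \<omega>) \<partial>M3) = (\<integral>\<^sup>+\<omega>. ennreal (B (kcos \<omega>)) * H \<omega> \<partial>M3)"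
 shows "distr KM borel T = KM"
proof (rule measure_eqI)
 have Tm: "T \<in> KM \<rightarrow>\<^sub>M borel" using T by (simp cong: measurable_cong_sets)
 fix A assume "A \<in> sets (distr KM borel T)"
 then have A: "A \<in> sets borel" by simp
 have "emeasure (distr KM borel T) A = (\<integral>\<^sup>+x. indicator A x \<partial>distr KM borel T)" using A by simp
 also have "\<dots> = (\<integral>\<^sup>+x. indicator A (T x) \<partial>KM)" by (rule nn_integral_distr[OF Tm]) (use A in simp)
 also have "\<dots> = (\<integral>\<^sup>+x. ennreal (B (kcos x)) * indicator A (T x) \<partial>M3)"
  by (rule nn_integral_KM) (rule measurable_compose[OF T], use A in simp)
 also have "\<dots> = (\<integral>\<^sup>+x. ennreal (B (kcos x)) * indicator A x \<partial>M3)" by (rule inv) (use A in simp)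
 also have "\<dots> = (\<integral>\<^sup>+x. indicator A x \<partial>KM)" by (rule nn_integral_KM[symmetric]) (use A in simp)
 finally show "emeasure (distr KM borel T) A = emeasure KM A" using A by simp
qed simp

lemma distr_KM_flow: "distr KM borel (flow e y) = KM"
proof (rule distr_KM_eqI[OF measurable_flow])
 fix H :: "vec3 \<times> vec3 \<times> vec3 \<Rightarrow> ennreal" assume H: "H \<in> borel_measurable borel"
 have "(\<integral>\<^sup>+\<omega>. ennreal (B (kcos \<omega>)) * H (flow e y \<omega>) \<partial>M3) = (\<integral>\<^sup>+\<omega>. ennreal (B (kcos (flow e y \<omega>))) * H (flow e y \<omega>) \<partial>M3)"
 proof (rule nn_integral_cong_AE)
  show "AE \<omega> in M3. ennreal (B (kcos \<omega>)) * H (flow e y \<omega>) = ennreal (B (kcos (flow e y \<omega>))) * H (flow e y \<omega>)"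
   using AE_KM_flow(2)[of y] by eventually_elim simp
 qed
 also have "\<dots> = (\<integral>\<^sup>+\<omega>. ennreal (B (kcos \<omega>)) * H \<omega> \<partial>M3)"
  by (rule nn_integral_flow[OF e0, where H="\<lambda>\<omega>. ennreal (B (kcos \<omega>)) * H \<omega>"]) (use Bk_measurable H in measurable)
 finally show "(\<integral>\<^sup>+\<omega>. ennreal (B (kcos \<omega>)) * H (flow e y \<omega>) \<partial>M3) = (\<integral>\<^sup>+\<omega>. ennreal (B (kcos \<omega>)) * H \<omega> \<partial>M3)" .
qed

definition swap3 :: "vec3 \<times> vec3 \<times> vec3 \<Rightarrow> vec3 \<times> vec3 \<times> vec3" where
 "swap3 = (\<lambda>(v, w, n). (w, v, n))"

lemma measurable_swap3: "swap3 \<in> borel_measurable borel"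
proof -
 have "swap3 \<in> (borel \<Otimes>\<^sub>M (borel \<Otimes>\<^sub>M borel)) \<rightarrow>\<^sub>M (borel \<Otimes>\<^sub>M (borel \<Otimes>\<^sub>M borel))"
  unfolding swap3_def by measurable
 then show ?thesis by (simp add: borel_prod)
qed

lemma kcos_swap3: "kcos (swap3 \<omega>) = - kcos \<omega>"
proof -
 obtain v w n where \<omega>: "\<omega> = (v, w, n)" by (metis prod.exhaust)
 have "w - v = - (v - w)" by simp
 then show ?thesis unfolding \<omega> kcos_def swap3_def prod.case by (simp only: norm_minus_cancel scaleR_minus_right inner_minus_right)
qed

text \<open>Exchanging the particles with \<open>n\<close> kept reverses the sign of
  \<open>kcos\<close>; evenness of the kernel makes this a symmetry.\<close>

lemma distr_KM_swap3: "distr KM borel swap3 = KM"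
proof (rule distr_KM_eqI[OF measurable_swap3])
 fix H :: "vec3 \<times> vec3 \<times> vec3 \<Rightarrow> ennreal" assume H: "H \<in> borel_measurable borel"
 let ?H = "\<lambda>\<omega>. ennreal (B (kcos \<omega>)) * H \<omega>"
 have Hm: "?H \<in> borel_measurable borel" using Bk_measurable H by measurable
 have Hm'[measurable]: "?H \<in> borel_measurable (borel \<Otimes>\<^sub>M (borel \<Otimes>\<^sub>M borel))"
  using Hm by (simp only: measurable_triple_iff)
 have "(\<integral>\<^sup>+\<omega>. ennreal (B (kcos \<omega>)) * H (swap3 \<omega>) \<partial>M3) = (\<integral>\<^sup>+\<omega>. ?H (swap3 \<omega>) \<partial>M3)"
  by (simp add: kcos_swap3 Be)
 also have "\<dots> = (\<integral>\<^sup>+n. \<integral>\<^sup>+v. \<integral>\<^sup>+w. ?H (swap3 (v, w, n)) \<partial>lborel \<partial>lborel \<partial>S2)"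
  by (rule nn_integral_M3(2)) (rule measurable_compose[OF measurable_swap3 Hm])
 also have "\<dots> = (\<integral>\<^sup>+n. \<integral>\<^sup>+v. \<integral>\<^sup>+w. ?H (w, v, n) \<partial>lborel \<partial>lborel \<partial>S2)"
  by (simp add: swap3_def)
 also have "\<dots> = (\<integral>\<^sup>+n. \<integral>\<^sup>+w. \<integral>\<^sup>+v. ?H (w, v, n) \<partial>lborel \<partial>lborel \<partial>S2)"
 proof (rule nn_integral_cong)
  fix n :: vec3
  have "(\<lambda>(w, v). ?H (w, v, n)) \<in> borel_measurable (lborel \<Otimes>\<^sub>M lborel)" by measurable
  from lborel_pair.Fubini'[OF this]
  show "(\<integral>\<^sup>+v. \<integral>\<^sup>+w. ?H (w, v, n) \<partial>lborel \<partial>lborel) = (\<integral>\<^sup>+w. \<integral>\<^sup>+v. ?H (w, v, n) \<partial>lborel \<partial>lborel)" by simp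
 qed
 also have "\<dots> = (\<integral>\<^sup>+\<omega>. ?H \<omega> \<partial>M3)"
  by (rule nn_integral_M3(2)[OF Hm, symmetric])
 finally show "(\<integral>\<^sup>+\<omega>. ennreal (B (kcos \<omega>)) * H (swap3 \<omega>) \<partial>M3) = (\<integral>\<^sup>+\<omega>. ?H \<omega> \<partial>M3)" .
qed

lemma integral_KM_distr:
 fixes H :: "vec3 \<times> vec3 \<times> vec3 \<Rightarrow> real"
 assumes T: "T \<in> borel_measurable borel" "distr KM borel T = KM" and H: "H \<in> borel_measurable borel"
 shows "(\<integral>\<omega>. H (T \<omega>) \<partial>KM) = (\<integral>\<omega>. H \<omega> \<partial>KM)" "integrable KM (\<lambda>\<omega>. H (T \<omega>)) \<longleftrightarrow> integrable KM H"
proof -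
 have Tm: "T \<in> KM \<rightarrow>\<^sub>M borel" using T by (simp cong: measurable_cong_sets)
 show "(\<integral>\<omega>. H (T \<omega>) \<partial>KM) = (\<integral>\<omega>. H \<omega> \<partial>KM)"
  using integral_distr[OF Tm H] T(2) by simp
 show "integrable KM (\<lambda>\<omega>. H (T \<omega>)) \<longleftrightarrow> integrable KM H"
  using integrable_distr_eq[OF Tm H] T(2) by simp
qed

text \<open>Integrating out the second particle and \<open>n\<close> leaves a pairing of
  \<open>F\<close> with a fixed function, bounded because the kernel has mass \<open>4 * pi\<close>
  for every direction. This brings collision integrals into the form of
  \<open>weak_divergence_extend\<close>.\<close>

lemma KM_average:
 fixes G :: "vec3 \<Rightarrow> real"
 assumes G: "integrable lborel G" and \<Phi>: "\<Phi> \<in> borel_measurable borel" and b: "\<And>\<omega>. \<bar>\<Phi> \<omega>\<bar> \<le> C"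
 shows "\<exists>A C'. A \<in> borel_measurable borel \<and> (\<forall>v. \<bar>A v\<bar> \<le> C') \<and>
  (\<forall>F. integrable lborel F \<longrightarrow> (LBINT v. F v * A v) = (\<integral>\<omega>. F (fst \<omega>) * G (fst (snd \<omega>)) * \<Phi> \<omega> \<partial>KM))"
proof -
 interpret P: pair_sigma_finite "lborel :: vec3 measure" "(lborel :: vec3 measure) \<Otimes>\<^sub>M S2"
  by (rule lborel_lborel_S2_pair)
 have [measurable]: "G \<in> borel_measurable borel" using G by auto
 have \<Phi>m[measurable]: "\<Phi> \<in> borel_measurable (borel \<Otimes>\<^sub>M (borel \<Otimes>\<^sub>M borel))"
  using \<Phi> by (simp only: measurable_triple_iff)
 have C0: "0 \<le> C" using b[of undefined] by linarith
 define K where "K v x = B (kcos (v, x)) * (G (fst x) * \<Phi> (v, x))" for v x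
 define A where "A v = (\<integral>x. K v x \<partial>(lborel \<Otimes>\<^sub>M S2))" for v
 have Km[measurable]: "(\<lambda>(v, x). K v x) \<in> borel_measurable (borel \<Otimes>\<^sub>M (borel \<Otimes>\<^sub>M borel))"
  unfolding K_def by measurable
 have "A \<in> borel_measurable lborel" unfolding A_def by measurable
 then have Am: "A \<in> borel_measurable borel" by simp
 let ?n = "\<integral>w. \<bar>G w\<bar> \<partial>lborel"
 have nnle: "(\<integral>\<^sup>+x. ennreal \<bar>K v x\<bar> \<partial>(lborel \<Otimes>\<^sub>M S2)) \<le> ennreal (4 * pi * (C * ?n))" for v
 proof -
  have "(\<integral>\<^sup>+x. ennreal \<bar>K v x\<bar> \<partial>(lborel \<Otimes>\<^sub>M S2)) \<le> (\<integral>\<^sup>+x. ennreal (B (kcos (v, x))) * ennreal (C * \<bar>G (fst x)\<bar>) \<partial>(lborel \<Otimes>\<^sub>M S2))"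
  proof (rule nn_integral_mono)
   fix x :: "vec3 \<times> vec3"
   have "\<bar>K v x\<bar> = B (kcos (v, x)) * (\<bar>G (fst x)\<bar> * \<bar>\<Phi> (v, x)\<bar>)" using B0 by (simp add: K_def abs_mult)
   also have "\<dots> \<le> B (kcos (v, x)) * (\<bar>G (fst x)\<bar> * C)" using B0 b by (intro mult_left_mono) auto
   finally show "ennreal \<bar>K v x\<bar> \<le> ennreal (B (kcos (v, x))) * ennreal (C * \<bar>G (fst x)\<bar>)"
    using B0 C0 by (simp add: ennreal_mult'[symmetric] mult.commute[of C] ennreal_leI)
  qed
  also have "\<dots> = (\<integral>\<^sup>+w. \<integral>\<^sup>+n. ennreal (B (kcos (v, w, n))) * ennreal (C * \<bar>G w\<bar>) \<partial>S2 \<partial>lborel)"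
   by (subst S2.nn_integral_fst[symmetric]) simp_all
  also have "\<dots> = (\<integral>\<^sup>+w. ennreal (4 * pi) * ennreal (C * \<bar>G w\<bar>) \<partial>lborel)"
  proof (rule nn_integral_cong_AE)
   have "AE w in lborel. w \<noteq> v" by (rule AE_lborel_singleton)
   then show "AE w in lborel. (\<integral>\<^sup>+n. ennreal (B (kcos (v, w, n))) * ennreal (C * \<bar>G w\<bar>) \<partial>S2) = ennreal (4 * pi) * ennreal (C * \<bar>G w\<bar>)"
   proof eventually_elim
    case (elim w)
    have "(\<integral>\<^sup>+n. ennreal (B (kcos (v, w, n))) * ennreal (C * \<bar>G w\<bar>) \<partial>S2) = (\<integral>\<^sup>+n. ennreal (B (kcos (v, w, n))) \<partial>S2) * ennreal (C * \<bar>G w\<bar>)"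
     by (rule nn_integral_multc) (simp only: kcos_def prod.case, measurable)
    then show ?case using nn_integral_kernel[of v w] elim by simp
   qed
  qed
  also have "\<dots> = (\<integral>\<^sup>+w. ennreal (4 * pi * (C * \<bar>G w\<bar>)) \<partial>lborel)"
   by (simp add: ennreal_mult')
  also have "\<dots> = ennreal (LBINT w. 4 * pi * (C * \<bar>G w\<bar>))"
   using G C0 by (intro nn_integral_eq_integral) auto
  finally show ?thesis by simp
 qed
 have Ab: "\<bar>A v\<bar> \<le> 4 * pi * (C * ?n)" for v
 proof -
  have [measurable]: "K v \<in> borel_measurable (lborel \<Otimes>\<^sub>M S2)"
   using measurable_compose[OF measurable_Pair1'[of v borel "borel \<Otimes>\<^sub>M borel"] Km] by simp
  have i: "integrable (lborel \<Otimes>\<^sub>M S2) (K v)"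
   by (rule integrableI_bounded) (use nnle[of v] in \<open>auto intro: le_less_trans\<close>)
  have "ennreal \<bar>A v\<bar> \<le> (\<integral>\<^sup>+x. ennreal \<bar>K v x\<bar> \<partial>(lborel \<Otimes>\<^sub>M S2))"
   unfolding A_def using integral_norm_bound_ennreal[OF i] by simp
  also have "\<dots> \<le> ennreal (4 * pi * (C * ?n))" by (rule nnle)
  finally show ?thesis using C0 by (subst (asm) ennreal_le_iff) (auto intro!: mult_nonneg_nonneg)
 qed
 have "(LBINT v. F v * A v) = (\<integral>\<omega>. F (fst \<omega>) * G (fst (snd \<omega>)) * \<Phi> \<omega> \<partial>KM)" if F: "integrable lborel F" for F
 proof -
  have [measurable]: "F \<in> borel_measurable borel" using F by auto
  let ?H = "\<lambda>\<omega>. F (fst \<omega>) * G (fst (snd \<omega>)) * \<Phi> \<omega>"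
  have Hm: "?H \<in> borel_measurable M3"
  proof -
   have "?H \<in> borel_measurable (borel \<Otimes>\<^sub>M (borel \<Otimes>\<^sub>M borel))" by measurable
   then show ?thesis by (simp only: measurable_triple_iff measurable_M3_eq)
  qed
  have Bk: "(\<lambda>\<omega>. B (kcos \<omega>)) \<in> borel_measurable M3"
  proof -
   have "(\<lambda>\<omega>. B (kcos \<omega>)) \<in> borel_measurable (borel \<Otimes>\<^sub>M (borel \<Otimes>\<^sub>M borel))" by measurable
   then show ?thesis by (simp only: measurable_triple_iff measurable_M3_eq)
  qed
  have i: "integrable KM ?H" by (rule integrable_KM[OF F G \<Phi>, of C]) (rule AE_I2, rule b)
  then have i': "integrable M3 (\<lambda>\<omega>. B (kcos \<omega>) * ?H \<omega>)"
   unfolding KM_def using Hm Bk B0 by (subst (asm) integrable_density) auto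
  have "(\<integral>\<omega>. ?H \<omega> \<partial>KM) = (\<integral>\<omega>. B (kcos \<omega>) * ?H \<omega> \<partial>M3)"
   unfolding KM_def using Hm Bk B0 by (subst integral_density) auto
  also have "\<dots> = (\<integral>v. \<integral>x. F v * K v x \<partial>(lborel \<Otimes>\<^sub>M S2) \<partial>lborel)"
   using P.integral_fst'[OF i'[unfolded M3_def]] by (simp add: M3_def K_def mult_ac)
  also have "\<dots> = (LBINT v. F v * A v)" by (simp add: A_def)
  finally show ?thesis by simp
 qed
 then show ?thesis using Am Ab by blast
qed

end

section \<open>Integration by parts along the flow for test functions\<close>

definition vprime :: "real \<Rightarrow> vec3 \<times> vec3 \<times> vec3 \<Rightarrow> vec3" where
 "vprime e = (\<lambda>(v, w, n). vpost e v w n)"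

lemma measurable_vprime'[measurable]: "vprime e \<in> (borel \<Otimes>\<^sub>M (borel \<Otimes>\<^sub>M borel)) \<rightarrow>\<^sub>M borel"
 unfolding vprime_def by (rule measurable_vpost)

lemma borel_triple: "(borel \<Otimes>\<^sub>M (borel \<Otimes>\<^sub>M borel)) = (borel :: (vec3 \<times> vec3 \<times> vec3) measure)"
 by (simp add: borel_prod)

lemma measurable_vprime: "vprime e \<in> borel_measurable borel"
 using measurable_vprime'[of e] by (simp only: borel_triple)

lemma measurable_dflow: "dflow e h \<in> borel_measurable borel"
 using measurable_dflow'[of e h] by (simp only: borel_triple)

lemma
 assumes [measurable]: "F \<in> borel_measurable borel"
 shows measurable_comp_fst: "(\<lambda>\<omega>. F (fst \<omega>)) \<in> borel_measurable (borel :: (vec3 \<times> vec3 \<times> vec3) measure)"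
  and measurable_comp_fst_snd: "(\<lambda>\<omega>. F (fst (snd \<omega>))) \<in> borel_measurable (borel :: (vec3 \<times> vec3 \<times> vec3) measure)"
  and measurable_comp_snd_snd: "(\<lambda>\<omega>. F (snd (snd \<omega>))) \<in> borel_measurable (borel :: (vec3 \<times> vec3 \<times> vec3) measure)"
 unfolding borel_triple[symmetric] by measurable

lemma test_fun_chain:
 assumes "test_fun f" "(\<gamma> has_vector_derivative d) (at (0::real))"
 shows "((\<lambda>t. f (\<gamma> t)) has_real_derivative frechet_derivative f (at (\<gamma> 0)) d) (at 0)"
proof -
 have "(f has_derivative frechet_derivative f (at (\<gamma> 0))) (at (\<gamma> 0))"
  using test_fun_differentiable[OF assms(1)] by (simp add: frechet_derivative_works)
 then have "(f has_derivative frechet_derivative f (at (\<gamma> 0))) (at (\<gamma> 0) within range \<gamma>)"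
  by (rule has_derivative_at_withinI)
 then have "((f \<circ> \<gamma>) has_vector_derivative frechet_derivative f (at (\<gamma> 0)) d) (at 0)"
  using vector_derivative_diff_chain_within[OF assms(2)] by simp
 then show ?thesis by (simp add: has_real_derivative_iff_has_vector_derivative comp_def)
qed

lemma product3_difference:
 fixes a a' b b' c c' :: real
 assumes "\<bar>a\<bar> \<le> M" "\<bar>a'\<bar> \<le> M" "\<bar>b\<bar> \<le> M" "\<bar>b'\<bar> \<le> M" "\<bar>c\<bar> \<le> M" "\<bar>c'\<bar> \<le> M"
  "\<bar>a - a'\<bar> \<le> d" "\<bar>b - b'\<bar> \<le> d" "\<bar>c - c'\<bar> \<le> d"
 shows "\<bar>a * b * c - a' * b' * c'\<bar> \<le> 3 * (d * (M * M))"
proof -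
 have "a * b * c - a' * b' * c' = (a - a') * (b * c) + (b - b') * (a' * c) + (c - c') * (a' * b')"
  by (simp add: algebra_simps)
 also have "\<bar>\<dots>\<bar> \<le> \<bar>a - a'\<bar> * (\<bar>b\<bar> * \<bar>c\<bar>) + \<bar>b - b'\<bar> * (\<bar>a'\<bar> * \<bar>c\<bar>) + \<bar>c - c'\<bar> * (\<bar>a'\<bar> * \<bar>b'\<bar>)"
  unfolding abs_mult[symmetric] by linarith
 also have "\<dots> \<le> d * (M * M) + d * (M * M) + d * (M * M)"
  by (intro add_mono mult_mono) (use assms in \<open>auto intro: order_trans[OF abs_ge_zero]\<close>)
 finally show ?thesis by linarith
qed

context collision
begin

text \<open>\<open>D\<close> is the derivative of \<open>f v * g w * \<psi> v'\<close> along the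
  flow in direction \<open>h\<close>. The flow preserves \<open>KM\<close>, so every difference
  quotient integrates to zero, and dominated convergence passes this to \<open>D\<close>.\<close>

lemma flow_identity:
 fixes h :: vec3
 assumes f: "test_fun f" and g: "test_fun g" and \<psi>: "test_fun \<psi>"
 defines "D \<equiv> \<lambda>\<omega>. frechet_derivative f (at (fst \<omega>)) (h + (1/2) *\<^sub>R dflow e h \<omega>) * g (fst (snd \<omega>)) * \<psi> (vprime e \<omega>)
   + f (fst \<omega>) * frechet_derivative g (at (fst (snd \<omega>))) (h - (1/2) *\<^sub>R dflow e h \<omega>) * \<psi> (vprime e \<omega>)
   + f (fst \<omega>) * g (fst (snd \<omega>)) * frechet_derivative \<psi> (at (vprime e \<omega>)) (2 *\<^sub>R h)"
 shows "(\<integral>\<omega>. D \<omega> \<partial>KM) = 0"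
proof -
 note [measurable] = test_fun_measurable[OF f] test_fun_measurable[OF g] test_fun_measurable[OF \<psi>]
 define X :: "nat \<Rightarrow> real" where "X k = inverse (real (Suc k))" for k
 have X0: "X \<longlonglongrightarrow> 0" using LIMSEQ_inverse_real_of_nat by (simp add: X_def[abs_def])
 have Xp: "0 < X k" and X1: "X k \<le> 1" for k
 proof -
  show "0 < X k" by (simp add: X_def)
  have "(1::real) \<le> real (Suc k)" by simp
  then show "X k \<le> 1" unfolding X_def by (rule inverse_le_1_iff[THEN iffD2, OF disjI2])
 qed
 define \<Gamma> where "\<Gamma> \<omega> = f (fst \<omega>) * g (fst (snd \<omega>)) * \<psi> (vprime e \<omega>)" for \<omega>
 define \<Gamma>' where "\<Gamma>' k \<omega> = (\<Gamma> (flow e (X k *\<^sub>R h) \<omega>) - \<Gamma> \<omega>) / X k" for k \<omega>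
 obtain Mf where Mf: "\<And>x. \<bar>f x\<bar> \<le> Mf" using test_fun_bounded[OF f] by metis
 obtain Mg where Mg: "\<And>x. \<bar>g x\<bar> \<le> Mg" using test_fun_bounded[OF g] by metis
 obtain M\<psi> where M\<psi>: "\<And>x. \<bar>\<psi> x\<bar> \<le> M\<psi>" using test_fun_bounded[OF \<psi>] by metis
 define M where "M = \<bar>Mf\<bar> + \<bar>Mg\<bar> + \<bar>M\<psi>\<bar>"
 have M: "\<bar>f x\<bar> \<le> M" "\<bar>g x\<bar> \<le> M" "\<bar>\<psi> x\<bar> \<le> M" for x
  using Mf[of x] Mg[of x] M\<psi>[of x] unfolding M_def by linarith+
 obtain Lf where Lf: "Lf > 0" "\<And>x y. \<bar>f x - f y\<bar> \<le> Lf * norm (x - y)" using test_fun_lipschitz[OF f] by metis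
 obtain Lg where Lg: "Lg > 0" "\<And>x y. \<bar>g x - g y\<bar> \<le> Lg * norm (x - y)" using test_fun_lipschitz[OF g] by metis
 obtain L\<psi> where L\<psi>: "L\<psi> > 0" "\<And>x y. \<bar>\<psi> x - \<psi> y\<bar> \<le> L\<psi> * norm (x - y)" using test_fun_lipschitz[OF \<psi>] by metis
 define L where "L = Lf + Lg + L\<psi>"
 have LL: "Lf \<le> L" "Lg \<le> L" "L\<psi> \<le> L" "0 < L" using Lf(1) Lg(1) L\<psi>(1) by (simp_all add: L_def)
 have L: "\<bar>f x - f y\<bar> \<le> L * norm (x - y)" "\<bar>g x - g y\<bar> \<le> L * norm (x - y)" "\<bar>\<psi> x - \<psi> y\<bar> \<le> L * norm (x - y)" for x y
  using order_trans[OF Lf(2) mult_right_mono[OF LL(1) norm_ge_zero]]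
   order_trans[OF Lg(2) mult_right_mono[OF LL(2) norm_ge_zero]]
   order_trans[OF L\<psi>(2) mult_right_mono[OF LL(3) norm_ge_zero]] by blast+
 obtain Rf where Rf: "\<And>x. norm x > Rf \<Longrightarrow> f x = 0" using test_fun_support[OF f] by metis
 obtain Rg where Rg: "\<And>x. norm x > Rg \<Longrightarrow> g x = 0" using test_fun_support[OF g] by metis
 \<comment> \<open>\<open>c\<close> is the displacement rate of \<open>flow_dist\<close>; it also
   exceeds 2, the rate of the post-collisional velocity. Since \<open>X k \<le> 1\<close>, the term
   \<open>c * norm h\<close> in \<open>R\<close> covers the whole displacement: if \<open>v\<close>
   or \<open>w\<close> lies outside the ball of radius \<open>R\<close>, the product vanishes before
   and after the flow.\<close>
 define c where "c = 6 / e"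
 have c6: "6 \<le> c" using e0 e1 by (simp add: c_def field_simps)
 define R where "R = \<bar>Rf\<bar> + \<bar>Rg\<bar> + c * norm h"
 define W where "W = 3 * ((L * (c * norm h)) * (M * M))"
 have W0: "0 \<le> W" unfolding W_def using LL(4) c6 by auto
 have \<Gamma>m: "\<Gamma> \<in> borel_measurable borel"
 proof -
  have "\<Gamma> \<in> borel_measurable (borel \<Otimes>\<^sub>M (borel \<Otimes>\<^sub>M borel))" unfolding \<Gamma>_def by measurable
  then show ?thesis by (simp only: borel_triple)
 qed
 have \<Gamma>i: "integrable KM \<Gamma>"
  unfolding \<Gamma>_def
  by (rule integrable_KM[where C=M, OF test_fun_integrable[OF f] test_fun_integrable[OF g]])
   (rule measurable_compose[OF measurable_vprime], simp, simp add: M)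
 have \<Gamma>fm: "(\<lambda>\<omega>. \<Gamma> (flow e y \<omega>)) \<in> borel_measurable KM" for y
  using measurable_compose[OF measurable_flow \<Gamma>m] by simp
 have \<Gamma>'m: "\<Gamma>' k \<in> borel_measurable KM" for k
  unfolding \<Gamma>'_def using \<Gamma>fm \<Gamma>m by simp
 have int0: "(\<integral>\<omega>. \<Gamma>' k \<omega> \<partial>KM) = 0" for k
  unfolding \<Gamma>'_def using integral_KM_distr[OF measurable_flow distr_KM_flow \<Gamma>m] \<Gamma>i by simp
 have bound: "\<bar>\<Gamma>' k (v, w, n)\<bar> \<le> indicator (cball 0 R) v * indicator (cball 0 R) w * W"
  if n: "norm n = 1" and q: "v \<noteq> w" and u: "relu e (v - w) n \<noteq> 0" "relu e (v - w) n + X k *\<^sub>R h \<noteq> 0" for k v w n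
 proof -
  obtain v' w' n' where fl: "flow e (X k *\<^sub>R h) (v, w, n) = (v', w', n')" by (metis prod.exhaust)
  have Xh: "norm (X k *\<^sub>R h) = X k * norm h" using Xp[of k] by simp
  have dv: "norm (v' - v) \<le> c * (X k * norm h)" and dw: "norm (w' - w) \<le> c * (X k * norm h)"
   using flow_dist[OF e0 e1 n u fl] by (simp_all only: Xh c_def)
  have dp: "norm (vpost e v' w' n' - vpost e v w n) \<le> c * (X k * norm h)"
  proof -
   have "norm (vpost e v' w' n' - vpost e v w n) = 2 * (X k * norm h)"
    unfolding flow_props(2)[OF e0 n q u fl] using Xp[of k] by simp
   also have "\<dots> \<le> c * (X k * norm h)" using c6 Xp[of k] by (intro mult_right_mono) auto
   finally show ?thesis .
  qed
  have cX: "c * (X k * norm h) \<le> c * norm h"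
   using X1[of k] Xp[of k] c6 by (intro mult_left_mono mult_left_le_one_le) auto
  have out: "\<Gamma> (v', w', n') = 0 \<and> \<Gamma> (v, w, n) = 0" if "norm v > R \<or> norm w > R"
   using that
  proof
   assume a: "norm v > R"
   have "norm v \<le> norm v' + norm (v' - v)" using norm_triangle_sub[of v v'] by (simp add: norm_minus_commute)
   then have "norm v' > Rf" "norm v > Rf" using a dv cX norm_ge_zero[of h] c6 unfolding R_def
    by (smt (verit) mult_nonneg_nonneg)+
   then show ?thesis by (simp add: \<Gamma>_def Rf)
  next
   assume a: "norm w > R"
   have "norm w \<le> norm w' + norm (w' - w)" using norm_triangle_sub[of w w'] by (simp add: norm_minus_commute)
   then have "norm w' > Rg" "norm w > Rg" using a dw cX norm_ge_zero[of h] c6 unfolding R_def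
    by (smt (verit) mult_nonneg_nonneg)+
   then show ?thesis by (simp add: \<Gamma>_def Rg)
  qed
  show ?thesis
  proof (cases "norm v > R \<or> norm w > R")
   case True
   then show ?thesis using out W0 by (simp add: \<Gamma>'_def fl)
  next
   case False
   let ?d = "L * (c * (X k * norm h))"
   have "\<bar>\<Gamma> (v', w', n') - \<Gamma> (v, w, n)\<bar> \<le> 3 * (?d * (M * M))"
    unfolding \<Gamma>_def vprime_def fst_conv snd_conv prod.case
    by (rule product3_difference[OF M(1) M(1) M(2) M(2) M(3) M(3)])
     (rule order_trans[OF L(1) mult_left_mono[OF dv]], use LL(4) in simp,
     rule order_trans[OF L(2) mult_left_mono[OF dw]], use LL(4) in simp,
     rule order_trans[OF L(3) mult_left_mono[OF dp]], use LL(4) in simp)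
   also have "\<dots> = W * X k" by (simp add: W_def)
   finally have "\<bar>\<Gamma>' k (v, w, n)\<bar> \<le> W"
    unfolding \<Gamma>'_def fl using Xp[of k] by (simp add: divide_le_eq)
   then show ?thesis using False by simp
  qed
 qed
 have lim: "(\<lambda>k. \<Gamma>' k (v, w, n)) \<longlonglongrightarrow> D (v, w, n)"
  if n: "norm n = 1" and q: "v \<noteq> w" and u: "relu e (v - w) n \<noteq> 0" "\<And>k. relu e (v - w) n + X k *\<^sub>R h \<noteq> 0" for v w n
 proof -
  let ?c = "(1/2) *\<^sub>R (v + w)"
  let ?F = "\<lambda>t. flow_q e (t *\<^sub>R h) (v - w) n"
  define \<gamma>1 where "\<gamma>1 t = ?c + t *\<^sub>R h + (1/2) *\<^sub>R ?F t" for t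
  define \<gamma>2 where "\<gamma>2 t = ?c + t *\<^sub>R h - (1/2) *\<^sub>R ?F t" for t
  define \<gamma>3 where "\<gamma>3 t = vpost e v w n + t *\<^sub>R (2 *\<^sub>R h)" for t
  note dF = flow_q_has_vector_derivative[OF n e0 u(1), of h]
  have dF2: "((\<lambda>t. (1/2) *\<^sub>R ?F t) has_vector_derivative (1/2) *\<^sub>R dflow e h (v, w, n)) (at 0)"
   using has_vector_derivative_scaleR[OF DERIV_const dF, of "1/2"] by simp
  have dl: "((\<lambda>t. p + t *\<^sub>R z) has_vector_derivative z) (at 0)" for p z :: vec3
   by (auto intro!: derivative_eq_intros)
  have d1: "(\<gamma>1 has_vector_derivative h + (1/2) *\<^sub>R dflow e h (v, w, n)) (at 0)"
   unfolding \<gamma>1_def by (rule has_vector_derivative_add[OF dl dF2])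
  have d2: "(\<gamma>2 has_vector_derivative h - (1/2) *\<^sub>R dflow e h (v, w, n)) (at 0)"
   unfolding \<gamma>2_def by (rule has_vector_derivative_diff[OF dl dF2])
  have d3: "(\<gamma>3 has_vector_derivative 2 *\<^sub>R h) (at 0)" unfolding \<gamma>3_def by (rule dl)
  \<comment> \<open>The displacement bound with \<open>y = 0\<close> shows that the flow starts at
    \<open>(v, w)\<close>.\<close>
  have at0: "\<gamma>1 0 = v" "\<gamma>2 0 = w" "\<gamma>3 0 = vpost e v w n"
  proof -
   obtain v' w' n' where fl: "flow e 0 (v, w, n) = (v', w', n')" by (metis prod.exhaust)
   have "v' = v" "w' = w" using flow_dist[OF e0 e1 n u(1) _ fl] u(1) by simp_all
   moreover have "v' = \<gamma>1 0" "w' = \<gamma>2 0" using fl by (auto simp: flow_def \<gamma>1_def \<gamma>2_def)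
   ultimately show "\<gamma>1 0 = v" "\<gamma>2 0 = w" by simp_all
   show "\<gamma>3 0 = vpost e v w n" by (simp add: \<gamma>3_def)
  qed
  have atX: "\<Gamma> (flow e (X k *\<^sub>R h) (v, w, n)) = f (\<gamma>1 (X k)) * g (\<gamma>2 (X k)) * \<psi> (\<gamma>3 (X k))" for k
  proof -
   obtain v' w' n' where fl: "flow e (X k *\<^sub>R h) (v, w, n) = (v', w', n')" by (metis prod.exhaust)
   have "v' = \<gamma>1 (X k)" "w' = \<gamma>2 (X k)" using fl by (auto simp: flow_def \<gamma>1_def \<gamma>2_def)
   moreover have "vpost e v' w' n' = \<gamma>3 (X k)"
    unfolding flow_props(2)[OF e0 n q u(1) u(2) fl] \<gamma>3_def by simp
   ultimately show ?thesis by (simp add: fl \<Gamma>_def vprime_def)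
  qed
  have "((\<lambda>t. f (\<gamma>1 t) * g (\<gamma>2 t) * \<psi> (\<gamma>3 t)) has_real_derivative
   (frechet_derivative f (at (\<gamma>1 0)) (h + (1/2) *\<^sub>R dflow e h (v, w, n)) * g (\<gamma>2 0) + frechet_derivative g (at (\<gamma>2 0)) (h - (1/2) *\<^sub>R dflow e h (v, w, n)) * f (\<gamma>1 0)) * \<psi> (\<gamma>3 0)
   + frechet_derivative \<psi> (at (\<gamma>3 0)) (2 *\<^sub>R h) * (f (\<gamma>1 0) * g (\<gamma>2 0))) (at 0)"
   by (rule DERIV_mult[OF DERIV_mult[OF test_fun_chain[OF f d1] test_fun_chain[OF g d2]] test_fun_chain[OF \<psi> d3]])
  then have "((\<lambda>t. f (\<gamma>1 t) * g (\<gamma>2 t) * \<psi> (\<gamma>3 t)) has_real_derivative D (v, w, n)) (at 0)"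
   by (simp add: at0 D_def vprime_def algebra_simps)
  then have "(\<lambda>k. (f (\<gamma>1 (X k)) * g (\<gamma>2 (X k)) * \<psi> (\<gamma>3 (X k)) - f (\<gamma>1 0) * g (\<gamma>2 0) * \<psi> (\<gamma>3 0)) / X k) \<longlonglongrightarrow> D (v, w, n)"
   by (rule has_real_derivative_seqD[OF _ _ X0]) (use Xp in \<open>simp add: less_imp_neq[symmetric]\<close>)
  then show ?thesis by (simp add: \<Gamma>'_def atX at0) (simp add: \<Gamma>_def vprime_def)
 qed
 \<comment> \<open>One null set for each step length; the step lengths form a sequence, so their
   union is null.\<close>
 have good: "AE \<omega> in KM. \<forall>k. norm (snd (snd \<omega>)) = 1 \<and> fst \<omega> \<noteq> fst (snd \<omega>) \<and> relu e (fst \<omega> - fst (snd \<omega>)) (snd (snd \<omega>)) \<noteq> 0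
   \<and> relu e (fst \<omega> - fst (snd \<omega>)) (snd (snd \<omega>)) + X k *\<^sub>R h \<noteq> 0"
  unfolding AE_all_countable
 proof
  fix k
  show "AE \<omega> in KM. norm (snd (snd \<omega>)) = 1 \<and> fst \<omega> \<noteq> fst (snd \<omega>) \<and> relu e (fst \<omega> - fst (snd \<omega>)) (snd (snd \<omega>)) \<noteq> 0
   \<and> relu e (fst \<omega> - fst (snd \<omega>)) (snd (snd \<omega>)) + X k *\<^sub>R h \<noteq> 0"
   using AE_KM_good[of 0] AE_KM_good[of "- (X k *\<^sub>R h)"]
   by eventually_elim (auto simp: eq_neg_iff_add_eq_0)
 qed
 have AElim: "AE \<omega> in KM. (\<lambda>k. \<Gamma>' k \<omega>) \<longlonglongrightarrow> D \<omega>"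
  using good
 proof eventually_elim
  case (elim \<omega>)
  obtain v w n where \<omega>: "\<omega> = (v, w, n)" by (metis prod.exhaust)
  show ?case unfolding \<omega> by (rule lim) (use elim \<omega> in auto)
 qed
 have Dm: "D \<in> borel_measurable KM"
 proof -
  have pm: "partial j \<phi> \<in> borel_measurable borel" if "test_fun \<phi>" for j \<phi>
   by (rule test_fun_measurable[OF test_fun_partial[OF that]])
  note [measurable] = pm[OF f] pm[OF g] pm[OF \<psi>] borel_measurable_vec_nth_comp
  have "D \<in> borel_measurable (borel \<Otimes>\<^sub>M (borel \<Otimes>\<^sub>M borel))"
   unfolding D_def frechet_derivative_partial[OF test_fun_differentiable[OF f]] frechet_derivative_partial[OF test_fun_differentiable[OF g]]
    frechet_derivative_partial[OF test_fun_differentiable[OF \<psi>]]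
   by (simp only: vector_add_component vector_minus_component vector_scaleR_component) measurable
  then show ?thesis by (simp only: borel_triple) simp
 qed
 have "(\<lambda>k. \<integral>\<omega>. \<Gamma>' k \<omega> \<partial>KM) \<longlonglongrightarrow> (\<integral>\<omega>. D \<omega> \<partial>KM)"
 proof (rule integral_dominated_convergence[OF Dm \<Gamma>'m])
  have i: "integrable lborel (indicator (cball (0::vec3) R) :: vec3 \<Rightarrow> real)"
   by (rule integrable_indicator_compact) simp
  show "integrable KM (\<lambda>\<omega>. indicator (cball 0 R) (fst \<omega>) * indicator (cball 0 R) (fst (snd \<omega>)) * W)"
   by (rule integrable_KM[OF i i, of _ W]) (use W0 in auto)
  show "AE \<omega> in KM. (\<lambda>k. \<Gamma>' k \<omega>) \<longlonglongrightarrow> D \<omega>" by (rule AElim)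
  fix k
  show "AE \<omega> in KM. norm (\<Gamma>' k \<omega>) \<le> indicator (cball 0 R) (fst \<omega>) * indicator (cball 0 R) (fst (snd \<omega>)) * W"
   using good
  proof eventually_elim
   case (elim \<omega>)
   obtain v w n where \<omega>: "\<omega> = (v, w, n)" by (metis prod.exhaust)
   show ?case unfolding \<omega> fst_conv snd_conv real_norm_def by (rule bound) (use elim \<omega> in auto)
  qed
 qed
 then show ?thesis by (simp add: int0 LIMSEQ_const_iff)
qed

end

section \<open>From test functions to densities with a score\<close>

context collision
begin

text \<open>Averaging over the second particle turns the identity into a statement about the first
  particle alone, to which \<open>weak_divergence_extend\<close> applies. It will be used once for
  each particle, with \<open>swap3\<close> in between.\<close>

lemma KM_extend:
 fixes G :: "vec3 \<Rightarrow> real" and G' :: "3 \<Rightarrow> vec3 \<Rightarrow> real" and \<Phi> :: "vec3 \<times> vec3 \<times> vec3 \<Rightarrow> real"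
  and \<Phi>' \<Psi> :: "3 \<Rightarrow> vec3 \<times> vec3 \<times> vec3 \<Rightarrow> real"
 assumes \<eta>: "mollifier \<eta>"
  and G: "integrable lborel G" and G': "\<And>j. integrable lborel (G' j)"
  and \<Phi>: "\<Phi> \<in> borel_measurable borel" "\<And>j. \<Phi>' j \<in> borel_measurable borel" "\<And>j. \<Psi> j \<in> borel_measurable borel"
  and b: "\<And>\<omega>. \<bar>\<Phi> \<omega>\<bar> \<le> C" "\<And>j \<omega>. \<bar>\<Phi>' j \<omega>\<bar> \<le> C" "\<And>j \<omega>. \<bar>\<Psi> j \<omega>\<bar> \<le> C"
  and id: "\<And>\<phi>. test_fun \<phi> \<Longrightarrow> (\<integral>\<omega>. (\<Sum>j\<in>UNIV. partial j \<phi> (fst \<omega>) * G (fst (snd \<omega>)) * \<Psi> j \<omega>) + \<phi> (fst \<omega>) * G (fst (snd \<omega>)) * \<Phi> \<omega>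
    + (\<Sum>j\<in>UNIV. \<phi> (fst \<omega>) * G' j (fst (snd \<omega>)) * \<Phi>' j \<omega>) \<partial>KM) = 0"
  and f: "integrable lborel f" and p: "\<And>i. integrable lborel (p i)"
  and w: "\<And>\<phi> i. test_fun \<phi> \<Longrightarrow> (LBINT x. f x * partial i \<phi> x) = - (LBINT x. p i x * \<phi> x)"
 shows "(\<integral>\<omega>. (\<Sum>j\<in>UNIV. p j (fst \<omega>) * G (fst (snd \<omega>)) * \<Psi> j \<omega>) + f (fst \<omega>) * G (fst (snd \<omega>)) * \<Phi> \<omega>
    + (\<Sum>j\<in>UNIV. f (fst \<omega>) * G' j (fst (snd \<omega>)) * \<Phi>' j \<omega>) \<partial>KM) = 0"
proof -
 have "\<exists>A C'. A \<in> borel_measurable borel \<and> (\<forall>v. \<bar>A v\<bar> \<le> C') \<and>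
  (\<forall>F. integrable lborel F \<longrightarrow> (LBINT v. F v * A v) = (\<integral>\<omega>. F (fst \<omega>) * G (fst (snd \<omega>)) * \<Phi> \<omega> \<partial>KM))"
  by (rule KM_average[OF G \<Phi>(1) b(1)])
 then obtain A0 C0 where A0: "A0 \<in> borel_measurable borel" "\<And>v. \<bar>A0 v\<bar> \<le> C0"
  "\<And>F. integrable lborel F \<Longrightarrow> (LBINT v. F v * A0 v) = (\<integral>\<omega>. F (fst \<omega>) * G (fst (snd \<omega>)) * \<Phi> \<omega> \<partial>KM)"
  by blast
 have "\<forall>j. \<exists>A C'. A \<in> borel_measurable borel \<and> (\<forall>v. \<bar>A v\<bar> \<le> C') \<and>
  (\<forall>F. integrable lborel F \<longrightarrow> (LBINT v. F v * A v) = (\<integral>\<omega>. F (fst \<omega>) * G' j (fst (snd \<omega>)) * \<Phi>' j \<omega> \<partial>KM))"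
  by (intro allI KM_average[OF G' \<Phi>(2) b(2)])
 from choice[OF this] obtain A1 where "\<forall>j. \<exists>C'. A1 j \<in> borel_measurable borel \<and> (\<forall>v. \<bar>A1 j v\<bar> \<le> C') \<and>
  (\<forall>F. integrable lborel F \<longrightarrow> (LBINT v. F v * A1 j v) = (\<integral>\<omega>. F (fst \<omega>) * G' j (fst (snd \<omega>)) * \<Phi>' j \<omega> \<partial>KM))" by blast
 from choice[OF this] obtain C1 where A1: "\<And>j. A1 j \<in> borel_measurable borel" "\<And>j v. \<bar>A1 j v\<bar> \<le> C1 j"
  "\<And>j F. integrable lborel F \<Longrightarrow> (LBINT v. F v * A1 j v) = (\<integral>\<omega>. F (fst \<omega>) * G' j (fst (snd \<omega>)) * \<Phi>' j \<omega> \<partial>KM)"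
  by blast
 have "\<forall>j. \<exists>A C'. A \<in> borel_measurable borel \<and> (\<forall>v. \<bar>A v\<bar> \<le> C') \<and>
  (\<forall>F. integrable lborel F \<longrightarrow> (LBINT v. F v * A v) = (\<integral>\<omega>. F (fst \<omega>) * G (fst (snd \<omega>)) * \<Psi> j \<omega> \<partial>KM))"
  by (intro allI KM_average[OF G \<Phi>(3) b(3)])
 from choice[OF this] obtain A2 where "\<forall>j. \<exists>C'. A2 j \<in> borel_measurable borel \<and> (\<forall>v. \<bar>A2 j v\<bar> \<le> C') \<and>
  (\<forall>F. integrable lborel F \<longrightarrow> (LBINT v. F v * A2 j v) = (\<integral>\<omega>. F (fst \<omega>) * G (fst (snd \<omega>)) * \<Psi> j \<omega> \<partial>KM))" by blast
 from choice[OF this] obtain C2 where A2: "\<And>j. A2 j \<in> borel_measurable borel" "\<And>j v. \<bar>A2 j v\<bar> \<le> C2 j"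
  "\<And>j F. integrable lborel F \<Longrightarrow> (LBINT v. F v * A2 j v) = (\<integral>\<omega>. F (fst \<omega>) * G (fst (snd \<omega>)) * \<Psi> j \<omega> \<partial>KM)"
  by blast
 define a where "a v = A0 v + (\<Sum>j\<in>UNIV. A1 j v)" for v
 define K where "K = \<bar>C0\<bar> + (\<Sum>j\<in>UNIV. \<bar>C1 j\<bar>) + (\<Sum>j\<in>UNIV. \<bar>C2 j\<bar>)"
 have am: "a \<in> borel_measurable borel" unfolding a_def using A0(1) A1(1) by measurable
 have sum_abs_le: "\<bar>\<Sum>j\<in>UNIV. A1 j v\<bar> \<le> (\<Sum>j\<in>UNIV. \<bar>C1 j\<bar>)" for v
  by (rule order_trans[OF sum_abs sum_mono]) (rule order_trans[OF A1(2) abs_ge_self])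
 have nn: "0 \<le> (\<Sum>j\<in>UNIV. \<bar>C1 j\<bar>)" "0 \<le> (\<Sum>j\<in>UNIV. \<bar>C2 j\<bar>)" by (simp_all add: sum_nonneg)
 have aK: "\<bar>a v\<bar> \<le> K" for v
  using A0(2)[of v] sum_abs_le[of v] nn unfolding a_def K_def by linarith
 have bK: "\<bar>A2 j v\<bar> \<le> K" for j v
 proof -
  have "\<bar>C2 j\<bar> \<le> (\<Sum>j\<in>UNIV. \<bar>C2 j\<bar>)" by (rule member_le_sum) auto
  then show ?thesis using A2(2)[of j v] nn unfolding K_def by linarith
 qed
 have ib: "integrable lborel (\<lambda>v. F v * c v)" if "integrable lborel F" "c \<in> borel_measurable borel" "\<And>v. \<bar>c v\<bar> \<le> B'"
  for F c :: "vec3 \<Rightarrow> real" and B'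
 proof (rule Bochner_Integration.integrable_bound)
  show "integrable lborel (\<lambda>v. B' * F v)" using that by simp
  have "F \<in> borel_measurable borel" using that(1) by auto
  then show "(\<lambda>v. F v * c v) \<in> borel_measurable lborel" using that(2) by simp
  show "AE v in lborel. norm (F v * c v) \<le> norm (B' * F v)"
  proof (rule AE_I2)
   fix v
   have "\<bar>c v\<bar> \<le> \<bar>B'\<bar>" using that(3)[of v] by linarith
   then have "\<bar>F v\<bar> * \<bar>c v\<bar> \<le> \<bar>F v\<bar> * \<bar>B'\<bar>" by (rule mult_left_mono) simp
   then show "norm (F v * c v) \<le> norm (B' * F v)" by (simp add: abs_mult mult.commute)
  qed
 qed
 have key: "(LBINT v. F v * a v + (\<Sum>j\<in>UNIV. P j v * A2 j v))
  = (\<integral>\<omega>. (\<Sum>j\<in>UNIV. P j (fst \<omega>) * G (fst (snd \<omega>)) * \<Psi> j \<omega>) + F (fst \<omega>) * G (fst (snd \<omega>)) * \<Phi> \<omega>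
    + (\<Sum>j\<in>UNIV. F (fst \<omega>) * G' j (fst (snd \<omega>)) * \<Phi>' j \<omega>) \<partial>KM)"
  if F: "integrable lborel F" and P: "\<And>j. integrable lborel (P j)" for F :: "vec3 \<Rightarrow> real" and P :: "3 \<Rightarrow> vec3 \<Rightarrow> real"
 proof -
  have i0: "integrable KM (\<lambda>\<omega>. F (fst \<omega>) * G (fst (snd \<omega>)) * \<Phi> \<omega>)"
   by (rule integrable_KM[OF F G \<Phi>(1), where C=C]) (rule AE_I2, rule b)
  have i1: "integrable KM (\<lambda>\<omega>. F (fst \<omega>) * G' j (fst (snd \<omega>)) * \<Phi>' j \<omega>)" for j
   by (rule integrable_KM[OF F G' \<Phi>(2), where C=C]) (rule AE_I2, rule b)
  have i2: "integrable KM (\<lambda>\<omega>. P j (fst \<omega>) * G (fst (snd \<omega>)) * \<Psi> j \<omega>)" for j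
   by (rule integrable_KM[OF P G \<Phi>(3), where C=C]) (rule AE_I2, rule b)
  have "(LBINT v. F v * a v + (\<Sum>j\<in>UNIV. P j v * A2 j v)) = (LBINT v. F v * A0 v + (\<Sum>j\<in>UNIV. F v * A1 j v) + (\<Sum>j\<in>UNIV. P j v * A2 j v))"
   by (simp add: a_def distrib_left sum_distrib_left)
  also have "\<dots> = (LBINT v. F v * A0 v) + (\<Sum>j\<in>UNIV. \<integral>v. F v * A1 j v \<partial>lborel) + (\<Sum>j\<in>UNIV. \<integral>v. P j v * A2 j v \<partial>lborel)"
   using ib[OF F A0(1,2)] ib[OF F A1(1,2)] ib[OF P A2(1,2)] by simp
  also have "\<dots> = (\<Sum>j\<in>UNIV. \<integral>\<omega>. P j (fst \<omega>) * G (fst (snd \<omega>)) * \<Psi> j \<omega> \<partial>KM) + (\<integral>\<omega>. F (fst \<omega>) * G (fst (snd \<omega>)) * \<Phi> \<omega> \<partial>KM)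
    + (\<Sum>j\<in>UNIV. \<integral>\<omega>. F (fst \<omega>) * G' j (fst (snd \<omega>)) * \<Phi>' j \<omega> \<partial>KM)"
   by (simp add: A0(3)[OF F] A1(3)[OF F] A2(3)[OF P])
  also have "\<dots> = (\<integral>\<omega>. (\<Sum>j\<in>UNIV. P j (fst \<omega>) * G (fst (snd \<omega>)) * \<Psi> j \<omega>) + F (fst \<omega>) * G (fst (snd \<omega>)) * \<Phi> \<omega>
    + (\<Sum>j\<in>UNIV. F (fst \<omega>) * G' j (fst (snd \<omega>)) * \<Phi>' j \<omega>) \<partial>KM)"
   using i0 i1 i2 by simp
  finally show ?thesis .
 qed
 have "(LBINT x. f x * a x + (\<Sum>i\<in>UNIV. p i x * A2 i x)) = 0"
 proof (rule weak_divergence_extend[OF \<eta> am A2(1) aK bK _ f p w])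
  fix \<phi> assume \<phi>: "test_fun \<phi>"
  show "(LBINT x. \<phi> x * a x + (\<Sum>i\<in>UNIV. partial i \<phi> x * A2 i x)) = 0"
   using id[OF \<phi>] key[of \<phi> "\<lambda>j. partial j \<phi>", OF test_fun_integrable[OF \<phi>] test_fun_integrable[OF test_fun_partial[OF \<phi>]]] by simp
 qed auto
 then show ?thesis using key[OF f p] by simp
qed

text \<open>Cutting \<open>dflow\<close> off at non-unit \<open>n\<close>, a null set for
  \<open>KM\<close>, makes its bound hold everywhere instead of almost everywhere.\<close>

definition Tn :: "vec3 \<Rightarrow> vec3 \<times> vec3 \<times> vec3 \<Rightarrow> vec3" where
 "Tn h \<omega> = indicator {\<omega>. norm (snd (snd \<omega>)) = 1} \<omega> *\<^sub>R dflow e h \<omega>"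

lemma measurable_norm_snd_snd: "{\<omega> :: vec3 \<times> vec3 \<times> vec3. norm (snd (snd \<omega>)) = 1} \<in> sets borel"
 by (intro borel_closed closed_Collect_eq continuous_intros)

lemma measurable_Tn: "Tn h \<in> borel_measurable borel"
 unfolding Tn_def using measurable_norm_snd_snd measurable_dflow by measurable

lemma norm_Tn: "norm (Tn h \<omega>) \<le> 6 / e * norm h"
proof -
 obtain v w n where \<omega>: "\<omega> = (v, w, n)" by (metis prod.exhaust)
 show ?thesis using dflow_bound[OF e0 e1, of n h v w] e0 by (simp add: Tn_def \<omega> indicator_def)
qed

lemma AE_Tn: "AE \<omega> in KM. Tn h \<omega> = dflow e h \<omega>"
 using AE_KM_good[of 0] by eventually_elim (simp add: Tn_def)

text \<open>Exchange reverses both \<open>q\<close> and \<open>u\<close>, and \<open>dflow\<close>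
  is bilinear in them up to the factor that depends on \<open>norm u\<close>.\<close>

lemma dflow_swap3: "dflow e h (swap3 \<omega>) = dflow e h \<omega>"
proof -
 obtain v w n where \<omega>: "\<omega> = (v, w, n)" by (metis prod.exhaust)
 define q u where "q = v - w" and "u = relu e q n"
 have r: "relu e (w - v) n = - u"
  by (simp add: u_def q_def relu_def vec_eq_iff inner_diff_left field_simps)
 have q: "w - v = - q" by (simp add: q_def)
 show ?thesis
  unfolding \<omega> swap3_def dflow_def Let_def prod.case r
  unfolding q q_def[symmetric] u_def[symmetric] by simp
qed

end

text \<open>The right side minus the left side is the square of the determinant of \<open>q\<close>,
  \<open>u\<close>, \<open>z\<close>.\<close>

lemma gram_vec3_nonneg:
 fixes q u z :: vec3
 shows "(norm ((q \<bullet> z) *\<^sub>R u - (u \<bullet> z) *\<^sub>R q + (q \<bullet> u) *\<^sub>R z))\<^sup>2 \<le> (norm q)\<^sup>2 * (norm u)\<^sup>2 * (norm z)\<^sup>2"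
proof -
 define D where "D = q$1 * (u$2 * z$3 - u$3 * z$2) - q$2 * (u$1 * z$3 - u$3 * z$1) + q$3 * (u$1 * z$2 - u$2 * z$1)"
 have "(norm q)\<^sup>2 * (norm u)\<^sup>2 * (norm z)\<^sup>2 - (norm ((q \<bullet> z) *\<^sub>R u - (u \<bullet> z) *\<^sub>R q + (q \<bullet> u) *\<^sub>R z))\<^sup>2 = D\<^sup>2"
  unfolding norm_sq_vec3 inner_vec_def sum_3 D_def vector_add_component vector_minus_component vector_scaleR_component inner_real_def
   real_scaleR_def by algebra
 then show ?thesis using zero_le_power2[of D] by linarith
qed

context collision
begin

text \<open>Half the transpose of \<open>h \<mapsto> Tn h \<omega>\<close>; transposing moves the
  derivative of the flow from the displacement to the scores. The half makes the post-collisional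
  velocity, which moves by twice the parameter, move by a unit vector.\<close>

definition Tt :: "vec3 \<times> vec3 \<times> vec3 \<Rightarrow> vec3 \<Rightarrow> vec3" where
 "Tt \<omega> z = (\<chi> i. z \<bullet> Tn (axis i (1/2)) \<omega>)"

lemma Tt_diff: "Tt \<omega> (x - y) = Tt \<omega> x - Tt \<omega> y"
 by (simp add: Tt_def vec_eq_iff inner_diff_left)

text \<open>Transposed, the formula of \<open>dflow\<close> reads
  \<open>Y / (2 * r\<^sup>2)\<close>. The determinant inequality bounds \<open>norm Y\<close> by the
  plain product of the three norms, and \<open>norm q\<close> is at most 2/e times
  \<open>r\<close>.\<close>

lemma norm_Tt: "norm (Tt \<omega> z) \<le> norm z / e"
proof -
 obtain v w n where \<omega>: "\<omega> = (v, w, n)" by (metis prod.exhaust)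
 define q u where "q = v - w" and "u = relu e q n"
 show ?thesis
 proof (cases "norm n = 1 \<and> u \<noteq> 0")
  case False
  then have T0: "Tn h \<omega> = 0" for h
   by (auto simp: Tn_def \<omega> dflow_def Let_def q_def u_def)
  have "Tt \<omega> z = 0" unfolding Tt_def T0 by (simp add: vec_eq_iff)
  then show ?thesis using e0 by simp
 next
  case True
  define r where "r = norm u"
  have r: "r > 0" using True by (simp add: r_def)
  define Y where "Y = (q \<bullet> z) *\<^sub>R u - (u \<bullet> z) *\<^sub>R q + (q \<bullet> u) *\<^sub>R z"
  have "Tt \<omega> z = (1 / (2 * r\<^sup>2)) *\<^sub>R Y"
  proof -
   have "z \<bullet> Tn (axis i (1/2)) \<omega> = (1 / (2 * r\<^sup>2)) * Y $ i" for i
    using True unfolding Tn_def \<omega> dflow_def Let_def Y_def r_def prod.case q_def[symmetric] u_def[symmetric]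
    by (simp add: inner_add_right inner_diff_right inner_axis inner_commute[of z] field_simps)
   then show ?thesis by (simp add: Tt_def vec_eq_iff)
  qed
  then have "norm (Tt \<omega> z) = norm Y / (2 * r\<^sup>2)" by simp
  moreover have "norm Y \<le> norm q * r * norm z"
   by (rule power2_le_imp_le) (use gram_vec3_nonneg[of q z u] in \<open>simp_all add: Y_def r_def power_mult_distrib\<close>)
  ultimately have "norm (Tt \<omega> z) \<le> (norm q * r * norm z) / (2 * r\<^sup>2)"
   by (simp add: divide_right_mono)
  also have "\<dots> = (norm q / (2 * r)) * norm z" using r by (simp add: power2_eq_square)
  also have "\<dots> \<le> (1 / e) * norm z"
  proof (rule mult_right_mono)
   have "e * norm q \<le> 2 * r" unfolding r_def u_def using True e0 e1 by (intro relu_norm) auto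
   then show "norm q / (2 * r) \<le> 1 / e" using r e0 by (simp add: field_simps)
  qed simp
  finally show ?thesis by simp
 qed
qed

lemma Tn_swap3: "Tn h (swap3 \<omega>) = Tn h \<omega>"
proof -
 have "snd (snd (swap3 \<omega>)) = snd (snd \<omega>)" by (simp add: swap3_def split_beta)
 then show ?thesis by (simp add: Tn_def dflow_swap3 indicator_def)
qed

lemma Tt_swap3: "Tt (swap3 \<omega>) z = Tt \<omega> z"
 by (simp add: Tt_def Tn_swap3)

text \<open>By the parallelogram law, once the symmetric part is also given the coefficient
  \<open>1 / e\<^sup>2\<close>, which is at least 1. The mixed term is kept because it will cancel
  under exchange of the particles; its own bound serves integrability.\<close>

lemma score_combination_bound:
 "(norm ((1/2) *\<^sub>R (x + y) + (1/2) *\<^sub>R Tt \<omega> (x - y)))\<^sup>2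
  \<le> (1 / e\<^sup>2) * ((norm x)\<^sup>2 + (norm y)\<^sup>2) / 2 + (1/2) * ((x + y) \<bullet> Tt \<omega> (x - y))"
 and score_cross_bound: "\<bar>(1/2) * ((x + y) \<bullet> Tt \<omega> (x - y))\<bar> \<le> (1 / e) * ((norm x)\<^sup>2 + (norm y)\<^sup>2)"
proof -
 define T where "T = Tt \<omega> (x - y)"
 have T: "norm T \<le> norm (x - y) / e" unfolding T_def by (rule norm_Tt)
 then have "(norm T)\<^sup>2 \<le> (norm (x - y) / e)\<^sup>2" by (rule power_mono) simp
 then have T2: "(norm T)\<^sup>2 \<le> (1 / e\<^sup>2) * (norm (x - y))\<^sup>2" by (simp add: power_divide)
 have par: "(norm (x + y))\<^sup>2 + (norm (x - y))\<^sup>2 = 2 * ((norm x)\<^sup>2 + (norm y)\<^sup>2)"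
  by (simp add: power2_norm_eq_inner inner_add_left inner_add_right inner_diff_left inner_diff_right inner_commute)
 have e2: "1 \<le> 1 / e\<^sup>2" using e0 e1 by (simp add: power_le_one)
 have e2': "1 * (norm (x + y))\<^sup>2 \<le> (1 / e\<^sup>2) * (norm (x + y))\<^sup>2" by (rule mult_right_mono[OF e2]) simp
 have "(norm ((1/2) *\<^sub>R (x + y) + (1/2) *\<^sub>R T))\<^sup>2 = (norm (x + y))\<^sup>2 / 4 + (norm T)\<^sup>2 / 4 + (1/2) * ((x + y) \<bullet> T)"
  by (simp add: power2_norm_eq_inner inner_add_left inner_add_right inner_commute field_simps)
 also have "\<dots> \<le> (1 / e\<^sup>2) * (norm (x + y))\<^sup>2 / 4 + (1 / e\<^sup>2) * (norm (x - y))\<^sup>2 / 4 + (1/2) * ((x + y) \<bullet> T)"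
  by (intro add_right_mono add_mono divide_right_mono T2) (use e2' in simp_all)
 also have "\<dots> = (1 / e\<^sup>2) * ((norm (x + y))\<^sup>2 + (norm (x - y))\<^sup>2) / 4 + (1/2) * ((x + y) \<bullet> T)"
  by (simp add: distrib_left add_divide_distrib)
 also have "\<dots> = (1 / e\<^sup>2) * ((norm x)\<^sup>2 + (norm y)\<^sup>2) / 2 + (1/2) * ((x + y) \<bullet> T)"
  unfolding par using e0 by (simp add: field_simps)
 finally show "(norm ((1/2) *\<^sub>R (x + y) + (1/2) *\<^sub>R Tt \<omega> (x - y)))\<^sup>2
  \<le> (1 / e\<^sup>2) * ((norm x)\<^sup>2 + (norm y)\<^sup>2) / 2 + (1/2) * ((x + y) \<bullet> Tt \<omega> (x - y))" by (simp only: T_def)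
 have "\<bar>(x + y) \<bullet> T\<bar> \<le> norm (x + y) * norm T" by (rule Cauchy_Schwarz_ineq2)
 also have "\<dots> \<le> norm (x + y) * (norm (x - y) / e)" using T by (rule mult_left_mono) simp
 also have "\<dots> = (1 / e) * (norm (x + y) * norm (x - y))" by simp
 also have "\<dots> \<le> (1 / e) * ((norm x)\<^sup>2 + (norm y)\<^sup>2)"
 proof (rule mult_left_mono)
  have "2 * (norm (x + y) * norm (x - y)) \<le> (norm (x + y))\<^sup>2 + (norm (x - y))\<^sup>2"
   using sum_squares_bound[of "norm (x + y)" "norm (x - y)"] by (simp add: mult.assoc)
  then show "norm (x + y) * norm (x - y) \<le> (norm x)\<^sup>2 + (norm y)\<^sup>2" unfolding par by simp
 qed (use e0 in simp)
 finally have "\<bar>(x + y) \<bullet> T\<bar> \<le> (1 / e) * ((norm x)\<^sup>2 + (norm y)\<^sup>2)" .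
 then show "\<bar>(1/2) * ((x + y) \<bullet> Tt \<omega> (x - y))\<bar> \<le> (1 / e) * ((norm x)\<^sup>2 + (norm y)\<^sup>2)"
  unfolding T_def[symmetric] by (simp only: abs_mult)
qed

lemma integrable_score_component:
 assumes "has_score f s" shows "integrable lborel (\<lambda>v. f v * s v $ j)"
proof (rule integrable_dominated)
 have [measurable]: "f \<in> borel_measurable borel" "s \<in> borel_measurable borel" and pos: "\<And>v. 0 \<le> f v"
  and i: "integrable lborel f" "integrable lborel (\<lambda>v. f v * (norm (s v))\<^sup>2)"
  using assms by (auto simp: has_score_def)
 show "integrable lborel (\<lambda>v. f v + f v * (norm (s v))\<^sup>2)" using i by simp
 have [measurable]: "(\<lambda>v. s v $ j) \<in> borel_measurable borel" by (rule borel_measurable_vec_nth_comp) simp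
 show "(\<lambda>v. f v * s v $ j) \<in> borel_measurable lborel" by measurable
 fix v
 have "\<bar>s v $ j\<bar> \<le> 1 + (norm (s v))\<^sup>2"
 proof -
  have "0 \<le> (norm (s v) - 1)\<^sup>2" by simp
  then have "2 * norm (s v) \<le> 1 + (norm (s v))\<^sup>2" by (simp add: power2_eq_square algebra_simps)
  then show ?thesis using component_le_norm_cart[of "s v" j] norm_ge_zero[of "s v"] by linarith
 qed
 then have "f v * \<bar>s v $ j\<bar> \<le> f v * (1 + (norm (s v))\<^sup>2)" using pos by (rule mult_left_mono)
 then show "\<bar>f v * s v $ j\<bar> \<le> f v + f v * (norm (s v))\<^sup>2" using pos[of v] by (simp add: abs_mult distrib_left)
qed

text \<open>\<open>flow_identity\<close> is extended from test functions to \<open>f\<close> in the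
  first particle; then the particles are exchanged, the same extension is made for \<open>g\<close>,
  and the exchange is undone.\<close>

lemma gain_score_identity:
 assumes f: "has_score f s" and g: "has_score g \<sigma>" and \<psi>: "test_fun \<psi>"
 shows "(\<integral>\<omega>. (f (fst \<omega>) * g (fst (snd \<omega>))) * partial i \<psi> (vprime e \<omega>) \<partial>KM)
  = - (\<integral>\<omega>. (f (fst \<omega>) * g (fst (snd \<omega>))) * (((1/2) *\<^sub>R (s (fst \<omega>) + \<sigma> (fst (snd \<omega>))) + (1/2) *\<^sub>R Tt \<omega> (s (fst \<omega>) - \<sigma> (fst (snd \<omega>)))) $ i * \<psi> (vprime e \<omega>)) \<partial>KM)"
proof (cases "\<forall>x. \<psi> x = 0")
 case True
 then have "\<psi> = (\<lambda>_. 0)" by auto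
 then have "partial i \<psi> x = 0" for x using partial_eqI[OF has_derivative_const[of 0], of i x] by simp
 then show ?thesis using True by simp
next
 case False
 then obtain \<eta> where \<eta>: "mollifier \<eta>" using mollifier_exists[OF \<psi>] by metis
 \<comment> \<open>Half a unit vector, since the post-collisional velocity moves by
   \<open>2 *\<^sub>R h\<close>; the last term of \<open>flow_identity\<close> then is
   \<open>partial i \<psi>\<close>.\<close>
 define h where "h = (axis i (1/2) :: vec3)"
 have "h \<bullet> h = (1/2)\<^sup>2" unfolding h_def inner_axis by (simp add: axis_def power2_eq_square)
 then have nh: "norm h = 1/2" by (simp add: norm_eq_sqrt_inner)
 \<comment> \<open>The components of the initial velocities with which the flow moves
   \<open>v\<close> and \<open>w\<close>; they multiply the two scores.\<close>
 define a b where "a j \<omega> = h $ j + (1/2) * Tn h \<omega> $ j" and "b j \<omega> = h $ j - (1/2) * Tn h \<omega> $ j" for j \<omega>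
 define \<Phi> \<Psi> \<Phi>' where "\<Phi> \<omega> = partial i \<psi> (vprime e \<omega>)" and "\<Psi> j \<omega> = a j \<omega> * \<psi> (vprime e \<omega>)" and "\<Phi>' j \<omega> = b j \<omega> * \<psi> (vprime e \<omega>)" for j \<omega>
 obtain M where M: "\<And>x. \<bar>\<psi> x\<bar> \<le> M" using test_fun_bounded[OF \<psi>] by metis
 obtain M' where M': "\<And>x. \<bar>partial i \<psi> x\<bar> \<le> M'" using test_fun_bounded[OF test_fun_partial[OF \<psi>]] by metis
 define C where "C = (1/2 + 3 / e) * M + M'"
 have M0: "0 \<le> M" "0 \<le> M'" using M[of 0] M'[of 0] by linarith+
 have ab: "\<bar>a j \<omega>\<bar> \<le> 1/2 + 3 / e" "\<bar>b j \<omega>\<bar> \<le> 1/2 + 3 / e" for j \<omega>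
 proof -
  have "\<bar>Tn h \<omega> $ j\<bar> \<le> 3 / e"
   using component_le_norm_cart[of "Tn h \<omega>" j] norm_Tn[of h \<omega>] unfolding nh by simp
  moreover have "\<bar>h $ j\<bar> \<le> 1/2" using component_le_norm_cart[of h j] nh by simp
  moreover have "0 \<le> 3 / e" using e0 by simp
  ultimately show "\<bar>a j \<omega>\<bar> \<le> 1/2 + 3 / e" "\<bar>b j \<omega>\<bar> \<le> 1/2 + 3 / e" unfolding a_def b_def by linarith+
 qed
 have e3: "0 \<le> (1/2 + 3 / e) * M" using e0 M0 by (intro mult_nonneg_nonneg) (auto intro: add_nonneg_nonneg)
 have bd: "\<bar>\<Phi> \<omega>\<bar> \<le> C" "\<bar>\<Phi>' j \<omega>\<bar> \<le> C" "\<bar>\<Psi> j \<omega>\<bar> \<le> C" for j \<omega>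
 proof -
  show "\<bar>\<Phi> \<omega>\<bar> \<le> C" using M'[of "vprime e \<omega>"] e3 unfolding \<Phi>_def C_def by linarith
  have *: "\<bar>x * \<psi> (vprime e \<omega>)\<bar> \<le> C" if "\<bar>x\<bar> \<le> 1/2 + 3 / e" for x
  proof -
   have "\<bar>x\<bar> * \<bar>\<psi> (vprime e \<omega>)\<bar> \<le> (1/2 + 3 / e) * M" using that M by (intro mult_mono) auto
   then show ?thesis using M0 unfolding abs_mult C_def by linarith
  qed
  show "\<bar>\<Phi>' j \<omega>\<bar> \<le> C" "\<bar>\<Psi> j \<omega>\<bar> \<le> C" unfolding \<Phi>'_def \<Psi>_def by (rule *[OF ab(2)] *[OF ab(1)])+
 qed
 have Tm: "(\<lambda>\<omega>. Tn h \<omega> $ j) \<in> borel_measurable borel" for j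
  by (rule borel_measurable_vec_nth_comp[OF measurable_Tn])
 have \<psi>m: "(\<lambda>\<omega>. \<psi> (vprime e \<omega>)) \<in> borel_measurable borel" "(\<lambda>\<omega>. partial i \<psi> (vprime e \<omega>)) \<in> borel_measurable borel"
  by (rule measurable_compose[OF measurable_vprime test_fun_measurable], intro \<psi> test_fun_partial)+
 have \<Phi>m: "\<Phi> \<in> borel_measurable borel" "\<Phi>' j \<in> borel_measurable borel" "\<Psi> j \<in> borel_measurable borel" for j
  unfolding \<Phi>_def[abs_def] \<Phi>'_def[abs_def] \<Psi>_def[abs_def] a_def b_def using Tm \<psi>m by simp_all
 have if': "integrable lborel f" "integrable lborel g" using f g by (auto simp: has_score_def)
 have ibp: "(LBINT x. f x * partial j \<phi> x) = - (LBINT x. (f x * s x $ j) * \<phi> x)"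
  "(LBINT x. g x * partial j \<phi> x) = - (LBINT x. (g x * \<sigma> x $ j) * \<phi> x)" if "test_fun \<phi>" for \<phi> j
  using f g that by (auto simp: has_score_def)
 have base: "(\<integral>\<omega>. (\<Sum>j\<in>UNIV. partial j \<phi> (fst \<omega>) * \<zeta> (fst (snd \<omega>)) * \<Psi> j \<omega>) + \<phi> (fst \<omega>) * \<zeta> (fst (snd \<omega>)) * \<Phi> \<omega>
   + (\<Sum>j\<in>UNIV. \<phi> (fst \<omega>) * partial j \<zeta> (fst (snd \<omega>)) * \<Phi>' j \<omega>) \<partial>KM) = 0"
  if \<phi>: "test_fun \<phi>" and \<zeta>: "test_fun \<zeta>" for \<phi> \<zeta> :: "vec3 \<Rightarrow> real"
 proof -
  have h2: "2 *\<^sub>R h = axis i 1" by (simp add: h_def vec_eq_iff axis_def)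
  have "(\<integral>\<omega>. (\<Sum>j\<in>UNIV. partial j \<phi> (fst \<omega>) * \<zeta> (fst (snd \<omega>)) * \<Psi> j \<omega>) + \<phi> (fst \<omega>) * \<zeta> (fst (snd \<omega>)) * \<Phi> \<omega>
   + (\<Sum>j\<in>UNIV. \<phi> (fst \<omega>) * partial j \<zeta> (fst (snd \<omega>)) * \<Phi>' j \<omega>) \<partial>KM)
   = (\<integral>\<omega>. frechet_derivative \<phi> (at (fst \<omega>)) (h + (1/2) *\<^sub>R dflow e h \<omega>) * \<zeta> (fst (snd \<omega>)) * \<psi> (vprime e \<omega>)
   + \<phi> (fst \<omega>) * frechet_derivative \<zeta> (at (fst (snd \<omega>))) (h - (1/2) *\<^sub>R dflow e h \<omega>) * \<psi> (vprime e \<omega>)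
   + \<phi> (fst \<omega>) * \<zeta> (fst (snd \<omega>)) * frechet_derivative \<psi> (at (vprime e \<omega>)) (2 *\<^sub>R h) \<partial>KM)"
  proof (rule integral_cong_AE)
   let ?L = "\<lambda>\<omega>. (\<Sum>j\<in>UNIV. partial j \<phi> (fst \<omega>) * \<zeta> (fst (snd \<omega>)) * \<Psi> j \<omega>) + \<phi> (fst \<omega>) * \<zeta> (fst (snd \<omega>)) * \<Phi> \<omega>
   + (\<Sum>j\<in>UNIV. \<phi> (fst \<omega>) * partial j \<zeta> (fst (snd \<omega>)) * \<Phi>' j \<omega>)"
   let ?R = "\<lambda>\<omega>. frechet_derivative \<phi> (at (fst \<omega>)) (h + (1/2) *\<^sub>R dflow e h \<omega>) * \<zeta> (fst (snd \<omega>)) * \<psi> (vprime e \<omega>)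
   + \<phi> (fst \<omega>) * frechet_derivative \<zeta> (at (fst (snd \<omega>))) (h - (1/2) *\<^sub>R dflow e h \<omega>) * \<psi> (vprime e \<omega>)
   + \<phi> (fst \<omega>) * \<zeta> (fst (snd \<omega>)) * frechet_derivative \<psi> (at (vprime e \<omega>)) (2 *\<^sub>R h)"
   note pm = test_fun_measurable[OF \<phi>] test_fun_measurable[OF \<zeta>] test_fun_measurable[OF test_fun_partial[OF \<phi>]]
    test_fun_measurable[OF test_fun_partial[OF \<zeta>]]
   note pm' = pm(1,3)[THEN measurable_comp_fst] pm(2,4)[THEN measurable_comp_fst_snd]
   have dm: "(\<lambda>\<omega>. dflow e h \<omega> $ j) \<in> borel_measurable borel" for j
    by (rule borel_measurable_vec_nth_comp[OF measurable_dflow])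
   have "?L \<in> borel_measurable borel" using pm' \<Phi>m by measurable
   then show "?L \<in> borel_measurable KM" by simp
   have "?R \<in> borel_measurable borel"
    unfolding h2 frechet_derivative_partial[OF test_fun_differentiable[OF \<phi>]] frechet_derivative_partial[OF test_fun_differentiable[OF \<zeta>]]
     partial_def[symmetric] vector_add_component vector_minus_component vector_scaleR_component
    using pm' dm \<psi>m by measurable
   then show "?R \<in> borel_measurable KM" by simp
   show "AE \<omega> in KM. ?L \<omega> = ?R \<omega>"
    using AE_Tn[of h]
   proof eventually_elim
    case (elim \<omega>)
    show ?case
     unfolding h2 frechet_derivative_partial[OF test_fun_differentiable[OF \<phi>]] frechet_derivative_partial[OF test_fun_differentiable[OF \<zeta>]]
      partial_def[symmetric] vector_add_component vector_minus_component vector_scaleR_component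
     unfolding \<Phi>_def \<Phi>'_def \<Psi>_def a_def b_def elim
     by (simp add: sum_3) (simp add: algebra_simps)
   qed
  qed
  also have "\<dots> = 0" by (rule flow_identity[OF \<phi> \<zeta> \<psi>])
  finally show ?thesis .
 qed
 have step1: "(\<integral>\<omega>. (\<Sum>j\<in>UNIV. (f (fst \<omega>) * s (fst \<omega>) $ j) * \<zeta> (fst (snd \<omega>)) * \<Psi> j \<omega>) + f (fst \<omega>) * \<zeta> (fst (snd \<omega>)) * \<Phi> \<omega>
   + (\<Sum>j\<in>UNIV. f (fst \<omega>) * partial j \<zeta> (fst (snd \<omega>)) * \<Phi>' j \<omega>) \<partial>KM) = 0"
  if \<zeta>: "test_fun \<zeta>" for \<zeta> :: "vec3 \<Rightarrow> real"
  by (rule KM_extend[OF \<eta> test_fun_integrable[OF \<zeta>] test_fun_integrable[OF test_fun_partial[OF \<zeta>]] \<Phi>m bd base[OF _ \<zeta>]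
   if'(1) integrable_score_component[OF f] ibp(1)])
 have sw: "swap3 (swap3 \<omega>) = \<omega>" "fst (swap3 \<omega>) = fst (snd \<omega>)" "fst (snd (swap3 \<omega>)) = fst \<omega>" for \<omega>
  by (simp_all add: swap3_def split_beta)
 have sm: "(\<lambda>\<omega>. F (swap3 \<omega>)) \<in> borel_measurable borel" if "F \<in> borel_measurable borel" for F :: "_ \<Rightarrow> real"
  by (rule measurable_compose[OF measurable_swap3 that])
 note fm = borel_measurable_integrable[OF if'(1), simplified, THEN measurable_comp_fst]
  borel_measurable_integrable[OF if'(1), simplified, THEN measurable_comp_fst_snd]
  borel_measurable_integrable[OF if'(2), simplified, THEN measurable_comp_fst]
  borel_measurable_integrable[OF if'(2), simplified, THEN measurable_comp_fst_snd]
  borel_measurable_integrable[OF integrable_score_component[OF f], simplified, THEN measurable_comp_fst]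
  borel_measurable_integrable[OF integrable_score_component[OF f], simplified, THEN measurable_comp_fst_snd]
  borel_measurable_integrable[OF integrable_score_component[OF g], simplified, THEN measurable_comp_fst]
  borel_measurable_integrable[OF integrable_score_component[OF g], simplified, THEN measurable_comp_fst_snd]
 have swap1: "(\<integral>\<omega>. (\<Sum>j\<in>UNIV. partial j \<zeta> (fst \<omega>) * f (fst (snd \<omega>)) * \<Phi>' j (swap3 \<omega>)) + \<zeta> (fst \<omega>) * f (fst (snd \<omega>)) * \<Phi> (swap3 \<omega>)
   + (\<Sum>j\<in>UNIV. \<zeta> (fst \<omega>) * (f (fst (snd \<omega>)) * s (fst (snd \<omega>)) $ j) * \<Psi> j (swap3 \<omega>)) \<partial>KM) = 0"
  if \<zeta>: "test_fun \<zeta>" for \<zeta> :: "vec3 \<Rightarrow> real"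
 proof -
  let ?H = "\<lambda>\<omega>. (\<Sum>j\<in>UNIV. (f (fst \<omega>) * s (fst \<omega>) $ j) * \<zeta> (fst (snd \<omega>)) * \<Psi> j \<omega>) + f (fst \<omega>) * \<zeta> (fst (snd \<omega>)) * \<Phi> \<omega>
   + (\<Sum>j\<in>UNIV. f (fst \<omega>) * partial j \<zeta> (fst (snd \<omega>)) * \<Phi>' j \<omega>)"
  have "?H \<in> borel_measurable borel"
   using fm \<Phi>m test_fun_measurable[OF \<zeta>, THEN measurable_comp_fst_snd] test_fun_measurable[OF test_fun_partial[OF \<zeta>], THEN measurable_comp_fst_snd]
   by measurable
  from integral_KM_distr(1)[OF measurable_swap3 distr_KM_swap3 this] show ?thesis
   using step1[OF \<zeta>] by (simp add: sw mult_ac add_ac)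
 qed
 have step2: "(\<integral>\<omega>. (\<Sum>j\<in>UNIV. (g (fst \<omega>) * \<sigma> (fst \<omega>) $ j) * f (fst (snd \<omega>)) * \<Phi>' j (swap3 \<omega>)) + g (fst \<omega>) * f (fst (snd \<omega>)) * \<Phi> (swap3 \<omega>)
   + (\<Sum>j\<in>UNIV. g (fst \<omega>) * (f (fst (snd \<omega>)) * s (fst (snd \<omega>)) $ j) * \<Psi> j (swap3 \<omega>)) \<partial>KM) = 0"
  by (rule KM_extend[OF \<eta> if'(1) integrable_score_component[OF f] sm[OF \<Phi>m(1)] sm[OF \<Phi>m(3)] sm[OF \<Phi>m(2)] bd(1) bd(3) bd(2) swap1
   if'(2) integrable_score_component[OF g] ibp(2)])
 define H where "H \<omega> = (\<Sum>j\<in>UNIV. (f (fst \<omega>) * s (fst \<omega>) $ j) * g (fst (snd \<omega>)) * \<Psi> j \<omega>) + f (fst \<omega>) * g (fst (snd \<omega>)) * \<Phi> \<omega>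
   + (\<Sum>j\<in>UNIV. f (fst \<omega>) * (g (fst (snd \<omega>)) * \<sigma> (fst (snd \<omega>)) $ j) * \<Phi>' j \<omega>)" for \<omega>
 have "H \<in> borel_measurable borel" unfolding H_def[abs_def] using fm \<Phi>m by measurable
 from integral_KM_distr(1)[OF measurable_swap3 distr_KM_swap3 this]
 have H0: "(\<integral>\<omega>. H \<omega> \<partial>KM) = 0" using step2 by (simp add: H_def sw mult_ac add_ac)
 define Z where "Z \<omega> = (f (fst \<omega>) * g (fst (snd \<omega>))) * (((1/2) *\<^sub>R (s (fst \<omega>) + \<sigma> (fst (snd \<omega>))) + (1/2) *\<^sub>R Tt \<omega> (s (fst \<omega>) - \<sigma> (fst (snd \<omega>)))) $ i * \<psi> (vprime e \<omega>))" for \<omega>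
 have ZH: "Z \<omega> = (\<Sum>j\<in>UNIV. (f (fst \<omega>) * s (fst \<omega>) $ j) * g (fst (snd \<omega>)) * \<Psi> j \<omega>)
   + (\<Sum>j\<in>UNIV. f (fst \<omega>) * (g (fst (snd \<omega>)) * \<sigma> (fst (snd \<omega>)) $ j) * \<Phi>' j \<omega>)" for \<omega>
 proof -
  have sh: "x $ i = 2 * (x \<bullet> h)" for x :: vec3 by (simp add: h_def inner_axis)
  have Tti: "Tt \<omega> z $ i = z \<bullet> Tn h \<omega>" for z by (simp add: Tt_def h_def)
  define x y where "x = s (fst \<omega>)" and "y = \<sigma> (fst (snd \<omega>))"
  have "((1/2) *\<^sub>R (x + y) + (1/2) *\<^sub>R Tt \<omega> (x - y)) $ i = (\<Sum>j\<in>UNIV. x $ j * a j \<omega>) + (\<Sum>j\<in>UNIV. y $ j * b j \<omega>)"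
   unfolding a_def b_def
   unfolding vector_add_component vector_scaleR_component Tti sh[of x] sh[of y]
   by (simp add: inner_vec_def sum_3 algebra_simps)
  then show ?thesis unfolding Z_def \<Phi>'_def \<Psi>_def x_def[symmetric] y_def[symmetric]
   by (simp add: sum_3) (simp add: algebra_simps)
 qed
 have iZ: "integrable KM Z"
  unfolding ZH[abs_def]
  using integrable_KM[OF integrable_score_component[OF f] if'(2) \<Phi>m(3) AE_I2, OF bd(3)]
   integrable_KM[OF if'(1) integrable_score_component[OF g] \<Phi>m(2) AE_I2, OF bd(2)]
  by (intro Bochner_Integration.integrable_add Bochner_Integration.integrable_sum)
 have iP: "integrable KM (\<lambda>\<omega>. (f (fst \<omega>) * g (fst (snd \<omega>))) * \<Phi> \<omega>)"
  using integrable_KM[OF if' \<Phi>m(1) AE_I2, OF bd(1)] .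
 have "H \<omega> = (f (fst \<omega>) * g (fst (snd \<omega>))) * \<Phi> \<omega> + Z \<omega>" for \<omega> by (simp add: H_def ZH)
 then have "(\<integral>\<omega>. (f (fst \<omega>) * g (fst (snd \<omega>))) * \<Phi> \<omega> \<partial>KM) + (\<integral>\<omega>. Z \<omega> \<partial>KM) = 0"
  using H0 iZ iP by simp
 then show ?thesis unfolding Z_def \<Phi>_def by linarith
qed

end

section \<open>The gain term as an image measure, its score and its energy\<close>

context collision
begin

text \<open>With the relative velocity and \<open>n\<close> fixed, the post-collisional velocity is
  a translate of the centre of mass, so null sets pull back to null sets.\<close>

lemma nn_integral_KM_vprime_null:
 assumes A: "A \<in> sets borel" "emeasure lborel A = 0"
 shows "AE \<omega> in KM. vprime e \<omega> \<notin> A"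
proof -
 have Am[measurable]: "(\<lambda>\<omega>. indicator A (vprime e \<omega>) :: ennreal) \<in> borel_measurable borel"
  by (rule measurable_compose[OF measurable_vprime]) (use A in simp)
 let ?H = "\<lambda>\<omega>. ennreal (B (kcos \<omega>)) * indicator A (vprime e \<omega>)"
 have Hm: "?H \<in> borel_measurable borel" using Bk_measurable by simp
 then have Hm'[measurable]: "?H \<in> borel_measurable (borel \<Otimes>\<^sub>M (borel \<Otimes>\<^sub>M borel))"
  by (simp only: borel_triple)
 have "(\<integral>\<^sup>+\<omega>. indicator A (vprime e \<omega>) \<partial>KM) = (\<integral>\<^sup>+\<omega>. ?H \<omega> \<partial>M3)" by (rule nn_integral_KM[OF Am])
 also have "\<dots> = (\<integral>\<^sup>+n. \<integral>\<^sup>+v. \<integral>\<^sup>+w. ?H (v, w, n) \<partial>lborel \<partial>lborel \<partial>S2)"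
  by (rule nn_integral_M3(2)[OF Hm])
 also have "\<dots> = (\<integral>\<^sup>+n. \<integral>\<^sup>+q. \<integral>\<^sup>+z. ?H (z + (1/2) *\<^sub>R q, z - (1/2) *\<^sub>R q, n) \<partial>lborel \<partial>lborel \<partial>S2)"
 proof (rule nn_integral_cong)
  fix n :: vec3
  show "(\<integral>\<^sup>+v. \<integral>\<^sup>+w. ?H (v, w, n) \<partial>lborel \<partial>lborel) = (\<integral>\<^sup>+q. \<integral>\<^sup>+z. ?H (z + (1/2) *\<^sub>R q, z - (1/2) *\<^sub>R q, n) \<partial>lborel \<partial>lborel)"
   by (rule nn_integral_center_of_mass) measurable
 qed
 also have "\<dots> = (\<integral>\<^sup>+n. \<integral>\<^sup>+q. 0 \<partial>(lborel :: vec3 measure) \<partial>S2)"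
 proof (rule nn_integral_cong, rule nn_integral_cong)
  fix n q :: vec3
  have "(\<integral>\<^sup>+z. indicator A (z + relu e q n) \<partial>lborel) = (\<integral>\<^sup>+z. indicator A z \<partial>lborel)"
   by (rule nn_integral_lborel_shift) (use A in simp)
  then have "(\<integral>\<^sup>+z. indicator A (z + relu e q n) \<partial>lborel) = 0" using A by simp
  moreover have "(\<lambda>z. indicator A (z + relu e q n) :: ennreal) \<in> borel_measurable lborel"
   by (rule measurable_compose[of "\<lambda>z. z + relu e q n" _ borel]) (use A in simp_all)
  ultimately have AEz: "AE z in lborel. (indicator A (z + relu e q n) :: ennreal) = 0"
   by (simp add: nn_integral_0_iff_AE)
  have vp: "vprime e (z + (1/2) *\<^sub>R q, z - (1/2) *\<^sub>R q, n) = z + relu e q n" for z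
  proof -
   have "(1/2) *\<^sub>R (z + (1/2) *\<^sub>R q + (z - (1/2) *\<^sub>R q)) = z" "z + (1/2) *\<^sub>R q - (z - (1/2) *\<^sub>R q) = q"
    by (simp_all add: vec_eq_iff)
   then show ?thesis by (simp only: vprime_def prod.case vpost_relu)
  qed
  have "(\<integral>\<^sup>+z. ?H (z + (1/2) *\<^sub>R q, z - (1/2) *\<^sub>R q, n) \<partial>lborel) = (\<integral>\<^sup>+z. 0 \<partial>(lborel :: vec3 measure))"
  proof (rule nn_integral_cong_AE)
   show "AE z in lborel. ?H (z + (1/2) *\<^sub>R q, z - (1/2) *\<^sub>R q, n) = 0"
    using AEz unfolding vp by eventually_elim simp
  qed
  then show "(\<integral>\<^sup>+z. ?H (z + (1/2) *\<^sub>R q, z - (1/2) *\<^sub>R q, n) \<partial>lborel) = 0" by simp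
 qed
 finally have "(\<integral>\<^sup>+\<omega>. indicator A (vprime e \<omega>) \<partial>KM) = 0" by simp
 then have "AE \<omega> in KM. (indicator A (vprime e \<omega>) :: ennreal) = 0"
  using Am by (simp add: nn_integral_0_iff_AE)
 then show ?thesis by eventually_elim (simp add: indicator_def split: if_splits)
qed

text \<open>Joint law of the two velocities and the normal; the factor \<open>4 * pi\<close> makes
  it a probability measure when \<open>f\<close> and \<open>g\<close> have unit mass.\<close>

definition NM :: "(vec3 \<Rightarrow> real) \<Rightarrow> (vec3 \<Rightarrow> real) \<Rightarrow> (vec3 \<times> vec3 \<times> vec3) measure" where
 "NM f g = density KM (\<lambda>\<omega>. ennreal (f (fst \<omega>) * g (fst (snd \<omega>)) / (4 * pi)))"

lemma sets_NM[measurable_cong, simp]: "sets (NM f g) = sets borel" and space_NM[simp]: "space (NM f g) = UNIV"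
 by (simp_all add: NM_def)

lemma weight_measurable:
 assumes [measurable]: "f \<in> borel_measurable borel" "g \<in> borel_measurable borel"
 shows "(\<lambda>\<omega>. f (fst \<omega>) * g (fst (snd \<omega>)) / (4 * pi)) \<in> borel_measurable (borel :: (vec3 \<times> vec3 \<times> vec3) measure)"
 unfolding borel_triple[symmetric] by measurable

lemma integral_NM:
 assumes f: "f \<in> borel_measurable borel" "\<And>v. 0 \<le> f v" and g: "g \<in> borel_measurable borel" "\<And>v. 0 \<le> g v"
  and H: "H \<in> borel_measurable borel"
 shows "(\<integral>\<omega>. H \<omega> \<partial>NM f g) = (1 / (4 * pi)) * (\<integral>\<omega>. f (fst \<omega>) * g (fst (snd \<omega>)) * H \<omega> \<partial>KM)"
  and "integrable (NM f g) H \<longleftrightarrow> integrable KM (\<lambda>\<omega>. f (fst \<omega>) * g (fst (snd \<omega>)) * H \<omega>)"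
proof -
 let ?w = "\<lambda>\<omega> :: vec3 \<times> vec3 \<times> vec3. f (fst \<omega>) * g (fst (snd \<omega>)) / (4 * pi)"
 have w: "?w \<in> borel_measurable KM" "AE \<omega> in KM. 0 \<le> ?w \<omega>" and H': "H \<in> borel_measurable KM"
  using weight_measurable[OF f(1) g(1)] f(2) g(2) H by simp_all
 have eq: "?w \<omega> *\<^sub>R H \<omega> = (1 / (4 * pi)) * (f (fst \<omega>) * g (fst (snd \<omega>)) * H \<omega>)" for \<omega> by simp
 show "(\<integral>\<omega>. H \<omega> \<partial>NM f g) = (1 / (4 * pi)) * (\<integral>\<omega>. f (fst \<omega>) * g (fst (snd \<omega>)) * H \<omega> \<partial>KM)"
  unfolding NM_def integral_density[OF H' w] eq by simp
 show "integrable (NM f g) H \<longleftrightarrow> integrable KM (\<lambda>\<omega>. f (fst \<omega>) * g (fst (snd \<omega>)) * H \<omega>)"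
  unfolding NM_def integrable_density[OF H' w] eq integrable_mult_left_iff by simp
qed

lemma emeasure_NM:
 assumes [measurable]: "f \<in> borel_measurable borel" "g \<in> borel_measurable borel" and p: "\<And>v. 0 \<le> f v" "\<And>v. 0 \<le> g v"
  and i: "integrable lborel f" "integrable lborel g"
 shows "emeasure (NM f g) UNIV = ennreal ((LBINT v. f v) * (LBINT w. g w))"
proof -
 let ?w = "\<lambda>\<omega> :: vec3 \<times> vec3 \<times> vec3. f (fst \<omega>) * g (fst (snd \<omega>)) / (4 * pi)"
 have "emeasure (NM f g) UNIV = (\<integral>\<^sup>+\<omega>. ennreal (?w \<omega>) \<partial>KM)"
  unfolding NM_def using weight_measurable[of f g] by (subst emeasure_density) simp_all
 also have "\<dots> = (\<integral>\<^sup>+\<omega>. ennreal (f (fst \<omega>) / (4 * pi)) * ennreal (g (fst (snd \<omega>))) \<partial>KM)"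
  using p by (simp flip: ennreal_mult)
 also have "\<dots> = ennreal (4 * pi) * ((\<integral>\<^sup>+v. ennreal (f v / (4 * pi)) \<partial>lborel) * (\<integral>\<^sup>+w. ennreal (g w) \<partial>lborel))"
  by (rule nn_integral_KM_prod[of "\<lambda>v. ennreal (f v / (4 * pi))" "\<lambda>w. ennreal (g w)"]) measurable
 also have "(\<integral>\<^sup>+v. ennreal (f v / (4 * pi)) \<partial>lborel) = ennreal ((LBINT v. f v) / (4 * pi))"
  using i p by (subst nn_integral_eq_integral) auto
 also have "(\<integral>\<^sup>+v. ennreal (g v) \<partial>lborel) = ennreal (LBINT v. g v)"
  using i p by (subst nn_integral_eq_integral) auto
 finally show ?thesis using p by (simp flip: ennreal_mult add: integral_nonneg_AE)
qed

lemma integral_KM_prod: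
 assumes [measurable]: "f \<in> borel_measurable borel" "g \<in> borel_measurable borel" and p: "\<And>v. 0 \<le> f v" "\<And>v. 0 \<le> g v"
  and i: "integrable lborel f" "integrable lborel g"
 shows "(\<integral>\<omega>. f (fst \<omega>) * g (fst (snd \<omega>)) \<partial>KM) = 4 * pi * ((LBINT v. f v) * (LBINT w. g w))"
proof -
 have "(\<integral>\<omega>. 1 \<partial>NM f g) = (1 / (4 * pi)) * (\<integral>\<omega>. f (fst \<omega>) * g (fst (snd \<omega>)) * 1 \<partial>KM)"
  by (rule integral_NM(1)) (use p in simp_all)
 moreover have "(\<integral>\<omega>. 1 \<partial>NM f g) = (LBINT v. f v) * (LBINT w. g w)"
  using emeasure_NM[of f g] p i by (simp add: measure_def integral_nonneg_AE)
 ultimately show ?thesis by (simp add: field_simps)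
qed

text \<open>Radon-Nikodym, since the law of the post-collisional velocity charges no null set. Its
  mass is finite, so the density can be taken real-valued.\<close>

lemma gain_law:
 assumes fm: "f \<in> borel_measurable borel" "g \<in> borel_measurable borel" and p: "\<And>v. 0 \<le> f v" "\<And>v. 0 \<le> g v"
  and i: "integrable lborel f" "integrable lborel g"
 shows "\<exists>q. q \<in> borel_measurable borel \<and> (\<forall>v. 0 \<le> q v) \<and> integrable lborel q \<and>
  distr (NM f g) borel (vprime e) = density lborel (\<lambda>v. ennreal (q v))"
proof -
 let ?N = "distr (NM f g) borel (vprime e)"
 have X: "vprime e \<in> NM f g \<rightarrow>\<^sub>M borel" using measurable_vprime by (simp cong: measurable_cong_sets)
 have mass: "emeasure ?N UNIV < \<infinity>"
  using emeasure_NM[of f g] fm p i by (subst emeasure_distr[OF X]) simp_all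
 have "absolutely_continuous lborel ?N"
  unfolding absolutely_continuous_def null_sets_def
 proof safe
  fix A :: "vec3 set" assume A: "A \<in> sets lborel" "emeasure lborel A = 0"
  then have A': "A \<in> sets borel" by simp
  have "AE \<omega> in NM f g. vprime e \<omega> \<notin> A"
   unfolding NM_def using nn_integral_KM_vprime_null[OF A' A(2)]
   by (subst AE_density) (use weight_measurable[OF fm] in \<open>auto elim: eventually_mono\<close>)
  then have "emeasure (NM f g) {\<omega> \<in> space (NM f g). \<not> vprime e \<omega> \<notin> A} = 0"
   by (rule AE_E2)
  then show "emeasure ?N A = 0" using A' by (simp add: emeasure_distr[OF X] vimage_def)
  show "A \<in> sets ?N" using A' by simp
 qed
 then obtain Q where Q: "Q \<in> borel_measurable lborel" "density lborel Q = ?N"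
  using sigma_finite_measure.Radon_Nikodym[OF sigma_finite_lborel, of ?N] by auto
 have Qi: "(\<integral>\<^sup>+v. Q v \<partial>lborel) < \<infinity>"
 proof -
  have "(\<integral>\<^sup>+v. Q v \<partial>lborel) = emeasure (density lborel Q) UNIV" using Q(1) by (simp add: emeasure_density)
  then show ?thesis using mass unfolding Q(2) by simp
 qed
 have fin: "AE v in lborel. Q v \<noteq> \<infinity>" by (rule nn_integral_noteq_infinite[OF Q(1)]) (use Qi in simp)
 define q where "q v = enn2real (Q v)" for v
 have qm: "q \<in> borel_measurable borel" using Q(1) unfolding q_def by simp
 have qQ: "AE v in lborel. ennreal (q v) = Q v" using fin by eventually_elim (simp add: q_def less_top)
 have "density lborel (\<lambda>v. ennreal (q v)) = density lborel Q"
  by (rule density_cong) (use qm Q(1) qQ in simp_all)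
 moreover have "integrable lborel q"
 proof (rule integrableI_bounded)
  have "(\<integral>\<^sup>+v. ennreal (norm (q v)) \<partial>lborel) = (\<integral>\<^sup>+v. Q v \<partial>lborel)"
   by (rule nn_integral_cong_AE) (use qQ in eventually_elim, simp add: q_def)
  then show "(\<integral>\<^sup>+v. ennreal (norm (q v)) \<partial>lborel) < \<infinity>" using Qi by simp
 qed (use qm in simp)
 ultimately show ?thesis using qm Q(2) by (intro exI[of _ q]) (simp add: q_def)
qed

text \<open>The integrated mixed term of \<open>score_combination_bound\<close>, separated from the
  rest because of its antisymmetry in the two particles.\<close>

definition cross :: "(vec3 \<Rightarrow> real) \<Rightarrow> (vec3 \<Rightarrow> vec3) \<Rightarrow> (vec3 \<Rightarrow> real) \<Rightarrow> (vec3 \<Rightarrow> vec3) \<Rightarrow> real" where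
 "cross f s g \<sigma> = (1 / (4 * pi)) * (\<integral>\<omega>. f (fst \<omega>) * g (fst (snd \<omega>)) *
  ((1/2) * ((s (fst \<omega>) + \<sigma> (fst (snd \<omega>))) \<bullet> Tt \<omega> (s (fst \<omega>) - \<sigma> (fst (snd \<omega>))))) \<partial>KM)"

lemma measurable_Tt:
 assumes z: "z \<in> borel_measurable borel" shows "(\<lambda>\<omega>. Tt \<omega> (z \<omega>)) \<in> borel_measurable borel"
proof -
 have "(\<lambda>\<omega>. \<chi> i. z \<omega> \<bullet> Tn (axis i (1/2)) \<omega>) \<in> borel_measurable borel"
  by (rule borel_measurable_vec_lambda, simp only: vec_lambda_beta, intro borel_measurable_inner z measurable_Tn)
 then show ?thesis by (simp add: Tt_def)
qed

lemma score_pair_measurable: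
 assumes "s \<in> borel_measurable borel" "\<sigma> \<in> borel_measurable borel"
 shows "(\<lambda>\<omega>. (1/2) * ((s (fst \<omega>) + \<sigma> (fst (snd \<omega>))) \<bullet> Tt \<omega> (s (fst \<omega>) - \<sigma> (fst (snd \<omega>))))) \<in> borel_measurable borel"
  and "(\<lambda>\<omega>. (1/2) *\<^sub>R (s (fst \<omega>) + \<sigma> (fst (snd \<omega>))) + (1/2) *\<^sub>R Tt \<omega> (s (fst \<omega>) - \<sigma> (fst (snd \<omega>)))) \<in> borel_measurable borel"
proof -
 have [measurable]: "(\<lambda>\<omega> :: vec3 \<times> vec3 \<times> vec3. s (fst \<omega>)) \<in> borel_measurable borel"
  "(\<lambda>\<omega> :: vec3 \<times> vec3 \<times> vec3. \<sigma> (fst (snd \<omega>))) \<in> borel_measurable borel"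
  by (rule measurable_comp_fst[OF assms(1)], rule measurable_comp_fst_snd[OF assms(2)])
 have [measurable]: "(\<lambda>\<omega>. Tt \<omega> (s (fst \<omega>) - \<sigma> (fst (snd \<omega>)))) \<in> borel_measurable borel"
  by (rule measurable_Tt) measurable
 show "(\<lambda>\<omega>. (1/2) * ((s (fst \<omega>) + \<sigma> (fst (snd \<omega>))) \<bullet> Tt \<omega> (s (fst \<omega>) - \<sigma> (fst (snd \<omega>))))) \<in> borel_measurable borel"
  "(\<lambda>\<omega>. (1/2) *\<^sub>R (s (fst \<omega>) + \<sigma> (fst (snd \<omega>))) + (1/2) *\<^sub>R Tt \<omega> (s (fst \<omega>) - \<sigma> (fst (snd \<omega>)))) \<in> borel_measurable borel"
  by measurable
qed

text \<open>Exchange leaves \<open>Tt\<close> and the sum of the scores unchanged and reverses their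
  difference.\<close>

lemma cross_swap:
 assumes [measurable]: "f \<in> borel_measurable borel" "g \<in> borel_measurable borel" "s \<in> borel_measurable borel" "\<sigma> \<in> borel_measurable borel"
 shows "cross g \<sigma> f s = - cross f s g \<sigma>"
proof -
 let ?H = "\<lambda>\<omega>. f (fst \<omega>) * g (fst (snd \<omega>)) * ((1/2) * ((s (fst \<omega>) + \<sigma> (fst (snd \<omega>))) \<bullet> Tt \<omega> (s (fst \<omega>) - \<sigma> (fst (snd \<omega>)))))"
 have Hm: "?H \<in> borel_measurable borel"
  using score_pair_measurable(1)[OF assms(3,4)] measurable_comp_fst[OF assms(1)] measurable_comp_fst_snd[OF assms(2)] by measurable
 have "?H (swap3 \<omega>) = - (g (fst \<omega>) * f (fst (snd \<omega>)) * ((1/2) * ((\<sigma> (fst \<omega>) + s (fst (snd \<omega>))) \<bullet> Tt \<omega> (\<sigma> (fst \<omega>) - s (fst (snd \<omega>))))))" for \<omega>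
 proof -
  have "fst (swap3 \<omega>) = fst (snd \<omega>)" "fst (snd (swap3 \<omega>)) = fst \<omega>" by (simp_all add: swap3_def split_beta)
  then show ?thesis by (simp add: Tt_swap3 Tt_diff inner_diff_right add.commute algebra_simps)
 qed
 then have "(\<integral>\<omega>. ?H \<omega> \<partial>KM) = (\<integral>\<omega>. - (g (fst \<omega>) * f (fst (snd \<omega>)) * ((1/2) * ((\<sigma> (fst \<omega>) + s (fst (snd \<omega>))) \<bullet> Tt \<omega> (\<sigma> (fst \<omega>) - s (fst (snd \<omega>)))))) \<partial>KM)"
  using integral_KM_distr(1)[OF measurable_swap3 distr_KM_swap3 Hm] by simp
 then show ?thesis unfolding cross_def by simp
qed

text \<open>Push-forward of \<open>NM f g\<close> under the collision map, with the field
  \<open>\<Theta>\<close> in the role of the score; \<open>gain_score_identity\<close> supplies its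
  integration by parts. Two different densities are allowed because the Wild sum collides different
  terms.\<close>

theorem gain_score:
 assumes f: "has_score f s" and g: "has_score g \<sigma>" and f1: "(LBINT v. f v) = 1" and g1: "(LBINT v. g v) = 1"
 shows "\<exists>q S. has_score q S \<and> (LBINT v. q v) = 1 \<and>
  (\<forall>\<phi>. \<phi> \<in> borel_measurable borel \<longrightarrow> (LBINT v. q v * \<phi> v) = (1 / (4 * pi)) * (\<integral>\<omega>. f (fst \<omega>) * g (fst (snd \<omega>)) * \<phi> (vprime e \<omega>) \<partial>KM)) \<and>
  (LBINT v. q v * (norm (S v))\<^sup>2) \<le> (1 / e\<^sup>2) * ((LBINT v. f v * (norm (s v))\<^sup>2) + (LBINT v. g v * (norm (\<sigma> v))\<^sup>2)) / 2 + cross f s g \<sigma>"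
proof -
 have fm: "f \<in> borel_measurable borel" "g \<in> borel_measurable borel" and sm: "s \<in> borel_measurable borel" "\<sigma> \<in> borel_measurable borel"
  and p: "\<And>v. 0 \<le> f v" "\<And>v. 0 \<le> g v" and i: "integrable lborel f" "integrable lborel g"
  and i2: "integrable lborel (\<lambda>v. f v * (norm (s v))\<^sup>2)" "integrable lborel (\<lambda>v. g v * (norm (\<sigma> v))\<^sup>2)"
  using f g by (auto simp: has_score_def)
 note [measurable] = fm sm
 obtain q where q: "q \<in> borel_measurable borel" "\<And>v. 0 \<le> q v" "integrable lborel q"
  "distr (NM f g) borel (vprime e) = density lborel (\<lambda>v. ennreal (q v))"
  using gain_law[OF fm p i] by blast
 have X: "vprime e \<in> NM f g \<rightarrow>\<^sub>M borel" using measurable_vprime by (simp cong: measurable_cong_sets)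
 have law: "(LBINT v. q v * \<phi> v) = (1 / (4 * pi)) * (\<integral>\<omega>. f (fst \<omega>) * g (fst (snd \<omega>)) * \<phi> (vprime e \<omega>) \<partial>KM)"
  if \<phi>: "\<phi> \<in> borel_measurable borel" for \<phi> :: "vec3 \<Rightarrow> real"
 proof -
  have "(LBINT v. q v * \<phi> v) = (\<integral>v. \<phi> v \<partial>density lborel (\<lambda>v. ennreal (q v)))"
   using \<phi> q by (subst integral_density) auto
  also have "\<dots> = (\<integral>\<omega>. \<phi> (vprime e \<omega>) \<partial>NM f g)"
   unfolding q(4)[symmetric] by (rule integral_distr[OF X \<phi>])
  also have "\<dots> = (1 / (4 * pi)) * (\<integral>\<omega>. f (fst \<omega>) * g (fst (snd \<omega>)) * \<phi> (vprime e \<omega>) \<partial>KM)"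
   by (rule integral_NM(1)[OF fm(1) p(1) fm(2) p(2) measurable_compose[OF measurable_vprime \<phi>]])
  finally show ?thesis .
 qed
 have q1: "(LBINT v. q v) = 1"
  using law[of "\<lambda>_. 1"] integral_KM_prod[OF fm p i] f1 g1 by simp
 define \<Theta> where "\<Theta> \<omega> = (1/2) *\<^sub>R (s (fst \<omega>) + \<sigma> (fst (snd \<omega>))) + (1/2) *\<^sub>R Tt \<omega> (s (fst \<omega>) - \<sigma> (fst (snd \<omega>)))" for \<omega>
 define c where "c \<omega> = (1/2) * ((s (fst \<omega>) + \<sigma> (fst (snd \<omega>))) \<bullet> Tt \<omega> (s (fst \<omega>) - \<sigma> (fst (snd \<omega>))))" for \<omega>
 define m where "m \<omega> = (norm (s (fst \<omega>)))\<^sup>2 + (norm (\<sigma> (fst (snd \<omega>))))\<^sup>2" for \<omega> :: "vec3 \<times> vec3 \<times> vec3"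
 have \<Theta>c: "(norm (\<Theta> \<omega>))\<^sup>2 \<le> (1 / e\<^sup>2) * m \<omega> / 2 + c \<omega>" and cm: "\<bar>c \<omega>\<bar> \<le> (1 / e) * m \<omega>" for \<omega>
  unfolding \<Theta>_def c_def m_def by (rule score_combination_bound, rule score_cross_bound)
 have \<Theta>m: "\<Theta> \<in> borel_measurable borel" and cmm: "c \<in> borel_measurable borel"
  unfolding \<Theta>_def c_def using score_pair_measurable[OF sm] by simp_all
 have \<Theta>2m: "(\<lambda>\<omega>. (norm (\<Theta> \<omega>))\<^sup>2) \<in> borel_measurable borel" using \<Theta>m by simp
 have mm: "m \<in> borel_measurable borel"
  unfolding m_def using measurable_comp_fst[OF sm(1)] measurable_comp_fst_snd[OF sm(2)] by simp
 let ?fg = "\<lambda>\<omega> :: vec3 \<times> vec3 \<times> vec3. f (fst \<omega>) * g (fst (snd \<omega>))"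
 have fgm: "?fg \<in> borel_measurable borel" using measurable_comp_fst[OF fm(1)] measurable_comp_fst_snd[OF fm(2)] by simp
 have fg0: "0 \<le> ?fg \<omega>" for \<omega> using p by simp
 have fgm_eq: "?fg \<omega> * m \<omega> = (f (fst \<omega>) * (norm (s (fst \<omega>)))\<^sup>2) * g (fst (snd \<omega>)) + f (fst \<omega>) * (g (fst (snd \<omega>)) * (norm (\<sigma> (fst (snd \<omega>))))\<^sup>2)" for \<omega>
  by (simp add: m_def algebra_simps)
 have im1: "integrable KM (\<lambda>\<omega>. (f (fst \<omega>) * (norm (s (fst \<omega>)))\<^sup>2) * g (fst (snd \<omega>)))"
  using integrable_KM[OF i2(1) i(2), of "\<lambda>_. 1" 1] by simp
 have im2: "integrable KM (\<lambda>\<omega>. f (fst \<omega>) * (g (fst (snd \<omega>)) * (norm (\<sigma> (fst (snd \<omega>))))\<^sup>2))"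
  using integrable_KM[OF i(1) i2(2), of "\<lambda>_. 1" 1] by simp
 have im: "integrable KM (\<lambda>\<omega>. ?fg \<omega> * m \<omega>)" unfolding fgm_eq using im1 im2 by simp
 have mint: "(\<integral>\<omega>. ?fg \<omega> * m \<omega> \<partial>KM) = 4 * pi * ((LBINT v. f v * (norm (s v))\<^sup>2) + (LBINT v. g v * (norm (\<sigma> v))\<^sup>2))"
 proof -
  have "(\<integral>\<omega>. (f (fst \<omega>) * (norm (s (fst \<omega>)))\<^sup>2) * g (fst (snd \<omega>)) \<partial>KM) = 4 * pi * ((LBINT v. f v * (norm (s v))\<^sup>2) * (LBINT w. g w))"
   by (rule integral_KM_prod[OF _ fm(2) _ p(2) i2(1) i(2)]) (use p in simp_all)
  moreover have "(\<integral>\<omega>. f (fst \<omega>) * (g (fst (snd \<omega>)) * (norm (\<sigma> (fst (snd \<omega>))))\<^sup>2) \<partial>KM) = 4 * pi * ((LBINT v. f v) * (LBINT w. g w * (norm (\<sigma> w))\<^sup>2))"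
   by (rule integral_KM_prod[OF fm(1) _ p(1) _ i(1) i2(2)]) (use p in simp_all)
  ultimately show ?thesis unfolding fgm_eq using im1 im2 f1 g1 by (simp add: distrib_left)
 qed
 have ic: "integrable KM (\<lambda>\<omega>. ?fg \<omega> * c \<omega>)"
 proof (rule integrable_dominated)
  show "integrable KM (\<lambda>\<omega>. (1 / e) * (?fg \<omega> * m \<omega>))" using im by (rule integrable_mult_right)
  show "(\<lambda>\<omega>. ?fg \<omega> * c \<omega>) \<in> borel_measurable KM" using fgm cmm by simp
  fix \<omega>
  have "?fg \<omega> * \<bar>c \<omega>\<bar> \<le> ?fg \<omega> * ((1 / e) * m \<omega>)" by (rule mult_left_mono[OF cm fg0])
  then show "\<bar>?fg \<omega> * c \<omega>\<bar> \<le> (1 / e) * (?fg \<omega> * m \<omega>)" using p by (simp add: abs_mult mult_ac)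
 qed
 have ib: "integrable KM (\<lambda>\<omega>. (1 / e\<^sup>2) * (?fg \<omega> * m \<omega>) / 2 + ?fg \<omega> * c \<omega>)"
  using im ic by simp
 have le: "?fg \<omega> * (norm (\<Theta> \<omega>))\<^sup>2 \<le> (1 / e\<^sup>2) * (?fg \<omega> * m \<omega>) / 2 + ?fg \<omega> * c \<omega>" for \<omega>
 proof -
  have "?fg \<omega> * (norm (\<Theta> \<omega>))\<^sup>2 \<le> ?fg \<omega> * ((1 / e\<^sup>2) * m \<omega> / 2 + c \<omega>)" by (rule mult_left_mono[OF \<Theta>c fg0])
  then show ?thesis by (simp add: distrib_left mult_ac)
 qed
 have i\<Theta>: "integrable KM (\<lambda>\<omega>. ?fg \<omega> * (norm (\<Theta> \<omega>))\<^sup>2)"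
  by (rule integrable_dominated[OF ib]) (use fgm \<Theta>2m p le in \<open>simp_all add: abs_mult\<close>)
 have "(\<integral>\<omega>. ?fg \<omega> * (norm (\<Theta> \<omega>))\<^sup>2 \<partial>KM) \<le> (\<integral>\<omega>. (1 / e\<^sup>2) * (?fg \<omega> * m \<omega>) / 2 + ?fg \<omega> * c \<omega> \<partial>KM)"
  by (rule integral_mono[OF i\<Theta> ib le])
 also have "\<dots> = (1 / e\<^sup>2) * (\<integral>\<omega>. ?fg \<omega> * m \<omega> \<partial>KM) / 2 + (\<integral>\<omega>. ?fg \<omega> * c \<omega> \<partial>KM)"
  using im ic by simp
 finally have "(1 / (4 * pi)) * (\<integral>\<omega>. ?fg \<omega> * (norm (\<Theta> \<omega>))\<^sup>2 \<partial>KM)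
  \<le> (1 / (4 * pi)) * ((1 / e\<^sup>2) * (\<integral>\<omega>. ?fg \<omega> * m \<omega> \<partial>KM) / 2 + (\<integral>\<omega>. ?fg \<omega> * c \<omega> \<partial>KM))"
  by (rule mult_left_mono) simp
 also have "\<dots> = (1 / e\<^sup>2) * ((LBINT v. f v * (norm (s v))\<^sup>2) + (LBINT v. g v * (norm (\<sigma> v))\<^sup>2)) / 2 + cross f s g \<sigma>"
  unfolding mint by (simp add: cross_def c_def distrib_left)
 also have "(1 / (4 * pi)) * (\<integral>\<omega>. ?fg \<omega> * (norm (\<Theta> \<omega>))\<^sup>2 \<partial>KM) = (\<integral>\<omega>. (norm (\<Theta> \<omega>))\<^sup>2 \<partial>NM f g)"
  by (rule integral_NM(1)[OF fm(1) p(1) fm(2) p(2) \<Theta>2m, symmetric])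
 finally have J: "(\<integral>\<omega>. (norm (\<Theta> \<omega>))\<^sup>2 \<partial>NM f g) \<le> (1 / e\<^sup>2) * ((LBINT v. f v * (norm (s v))\<^sup>2) + (LBINT v. g v * (norm (\<sigma> v))\<^sup>2)) / 2 + cross f s g \<sigma>" .
 have "\<exists>S. has_score q S \<and> (LBINT x. q x * (norm (S x))\<^sup>2) \<le> (\<integral>\<omega>. (norm (\<Theta> \<omega>))\<^sup>2 \<partial>NM f g)"
 proof (rule score_pushforward[OF _ X _ _ q(3,2,4)])
  show "finite_measure (NM f g)"
   by (rule finite_measureI) (use emeasure_NM[OF fm p i] in simp)
  show "\<Theta> \<in> borel_measurable (NM f g)" using \<Theta>m by (simp cong: measurable_cong_sets)
  show "integrable (NM f g) (\<lambda>\<omega>. (norm (\<Theta> \<omega>))\<^sup>2)"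
   using i\<Theta> integral_NM(2)[OF fm(1) p(1) fm(2) p(2) \<Theta>2m] by simp
  fix \<psi> k assume \<psi>: "test_fun \<psi>"
  have m1: "(\<lambda>\<omega>. partial k \<psi> (vprime e \<omega>)) \<in> borel_measurable borel"
   by (rule measurable_compose[OF measurable_vprime test_fun_measurable[OF test_fun_partial[OF \<psi>]]])
  have m2: "(\<lambda>\<omega>. \<Theta> \<omega> $ k * \<psi> (vprime e \<omega>)) \<in> borel_measurable borel"
   using borel_measurable_vec_nth_comp[OF \<Theta>m, of k] measurable_compose[OF measurable_vprime test_fun_measurable[OF \<psi>]]
   by (rule borel_measurable_times)
  show "(\<integral>\<omega>. partial k \<psi> (vprime e \<omega>) \<partial>NM f g) = - (\<integral>\<omega>. \<Theta> \<omega> $ k * \<psi> (vprime e \<omega>) \<partial>NM f g)"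
   unfolding integral_NM(1)[OF fm(1) p(1) fm(2) p(2) m1] integral_NM(1)[OF fm(1) p(1) fm(2) p(2) m2]
   using gain_score_identity[OF f g \<psi>, of k] by (simp only: \<Theta>_def mult_minus_right)
 qed
 then obtain S where "has_score q S" "(LBINT x. q x * (norm (S x))\<^sup>2) \<le> (\<integral>\<omega>. (norm (\<Theta> \<omega>))\<^sup>2 \<partial>NM f g)" by blast
 with J q1 law show ?thesis by (intro exI[of _ q] exI[of _ S]) auto
qed

end

section \<open>Wild sums: construction and energy of the terms\<close>

context collision
begin

abbreviation energy :: "(vec3 \<Rightarrow> real) \<Rightarrow> (vec3 \<Rightarrow> vec3) \<Rightarrow> real" where
 "energy f s \<equiv> (LBINT v. f v * (norm (s v))\<^sup>2)"

text \<open>The polarised gain functional, bilinear in the two densities, as the Wild recursion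
  demands.\<close>

definition gain :: "(vec3 \<Rightarrow> real) \<Rightarrow> (vec3 \<Rightarrow> real) \<Rightarrow> (vec3 \<Rightarrow> real) \<Rightarrow> real" where
 "gain f g \<phi> = (1 / (4 * pi)) * (\<integral>\<omega>. f (fst \<omega>) * g (fst (snd \<omega>)) * \<phi> (vprime e \<omega>) \<partial>KM)"

text \<open>The new term is the equal-weight mixture of the collisions of \<open>g k\<close> with
  \<open>g (n - k)\<close>. Reversing the order of summation pairs each mixed term with its
  negative, so their sum vanishes although single ones do not.\<close>

lemma wild_step:
 fixes g :: "nat \<Rightarrow> vec3 \<Rightarrow> real" and s :: "nat \<Rightarrow> vec3 \<Rightarrow> vec3"
 assumes g: "\<And>k. k \<le> n \<Longrightarrow> has_score (g k) (s k)" and g1: "\<And>k. k \<le> n \<Longrightarrow> (LBINT v. g k v) = 1"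
 shows "\<exists>G S. has_score G S \<and> (LBINT v. G v) = 1 \<and>
  (\<forall>\<phi>. \<phi> \<in> borel_measurable borel \<longrightarrow> bounded (range \<phi>) \<longrightarrow> real (Suc n) * (LBINT v. G v * \<phi> v) = (\<Sum>k\<le>n. gain (g k) (g (n - k)) \<phi>)) \<and>
  real (Suc n) * energy G S \<le> (1 / e\<^sup>2) * (\<Sum>k\<le>n. energy (g k) (s k))"
proof -
 let ?J = "\<lambda>k. (1 / e\<^sup>2) * (energy (g k) (s k) + energy (g (n - k)) (s (n - k))) / 2 + cross (g k) (s k) (g (n - k)) (s (n - k))"
 have "\<forall>k. \<exists>r. k \<le> n \<longrightarrow> has_score (fst r) (snd r) \<and> (LBINT v. fst r v) = 1 \<and>
  (\<forall>\<phi>. \<phi> \<in> borel_measurable borel \<longrightarrow> (LBINT v. fst r v * \<phi> v) = gain (g k) (g (n - k)) \<phi>) \<and>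
  energy (fst r) (snd r) \<le> ?J k"
 proof
  fix k
  show "\<exists>r. k \<le> n \<longrightarrow> has_score (fst r) (snd r) \<and> (LBINT v. fst r v) = 1 \<and>
   (\<forall>\<phi>. \<phi> \<in> borel_measurable borel \<longrightarrow> (LBINT v. fst r v * \<phi> v) = gain (g k) (g (n - k)) \<phi>) \<and>
   energy (fst r) (snd r) \<le> ?J k"
  proof (cases "k \<le> n")
   case True
   then obtain q S where "has_score q S" "(LBINT v. q v) = 1"
    "\<And>\<phi>. \<phi> \<in> borel_measurable borel \<Longrightarrow> (LBINT v. q v * \<phi> v) = gain (g k) (g (n - k)) \<phi>" "energy q S \<le> ?J k"
    using gain_score[OF g[of k] g[of "n - k"] g1[of k] g1[of "n - k"]] unfolding gain_def by auto
   then show ?thesis by (intro exI[of _ "(q, S)"]) simp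
  qed simp
 qed
 from choice[OF this] obtain r where r: "\<And>k. k \<le> n \<Longrightarrow> has_score (fst (r k)) (snd (r k))" "\<And>k. k \<le> n \<Longrightarrow> (LBINT v. fst (r k) v) = 1"
  "\<And>k \<phi>. k \<le> n \<Longrightarrow> \<phi> \<in> borel_measurable borel \<Longrightarrow> (LBINT v. fst (r k) v * \<phi> v) = gain (g k) (g (n - k)) \<phi>"
  "\<And>k. k \<le> n \<Longrightarrow> energy (fst (r k)) (snd (r k)) \<le> ?J k" by blast
 \<comment> \<open>\<open>score_mixture\<close> expects a sequence: beyond \<open>n\<close> the last
   term is repeated and receives weight zero.\<close>
 define q S J where "q k = fst (r (min k n))" and "S k = snd (r (min k n))" and "J k = ?J (min k n)" for k
 define p :: "nat \<Rightarrow> real" where "p k = (if k \<in> {..n} then 1 / real (Suc n) else 0)" for k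
 define G where "G v = (\<Sum>k\<le>n. p k * q k v)" for v
 have qs: "has_score (q k) (S k)" for k unfolding q_def S_def by (rule r) simp
 have qi: "integrable lborel (q k)" and qm: "q k \<in> borel_measurable borel" and q0: "0 \<le> q k v" for k v
  using qs[of k] by (auto simp: has_score_def)
 have p0: "0 \<le> p k" for k by (simp add: p_def)
 have fs: "(\<lambda>k. p k * z k) sums (\<Sum>k\<le>n. p k * z k)" for z :: "nat \<Rightarrow> real"
  by (rule sums_finite) (simp_all add: p_def)
 have "\<exists>T. has_score G T \<and> energy G T \<le> (\<Sum>k. p k * J k)"
 proof (rule score_mixture[OF qs p0])
  show "energy (q k) (S k) \<le> J k" for k unfolding q_def S_def J_def by (rule r) simp
  show "summable (\<lambda>k. p k * J k)" "summable (\<lambda>k. p k * (LBINT v. q k v))" by (rule sums_summable[OF fs])+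
  show "G \<in> borel_measurable borel" unfolding G_def using qm by measurable
  show "0 \<le> G v" for v unfolding G_def using p0 q0 by (simp add: sum_nonneg)
  show "AE v in lborel. (\<lambda>k. p k * q k v) sums G v" unfolding G_def by (intro AE_I2 fs)
 qed
 then obtain T where T: "has_score G T" "energy G T \<le> (\<Sum>k\<le>n. p k * J k)" using sums_unique[OF fs] by metis
 have int: "real (Suc n) * (LBINT v. G v * \<phi> v) = (\<Sum>k\<le>n. gain (g k) (g (n - k)) \<phi>)"
  if \<phi>: "\<phi> \<in> borel_measurable borel" and b: "bounded (range \<phi>)" for \<phi> :: "vec3 \<Rightarrow> real"
 proof -
  obtain C where C: "\<And>v. \<bar>\<phi> v\<bar> \<le> C" using b unfolding bounded_iff by auto
  have i: "integrable lborel (\<lambda>v. q k v * \<phi> v)" for k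
  proof (rule integrable_dominated)
   show "integrable lborel (\<lambda>v. C * q k v)" using qi by simp
   show "(\<lambda>v. q k v * \<phi> v) \<in> borel_measurable lborel" using qm \<phi> by simp
   show "\<bar>q k v * \<phi> v\<bar> \<le> C * q k v" for v using mult_left_mono[OF C[of v] q0[of k v]] q0[of k v] by (simp add: abs_mult mult.commute)
  qed
  have "(LBINT v. G v * \<phi> v) = (LBINT v. (\<Sum>k\<le>n. p k * (q k v * \<phi> v)))"
   by (simp add: G_def sum_distrib_right mult.assoc)
  also have "\<dots> = (\<Sum>k\<le>n. p k * (LBINT v. q k v * \<phi> v))" using i by simp
  also have "\<dots> = (\<Sum>k\<le>n. (1 / real (Suc n)) * gain (g k) (g (n - k)) \<phi>)"
   by (rule sum.cong) (use r(3) \<phi> in \<open>simp_all add: p_def q_def min_def\<close>)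
  finally show ?thesis by (simp only: sum_distrib_left[symmetric]) simp
 qed
 have G1: "(LBINT v. G v) = 1"
 proof -
  have "(LBINT v. G v) = (\<Sum>k\<le>n. p k * (LBINT v. q k v))" unfolding G_def using qi by simp
  also have "\<dots> = (\<Sum>k\<le>n. 1 / real (Suc n))"
   by (rule sum.cong) (use r(2) in \<open>simp_all add: p_def q_def min_def\<close>)
  finally show ?thesis by simp
 qed
 have "(\<Sum>k\<le>n. J k) = (1 / e\<^sup>2) * (\<Sum>k\<le>n. energy (g k) (s k))"
 proof -
  have rev: "(\<Sum>k\<le>n. z (n - k)) = (\<Sum>k\<le>n. z k)" for z :: "nat \<Rightarrow> real"
   by (rule sum.nat_diff_reindex[of _ "Suc n", simplified lessThan_Suc_atMost, simplified])
  let ?c = "\<lambda>k. cross (g k) (s k) (g (n - k)) (s (n - k))"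
  have "(\<Sum>k\<le>n. ?c k) = (\<Sum>k\<le>n. ?c (n - k))" by (rule rev[symmetric])
  also have "\<dots> = (\<Sum>k\<le>n. - ?c k)"
  proof (rule sum.cong)
   fix k assume "k \<in> {..n}"
   then have k: "k \<le> n" "n - (n - k) = k" by simp_all
   show "?c (n - k) = - ?c k" unfolding k(2)
    by (rule cross_swap) (use g[of k] g[of "n - k"] k in \<open>auto simp: has_score_def\<close>)
  qed simp
  finally have c0: "(\<Sum>k\<le>n. ?c k) = 0" by (simp add: sum_negf)
  have "(\<Sum>k\<le>n. J k) = (\<Sum>k\<le>n. ?J k)" by (rule sum.cong) (simp_all add: J_def min_def)
  also have "\<dots> = (1 / e\<^sup>2) * ((\<Sum>k\<le>n. energy (g k) (s k)) + (\<Sum>k\<le>n. energy (g (n - k)) (s (n - k)))) / 2 + (\<Sum>k\<le>n. ?c k)"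
   by (simp only: sum.distrib sum_distrib_left[symmetric] sum_divide_distrib[symmetric])
  also have "(\<Sum>k\<le>n. energy (g (n - k)) (s (n - k))) = (\<Sum>k\<le>n. energy (g k) (s k))" by (rule rev)
  finally show ?thesis by (simp add: c0)
 qed
 moreover have "(\<Sum>k\<le>n. p k * J k) = (1 / real (Suc n)) * (\<Sum>k\<le>n. J k)"
  unfolding sum_distrib_left by (rule sum.cong) (simp_all add: p_def)
 ultimately have "energy G T \<le> (1 / real (Suc n)) * ((1 / e\<^sup>2) * (\<Sum>k\<le>n. energy (g k) (s k)))" using T(2) by simp
 from mult_left_mono[OF this, of "real (Suc n)"]
 have "real (Suc n) * energy G T \<le> (1 / e\<^sup>2) * (\<Sum>k\<le>n. energy (g k) (s k))"
  by (simp del: of_nat_Suc)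
 with T(1) G1 int show ?thesis by blast
qed

text \<open>Each term depends on all earlier ones, hence the well-ordered choice. With
  \<open>K = 1 / e\<^sup>2\<close> the energies satisfy
  \<open>(n + 1) a (n + 1) \<le> K (a 0 + ... + a n)\<close>; the bound
  \<open>pochhammer K n / fact n\<close> solves this recursion with equality.\<close>

lemma wild_sequence:
 assumes f: "has_score f s" and f1: "(LBINT v. f v) = 1"
 shows "\<exists>g \<sigma>. g 0 = f \<and> (\<forall>n. has_score (g n) (\<sigma> n) \<and> (LBINT v. g n v) = 1) \<and>
  (\<forall>n \<phi>. \<phi> \<in> borel_measurable borel \<longrightarrow> bounded (range \<phi>) \<longrightarrow> real (Suc n) * (LBINT v. g (Suc n) v * \<phi> v) = (\<Sum>k\<le>n. gain (g k) (g (n - k)) \<phi>)) \<and>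
  (\<forall>n. energy (g n) (\<sigma> n) \<le> (pochhammer (1 / e\<^sup>2) n / fact n) * energy f s)"
proof -
 \<comment> \<open>The predicate looks up \<open>h\<close> only at indices below \<open>n\<close>,
   as \<open>dependent_wellorder_choice\<close> requires; the base case pins down the initial
   density and its score.\<close>
 define P where "P h n r \<longleftrightarrow> has_score (fst r) (snd r) \<and> (LBINT v. fst r v) = 1 \<and>
  (case n of 0 \<Rightarrow> r = (f, s) | Suc m \<Rightarrow>
   (\<forall>\<phi>. \<phi> \<in> borel_measurable borel \<longrightarrow> bounded (range \<phi>) \<longrightarrow> real (Suc m) * (LBINT v. fst r v * \<phi> v) = (\<Sum>k\<le>m. gain (fst (h k)) (fst (h (m - k))) \<phi>)) \<and>
   real (Suc m) * energy (fst r) (snd r) \<le> (1 / e\<^sup>2) * (\<Sum>k\<le>m. energy (fst (h k)) (snd (h k))))"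
  for h :: "nat \<Rightarrow> (vec3 \<Rightarrow> real) \<times> (vec3 \<Rightarrow> vec3)" and n r
 have "\<exists>h. \<forall>n. P h n (h n)"
 proof (rule dependent_wellorder_choice)
  fix r and h h' :: "nat \<Rightarrow> (vec3 \<Rightarrow> real) \<times> (vec3 \<Rightarrow> vec3)" and n :: nat assume eq: "\<And>k. k < n \<Longrightarrow> h k = h' k"
  show "P h n r = P h' n r"
  proof (cases n)
   case 0 then show ?thesis by (simp add: P_def)
  next
   case (Suc m)
   then have "(\<Sum>k\<le>m. gain (fst (h k)) (fst (h (m - k))) \<phi>) = (\<Sum>k\<le>m. gain (fst (h' k)) (fst (h' (m - k))) \<phi>)"
    "(\<Sum>k\<le>m. energy (fst (h k)) (snd (h k))) = (\<Sum>k\<le>m. energy (fst (h' k)) (snd (h' k)))" for \<phi>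
    using eq by (auto intro!: sum.cong)
   then show ?thesis unfolding P_def Suc by simp
  qed
 next
  fix n :: nat and h :: "nat \<Rightarrow> (vec3 \<Rightarrow> real) \<times> (vec3 \<Rightarrow> vec3)" assume IH: "\<And>k. k < n \<Longrightarrow> P h k (h k)"
  show "\<exists>r. P h n r"
  proof (cases n)
   case 0 then show ?thesis using f f1 by (intro exI[of _ "(f, s)"]) (simp add: P_def)
  next
   case (Suc m)
   have "has_score (fst (h k)) (snd (h k))" "(LBINT v. fst (h k) v) = 1" if "k \<le> m" for k
    using IH[of k] that Suc by (simp_all add: P_def)
   from wild_step[of m "\<lambda>k. fst (h k)" "\<lambda>k. snd (h k)", OF this]
   obtain G S where "has_score G S" "(LBINT v. G v) = 1"
    "\<And>\<phi>. \<phi> \<in> borel_measurable borel \<Longrightarrow> bounded (range \<phi>) \<Longrightarrow> real (Suc m) * (LBINT v. G v * \<phi> v) = (\<Sum>k\<le>m. gain (fst (h k)) (fst (h (m - k))) \<phi>)"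
    "real (Suc m) * energy G S \<le> (1 / e\<^sup>2) * (\<Sum>k\<le>m. energy (fst (h k)) (snd (h k)))" by blast
   then show ?thesis unfolding P_def Suc by (intro exI[of _ "(G, S)"]) (simp del: of_nat_Suc)
  qed
 qed
 then obtain h where h: "\<And>n. P h n (h n)" by blast
 define g \<sigma> where "g n = fst (h n)" and "\<sigma> n = snd (h n)" for n
 have h0: "g 0 = f" "\<sigma> 0 = s" using h[of 0] by (simp_all add: P_def g_def \<sigma>_def)
 have hs: "has_score (g n) (\<sigma> n)" "(LBINT v. g n v) = 1" for n
  using h[of n] by (simp_all add: P_def g_def \<sigma>_def)
 have hS: "\<phi> \<in> borel_measurable borel \<Longrightarrow> bounded (range \<phi>) \<Longrightarrow> real (Suc n) * (LBINT v. g (Suc n) v * \<phi> v) = (\<Sum>k\<le>n. gain (g k) (g (n - k)) \<phi>)"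
  and hE: "real (Suc n) * energy (g (Suc n)) (\<sigma> (Suc n)) \<le> (1 / e\<^sup>2) * (\<Sum>k\<le>n. energy (g k) (\<sigma> k))" for n \<phi>
  using h[of "Suc n"] unfolding P_def g_def \<sigma>_def by auto
 define K where "K = 1 / e\<^sup>2"
 have K0: "0 < K" using e0 by (simp add: K_def)
 have J0: "0 \<le> energy f s" using f by (auto simp: has_score_def intro!: integral_nonneg_AE)
 \<comment> \<open>The hockey-stick identity for rising factorials, which sums the recursion in
   closed form.\<close>
 have sa: "(\<Sum>k\<le>n. pochhammer K k / fact k) = pochhammer (K + 1) n / fact n" for n
 proof (induction n)
  case (Suc n)
  have "(\<Sum>k\<le>Suc n. pochhammer K k / fact k) = pochhammer (K + 1) n / fact n + K * pochhammer (K + 1) n / (real (Suc n) * fact n)"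
   using Suc by (simp add: pochhammer_rec)
  also have "\<dots> = pochhammer (K + 1) n * (K + real (Suc n)) / (real (Suc n) * fact n)"
  proof -
   have "A / z + K * A / (m * z) = A * (K + m) / (m * z)" if "z \<noteq> 0" "m \<noteq> 0" for A z m :: real
    using that by (simp add: field_simps)
   then show ?thesis by (simp del: of_nat_Suc)
  qed
  also have "\<dots> = pochhammer (K + 1) (Suc n) / fact (Suc n)" by (simp add: pochhammer_Suc add_ac)
  finally show ?case .
 qed simp
 have E: "energy (g n) (\<sigma> n) \<le> (pochhammer K n / fact n) * energy f s" for n
 proof (induction n rule: less_induct)
  case (less n)
  show ?case
  proof (cases n)
   case 0 then show ?thesis by (simp add: h0)
  next
   case (Suc m)
   have "(\<Sum>k\<le>m. energy (g k) (\<sigma> k)) \<le> (\<Sum>k\<le>m. (pochhammer K k / fact k) * energy f s)"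
    using less Suc by (intro sum_mono) simp
   also have "\<dots> = (pochhammer (K + 1) m / fact m) * energy f s" by (simp only: sum_distrib_right[symmetric] sa)
   finally have "K * (\<Sum>k\<le>m. energy (g k) (\<sigma> k)) \<le> K * ((pochhammer (K + 1) m / fact m) * energy f s)"
    by (rule mult_left_mono) (use K0 in simp)
   then have "real (Suc m) * energy (g (Suc m)) (\<sigma> (Suc m)) \<le> K * ((pochhammer (K + 1) m / fact m) * energy f s)"
    using hE[of m] unfolding K_def by linarith
   also have "\<dots> = real (Suc m) * ((pochhammer K (Suc m) / fact (Suc m)) * energy f s)"
    by (simp add: pochhammer_rec)
   finally have "energy (g (Suc m)) (\<sigma> (Suc m)) \<le> (pochhammer K (Suc m) / fact (Suc m)) * energy f s"
    by (rule mult_left_le_imp_le) simp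
   then show ?thesis by (simp only: Suc)
  qed
 qed
 show ?thesis using h0(1) hs hS E unfolding K_def by blast
qed

end

section \<open>A solution equals its Wild sum\<close>

context collision
begin

lemma AE_KM_marginals:
 assumes "AE v in lborel. P v"
 shows "AE \<omega> in KM. P (fst \<omega>) \<and> P (fst (snd \<omega>))"
proof -
 obtain N where N: "{v. \<not> P v} \<subseteq> N" "N \<in> sets borel" "emeasure lborel N = 0"
  using AE_E[OF assms] by auto
 note [measurable] = N(2)
 have "(\<integral>\<^sup>+\<omega>. indicator N (fst \<omega>) * 1 \<partial>KM) = ennreal (4 * pi) * ((\<integral>\<^sup>+v. indicator N v \<partial>lborel) * (\<integral>\<^sup>+w. 1 \<partial>(lborel :: vec3 measure)))"
  by (rule nn_integral_KM_prod) measurable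
 then have 1: "(\<integral>\<^sup>+\<omega>. indicator N (fst \<omega>) \<partial>KM) = 0" using N by simp
 have "(\<integral>\<^sup>+\<omega>. 1 * indicator N (fst (snd \<omega>)) \<partial>KM) = ennreal (4 * pi) * ((\<integral>\<^sup>+v. 1 \<partial>(lborel :: vec3 measure)) * (\<integral>\<^sup>+w. indicator N w \<partial>lborel))"
  by (rule nn_integral_KM_prod) measurable
 then have 2: "(\<integral>\<^sup>+\<omega>. indicator N (fst (snd \<omega>)) \<partial>KM) = 0" using N by simp
 have m: "(indicator N :: vec3 \<Rightarrow> ennreal) \<in> borel_measurable borel" by measurable
 have "AE \<omega> in KM. (indicator N (fst \<omega>) :: ennreal) = 0" "AE \<omega> in KM. (indicator N (fst (snd \<omega>)) :: ennreal) = 0"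
  using 1 2 measurable_comp_fst[OF m] measurable_comp_fst_snd[OF m] by (simp_all add: nn_integral_0_iff_AE)
 then show ?thesis by eventually_elim (use N(1) in \<open>auto simp: indicator_def split: if_splits\<close>)
qed

lemma gain_integrable:
 fixes f g \<phi> :: "vec3 \<Rightarrow> real"
 assumes "integrable lborel f" "integrable lborel g" and \<phi>: "\<phi> \<in> borel_measurable borel" "\<And>v. \<bar>\<phi> v\<bar> \<le> C"
 shows "integrable KM (\<lambda>\<omega>. f (fst \<omega>) * g (fst (snd \<omega>)) * \<phi> (vprime e \<omega>))"
 by (rule integrable_KM[OF assms(1,2) measurable_compose[OF measurable_vprime \<phi>(1)], where C=C]) (rule AE_I2, rule \<phi>)

text \<open>The lower bound for \<open>f\<close> is used in both particles. Of the resulting double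
  sum the terms with \<open>k + l \<ge> N\<close> are dropped, being nonnegative, and the others are
  grouped by \<open>n = k + l\<close>.\<close>

lemma gain_wild_lower_bound:
 fixes g :: "nat \<Rightarrow> vec3 \<Rightarrow> real"
 assumes f: "integrable lborel f" and g: "\<And>n. integrable lborel (g n)" "\<And>n v. 0 \<le> g n v" and a: "0 \<le> a" and x: "0 \<le> x"
  and le: "AE v in lborel. a * (\<Sum>n<N. x ^ n * g n v) \<le> f v"
  and \<phi>: "\<phi> \<in> borel_measurable borel" "\<And>v. \<bar>\<phi> v\<bar> \<le> C" "\<And>v. 0 \<le> \<phi> v"
 shows "a\<^sup>2 * (\<Sum>n<N. x ^ n * (\<Sum>k\<le>n. gain (g k) (g (n - k)) \<phi>)) \<le> gain f f \<phi>"
proof -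
 let ?T = "\<lambda>k l \<omega>. g k (fst \<omega>) * g l (fst (snd \<omega>)) * \<phi> (vprime e \<omega>)"
 have iT: "integrable KM (?T k l)" for k l by (rule gain_integrable[OF g(1) g(1) \<phi>(1,2)])
 have "(\<integral>\<omega>. a\<^sup>2 * (\<Sum>n<N. x ^ n * (\<Sum>k\<le>n. ?T k (n - k) \<omega>)) \<partial>KM) \<le> (\<integral>\<omega>. f (fst \<omega>) * f (fst (snd \<omega>)) * \<phi> (vprime e \<omega>) \<partial>KM)"
 proof (rule integral_mono_AE)
  show "integrable KM (\<lambda>\<omega>. a\<^sup>2 * (\<Sum>n<N. x ^ n * (\<Sum>k\<le>n. ?T k (n - k) \<omega>)))"
   using iT by (intro integrable_mult_right Bochner_Integration.integrable_sum)
  show "integrable KM (\<lambda>\<omega>. f (fst \<omega>) * f (fst (snd \<omega>)) * \<phi> (vprime e \<omega>))" by (rule gain_integrable[OF f f \<phi>(1,2)])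
  show "AE \<omega> in KM. a\<^sup>2 * (\<Sum>n<N. x ^ n * (\<Sum>k\<le>n. ?T k (n - k) \<omega>)) \<le> f (fst \<omega>) * f (fst (snd \<omega>)) * \<phi> (vprime e \<omega>)"
   using AE_KM_marginals[OF le]
  proof eventually_elim
   case (elim \<omega>)
   define p q where "p k = x ^ k * g k (fst \<omega>)" and "q k = x ^ k * g k (fst (snd \<omega>))" for k
   have pq: "0 \<le> p k" "0 \<le> q k" for k using x g(2) by (simp_all add: p_def q_def)
   have "(\<Sum>n<N. \<Sum>k\<le>n. p k * q (n - k)) = (\<Sum>(k, l) \<in> {(k, l). k + l < N}. p k * q l)"
    by (rule sum.triangle_reindex[symmetric])
   also have "\<dots> \<le> (\<Sum>(k, l) \<in> {..<N} \<times> {..<N}. p k * q l)"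
    by (rule sum_mono2) (use pq in auto)
   also have "\<dots> = (\<Sum>k<N. p k) * (\<Sum>l<N. q l)" by (simp add: sum_product sum.cartesian_product)
   finally have t: "(\<Sum>n<N. \<Sum>k\<le>n. p k * q (n - k)) \<le> (\<Sum>k<N. p k) * (\<Sum>l<N. q l)" .
   have "a\<^sup>2 * (\<Sum>n<N. x ^ n * (\<Sum>k\<le>n. ?T k (n - k) \<omega>)) = a\<^sup>2 * (\<Sum>n<N. \<Sum>k\<le>n. p k * q (n - k)) * \<phi> (vprime e \<omega>)"
   proof -
    have "x ^ n * (\<Sum>k\<le>n. ?T k (n - k) \<omega>) = (\<Sum>k\<le>n. p k * q (n - k)) * \<phi> (vprime e \<omega>)" for n
    proof -
     have "x ^ n * ?T k (n - k) \<omega> = p k * q (n - k) * \<phi> (vprime e \<omega>)" if "k \<in> {..n}" for k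
     proof -
      have "x ^ n = x ^ k * x ^ (n - k)" using that by (simp flip: power_add)
      then show ?thesis by (simp add: p_def q_def mult_ac)
     qed
     then show ?thesis unfolding sum_distrib_left sum_distrib_right by (rule sum.cong[OF refl])
    qed
    then show ?thesis by (simp only: sum_distrib_right[symmetric] mult.assoc)
   qed
   also have "\<dots> \<le> a\<^sup>2 * ((\<Sum>k<N. p k) * (\<Sum>l<N. q l)) * \<phi> (vprime e \<omega>)"
    by (intro mult_right_mono mult_left_mono t \<phi>) simp
   also have "\<dots> = (a * (\<Sum>k<N. p k)) * (a * (\<Sum>l<N. q l)) * \<phi> (vprime e \<omega>)" by (simp add: power2_eq_square mult_ac)
   also have "\<dots> \<le> f (fst \<omega>) * f (fst (snd \<omega>)) * \<phi> (vprime e \<omega>)"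
   proof (intro mult_right_mono mult_mono)
    show "a * sum p {..<N} \<le> f (fst \<omega>)" "a * sum q {..<N} \<le> f (fst (snd \<omega>))" using elim by (simp_all add: p_def q_def)
    show "0 \<le> a * sum q {..<N}" using a pq by (simp add: sum_nonneg)
    have "0 \<le> a * sum p {..<N}" using a pq by (simp add: sum_nonneg)
    then show "0 \<le> f (fst \<omega>)" using elim by (simp add: p_def)
   qed (rule \<phi>)
   finally show ?case .
  qed
 qed
 moreover have "(\<integral>\<omega>. a\<^sup>2 * (\<Sum>n<N. x ^ n * (\<Sum>k\<le>n. ?T k (n - k) \<omega>)) \<partial>KM) = a\<^sup>2 * (\<Sum>n<N. x ^ n * (\<Sum>k\<le>n. (\<integral>\<omega>. ?T k (n - k) \<omega> \<partial>KM)))"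
  using iT by simp
 ultimately have "a\<^sup>2 * (\<Sum>n<N. x ^ n * (\<Sum>k\<le>n. (\<integral>\<omega>. ?T k (n - k) \<omega> \<partial>KM))) \<le> (\<integral>\<omega>. f (fst \<omega>) * f (fst (snd \<omega>)) * \<phi> (vprime e \<omega>) \<partial>KM)"
  by (simp only:)
 then have "(1 / (4 * pi)) * (a\<^sup>2 * (\<Sum>n<N. x ^ n * (\<Sum>k\<le>n. (\<integral>\<omega>. ?T k (n - k) \<omega> \<partial>KM)))) \<le> (1 / (4 * pi)) * (\<integral>\<omega>. f (fst \<omega>) * f (fst (snd \<omega>)) * \<phi> (vprime e \<omega>) \<partial>KM)"
  by (rule mult_left_mono) simp
 also have "(1 / (4 * pi)) * (a\<^sup>2 * (\<Sum>n<N. x ^ n * (\<Sum>k\<le>n. (\<integral>\<omega>. ?T k (n - k) \<omega> \<partial>KM)))) = a\<^sup>2 * (\<Sum>n<N. x ^ n * (\<Sum>k\<le>n. gain (g k) (g (n - k)) \<phi>))"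
  unfolding gain_def by (simp add: sum_distrib_left mult_ac sum_divide_distrib)
 finally show ?thesis by (simp only: gain_def)
qed

text \<open>Induction on the number of terms. The factor \<open>exp s\<close> absorbs the loss term,
  so the derivative of \<open>D\<close> is the gain minus the derivative of the partial sum. It is
  nonnegative by \<open>gain_wild_lower_bound\<close> applied to the shorter sum, and
  \<open>D\<close> vanishes at 0 because \<open>g 0 = F 0\<close>.\<close>

lemma wild_lower_bound:
 fixes F :: "real \<Rightarrow> vec3 \<Rightarrow> real" and g :: "nat \<Rightarrow> vec3 \<Rightarrow> real"
 assumes F: "\<And>t. 0 \<le> t \<Longrightarrow> integrable lborel (F t)"
  and der: "\<And>\<phi> t. bounded_continuous \<phi> \<Longrightarrow> 0 \<le> t \<Longrightarrow> ((\<lambda>s. \<integral>v. F s v * \<phi> v \<partial>lborel) has_real_derivative gain (F t) (F t) \<phi> - (LBINT v. F t v * \<phi> v)) (at t within {0..})"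
  and F0: "\<And>t v. 0 \<le> t \<Longrightarrow> 0 \<le> F t v"
  and g: "\<And>n. integrable lborel (g n)" "\<And>n v. 0 \<le> g n v" and g0: "g 0 = F 0"
  and rec: "\<And>n \<phi>. \<phi> \<in> borel_measurable borel \<Longrightarrow> bounded (range \<phi>) \<Longrightarrow> real (Suc n) * (LBINT v. g (Suc n) v * \<phi> v) = (\<Sum>k\<le>n. gain (g k) (g (n - k)) \<phi>)"
  and t: "0 \<le> t"
 shows "AE v in lborel. exp (- t) * (\<Sum>n<N. (1 - exp (- t)) ^ n * g n v) \<le> F t v"
 using t
proof (induction N arbitrary: t)
 case 0
 then show ?case using F0 by simp
next
 case (Suc N)
 show ?case
 proof (rule AE_le_of_bounded_continuous)
  show "integrable lborel (F t)" by (rule F) (rule Suc)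
  show "integrable lborel (\<lambda>v. exp (- t) * (\<Sum>n<Suc N. (1 - exp (- t)) ^ n * g n v))"
   using g(1) by (intro integrable_mult_right Bochner_Integration.integrable_sum)
  fix \<phi> assume bc: "bounded_continuous \<phi>" and \<phi>0: "\<And>x. 0 \<le> \<phi> x"
  have \<phi>m: "\<phi> \<in> borel_measurable borel" and \<phi>b: "bounded (range \<phi>)"
   using bc by (auto simp: bounded_continuous_def borel_measurable_continuous_onI)
  obtain C where C: "\<And>v. \<bar>\<phi> v\<bar> \<le> C" using \<phi>b unfolding bounded_iff by auto
  define c where "c n = (LBINT v. g n v * \<phi> v)" for n
  have ig: "integrable lborel (\<lambda>v. g n v * \<phi> v)" for n
  proof (rule integrable_dominated)
   show "integrable lborel (\<lambda>v. C * g n v)" using g(1) by simp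
   show "(\<lambda>v. g n v * \<phi> v) \<in> borel_measurable lborel" using borel_measurable_integrable[OF g(1)] \<phi>m by simp
   show "\<bar>g n v * \<phi> v\<bar> \<le> C * g n v" for v using mult_left_mono[OF C[of v] g(2)[of n v]] g(2)[of n v] by (simp add: abs_mult mult.commute)
  qed
  define I where "I s = (LBINT v. F s v * \<phi> v)" for s
  \<comment> \<open>The sum has one term more than the induction hypothesis: differentiation removes
    the constant term and lowers the remaining indices by one, which matches the recursion for
    \<open>g (Suc n)\<close>.\<close>
  define D where "D s = exp s * I s - (\<Sum>n<Suc N. (1 - exp (- s)) ^ n * c n)" for s
  define D' where "D' s = exp s * gain (F s) (F s) \<phi> - exp (- s) * (\<Sum>n<N. (1 - exp (- s)) ^ n * (real (Suc n) * c (Suc n)))" for s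
  have dD: "(D has_real_derivative D' s) (at s within {0..})" if s: "0 \<le> s" for s
  proof -
   have dI: "(I has_real_derivative gain (F s) (F s) \<phi> - I s) (at s within {0..})"
    unfolding I_def by (rule der[OF bc s])
   have "((\<lambda>s. exp s * I s - (\<Sum>n<Suc N. (1 - exp (- s)) ^ n * c n)) has_real_derivative
    exp s * (gain (F s) (F s) \<phi> - I s) + exp s * I s - (\<Sum>n<Suc N. real n * (1 - exp (- s)) ^ (n - 1) * exp (- s) * c n)) (at s within {0..})"
    by (auto intro!: derivative_eq_intros dI sum.cong simp: mult_ac)
   moreover have "(\<Sum>n<Suc N. real n * (1 - exp (- s)) ^ (n - 1) * exp (- s) * c n) = exp (- s) * (\<Sum>n<N. (1 - exp (- s)) ^ n * (real (Suc n) * c (Suc n)))"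
    by (subst sum.lessThan_Suc_shift) (simp add: sum_distrib_left mult_ac)
   ultimately show ?thesis unfolding D_def[abs_def] D'_def by (simp add: algebra_simps)
  qed
  have D'0: "0 \<le> D' s" if s: "0 \<le> s" for s
  proof -
   have x: "0 \<le> 1 - exp (- s)" using s by simp
   have "(exp (- s))\<^sup>2 * (\<Sum>n<N. (1 - exp (- s)) ^ n * (\<Sum>k\<le>n. gain (g k) (g (n - k)) \<phi>)) \<le> gain (F s) (F s) \<phi>"
    by (rule gain_wild_lower_bound[OF F[OF s] g _ x Suc.IH[OF s] \<phi>m C \<phi>0]) simp
   then have "(exp (- s))\<^sup>2 * (\<Sum>n<N. (1 - exp (- s)) ^ n * (real (Suc n) * c (Suc n))) \<le> gain (F s) (F s) \<phi>"
    by (simp only: rec[OF \<phi>m \<phi>b, symmetric] c_def)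
   then have "exp s * ((exp (- s))\<^sup>2 * (\<Sum>n<N. (1 - exp (- s)) ^ n * (real (Suc n) * c (Suc n)))) \<le> exp s * gain (F s) (F s) \<phi>"
    by (rule mult_left_mono) simp
   moreover have "exp s * ((exp (- s))\<^sup>2 * z) = exp (- s) * z" for z
   proof -
    have "exp s * (exp (- s))\<^sup>2 = exp (- s)" by (simp add: power2_eq_square exp_minus)
    then show ?thesis by (simp only: mult.assoc[symmetric])
   qed
   ultimately show ?thesis by (simp only: D'_def diff_ge_0_iff_ge)
  qed
  have "D 0 = 0" unfolding D_def I_def c_def by (subst sum.lessThan_Suc_shift) (simp add: g0)
  have "0 \<le> D t"
  proof (cases "t = 0")
   case False
   then have "0 < t" using Suc.prems by simp
   then obtain z where "z \<in> {0<..<t}" "D t - D 0 = D' z * (t - 0)"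
    using mvt_simple[of 0 t D "\<lambda>s h. D' s * h"] has_field_derivative_subset[OF dD, of _ "{0..t}"]
    by (auto simp: has_field_derivative_def)
   then show ?thesis using D'0[of z] \<open>D 0 = 0\<close> \<open>0 < t\<close> by (simp add: mult_nonneg_nonneg)
  qed (simp add: \<open>D 0 = 0\<close>)
  then have "exp (- t) * (\<Sum>n<Suc N. (1 - exp (- t)) ^ n * c n) \<le> exp (- t) * (exp t * I t)"
   unfolding D_def by (intro mult_left_mono) simp_all
  also have "\<dots> = I t" by (simp add: exp_minus)
  finally have "exp (- t) * (\<Sum>n<Suc N. (1 - exp (- t)) ^ n * c n) \<le> I t" .
  moreover have "(LBINT v. exp (- t) * (\<Sum>n<Suc N. (1 - exp (- t)) ^ n * g n v) * \<phi> v) = exp (- t) * (\<Sum>n<Suc N. (1 - exp (- t)) ^ n * c n)"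
  proof -
   have "(LBINT v. exp (- t) * (\<Sum>n<Suc N. (1 - exp (- t)) ^ n * g n v) * \<phi> v) = (LBINT v. exp (- t) * (\<Sum>n<Suc N. (1 - exp (- t)) ^ n * (g n v * \<phi> v)))"
    by (simp only: sum_distrib_right mult.assoc)
   also have "\<dots> = exp (- t) * (\<Sum>n<Suc N. (1 - exp (- t)) ^ n * c n)"
    unfolding c_def using ig by (simp only: Bochner_Integration.integral_mult_right_zero)
     (simp only: Bochner_Integration.integral_sum integrable_mult_right Bochner_Integration.integral_mult_right_zero)
   finally show ?thesis .
  qed
  ultimately show "(LBINT x. exp (- t) * (\<Sum>n<Suc N. (1 - exp (- t)) ^ n * g n x) * \<phi> x) \<le> (LBINT x. F t x * \<phi> x)"
   by (simp only: I_def)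
 qed
qed

text \<open>The partial Wild sums lie below \<open>F t\<close> and have mass
  \<open>1 - x ^ N\<close>, which tends to 1, the mass of \<open>F t\<close>; hence the whole series
  equals \<open>F t\<close> almost everywhere, and \<open>score_mixture\<close> applies.\<close>

theorem solution_energy_bound:
 fixes F :: "real \<Rightarrow> vec3 \<Rightarrow> real"
 assumes F: "\<And>t. 0 \<le> t \<Longrightarrow> prob_density (F t)"
  and der: "\<And>\<phi> t. bounded_continuous \<phi> \<Longrightarrow> 0 \<le> t \<Longrightarrow> ((\<lambda>s. \<integral>v. F s v * \<phi> v \<partial>lborel) has_real_derivative gain (F t) (F t) \<phi> - (LBINT v. F t v * \<phi> v)) (at t within {0..})"
  and s: "has_score (F 0) s" and t: "0 \<le> t"
 shows "\<exists>S. has_score (F t) S \<and> energy (F t) S \<le> exp ((1 / e\<^sup>2 - 1) * t) * energy (F 0) s"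
proof -
 have Fp: "F t \<in> borel_measurable borel" "integrable lborel (F t)" "(LBINT v. F t v) = 1" "0 \<le> F t v" if "0 \<le> t" for t v
  using F[OF that] by (auto simp: prob_density_def)
 have "\<exists>g \<sigma>. g 0 = F 0 \<and> (\<forall>n. has_score (g n) (\<sigma> n) \<and> (LBINT v. g n v) = 1) \<and>
  (\<forall>n \<phi>. \<phi> \<in> borel_measurable borel \<longrightarrow> bounded (range \<phi>) \<longrightarrow> real (Suc n) * (LBINT v. g (Suc n) v * \<phi> v) = (\<Sum>k\<le>n. gain (g k) (g (n - k)) \<phi>)) \<and>
  (\<forall>n. energy (g n) (\<sigma> n) \<le> (pochhammer (1 / e\<^sup>2) n / fact n) * energy (F 0) s)"
  by (rule wild_sequence[OF s]) (simp add: Fp)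
 then obtain g \<sigma> where g0: "g 0 = F 0" and g: "\<And>n. has_score (g n) (\<sigma> n)" "\<And>n. (LBINT v. g n v) = 1"
  and rec: "\<And>n \<phi>. \<phi> \<in> borel_measurable borel \<Longrightarrow> bounded (range \<phi>) \<Longrightarrow> real (Suc n) * (LBINT v. g (Suc n) v * \<phi> v) = (\<Sum>k\<le>n. gain (g k) (g (n - k)) \<phi>)"
  and E: "\<And>n. energy (g n) (\<sigma> n) \<le> (pochhammer (1 / e\<^sup>2) n / fact n) * energy (F 0) s" by blast
 have gi: "integrable lborel (g n)" and gm: "g n \<in> borel_measurable borel" and gp: "0 \<le> g n v" for n v
  using g(1)[of n] by (auto simp: has_score_def)
 define x p where "x = 1 - exp (- t)" and "p n = exp (- t) * x ^ n" for n
 have x: "0 \<le> x" "x < 1" "1 - x = exp (- t)" using t by (simp_all add: x_def)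
 have p0: "0 \<le> p n" for n using x by (simp add: p_def)
 have lower: "AE v in lborel. \<forall>N. (\<Sum>n<N. p n * g n v) \<le> F t v"
  unfolding AE_all_countable
 proof
  fix N
  have "AE v in lborel. exp (- t) * (\<Sum>n<N. (1 - exp (- t)) ^ n * g n v) \<le> F t v"
   by (rule wild_lower_bound[where F=F and g=g, OF Fp(2) der Fp(4) gi gp g0 rec t])
  then show "AE v in lborel. (\<Sum>n<N. p n * g n v) \<le> F t v"
   by (simp add: p_def x_def sum_distrib_left mult.assoc)
 qed
 define W where "W v = (\<Sum>n. p n * g n v)" for v
 have Wm: "W \<in> borel_measurable borel" unfolding W_def using gm by measurable
 have summ: "summable (\<lambda>n. p n * g n v)" "W v \<le> F t v" "0 \<le> W v" if "\<forall>N. (\<Sum>n<N. p n * g n v) \<le> F t v" for v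
 proof -
  show "summable (\<lambda>n. p n * g n v)"
   by (rule summableI_nonneg_bounded[where x="F t v"]) (use that p0 gp in auto)
  then show "W v \<le> F t v" "0 \<le> W v" unfolding W_def using that p0 gp by (auto intro: suminf_le_const suminf_nonneg)
 qed
 have Wi: "integrable lborel W"
 proof (rule Bochner_Integration.integrable_bound[OF Fp(2)[OF t]])
  show "AE v in lborel. norm (W v) \<le> norm (F t v)" using lower by eventually_elim (use summ in fastforce)
 qed (use Wm in simp)
 have part: "1 - x ^ N \<le> (LBINT v. W v)" for N
 proof -
  have "(LBINT v. (\<Sum>n<N. p n * g n v)) = (\<Sum>n<N. p n)" using gi g(2) by simp
  also have "\<dots> = (1 - x) * (\<Sum>n<N. x ^ n)" by (simp add: p_def x(3) sum_distrib_left)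
  also have "\<dots> = 1 - x ^ N" by (rule one_diff_power_eq[symmetric])
  finally have eq: "(LBINT v. (\<Sum>n<N. p n * g n v)) = 1 - x ^ N" .
  have "(LBINT v. (\<Sum>n<N. p n * g n v)) \<le> (LBINT v. W v)"
  proof (rule integral_mono_AE[OF _ Wi])
   show "integrable lborel (\<lambda>v. \<Sum>n<N. p n * g n v)" using gi by simp
   show "AE v in lborel. (\<Sum>n<N. p n * g n v) \<le> W v"
    using lower
   proof eventually_elim
    case (elim v)
    show ?case unfolding W_def by (rule sum_le_suminf[OF summ(1)[OF elim]]) (use p0 gp in auto)
   qed
  qed
  then show ?thesis by (simp only: eq)
 qed
 have "1 \<le> (LBINT v. W v)"
 proof (rule LIMSEQ_le_const2)
  have "(\<lambda>N. x ^ N) \<longlonglongrightarrow> 0" using x by (intro LIMSEQ_power_zero) simp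
  from tendsto_diff[OF tendsto_const this, of 1] show "(\<lambda>N. 1 - x ^ N) \<longlonglongrightarrow> 1" by simp
 qed (use part in blast)
 then have "(LBINT v. F t v - W v) \<le> 0" using Wi Fp[OF t] by simp
 moreover have d0: "AE v in lborel. 0 \<le> F t v - W v" using lower by eventually_elim (use summ(2) in simp)
 ultimately have "(LBINT v. F t v - W v) = 0" using integral_nonneg_AE[OF d0] by simp
 then have eqW: "AE v in lborel. F t v - W v = 0"
  using integral_nonneg_eq_0_iff_AE[OF _ d0] Wi Fp(2)[OF t] by simp
 have sumsF: "AE v in lborel. (\<lambda>n. p n * g n v) sums F t v"
  using lower eqW
 proof eventually_elim
  case (elim v)
  then show ?case using summable_sums[OF summ(1)[OF elim(1)]] by (simp add: W_def)
 qed
 define K a where "K = 1 / e\<^sup>2" and "a n = (pochhammer K n / fact n) * energy (F 0) s" for n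
 \<comment> \<open>The series of \<open>(1 - x) powr (- K)\<close>, and \<open>1 - x\<close> is
   \<open>exp (- t)\<close>. The weight \<open>exp (- t)\<close> contained in \<open>p n\<close>
   turns the exponent \<open>K * t\<close> into \<open>(K - 1) * t\<close>.\<close>
 have "(\<lambda>n. ((- K) gchoose n) * (- x) ^ n) sums (1 + (- x)) powr (- K)"
  by (rule gen_binomial_real) (use x in simp)
 moreover have "((- K) gchoose n) * (- x) ^ n = pochhammer K n / fact n * x ^ n" for n
 proof -
  have "(- 1 :: real) ^ n * (- x) ^ n = x ^ n" by (simp flip: power_mult_distrib)
  then show ?thesis by (simp add: gbinomial_pochhammer mult_ac)
 qed
 ultimately have "(\<lambda>n. pochhammer K n / fact n * x ^ n) sums (exp (- t) powr (- K))" using x by simp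
 from sums_mult[OF this, of "exp (- t) * energy (F 0) s"]
 have "(\<lambda>n. p n * a n) sums (exp (- t) * energy (F 0) s * (exp (- t) powr (- K)))"
  by (simp add: p_def a_def mult_ac)
 moreover have "exp (- t) * energy (F 0) s * (exp (- t) powr (- K)) = exp ((K - 1) * t) * energy (F 0) s"
 proof -
  have "exp (- t) * (exp (- t) powr (- K)) = exp ((K - 1) * t)" by (simp add: powr_def flip: exp_add) (simp add: algebra_simps)
  then show ?thesis by (simp add: mult_ac)
 qed
 ultimately have A: "(\<lambda>n. p n * a n) sums (exp ((K - 1) * t) * energy (F 0) s)" by simp
 have "\<exists>S. has_score (F t) S \<and> energy (F t) S \<le> (\<Sum>n. p n * a n)"
 proof (rule score_mixture[OF g(1) p0])
  show "energy (g n) (\<sigma> n) \<le> a n" for n unfolding a_def K_def by (rule E)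
  show "summable (\<lambda>n. p n * a n)" by (rule sums_summable[OF A])
  show "summable (\<lambda>n. p n * (LBINT v. g n v))" unfolding g(2) p_def using x by (simp add: summable_geometric)
 qed (use Fp t sumsF in simp_all)
 then show ?thesis using sums_unique[OF A] unfolding K_def by simp
qed

end

section \<open>Back to the functionals of the statement\<close>

text \<open>The conditions on a kernel hold on [-1, 1]; the cut-off extends sign and symmetry to the
  line, and set integrability says that the cut-off function is Borel.\<close>

lemma collision_kernel:
 assumes e: "0 < e" "e \<le> 1" and B: "kernel_ok B"
 shows "collision e (\<lambda>s. indicator {-1..1} s * B s)"
proof
 let ?B = "\<lambda>s. indicator {-1..1} s * B s"
 have pos: "\<And>s. s \<in> {-1..1} \<Longrightarrow> 0 < B s" and ev: "\<And>s. s \<in> {-1..1} \<Longrightarrow> B (- s) = B s"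
  and i: "integrable lborel ?B" and i2: "(LBINT s. ?B s) = 2"
  using B by (auto simp: kernel_ok_def set_integrable_def set_lebesgue_integral_def)
 show "0 < e" "e \<le> 1" by fact+
 show "?B \<in> borel_measurable borel" using borel_measurable_integrable[OF i] by simp
 show nn: "0 \<le> ?B s" for s using pos[of s] by (auto simp: indicator_def intro: less_imp_le)
 show "?B (- s) = ?B s" for s using ev[of s] by (auto simp: indicator_def)
 have "(\<integral>\<^sup>+s. ennreal (?B s) * indicator {-1..1} s \<partial>lborel) = (\<integral>\<^sup>+s. ennreal (?B s) \<partial>lborel)"
  by (rule nn_integral_cong) (simp add: indicator_def)
 also have "\<dots> = ennreal (LBINT s. ?B s)"
  by (rule nn_integral_eq_integral[OF i]) (use nn in simp)
 finally show "(\<integral>\<^sup>+s. ennreal (?B s) * indicator {-1..1} s \<partial>lborel) = 2" by (simp add: i2)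
qed

lemma bounded_continuousD:
 assumes "bounded_continuous \<phi>"
 obtains C where "\<phi> \<in> borel_measurable borel" "\<And>v. \<bar>\<phi> v\<bar> \<le> C"
proof -
 have "\<phi> \<in> borel_measurable borel" using assms by (simp add: bounded_continuous_def borel_measurable_continuous_onI)
 moreover obtain C where "\<forall>x\<in>range \<phi>. norm x \<le> C" using assms unfolding bounded_continuous_def bounded_iff by blast
 ultimately show thesis by (intro that[of C]) auto
qed

context
 fixes e :: real and B :: "real \<Rightarrow> real"
 assumes e: "0 < e" "e \<le> 1" and B: "kernel_ok B" and BB: "B \<in> borel_measurable borel"
begin

interpretation C: collision e "\<lambda>s. indicator {-1..1} s * B s"
 by (rule collision_kernel[OF e B])

text \<open>For unit \<open>n\<close> the argument of the kernel lies in [-1, 1], where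
  \<open>B\<close> and its cut-off agree. The integrand of the statement contains \<open>B\<close>
  itself, and its measurability on the whole space rests on \<open>B\<close> being Borel.\<close>

lemma nested_integral_KM:
 assumes f: "integrable lborel f" and \<Phi>: "\<Phi> \<in> borel_measurable borel" and b: "\<And>\<omega>. \<bar>\<Phi> \<omega>\<bar> \<le> C"
 shows "(\<integral>v. \<integral>w. \<integral>n. B (n \<bullet> ((v - w) /\<^sub>R norm (v - w))) * f v * f w * \<Phi> (v, w, n) \<partial>S2 \<partial>lborel \<partial>lborel)
  = (\<integral>\<omega>. f (fst \<omega>) * f (fst (snd \<omega>)) * \<Phi> \<omega> \<partial>C.KM)"
proof -
 interpret S2: finite_measure S2 by (rule finite_measure_S2)
 interpret lS2: pair_sigma_finite "lborel :: vec3 measure" S2 ..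
 interpret P: pair_sigma_finite "lborel :: vec3 measure" "(lborel :: vec3 measure) \<Otimes>\<^sub>M S2"
  by (rule lborel_lborel_S2_pair)
 let ?B = "\<lambda>s. indicator {-1..1} s * B s"
 define H where "H \<omega> = ?B (kcos \<omega>) * (f (fst \<omega>) * f (fst (snd \<omega>)) * \<Phi> \<omega>)" for \<omega>
 have fm: "f \<in> borel_measurable borel" using f by auto
 have ffm: "(\<lambda>\<omega>. f (fst \<omega>) * f (fst (snd \<omega>)) * \<Phi> \<omega>) \<in> borel_measurable borel"
  using measurable_comp_fst[OF fm] measurable_comp_fst_snd[OF fm] \<Phi> by simp
 have kc: "kcos \<in> borel_measurable borel" using measurable_kcos by (simp only: borel_triple)
 have Bk: "(\<lambda>\<omega>. ?B (kcos \<omega>)) \<in> borel_measurable borel" by (rule measurable_compose[OF kc C.Bm])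
 have M3: "z \<in> borel_measurable M3" if "z \<in> borel_measurable borel" for z :: "_ \<Rightarrow> real"
  using that by (simp only: measurable_M3_eq)
 have iKM: "integrable C.KM (\<lambda>\<omega>. f (fst \<omega>) * f (fst (snd \<omega>)) * \<Phi> \<omega>)"
  by (rule C.integrable_KM[OF f f \<Phi>, where C=C]) (rule AE_I2, rule b)
 have eq: "(\<integral>\<omega>. f (fst \<omega>) * f (fst (snd \<omega>)) * \<Phi> \<omega> \<partial>C.KM) = (\<integral>\<omega>. H \<omega> \<partial>M3)"
  and iH: "integrable M3 H"
 proof -
  have nn: "AE \<omega> in M3. 0 \<le> ?B (kcos \<omega>)" using C.B0 by simp
  show "(\<integral>\<omega>. f (fst \<omega>) * f (fst (snd \<omega>)) * \<Phi> \<omega> \<partial>C.KM) = (\<integral>\<omega>. H \<omega> \<partial>M3)"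
   unfolding C.KM_def H_def[abs_def] integral_density[OF M3[OF ffm] M3[OF Bk] nn] by simp
  show "integrable M3 H"
   using iKM unfolding C.KM_def H_def[abs_def] integrable_density[OF M3[OF ffm] M3[OF Bk] nn] by simp
 qed
 note iH' = iH[unfolded M3_def]
 have "(\<integral>\<omega>. H \<omega> \<partial>M3) = (\<integral>v. \<integral>x. H (v, x) \<partial>(lborel \<Otimes>\<^sub>M S2) \<partial>lborel)"
  unfolding M3_def by (rule P.integral_fst'[OF iH', symmetric])
 also have "\<dots> = (\<integral>v. \<integral>w. \<integral>n. H (v, w, n) \<partial>S2 \<partial>lborel \<partial>lborel)"
 proof (rule integral_cong_AE)
  show "(\<lambda>v. \<integral>x. H (v, x) \<partial>(lborel \<Otimes>\<^sub>M S2)) \<in> borel_measurable lborel"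
   using P.integrable_fst'[OF iH'] by (rule borel_measurable_integrable)
  have Hm: "H \<in> borel_measurable (borel \<Otimes>\<^sub>M (borel \<Otimes>\<^sub>M borel))"
   unfolding borel_triple H_def[abs_def] using Bk ffm by simp
  note [measurable] = Hm
  have "(\<lambda>x. H (fst (fst x), snd (fst x), snd x)) \<in> borel_measurable ((lborel \<Otimes>\<^sub>M lborel) \<Otimes>\<^sub>M S2)"
   by measurable
  then have "(\<lambda>(v, w). \<integral>n. H (v, w, n) \<partial>S2) \<in> borel_measurable (lborel \<Otimes>\<^sub>M lborel)"
   using S2.borel_measurable_lebesgue_integral[of "\<lambda>vw n. H (fst vw, snd vw, n)" "lborel \<Otimes>\<^sub>M lborel"] by (simp add: split_beta)
  then show "(\<lambda>v. \<integral>w. \<integral>n. H (v, w, n) \<partial>S2 \<partial>lborel) \<in> borel_measurable lborel"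
   using lborel.borel_measurable_lebesgue_integral[of "\<lambda>v w. \<integral>n. H (v, w, n) \<partial>S2" lborel] by simp
  show "AE v in lborel. (\<integral>x. H (v, x) \<partial>(lborel \<Otimes>\<^sub>M S2)) = (\<integral>w. \<integral>n. H (v, w, n) \<partial>S2 \<partial>lborel)"
   using P.AE_integrable_fst'[OF iH']
  proof eventually_elim
   case (elim v)
   then show ?case by (rule lS2.integral_fst'[symmetric])
  qed
 qed
 also have "\<dots> = (\<integral>v. \<integral>w. \<integral>n. B (n \<bullet> ((v - w) /\<^sub>R norm (v - w))) * f v * f w * \<Phi> (v, w, n) \<partial>S2 \<partial>lborel \<partial>lborel)"
 proof (rule Bochner_Integration.integral_cong[OF refl], rule Bochner_Integration.integral_cong[OF refl])
  fix v w :: vec3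
  show "(\<integral>n. H (v, w, n) \<partial>S2) = (\<integral>n. B (n \<bullet> ((v - w) /\<^sub>R norm (v - w))) * f v * f w * \<Phi> (v, w, n) \<partial>S2)"
  proof (rule integral_cong_AE)
   have sec: "(\<lambda>n. z (v, w, n)) \<in> borel_measurable borel" if "z \<in> borel_measurable borel" for z :: "vec3 \<times> vec3 \<times> vec3 \<Rightarrow> real"
    by (rule measurable_compose[OF _ that]) (auto intro!: borel_measurable_continuous_onI continuous_intros)
   have "H \<in> borel_measurable borel" unfolding H_def[abs_def] using Bk ffm by simp
   from sec[OF this] show "(\<lambda>n. H (v, w, n)) \<in> borel_measurable S2" by (simp cong: measurable_cong_sets add: sets_S2)
   have "(\<lambda>n. B (n \<bullet> ((v - w) /\<^sub>R norm (v - w)))) \<in> borel_measurable borel"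
    by (rule measurable_compose[OF _ BB]) (auto intro!: borel_measurable_continuous_onI continuous_intros)
   then have "(\<lambda>n. B (n \<bullet> ((v - w) /\<^sub>R norm (v - w))) * f v * f w * \<Phi> (v, w, n)) \<in> borel_measurable borel"
    using sec[OF \<Phi>] by simp
   then show "(\<lambda>n. B (n \<bullet> ((v - w) /\<^sub>R norm (v - w))) * f v * f w * \<Phi> (v, w, n)) \<in> borel_measurable S2"
    by (simp cong: measurable_cong_sets add: sets_S2)
   show "AE n in S2. H (v, w, n) = B (n \<bullet> ((v - w) /\<^sub>R norm (v - w))) * f v * f w * \<Phi> (v, w, n)"
    using AE_S2_norm
   proof eventually_elim
    case (elim n)
    \<comment> \<open>An inequality, because for \<open>v = w\<close> the vector is zero by division
      by zero.\<close>
    have "norm ((v - w) /\<^sub>R norm (v - w)) \<le> 1" by (cases "v = w") simp_all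
    then have "\<bar>n \<bullet> ((v - w) /\<^sub>R norm (v - w))\<bar> \<le> 1"
     using Cauchy_Schwarz_ineq2[of n "(v - w) /\<^sub>R norm (v - w)"] elim by simp
    then have "n \<bullet> ((v - w) /\<^sub>R norm (v - w)) \<in> {-1..1}" by auto
    then show ?case by (simp only: H_def kcos_def prod.case fst_conv snd_conv indicator_simps mult_1 mult.assoc)
   qed
  qed
 qed
 finally show ?thesis by (simp only: eq)
qed

lemma gain_functional_eq:
 assumes f: "integrable lborel f" and \<phi>: "bounded_continuous \<phi>"
 shows "gain_functional e B f \<phi> = C.gain f f \<phi>"
proof -
 obtain C where C: "\<phi> \<in> borel_measurable borel" "\<And>v. \<bar>\<phi> v\<bar> \<le> C" using bounded_continuousD[OF \<phi>] by blast
 show ?thesis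
  unfolding gain_functional_def C.gain_def
  using nested_integral_KM[OF f measurable_compose[OF measurable_vprime C(1)], of e C] C(2) by (simp add: vprime_def)
qed

lemma coll_functional_eq:
 assumes f: "prob_density f" and \<phi>: "bounded_continuous \<phi>"
 shows "coll_functional e B f \<phi> = C.gain f f \<phi> - (LBINT v. f v * \<phi> v)"
proof -
 have fi: "integrable lborel f" and fm: "f \<in> borel_measurable borel" and f0: "\<And>v. 0 \<le> f v" and f1: "(LBINT v. f v) = 1"
  using f by (auto simp: prob_density_def)
 obtain C where C: "\<phi> \<in> borel_measurable borel" "\<And>v. \<bar>\<phi> v\<bar> \<le> C" using bounded_continuousD[OF \<phi>] by blast
 \<comment> \<open>\<open>integral_KM_prod\<close> is for nonnegative functions; adding the constant
   \<open>C\<close> brings \<open>\<phi>\<close> into its range, and the constant is subtracted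
   again at the end.\<close>
 have C0: "0 \<le> \<phi> v + C" for v using C(2)[of v] by linarith
 let ?\<Phi> = "\<lambda>\<omega>. \<phi> (vprime e \<omega>) - \<phi> (fst \<omega>)"
 have m: "(\<lambda>\<omega>. \<phi> (vprime e \<omega>)) \<in> borel_measurable borel" "(\<lambda>\<omega>. \<phi> (fst \<omega>)) \<in> borel_measurable (borel :: (vec3 \<times> vec3 \<times> vec3) measure)"
  by (rule measurable_compose[OF measurable_vprime C(1)], rule measurable_comp_fst[OF C(1)])
 have "\<bar>?\<Phi> \<omega>\<bar> \<le> 2 * C" for \<omega> using C(2)[of "vprime e \<omega>"] C(2)[of "fst \<omega>"] by linarith
 then have "coll_functional e B f \<phi> = (1 / (4 * pi)) * (\<integral>\<omega>. f (fst \<omega>) * f (fst (snd \<omega>)) * ?\<Phi> \<omega> \<partial>C.KM)"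
  unfolding coll_functional_def
  using nested_integral_KM[OF fi, of ?\<Phi> "2 * C"] m by (simp add: vprime_def)
 also have "(\<integral>\<omega>. f (fst \<omega>) * f (fst (snd \<omega>)) * ?\<Phi> \<omega> \<partial>C.KM) = (\<integral>\<omega>. f (fst \<omega>) * f (fst (snd \<omega>)) * \<phi> (vprime e \<omega>) \<partial>C.KM) - (\<integral>\<omega>. f (fst \<omega>) * f (fst (snd \<omega>)) * \<phi> (fst \<omega>) \<partial>C.KM)"
 proof -
  have "integrable C.KM (\<lambda>\<omega>. f (fst \<omega>) * f (fst (snd \<omega>)) * \<phi> (vprime e \<omega>))" "integrable C.KM (\<lambda>\<omega>. f (fst \<omega>) * f (fst (snd \<omega>)) * \<phi> (fst \<omega>))"
   by (rule C.integrable_KM[OF fi fi m(1), where C=C], simp add: C, rule C.integrable_KM[OF fi fi m(2), where C=C], simp add: C)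
  then show ?thesis by (simp add: right_diff_distrib)
 qed
 also have "(\<integral>\<omega>. f (fst \<omega>) * f (fst (snd \<omega>)) * \<phi> (fst \<omega>) \<partial>C.KM) = 4 * pi * (LBINT v. f v * \<phi> v)"
 proof -
  have i\<phi>: "integrable lborel (\<lambda>v. f v * \<phi> v)"
  proof (rule integrable_dominated)
   show "integrable lborel (\<lambda>v. C * f v)" using fi by simp
   show "(\<lambda>v. f v * \<phi> v) \<in> borel_measurable lborel" using fm C by simp
   show "\<bar>f v * \<phi> v\<bar> \<le> C * f v" for v using mult_left_mono[OF C(2)[of v] f0[of v]] f0[of v] by (simp add: abs_mult mult.commute)
  qed
  have ip: "integrable lborel (\<lambda>v. f v * (\<phi> v + C))" using i\<phi> fi by (simp add: distrib_left)
  have "(\<integral>\<omega>. (f (fst \<omega>) * (\<phi> (fst \<omega>) + C)) * f (fst (snd \<omega>)) \<partial>C.KM) = 4 * pi * ((LBINT v. f v * (\<phi> v + C)) * (LBINT w. f w))"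
   by (rule C.integral_KM_prod[OF _ fm _ f0 ip fi]) (use fm C C0 f0 in simp_all)
  also have "\<dots> = 4 * pi * ((LBINT v. f v * \<phi> v) + C)" using i\<phi> fi f1 by (simp add: distrib_left)
  finally have 1: "(\<integral>\<omega>. (f (fst \<omega>) * (\<phi> (fst \<omega>) + C)) * f (fst (snd \<omega>)) \<partial>C.KM) = 4 * pi * ((LBINT v. f v * \<phi> v) + C)" .
  have 2: "(\<integral>\<omega>. f (fst \<omega>) * f (fst (snd \<omega>)) \<partial>C.KM) = 4 * pi"
   using C.integral_KM_prod[OF fm fm f0 f0 fi fi] f1 by simp
  have j1: "integrable C.KM (\<lambda>\<omega>. f (fst \<omega>) * f (fst (snd \<omega>)) * \<phi> (fst \<omega>))"
   by (rule C.integrable_KM[OF fi fi m(2), where C=C], simp add: C)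
  have j2: "integrable C.KM (\<lambda>\<omega>. f (fst \<omega>) * f (fst (snd \<omega>)))"
   using C.integrable_KM[OF fi fi, of "\<lambda>_. 1" 1] by simp
  have "(\<integral>\<omega>. (f (fst \<omega>) * (\<phi> (fst \<omega>) + C)) * f (fst (snd \<omega>)) \<partial>C.KM) = (\<integral>\<omega>. f (fst \<omega>) * f (fst (snd \<omega>)) * \<phi> (fst \<omega>) + C * (f (fst \<omega>) * f (fst (snd \<omega>))) \<partial>C.KM)"
   by (simp add: algebra_simps)
  also have "\<dots> = (\<integral>\<omega>. f (fst \<omega>) * f (fst (snd \<omega>)) * \<phi> (fst \<omega>) \<partial>C.KM) + C * (4 * pi)"
   using j1 j2 2 by simp
  finally show ?thesis using 1 by (simp add: algebra_simps)
 qed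
 finally show ?thesis by (simp add: C.gain_def right_diff_distrib)
qed

text \<open>The density from \<open>gain_score\<close> and \<open>g\<close> have the same integrals
  against bounded continuous functions, so they agree almost everywhere. With both colliding
  densities equal, antisymmetry makes the mixed term zero.\<close>

lemma gain_density_energy:
 assumes gd: "gain_density e B f g" and f1: "(LBINT v. f v) = 1" and s: "has_score f s"
 shows "\<exists>S. has_score g S \<and> C.energy g S \<le> (1 / e\<^sup>2) * C.energy f s"
proof -
 have fi: "integrable lborel f" and fm: "f \<in> borel_measurable borel" and sm: "s \<in> borel_measurable borel" using s by (auto simp: has_score_def)
 have g: "prob_density g" and gl: "\<And>\<phi>. bounded_continuous \<phi> \<Longrightarrow> (LBINT v. g v * \<phi> v) = C.gain f f \<phi>"
  using gd gain_functional_eq[OF fi] by (auto simp: gain_density_def)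
 obtain q S where q: "has_score q S" "(LBINT v. q v) = 1"
  "\<And>\<phi>. \<phi> \<in> borel_measurable borel \<Longrightarrow> (LBINT v. q v * \<phi> v) = C.gain f f \<phi>"
  "C.energy q S \<le> (1 / e\<^sup>2) * (C.energy f s + C.energy f s) / 2 + C.cross f s f s"
  using C.gain_score[OF s s f1 f1] unfolding C.gain_def by blast
 have "C.cross f s f s = 0" using C.cross_swap[OF fm fm sm sm] by simp
 then have qE: "C.energy q S \<le> (1 / e\<^sup>2) * C.energy f s" using q(4) by simp
 have eq: "(LBINT v. g v * \<phi> v) = (LBINT v. q v * \<phi> v)" if "bounded_continuous \<phi>" for \<phi>
  using gl[OF that] q(3)[of \<phi>] that by (simp add: bounded_continuous_def borel_measurable_continuous_onI)
 have gi: "integrable lborel g" "integrable lborel q" using g q(1) by (auto simp: prob_density_def has_score_def)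
 have "AE v in lborel. g v \<le> q v" "AE v in lborel. q v \<le> g v"
  by (rule AE_le_of_bounded_continuous[OF gi], simp add: eq, rule AE_le_of_bounded_continuous[OF gi(2,1)], simp add: eq)
 then have gq: "AE v in lborel. q v = g v" by eventually_elim simp
 \<comment> \<open>A mixture with a single term, used to carry the score over to the almost
   everywhere equal density \<open>g\<close>.\<close>
 define p :: "nat \<Rightarrow> real" where "p k = (if k = 0 then 1 else 0)" for k
 have ps: "(\<lambda>k. p k * z) sums z" for z
  using sums_If_finite_set[of "{0}" "\<lambda>k::nat. z"] by (simp add: p_def if_distrib[of "\<lambda>x. x * z"] cong: if_cong)
 have "\<exists>T. has_score g T \<and> C.energy g T \<le> (\<Sum>k. p k * C.energy q S)"
 proof (rule score_mixture[where g="\<lambda>_. q" and s="\<lambda>_. S" and J="\<lambda>_. C.energy q S"])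
  show "AE v in lborel. (\<lambda>k. p k * q v) sums g v" using gq by eventually_elim (use ps in metis)
  show "summable (\<lambda>k. p k * C.energy q S)" "summable (\<lambda>k. p k * (LBINT v. q v))" by (rule sums_summable[OF ps])+
 qed (use q(1) g in \<open>auto simp: p_def prob_density_def\<close>)
 then show ?thesis using sums_unique[OF ps, of "C.energy q S"] qE by auto
qed

lemma E1_energy:
 assumes sol: "E1_solution e B F" and s: "has_score (F 0) s" and t: "0 \<le> t"
 shows "\<exists>S. has_score (F t) S \<and> C.energy (F t) S \<le> exp ((1 / e\<^sup>2 - 1) * t) * C.energy (F 0) s"
proof (rule C.solution_energy_bound[where F=F, OF _ _ s t])
 show pd: "prob_density (F t)" if "0 \<le> t" for t using sol that by (simp add: E1_solution_def)
 fix \<phi> and t :: real assume a: "bounded_continuous \<phi>" "0 \<le> t"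
 have "((\<lambda>s. \<integral>v. F s v * \<phi> v \<partial>lborel) has_real_derivative coll_functional e B (F t) \<phi>) (at t within {0..})"
  using sol a unfolding E1_solution_def by blast
 then show "((\<lambda>s. \<integral>v. F s v * \<phi> v \<partial>lborel) has_real_derivative C.gain (F t) (F t) \<phi> - (LBINT v. F t v * \<phi> v)) (at t within {0..})"
  by (simp only: coll_functional_eq[OF pd[OF a(2)] a(1)])
qed

end

section \<open>Kernels that are not Borel outside [-1, 1]\<close>

text \<open>On the line through \<open>y\<close> in direction \<open>k\<close> the integrand is
  \<open>B s * c\<close> times a continuous function of \<open>s\<close>, so dividing recovers
  \<open>B\<close> where that function is nonzero. By continuity of \<open>\<Delta>\<close>,
  countably many lines through a dense set of \<open>y\<close> cover all
  \<open>s \<noteq> 0\<close>; the remaining point 0 is Borel in any case.\<close>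

lemma borel_measurable_from_slices:
 fixes k :: vec3 and \<Delta> :: "vec3 \<Rightarrow> real"
 assumes k: "norm k = 1" and c: "c \<noteq> 0" and \<Delta>: "continuous_on UNIV \<Delta>"
  and m: "(\<lambda>n. B (n \<bullet> k) * c * \<Delta> n) \<in> borel_measurable borel"
  and cover: "\<And>s. s \<noteq> 0 \<Longrightarrow> \<exists>n. n \<bullet> k = s \<and> \<Delta> n \<noteq> 0"
 shows "B \<in> borel_measurable (borel :: real measure)"
proof -
 obtain D :: "vec3 set" where D: "countable D" "\<And>X. open X \<Longrightarrow> X \<noteq> {} \<Longrightarrow> \<exists>d\<in>D. d \<in> X"
  using countable_dense_exists by blast
 define l where "l y s = y + (s - y \<bullet> k) *\<^sub>R k" for y s
 have kk: "k \<bullet> k = 1" using k by (simp add: dot_square_norm)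
 have lk: "l y s \<bullet> k = s" for y s by (simp add: l_def inner_add_left kk)
 have lm: "l y \<in> borel_measurable borel" for y
  unfolding l_def by (intro borel_measurable_continuous_onI continuous_intros)
 define d where "d y s = \<Delta> (l y s)" for y s
 have dm: "d y \<in> borel_measurable borel" for y
  unfolding d_def by (rule measurable_compose[OF lm borel_measurable_continuous_onI[OF \<Delta>]])
 have Bm: "(\<lambda>s. B s * c * d y s) \<in> borel_measurable borel" for y
  using measurable_compose[OF lm m, of y] by (simp add: lk d_def)
 have "{s. a < B s} \<in> sets borel" for a
 proof -
  have E: "{s. a < B s} = (\<Union>y\<in>D. {s. d y s \<noteq> 0 \<and> a < (B s * c * d y s) / (c * d y s)}) \<union> ({0} \<inter> {s. a < B s})"
  proof (intro set_eqI iffI)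
   fix s assume s: "s \<in> {s. a < B s}"
   show "s \<in> (\<Union>y\<in>D. {s. d y s \<noteq> 0 \<and> a < (B s * c * d y s) / (c * d y s)}) \<union> ({0} \<inter> {s. a < B s})"
   proof (cases "s = 0")
    case False
    then obtain n where n: "n \<bullet> k = s" "\<Delta> n \<noteq> 0" using cover by blast
    have "open {y. \<Delta> (l y s) \<noteq> 0}"
     unfolding l_def by (intro open_Collect_neq continuous_on_compose2[OF \<Delta>] continuous_intros) auto
    moreover have "n \<in> {y. \<Delta> (l y s) \<noteq> 0}" using n(2) by (simp add: l_def n(1))
    ultimately obtain y where "y \<in> D" "\<Delta> (l y s) \<noteq> 0" using D(2)[of "{y. \<Delta> (l y s) \<noteq> 0}"] by blast
    then show ?thesis using s c by (auto simp: d_def)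
   qed (use s in simp)
  qed (use c in auto)
  have 1: "{s. d y s \<noteq> 0 \<and> a < (B s * c * d y s) / (c * d y s)} \<in> sets borel" for y
   using dm[of y] Bm[of y] by measurable
  have 2: "{0} \<inter> {s. a < B s} \<in> sets borel" by (cases "a < B 0") auto
  show ?thesis by (subst E) (intro sets.Un sets.countable_UN'' D(1) 1 2)
 qed
 then show ?thesis by (simp add: borel_measurable_iff_greater)
qed

text \<open>The measurable sets of \<open>S2\<close> are the Borel sets of the whole space, so off
  the sphere the integrand sees \<open>B\<close> at every real argument. If it were integrable,
  \<open>B\<close> would be Borel; as it is not, the integral takes its default value 0.\<close>

lemma integral_S2_nonmeasurable:
 fixes B :: "real \<Rightarrow> real" and f :: "vec3 \<Rightarrow> real" and \<Delta> :: "vec3 \<Rightarrow> real"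
 assumes B: "B \<notin> borel_measurable (borel :: real measure)" and q: "v \<noteq> w"
  and c: "f v * f w \<noteq> 0" and \<Delta>: "continuous_on UNIV \<Delta>"
  and cover: "\<And>s. s \<noteq> 0 \<Longrightarrow> \<exists>n. n \<bullet> ((v - w) /\<^sub>R norm (v - w)) = s \<and> \<Delta> n \<noteq> 0"
 shows "(\<integral>n. B (n \<bullet> ((v - w) /\<^sub>R norm (v - w))) * f v * f w * \<Delta> n \<partial>S2) = 0"
proof (rule not_integrable_integral_eq, rule notI)
 assume "integrable S2 (\<lambda>n. B (n \<bullet> ((v - w) /\<^sub>R norm (v - w))) * f v * f w * \<Delta> n)"
 then have "(\<lambda>n. B (n \<bullet> ((v - w) /\<^sub>R norm (v - w))) * f v * f w * \<Delta> n) \<in> borel_measurable S2"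
  by (rule borel_measurable_integrable)
 then have "(\<lambda>n. B (n \<bullet> ((v - w) /\<^sub>R norm (v - w))) * f v * f w * \<Delta> n) \<in> borel_measurable borel"
  by (simp only: measurable_cong_sets[OF sets_S2 refl])
 then have m: "(\<lambda>n. B (n \<bullet> ((v - w) /\<^sub>R norm (v - w))) * (f v * f w) * \<Delta> n) \<in> borel_measurable borel"
  by (rule measurable_cong[THEN iffD1, rotated]) simp
 have "B \<in> borel_measurable borel"
  by (rule borel_measurable_from_slices[OF _ c \<Delta> m cover]) (use q in simp)
 then show False using B by contradiction
qed

text \<open>If \<open>B\<close> is not Borel outside \<open>[-1, 1]\<close>, then the sphere integrals are integrals of functions that are
 not measurable, hence \<open>0\<close> by convention. The oscillating summand makes the test function nonconstant on
 every plane.\<close>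
lemma coll_functional_nonmeasurable:
 assumes e: "0 < e" and B: "B \<notin> borel_measurable (borel :: real measure)"
  and \<phi>: "continuous_on UNIV \<phi>" and M: "\<And>x. \<bar>\<phi> x\<bar> \<le> M" "M < c"
 shows "coll_functional e B f (\<lambda>x. \<phi> x + c * sin ((norm x)\<^sup>2)) = 0"
proof -
 define \<theta> where "\<theta> x = \<phi> x + c * sin ((norm x)\<^sup>2)" for x
 have \<theta>c: "continuous_on UNIV \<theta>" unfolding \<theta>_def by (intro continuous_intros \<phi>)
 have "(\<integral>n. B (n \<bullet> ((v - w) /\<^sub>R norm (v - w))) * f v * f w * (\<theta> (vpost e v w n) - \<theta> v) \<partial>S2) = 0" for v w :: vec3
 proof (cases "f v * f w = 0 \<or> v = w")
  case True
  then have Z: "B (n \<bullet> ((v - w) /\<^sub>R norm (v - w))) * f v * f w * (\<theta> (vpost e v w n) - \<theta> v) = 0" for n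
   by (auto simp: vpost_def)
  show ?thesis unfolding Z by simp
 next
  case False
  define k where "k = (v - w) /\<^sub>R norm (v - w)"
  have q: "v - w = norm (v - w) *\<^sub>R k" using False by (simp add: k_def)
  have kk: "k \<bullet> k = 1" using False by (simp add: k_def dot_square_norm power2_eq_square)
  obtain p where p: "p \<noteq> 0" "orthogonal k p" using orthogonal_to_vector_exists[of k] by auto
  have cov: "\<exists>n. n \<bullet> k = s \<and> \<theta> (vpost e v w n) - \<theta> v \<noteq> 0" if s: "s \<noteq> 0" for s
  proof -
   define m where "m = (1 + e) / 2 * (norm (v - w) * s)"
   \<comment> \<open>For \<open>s = 0\<close> the collision leaves \<open>v\<close> unchanged and
     the increment of the test function vanishes; for other \<open>s\<close> the post-collisional
     velocity moves along a line as \<open>n\<close> moves in the plane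
     \<open>n \<bullet> k = s\<close>.\<close>
   have m0: "m \<noteq> 0" using e s False by (simp add: m_def)
   define a b where "a = v - (m * s) *\<^sub>R k" and "b = m *\<^sub>R p"
   have b0: "norm b > 0" using m0 p by (simp add: b_def)
   have nk: "(s *\<^sub>R k + r *\<^sub>R p) \<bullet> k = s" for r using p kk by (simp add: inner_add_left orthogonal_def inner_commute[of p])
   have vp: "vpost e v w (s *\<^sub>R k + r *\<^sub>R p) = a - r *\<^sub>R b" for r
   proof -
    have IP: "(v - w) \<bullet> (s *\<^sub>R k + r *\<^sub>R p) = norm (v - w) * s"
     by (subst q) (use nk[of r] in \<open>simp add: inner_commute\<close>)
    have "vpost e v w (s *\<^sub>R k + r *\<^sub>R p) = v - m *\<^sub>R (s *\<^sub>R k + r *\<^sub>R p)"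
     by (simp only: vpost_def IP m_def)
    then show ?thesis by (simp add: a_def b_def scaleR_add_right mult.commute)
   qed
   have hit: "\<exists>r. (norm (a - r *\<^sub>R b))\<^sup>2 = T" if T: "(norm a)\<^sup>2 \<le> T" for T
   proof -
    define R where "R = (norm a + sqrt T) / norm b"
    have T0: "0 \<le> T" using T zero_le_power2[of "norm a"] by linarith
    have R0: "0 \<le> R" using b0 T0 by (simp add: R_def)
    have "norm (R *\<^sub>R b) = R * norm b" using R0 by simp
    then have "sqrt T = norm (R *\<^sub>R b) - norm a" using b0 by (simp add: R_def)
    also have "\<dots> \<le> norm (a - R *\<^sub>R b)" using norm_triangle_ineq2[of "R *\<^sub>R b" a] by (simp add: norm_minus_commute)
    finally have "(sqrt T)\<^sup>2 \<le> (norm (a - R *\<^sub>R b))\<^sup>2" by (rule power_mono) (use T0 in simp)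
    then have "T \<le> (norm (a - R *\<^sub>R b))\<^sup>2" using T0 by simp
    moreover have "continuous_on {0..R} (\<lambda>r. (norm (a - r *\<^sub>R b))\<^sup>2)" by (intro continuous_intros)
    ultimately obtain r where "(norm (a - r *\<^sub>R b))\<^sup>2 = T"
     using IVT'[of "\<lambda>r. (norm (a - r *\<^sub>R b))\<^sup>2" 0 T R] T R0 by auto
    then show ?thesis by blast
   qed
   obtain N :: nat where N: "(norm a)\<^sup>2 \<le> real N" using real_arch_simple by blast
   have "real N * 1 \<le> real N * (2 * pi)" using pi_ge_two by (intro mult_left_mono) auto
   then have "(norm a)\<^sup>2 \<le> real N * (2 * pi) + pi / 2" "(norm a)\<^sup>2 \<le> real N * (2 * pi) + pi / 2 + pi"
    using N pi_ge_zero by linarith+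
   \<comment> \<open>Two points of that line at which the sine is 1 and -1. There the values of
     \<open>\<theta>\<close> differ by at least \<open>2 * (c - M)\<close>, so at least one of them
     differs from \<open>\<theta> v\<close>.\<close>
   then obtain r r' where r: "(norm (a - r *\<^sub>R b))\<^sup>2 = real N * (2 * pi) + pi / 2" and r': "(norm (a - r' *\<^sub>R b))\<^sup>2 = real N * (2 * pi) + pi / 2 + pi"
    using hit by metis
   have sn: "sin (real N * (2 * pi) + pi / 2) = 1" 
   proof -
    have "real N * (2 * pi) = 2 * real N * pi" by simp
    then show ?thesis by (simp only: sin_add sin_2npi cos_2npi sin_pi_half cos_pi_half)
   qed
   have "\<theta> (a - r *\<^sub>R b) = \<phi> (a - r *\<^sub>R b) + c" "\<theta> (a - r' *\<^sub>R b) = \<phi> (a - r' *\<^sub>R b) - c"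
    unfolding \<theta>_def r r' by (simp_all only: sin_periodic_pi sn)
   then have "\<theta> (a - r *\<^sub>R b) \<noteq> \<theta> (a - r' *\<^sub>R b)"
    using M(1)[of "a - r *\<^sub>R b"] M(1)[of "a - r' *\<^sub>R b"] M(2) by linarith
   then have "\<theta> (vpost e v w (s *\<^sub>R k + r *\<^sub>R p)) \<noteq> \<theta> v \<or> \<theta> (vpost e v w (s *\<^sub>R k + r' *\<^sub>R p)) \<noteq> \<theta> v"
    unfolding vp by auto
   then show ?thesis using nk by (metis eq_iff_diff_eq_0)
  qed
  have "continuous_on UNIV (\<lambda>n. \<theta> (vpost e v w n) - \<theta> v)"
   unfolding vpost_def by (intro continuous_intros continuous_on_compose2[OF \<theta>c]) auto
  then show ?thesis using False by (intro integral_S2_nonmeasurable[OF B]) (use cov k_def in auto)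
 qed
 then show ?thesis unfolding coll_functional_def \<theta>_def by simp
qed

text \<open>A gain density would have to integrate the constant 1 to 1, so its existence forces
  \<open>B\<close> to be Borel.\<close>

lemma gain_functional_nonmeasurable:
 assumes B: "B \<notin> borel_measurable (borel :: real measure)"
 shows "gain_functional e B f (\<lambda>_. 1) = 0"
proof -
 have z: "(\<integral>n. B (n \<bullet> ((v - w) /\<^sub>R norm (v - w))) * f v * f w * 1 \<partial>S2) = 0" if vw: "v \<noteq> w" for v w :: vec3
 proof (cases "f v * f w = 0")
  case False
  have "k \<noteq> 0 \<Longrightarrow> \<exists>n. n \<bullet> (k /\<^sub>R norm k) = s \<and> (1::real) \<noteq> 0" for s and k :: vec3
   by (rule exI[of _ "s *\<^sub>R (k /\<^sub>R norm k)"]) (simp add: dot_square_norm power2_eq_square field_simps)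
  then show ?thesis using vw by (intro integral_S2_nonmeasurable[OF B vw False]) auto
 qed (simp add: mult.assoc)
 have "(\<integral>w. \<integral>n. B (n \<bullet> ((v - w) /\<^sub>R norm (v - w))) * f v * f w * 1 \<partial>S2 \<partial>lborel) = 0" for v :: vec3
 proof (rule integral_eq_zero_AE)
  have "AE w in lborel. w \<noteq> v" by (rule AE_lborel_singleton)
  then show "AE w in lborel. (\<integral>n. B (n \<bullet> ((v - w) /\<^sub>R norm (v - w))) * f v * f w * 1 \<partial>S2) = 0"
   by eventually_elim (rule z, simp)
 qed
 then show ?thesis unfolding gain_functional_def by simp
qed

section \<open>From scores to Fisher information, and the final estimates\<close>

lemma fisher_AE_cong:
 assumes f: "f \<in> borel_measurable borel" "g \<in> borel_measurable borel" and eq: "AE v in lborel. f v = g v"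
 shows "fisher f = fisher g"
proof -
 have "(LBINT x. sqrt (f x) * partial i \<psi> x) = (LBINT x. sqrt (g x) * partial i \<psi> x)" if "test_fun \<psi>" for \<psi> i
 proof (rule integral_cong_AE)
  have "partial i \<psi> \<in> borel_measurable borel" using that by (intro test_fun_measurable test_fun_partial)
  then show "(\<lambda>x. sqrt (f x) * partial i \<psi> x) \<in> borel_measurable lborel" "(\<lambda>x. sqrt (g x) * partial i \<psi> x) \<in> borel_measurable lborel"
   using f by simp_all
  show "AE x in lborel. sqrt (f x) * partial i \<psi> x = sqrt (g x) * partial i \<psi> x" using eq by eventually_elim simp
 qed
 then have "weak_grad (\<lambda>v. sqrt (f v)) G \<longleftrightarrow> weak_grad (\<lambda>v. sqrt (g v)) G" for G by (simp add: weak_grad_def)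
 then show ?thesis by (simp add: fisher_def)
qed

text \<open>Each weak gradient of finite energy yields a score, and one of infinite energy makes the
  right side infinite because \<open>r\<close> is positive. Dividing by \<open>r\<close> lets the
  estimate pass to the infimum that defines \<open>fisher f\<close>.\<close>

lemma fisher_bound_from_scores:
 assumes f: "prob_density f" and r: "0 < r"
  and sc: "\<And>s. has_score f s \<Longrightarrow> \<exists>S. has_score g S \<and> (LBINT v. g v * (norm (S v))\<^sup>2) \<le> r * (LBINT v. f v * (norm (s v))\<^sup>2)"
 shows "fisher g \<le> ennreal r * fisher f"
proof -
 have fp: "f \<in> borel_measurable borel" "\<And>v. 0 \<le> f v" "integrable lborel f" using f by (auto simp: prob_density_def)
 have le: "fisher g \<le> (4 * (\<integral>\<^sup>+ v. ennreal ((norm (G v))\<^sup>2) \<partial>lborel)) * ennreal r" if wg: "weak_grad (\<lambda>v. sqrt (f v)) G" for G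
 proof (cases "(\<integral>\<^sup>+ v. ennreal ((norm (G v))\<^sup>2) \<partial>lborel) < \<infinity>")
  case True
  let ?s = "\<lambda>v. (2 / sqrt (f v)) *\<^sub>R G v"
  obtain S where S: "has_score g S" "(LBINT v. g v * (norm (S v))\<^sup>2) \<le> r * (LBINT v. f v * (norm (?s v))\<^sup>2)"
   using sc[OF has_scoreI_weak_grad(1)[OF fp wg True]] by blast
  have "fisher g \<le> ennreal (LBINT v. g v * (norm (S v))\<^sup>2)" by (rule fisher_le_score[OF S(1)])
  also have "\<dots> \<le> ennreal (r * (LBINT v. f v * (norm (?s v))\<^sup>2))" by (rule ennreal_leI[OF S(2)])
  also have "\<dots> = ennreal r * ennreal (LBINT v. f v * (norm (?s v))\<^sup>2)" using r by (simp add: ennreal_mult')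
  also have "\<dots> \<le> ennreal r * (4 * (\<integral>\<^sup>+ v. ennreal ((norm (G v))\<^sup>2) \<partial>lborel))"
   by (rule mult_left_mono[OF has_scoreI_weak_grad(2)[OF fp wg True]]) simp
  finally show ?thesis by (simp only: mult.commute)
 next
  case False
  then have "(\<integral>\<^sup>+ v. ennreal ((norm (G v))\<^sup>2) \<partial>lborel) = \<infinity>" by (simp add: not_less top_unique)
  then show ?thesis using r by (simp add: ennreal_mult_eq_top_iff ennreal_top_mult ennreal_mult_top)
 qed
 have "fisher g / ennreal r \<le> fisher f"
  unfolding fisher_def[of f] by (rule INF_greatest) (rule divide_le_posI_ennreal, use r in simp, simp only: mult.commute[of "ennreal r"], rule le, simp)
 then have "ennreal r * (fisher g / ennreal r) \<le> ennreal r * fisher f" by (rule mult_left_mono) simp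
 moreover have "ennreal r * (fisher g / ennreal r) = fisher g"
  unfolding ennreal_times_divide mult.commute[of "ennreal r"] by (rule mult_divide_eq_ennreal) (use r in simp_all)
 ultimately show ?thesis by simp
qed

text \<open>Since \<open>1 / e\<^sup>2 - 1\<close> is \<open>(1 - e) (1 + e) / e\<^sup>2\<close>,
  the claim reduces to \<open>8 e (1 + e) \<le> 2 + e + 15 e\<^sup>2\<close>. The difference of the
  sides is the quadratic \<open>7 e\<^sup>2 - 7 e + 2\<close>, completed to a square in the first
  line.\<close>

lemma constant_bound:
 fixes e :: real
 assumes "0 < e" "e \<le> 1"
 shows "1 / e\<^sup>2 \<le> 1 + (1 - e) * (2 + e + 15 * e\<^sup>2) / (8 * e ^ 3)"
proof -
 have "0 \<le> 7 * (e - 1/2)\<^sup>2 + 1/4" by simp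
 then have "8 * e * (1 + e) \<le> 2 + e + 15 * e\<^sup>2" by (simp add: power2_eq_square algebra_simps)
 then have "(1 - e) * (8 * e * (1 + e)) \<le> (1 - e) * (2 + e + 15 * e\<^sup>2)" using assms by (intro mult_left_mono) auto
 then have "(1 - e) * (8 * e * (1 + e)) / (8 * e ^ 3) \<le> (1 - e) * (2 + e + 15 * e\<^sup>2) / (8 * e ^ 3)"
  using assms by (intro divide_right_mono) auto
 moreover have "(1 - e) * (8 * e * (1 + e)) / (8 * e ^ 3) = 1 / e\<^sup>2 - 1"
  using assms by (simp add: field_simps power2_eq_square power3_eq_cube)
 ultimately show ?thesis by linarith
qed

text \<open>For test functions with the oscillating summand the collision functional is zero, so
  their integrals are constant in time. Subtracting the case \<open>\<phi> = 0\<close> with the same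
  coefficient \<open>M + 1\<close> frees an arbitrary bounded continuous \<open>\<phi>\<close>, and
  the solution is stationary almost everywhere.\<close>

lemma E1_nonmeasurable:
 assumes e: "0 < e" and B: "B \<notin> borel_measurable (borel :: real measure)" and sol: "E1_solution e B F" and t: "0 \<le> t"
 shows "fisher (F t) = fisher (F 0)"
proof -
 have F: "prob_density (F t)" if "0 \<le> t" for t using sol that by (simp add: E1_solution_def)
 have Fp: "F t \<in> borel_measurable borel" "integrable lborel (F t)" if "0 \<le> t" for t
  using F[OF that] by (auto simp: prob_density_def)
 have const: "(LBINT v. F t v * (\<phi> v + c * sin ((norm v)\<^sup>2))) = (LBINT v. F 0 v * (\<phi> v + c * sin ((norm v)\<^sup>2)))"
  if \<phi>: "continuous_on UNIV \<phi>" and M: "\<And>x. \<bar>\<phi> x\<bar> \<le> M" "M < c" for \<phi> M c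
 proof -
  let ?\<theta> = "\<lambda>v. \<phi> v + c * sin ((norm v)\<^sup>2)"
  have c0: "0 \<le> c" using M(1)[of 0] M(2) by linarith
  have "\<bar>?\<theta> v\<bar> \<le> M + c" for v
  proof -
   have "\<bar>c * sin ((norm v)\<^sup>2)\<bar> \<le> c * 1" unfolding abs_mult using c0 by (intro mult_mono) auto
   then show ?thesis using M(1)[of v] by linarith
  qed
  then have "bounded_continuous ?\<theta>"
   unfolding bounded_continuous_def bounded_iff by (intro conjI continuous_intros \<phi> exI[of _ "M + c"]) auto
  then have "((\<lambda>s. \<integral>v. F s v * ?\<theta> v \<partial>lborel) has_real_derivative 0) (at s within {0..})" if "0 \<le> s" for s
   using sol that coll_functional_nonmeasurable[where f="F s", OF e B \<phi> M] unfolding E1_solution_def by fastforce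
  then have "\<exists>z. \<forall>s\<in>{0..}. (LBINT v. F s v * ?\<theta> v) = z"
   by (intro has_field_derivative_zero_constant) auto
  then show ?thesis using t by auto
 qed
 have eq: "(LBINT v. F t v * \<phi> v) = (LBINT v. F 0 v * \<phi> v)" if bc: "bounded_continuous \<phi>" for \<phi>
 proof -
  have \<phi>: "continuous_on UNIV \<phi>" using bc by (simp add: bounded_continuous_def)
  obtain M where M: "\<And>x. \<bar>\<phi> x\<bar> \<le> M" using bounded_continuousD[OF bc] by blast
  have M0: "0 \<le> M" using M[of 0] by linarith
  let ?o = "\<lambda>v :: vec3. (M + 1) * sin ((norm v)\<^sup>2)"
  have i: "integrable lborel (\<lambda>v. F s v * \<zeta> v)" if "0 \<le> s" "continuous_on UNIV \<zeta>" "\<And>v. \<bar>\<zeta> v\<bar> \<le> M + 1" for s and \<zeta> :: "vec3 \<Rightarrow> real"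
  proof (rule Bochner_Integration.integrable_bound)
   show "integrable lborel (\<lambda>v. (M + 1) * F s v)" using Fp[OF that(1)] by simp
   show "(\<lambda>v. F s v * \<zeta> v) \<in> borel_measurable lborel" using Fp[OF that(1)] borel_measurable_continuous_onI[OF that(2)] by simp
   have "\<bar>F s v\<bar> * \<bar>\<zeta> v\<bar> \<le> \<bar>F s v\<bar> * (M + 1)" for v by (rule mult_left_mono[OF that(3)]) simp
   then show "AE v in lborel. norm (F s v * \<zeta> v) \<le> norm ((M + 1) * F s v)" using M0 by (simp add: abs_mult mult.commute)
  qed
  have io: "integrable lborel (\<lambda>v. F s v * ?o v)" and i\<phi>: "integrable lborel (\<lambda>v. F s v * \<phi> v)" if "0 \<le> s" for s
  proof -
   have "\<bar>?o v\<bar> \<le> (M + 1) * 1" for v unfolding abs_mult using M0 by (intro mult_mono) auto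
   then show "integrable lborel (\<lambda>v. F s v * ?o v)" by (intro i that continuous_intros) simp
   have "\<bar>\<phi> v\<bar> \<le> M + 1" for v using M[of v] by linarith
   then show "integrable lborel (\<lambda>v. F s v * \<phi> v)" by (intro i that \<phi>)
  qed
  have "(LBINT v. F t v * (\<phi> v + ?o v)) = (LBINT v. F 0 v * (\<phi> v + ?o v))" by (rule const[OF \<phi> M]) simp
  moreover have "(LBINT v. F t v * (0 + ?o v)) = (LBINT v. F 0 v * (0 + ?o v))"
   by (rule const[of "\<lambda>_. 0" 0]) (use M0 in auto)
  ultimately show ?thesis using io[OF t] io[of 0] i\<phi>[OF t] i\<phi>[of 0] by (simp add: distrib_left)
 qed
 have "AE v in lborel. F t v \<le> F 0 v" "AE v in lborel. F 0 v \<le> F t v"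
  by (rule AE_le_of_bounded_continuous, use Fp t eq in auto)+
 then have "AE v in lborel. F t v = F 0 v" by eventually_elim simp
 then show ?thesis by (rule fisher_AE_cong[rotated 2]) (use Fp t in auto)
qed

theorem theorem2p1:
  fixes e :: real and B :: "real \<Rightarrow> real"
  assumes "0 < e" and "e \<le> 1" and "kernel_ok B"
  shows "(\<forall>f g. prob_density f \<and> gain_density e B f g \<longrightarrow>
            fisher g \<le> ennreal (1 + (1 - e) * (2 + e + 15 * e\<^sup>2) / (8 * e ^ 3)) * fisher f)
       \<and> (\<forall>F. E1_solution e B F \<longrightarrow>
            (\<forall>t\<ge>0. fisher (F t)
               \<le> ennreal (exp ((1 - e) * (2 + e + 15 * e\<^sup>2) / (8 * e ^ 3) * t)) * fisher (F 0)))"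
proof (intro conjI allI impI; (elim conjE)?)
  define K where "K = (1 - e) * (2 + e + 15 * e\<^sup>2) / (8 * e ^ 3)"
  have eK: "1 / e\<^sup>2 \<le> 1 + K" unfolding K_def by (rule constant_bound) fact+
  have e2: "1 \<le> 1 / e\<^sup>2" "0 < 1 / e\<^sup>2" using assms by (simp_all add: power_le_one)
  {
    fix f g assume f: "prob_density f" and g: "gain_density e B f g"
    have f1: "(\<integral>v. f v \<partial>lborel) = 1" using f by (simp add: prob_density_def)
    \<comment> \<open>The unit mass of \<open>g\<close> excludes the degenerate case here; for the
      equation it does occur and is treated below.\<close>
    have "B \<in> borel_measurable borel"
    proof (rule ccontr)
      assume "B \<notin> borel_measurable borel"
      then have "gain_functional e B f (\<lambda>_. 1) = 0" by (rule gain_functional_nonmeasurable)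
      moreover have "(\<integral>v. g v * 1 \<partial>lborel) = gain_functional e B f (\<lambda>_. 1)"
        using g unfolding gain_density_def bounded_continuous_def by (elim conjE allE[of _ "\<lambda>_. 1"]) auto
      ultimately show False using g by (simp add: gain_density_def prob_density_def)
    qed
    then have "fisher g \<le> ennreal (1 / e\<^sup>2) * fisher f"
      using assms g f1 by (intro fisher_bound_from_scores[OF f e2(2)] gain_density_energy) auto
    also have "\<dots> \<le> ennreal (1 + K) * fisher f" by (intro mult_right_mono ennreal_leI eK) simp
    finally show "fisher g \<le> ennreal (1 + (1 - e) * (2 + e + 15 * e\<^sup>2) / (8 * e ^ 3)) * fisher f" by (simp only: K_def)
  next
    fix F and t :: real assume sol: "E1_solution e B F" and t: "0 \<le> t"
    have "0 \<le> (1 / e\<^sup>2 - 1) * t" "(1 / e\<^sup>2 - 1) * t \<le> K * t" using e2 eK t by (simp, intro mult_right_mono) auto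
    then have ex: "exp ((1 / e\<^sup>2 - 1) * t) \<le> exp (K * t)" "1 \<le> exp (K * t)" by simp_all
    have "fisher (F t) \<le> ennreal (exp (K * t)) * fisher (F 0)"
    proof (cases "B \<in> borel_measurable borel")
      case True
      have "prob_density (F 0)" using sol by (simp add: E1_solution_def)
      then have "fisher (F t) \<le> ennreal (exp ((1 / e\<^sup>2 - 1) * t)) * fisher (F 0)"
        by (rule fisher_bound_from_scores) (simp, rule E1_energy[OF assms True sol _ t])
      also have "\<dots> \<le> ennreal (exp (K * t)) * fisher (F 0)" by (intro mult_right_mono ennreal_leI ex) simp
      finally show ?thesis .
    next
      \<comment> \<open>The solution is stationary, and the exponential factor is at least
        1.\<close>
      case False
      have "1 * fisher (F 0) \<le> ennreal (exp (K * t)) * fisher (F 0)"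
        using ex(2) by (intro mult_right_mono) simp_all
      then show ?thesis using E1_nonmeasurable[OF assms(1) False sol t] by simp
    qed
    then show "fisher (F t) \<le> ennreal (exp ((1 - e) * (2 + e + 15 * e\<^sup>2) / (8 * e ^ 3) * t)) * fisher (F 0)" by (simp only: K_def)
  }
qed

end
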